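(* Let $R$ be an F-finite ring and $M$ a finitely generated $R$-module. There exists a constant $C$ such that for all $P\in\operatorname{Spec}(R)$, all powers $q_1,q_2$ of $p$, and all ideals $I,J$ of $R$ such that $IR_P\subseteq JR_P$ is a $PR_P$-primary pair of ideals, $$\left|\lambda\left(\frac{J^{[q_1]}M_P}{I^{[q_1]}M_P}\right)q_2^{\dim(M_P)}-\lambda\left(\frac{J^{[q_1q_2]}M_P}{I^{[q_1q_2]}M_P}\right)\right|\leq C\, q_2^{\dim(M_P)}q_1^{\dim(M_P)-1}\,\lambda\left(\frac{JR_P}{IR_P}\right).$$
   Context: All rings are commutative, Noetherian, with identity, and of prime characteristic $p$; $q_1,q_2$ denote powers $p^{e}$ with $e\ge0$; $\lambda$ denotes length (over $R_P$). $I^{[q]}$ is the ideal generated by the $q$th powers of elements of $I$. A ring is F-finite if it is a finite module over itself via the Frobenius endomorphism $r\mapsto r^p$. For a local ring $(S,\mathfrak m)$, an $\mathfrak m$-primary pair of ideals is a containment $I\subseteq J$ of ideals of $S$ with $I$ being $\mathfrak m$-primary ($J$ is then $\mathfrak m$-primary or equal to $S$). If $M_P=0$ the inequality is regarded as trivially true (both sides are $0$). *)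

theory Defs
  imports
    Complex_Main
    "HOL-Library.Extended_Nat"
    "HOL-Computational_Algebra.Primes"
    "HOL-Algebra.Module"
    "HOL-Algebra.QuotRing"
    "HOL-Algebra.Ring_Divisibility"
begin

subsection \<open>Modules, submodules and quotients\<close>

definition self_module :: "('a, 'c) ring_scheme \<Rightarrow> ('a, 'a) module" where
  "self_module R =
     \<lparr>carrier = carrier R, mult = mult R, one = one R, zero = zero R, add = add R,
      smult = mult R\<rparr>"

definition module_span ::
    "('a, 'c) ring_scheme \<Rightarrow> ('a, 'b, 'd) module_scheme \<Rightarrow> 'b set \<Rightarrow> 'b set" where
  "module_span R M A = \<Inter>{H. submodule H R M \<and> A \<subseteq> H}"

definition finitely_generated ::
    "('a, 'c) ring_scheme \<Rightarrow> ('a, 'b, 'd) module_scheme \<Rightarrow> bool" where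
  "finitely_generated R M \<longleftrightarrow>
     (\<exists>A. finite A \<and> A \<subseteq> carrier M \<and> module_span R M A = carrier M)"

definition ideal_smult ::
    "('a, 'c) ring_scheme \<Rightarrow> 'a set \<Rightarrow> ('a, 'b, 'd) module_scheme \<Rightarrow> 'b set" where
  "ideal_smult R I M = module_span R M {a \<odot>\<^bsub>M\<^esub> x | a x. a \<in> I \<and> x \<in> carrier M}"

(* The quotient L / K of two submodules K \<subseteq> L of M. The ring multiplication and unit are
   unused fields of the module record. *)
definition quotient_module ::
    "('a, 'b, 'd) module_scheme \<Rightarrow> 'b set \<Rightarrow> 'b set \<Rightarrow> ('a, 'b set) module" where
  "quotient_module M L K =
     \<lparr>carrier = a_rcosets\<^bsub>M\<lparr>carrier := L\<rparr>\<^esub> K, mult = undefined, one = undefined,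
      zero = K, add = (\<lambda>X Y. X <+>\<^bsub>M\<^esub> Y),
      smult = (\<lambda>a X. \<Union>x\<in>X. K +>\<^bsub>M\<^esub> (a \<odot>\<^bsub>M\<^esub> x))\<rparr>"

subsection \<open>Length and dimension\<close>

(* Supremum of the n for which there is a chain F 0 \<subset> F 1 \<subset> ... \<subset> F n in the family;
   it is 0 for the empty family. *)
definition max_chain_length :: "'a set set \<Rightarrow> enat" where
  "max_chain_length \<F> =
     Sup {enat n | n. \<exists>F :: nat \<Rightarrow> 'a set.
            (\<forall>i\<le>n. F i \<in> \<F>) \<and> (\<forall>i<n. F i \<subset> F (Suc i))}"

definition module_length ::
    "('a, 'c) ring_scheme \<Rightarrow> ('a, 'b, 'd) module_scheme \<Rightarrow> enat" where
  "module_length R M = max_chain_length {H. submodule H R M}"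

definition krull_dim :: "('a, 'c) ring_scheme \<Rightarrow> enat" where
  "krull_dim R = max_chain_length {P. primeideal P R}"

definition annihilator ::
    "('a, 'c) ring_scheme \<Rightarrow> ('a, 'b, 'd) module_scheme \<Rightarrow> 'a set" where
  "annihilator R M = {a \<in> carrier R. \<forall>x\<in>carrier M. a \<odot>\<^bsub>M\<^esub> x = \<zero>\<^bsub>M\<^esub>}"

(* For the zero module the quotient has no prime ideals, so its dimension is 0 here. *)
definition module_dim ::
    "('a, 'c) ring_scheme \<Rightarrow> ('a, 'b, 'd) module_scheme \<Rightarrow> enat" where
  "module_dim R M = krull_dim (R Quot (annihilator R M))"

subsection \<open>Localization\<close>

(* The fraction x / s in the localization of M at the multiplicative set S, as an
   equivalence class of pairs: x / s = y / t iff u (t x) = u (s y) for some u in S. *)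
definition fraction ::
    "('a, 'c) ring_scheme \<Rightarrow> ('a, 'b, 'd) module_scheme \<Rightarrow> 'a set \<Rightarrow> 'b \<Rightarrow> 'a \<Rightarrow> ('b \<times> 'a) set"
  where
  "fraction R M S x s =
     {(y, t). y \<in> carrier M \<and> t \<in> S \<and>
        (\<exists>u\<in>S. u \<odot>\<^bsub>M\<^esub> (t \<odot>\<^bsub>M\<^esub> x) = u \<odot>\<^bsub>M\<^esub> (s \<odot>\<^bsub>M\<^esub> y))}"

abbreviation ring_fraction ::
    "('a, 'c) ring_scheme \<Rightarrow> 'a set \<Rightarrow> 'a \<Rightarrow> 'a \<Rightarrow> ('a \<times> 'a) set" where
  "ring_fraction R S a s \<equiv> fraction R (self_module R) S a s"

(* The operations are defined on representatives; all members of each union coincide. *)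
definition localize_ring :: "('a, 'c) ring_scheme \<Rightarrow> 'a set \<Rightarrow> ('a \<times> 'a) set ring" where
  "localize_ring R S =
     \<lparr>carrier = {ring_fraction R S a s | a s. a \<in> carrier R \<and> s \<in> S},
      mult = (\<lambda>X Y. \<Union>(a, s)\<in>X. \<Union>(b, t)\<in>Y. ring_fraction R S (a \<otimes>\<^bsub>R\<^esub> b) (s \<otimes>\<^bsub>R\<^esub> t)),
      one = ring_fraction R S \<one>\<^bsub>R\<^esub> \<one>\<^bsub>R\<^esub>,
      zero = ring_fraction R S \<zero>\<^bsub>R\<^esub> \<one>\<^bsub>R\<^esub>,
      add = (\<lambda>X Y. \<Union>(a, s)\<in>X. \<Union>(b, t)\<in>Y.
               ring_fraction R S (t \<otimes>\<^bsub>R\<^esub> a \<oplus>\<^bsub>R\<^esub> s \<otimes>\<^bsub>R\<^esub> b) (s \<otimes>\<^bsub>R\<^esub> t))\<rparr>"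

definition localize_module ::
    "('a, 'c) ring_scheme \<Rightarrow> ('a, 'b, 'd) module_scheme \<Rightarrow> 'a set \<Rightarrow>
       (('a \<times> 'a) set, ('b \<times> 'a) set) module" where
  "localize_module R M S =
     \<lparr>carrier = {fraction R M S x s | x s. x \<in> carrier M \<and> s \<in> S},
      mult = undefined, one = undefined,
      zero = fraction R M S \<zero>\<^bsub>M\<^esub> \<one>\<^bsub>R\<^esub>,
      add = (\<lambda>X Y. \<Union>(x, s)\<in>X. \<Union>(y, t)\<in>Y.
               fraction R M S (t \<odot>\<^bsub>M\<^esub> x \<oplus>\<^bsub>M\<^esub> s \<odot>\<^bsub>M\<^esub> y) (s \<otimes>\<^bsub>R\<^esub> t)),
      smult = (\<lambda>X Y. \<Union>(a, s)\<in>X. \<Union>(y, t)\<in>Y.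
               fraction R M S (a \<odot>\<^bsub>M\<^esub> y) (s \<otimes>\<^bsub>R\<^esub> t))\<rparr>"

definition ring_at :: "('a, 'c) ring_scheme \<Rightarrow> 'a set \<Rightarrow> ('a \<times> 'a) set ring" where
  "ring_at R P = localize_ring R (carrier R - P)"

definition module_at ::
    "('a, 'c) ring_scheme \<Rightarrow> ('a, 'b, 'd) module_scheme \<Rightarrow> 'a set \<Rightarrow>
       (('a \<times> 'a) set, ('b \<times> 'a) set) module" where
  "module_at R M P = localize_module R M (carrier R - P)"

(* The extended ideal, generated by the image of I under the map a \<mapsto> a / 1. *)
definition ideal_at :: "('a, 'c) ring_scheme \<Rightarrow> 'a set \<Rightarrow> 'a set \<Rightarrow> ('a \<times> 'a) set set" where
  "ideal_at R I P =
     genideal (ring_at R P) ((\<lambda>a. ring_fraction R (carrier R - P) a \<one>\<^bsub>R\<^esub>) ` I)"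

subsection \<open>Primary ideals\<close>

definition radical :: "('a, 'c) ring_scheme \<Rightarrow> 'a set \<Rightarrow> 'a set" where
  "radical R I = {a \<in> carrier R. \<exists>n::nat. a [^]\<^bsub>R\<^esub> n \<in> I}"

definition primary_ideal :: "('a, 'c) ring_scheme \<Rightarrow> 'a set \<Rightarrow> bool" where
  "primary_ideal R Q \<longleftrightarrow> ideal Q R \<and> Q \<noteq> carrier R \<and>
     (\<forall>a\<in>carrier R. \<forall>b\<in>carrier R. a \<otimes>\<^bsub>R\<^esub> b \<in> Q \<longrightarrow> a \<in> Q \<or> (\<exists>n::nat. b [^]\<^bsub>R\<^esub> n \<in> Q))"

definition primary_pair ::
    "('a, 'c) ring_scheme \<Rightarrow> 'a set \<Rightarrow> 'a set \<Rightarrow> 'a set \<Rightarrow> bool" where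
  "primary_pair R \<mm> I J \<longleftrightarrow>
     ideal I R \<and> ideal J R \<and> I \<subseteq> J \<and> primary_ideal R I \<and> radical R I = \<mm>"

subsection \<open>Prime characteristic\<close>

(* Analogous to the library's characteristic of a type of class semiring_1. *)
definition ring_char :: "('a, 'c) ring_scheme \<Rightarrow> nat" where
  "ring_char R = Gcd {n::nat. [n] \<cdot>\<^bsub>R\<^esub> \<one>\<^bsub>R\<^esub> = \<zero>\<^bsub>R\<^esub>}"

(* R as a module over itself by restriction of scalars along r \<mapsto> r^p. *)
definition frobenius_module :: "('a, 'c) ring_scheme \<Rightarrow> nat \<Rightarrow> ('a, 'a) module" where
  "frobenius_module R p =
     (self_module R)\<lparr>smult := (\<lambda>r x. (r [^]\<^bsub>R\<^esub> p) \<otimes>\<^bsub>R\<^esub> x)\<rparr>"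

definition F_finite :: "('a, 'c) ring_scheme \<Rightarrow> bool" where
  "F_finite R \<longleftrightarrow> finitely_generated R (frobenius_module R (ring_char R))"

definition frobenius_power :: "('a, 'c) ring_scheme \<Rightarrow> 'a set \<Rightarrow> nat \<Rightarrow> 'a set" where
  "frobenius_power R I q = genideal R ((\<lambda>a. a [^]\<^bsub>R\<^esub> q) ` I)"

subsection \<open>The lengths in the inequality\<close>

(* The length over R_P of J M_P / I M_P for ideals I, J of R. The conversion of an infinite
   length to nat is unspecified; the lengths in question are finite. *)
definition quotient_length_at ::
    "('a, 'c) ring_scheme \<Rightarrow> ('a, 'b, 'd) module_scheme \<Rightarrow> 'a set \<Rightarrow> 'a set \<Rightarrow> 'a set \<Rightarrow> nat" where
  "quotient_length_at R M P J I =
     the_enat (module_length (ring_at R P)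
       (quotient_module (module_at R M P)
         (ideal_smult (ring_at R P) (ideal_at R J P) (module_at R M P))
         (ideal_smult (ring_at R P) (ideal_at R I P) (module_at R M P))))"

(* The length over R_P of J R_P / I R_P. *)
definition ideal_quotient_length_at ::
    "('a, 'c) ring_scheme \<Rightarrow> 'a set \<Rightarrow> 'a set \<Rightarrow> 'a set \<Rightarrow> nat" where
  "ideal_quotient_length_at R P J I =
     the_enat (module_length (ring_at R P)
       (quotient_module (self_module (ring_at R P)) (ideal_at R J P) (ideal_at R I P)))"

definition dim_at ::
    "('a, 'c) ring_scheme \<Rightarrow> ('a, 'b, 'd) module_scheme \<Rightarrow> 'a set \<Rightarrow> nat" where
  "dim_at R M P = the_enat (module_dim (ring_at R P) (module_at R M P))"

end

theory Submission
  imports Defs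
begin

text \<open>All lengths over \<open>R\<^sub>P\<close> are computed inside \<open>R\<close>-modules, as lengths of chains of \<open>P\<close>-saturated
  submodules. Let \<open>a(P)\<close> be the degree of the residue field of \<open>P\<close> over its \<open>p\<close>-th powers. Restriction of
  scalars along Frobenius multiplies \<open>R\<^sub>P\<close>-lengths by \<open>a(P)\<close>, and it turns \<open>I\<^bsup>[q]\<^esup> M\<close> into \<open>I\<close> times the
  restricted module. Since \<open>R\<close> is F-finite, \<open>a\<close> is bounded, and \<open>a(Q) = p a(P)\<close> for adjacent primes
  \<open>Q \<subset> P\<close>; hence \<open>a(Q) \<le> p\<^bsup>d\<^esup> a(P)\<close> with \<open>d = dim M\<^sub>P\<close> whenever \<open>Ann M \<subseteq> Q \<subseteq> P\<close>.

  Prime filtrations and induction on \<open>a(Q)\<close> bound the Hilbert--Kunz functions of the \<open>(R/Q)\<^sub>P\<close> uniformly in \<open>P\<close>.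
  A module killed by an intersection of incomparable primes agrees with a direct sum of modules \<open>R/Q\<close> up to
  modules supported on larger primes, with multiplicities that Frobenius restriction multiplies by \<open>a(Q)\<close>.
  Comparing \<open>M\<close> with its restriction along Frobenius, after filtering \<open>J\<^sub>P / I\<^sub>P\<close> by steps of length one, gives
  the case \<open>q\<^sub>2 = p\<close>, and a geometric series gives the rest. The annihilator of an arbitrary \<open>M\<close> becomes
  radical after restricting along a sufficiently high power of Frobenius.\<close>

subsection \<open>Chains\<close>

text \<open>The obstacle is uniformity: one constant has to serve infinitely many primes
  \<open>P\<close>. Every filtration, direct sum and comparison map is therefore chosen once, over
  \<open>R\<close>, and \<open>P\<close> only decides how its pieces are weighed. The weight of a
  factor \<open>R / Q\<close> is bounded by \<open>C * fdeg Q ^ e\<close>, with \<open>C\<close>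
  depending on \<open>Q\<close> alone. Since \<open>fdeg Q = p ^ k * fdeg P\<close>, with
  \<open>k\<close> the length of a saturated chain from \<open>Q\<close> to \<open>P\<close>, this
  bound reads \<open>C * q ^ k\<close> once the common factor \<open>fdeg P ^ e\<close> is removed.

  The exponent \<open>d - 1\<close> has a simple origin. Passing to a strictly larger prime divides
  \<open>fdeg\<close> by at least \<open>p\<close>, so the \<open>e\<close>-th power loses the
  factor \<open>q\<close>. Errors supported on larger primes are thus one power of \<open>q\<close>
  smaller than the main term.

  The factor \<lambda>(J/I) is a number of steps. In a step of length one, \<open>J\<close> is
  locally generated over \<open>I\<close> by one \<open>u\<close> with
  \<open>u P \<subseteq> I\<close>, and multiplication by \<open>u^q\<close> bounds the error
  through \<open>P^[q]\<close>, which no longer mentions \<open>I\<close> or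
  \<open>J\<close>.\<close>

lemma max_chain_length_ge:
  assumes "\<And>i. i \<le> n \<Longrightarrow> F i \<in> \<F>" "\<And>i. i < n \<Longrightarrow> F i \<subset> F (Suc i)"
  shows "enat n \<le> max_chain_length \<F>"
  unfolding max_chain_length_def using assms by (intro Sup_upper) blast

lemma max_chain_length_le:
  assumes "\<And>n F. \<lbrakk>\<And>i. i \<le> n \<Longrightarrow> F i \<in> \<F>; \<And>i. i < n \<Longrightarrow> F i \<subset> F (Suc i)\<rbrakk> \<Longrightarrow> enat n \<le> b"
  shows "max_chain_length \<F> \<le> b"
  unfolding max_chain_length_def
  by (rule Sup_least) (use assms in blast)

lemma max_chain_length_map:
  assumes "\<And>X. X \<in> \<F> \<Longrightarrow> f X \<in> \<G>"
    and "\<And>X Y. \<lbrakk>X \<in> \<F>; Y \<in> \<F>; X \<subset> Y\<rbrakk> \<Longrightarrow> f X \<subset> f Y"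
  shows "max_chain_length \<F> \<le> max_chain_length \<G>"
proof (rule max_chain_length_le)
  fix n and F :: "nat \<Rightarrow> _"
  assume F: "\<And>i. i \<le> n \<Longrightarrow> F i \<in> \<F>" "\<And>i. i < n \<Longrightarrow> F i \<subset> F (Suc i)"
  show "enat n \<le> max_chain_length \<G>"
    by (rule max_chain_length_ge[of n "\<lambda>i. f (F i)"]) (use F assms in auto)
qed

lemma max_chain_length_mono:
  "\<F> \<subseteq> \<G> \<Longrightarrow> max_chain_length \<F> \<le> max_chain_length \<G>"
  by (rule max_chain_length_map[where f = id]) auto

text \<open>Deleting repetitions from a weakly increasing chain keeps exactly one step for every
  index at which the chain moves. The end point \<open>F n\<close> is part of the conclusion because
  the induction has to compare it with the next member.\<close>

lemma strict_subchain:
  fixes F :: "nat \<Rightarrow> 'a set"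
  assumes "\<And>i. i \<le> n \<Longrightarrow> F i \<in> \<F>" "\<And>i. i < n \<Longrightarrow> F i \<subseteq> F (Suc i)"
  shows "\<exists>G. (\<forall>i\<le>card {i. i < n \<and> F i \<noteq> F (Suc i)}. G i \<in> \<F>)
    \<and> (\<forall>i<card {i. i < n \<and> F i \<noteq> F (Suc i)}. G i \<subset> G (Suc i))
    \<and> G (card {i. i < n \<and> F i \<noteq> F (Suc i)}) = F n"
  using assms
proof (induction n)
  case 0
  then show ?case by (intro exI[of _ F]) auto
next
  case (Suc n)
  define c where "c = card {i. i < n \<and> F i \<noteq> F (Suc i)}"
  obtain G where G: "\<forall>i\<le>c. G i \<in> \<F>" "\<forall>i<c. G i \<subset> G (Suc i)" "G c = F n"
    using Suc.IH Suc.prems unfolding c_def by force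
  show ?case
  proof (cases "F n = F (Suc n)")
    case True
    then have "{i. i < Suc n \<and> F i \<noteq> F (Suc i)} = {i. i < n \<and> F i \<noteq> F (Suc i)}"
      by (auto simp: less_Suc_eq)
    then show ?thesis using G True unfolding c_def by (intro exI[of _ G]) auto
  next
    case False
    then have "{i. i < Suc n \<and> F i \<noteq> F (Suc i)} = insert n {i. i < n \<and> F i \<noteq> F (Suc i)}"
      by (auto simp: less_Suc_eq)
    then have c: "card {i. i < Suc n \<and> F i \<noteq> F (Suc i)} = Suc c" by (simp add: c_def)
    have "F n \<subset> F (Suc n)" using False Suc.prems(2)[of n] by auto
    then show ?thesis
      unfolding c using G Suc.prems(1)[of "Suc n"]
      by (intro exI[of _ "\<lambda>i. if i \<le> c then G i else F (Suc n)"]) (auto simp: less_Suc_eq le_Suc_eq)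
  qed
qed

lemma max_chain_length_ge_weak:
  assumes "\<And>i. i \<le> n \<Longrightarrow> F i \<in> \<F>" "\<And>i. i < n \<Longrightarrow> F i \<subseteq> F (Suc i)"
  shows "enat (card {i. i < n \<and> F i \<noteq> F (Suc i)}) \<le> max_chain_length \<F>"
proof -
  obtain G where "\<forall>i\<le>card {i. i < n \<and> F i \<noteq> F (Suc i)}. G i \<in> \<F>"
    "\<forall>i<card {i. i < n \<and> F i \<noteq> F (Suc i)}. G i \<subset> G (Suc i)"
    using strict_subchain[of n F \<F>] assms by blast
  then show ?thesis by (intro max_chain_length_ge[of _ G]) auto
qed

text \<open>A chain longer than \<open>n\<close> can be truncated, so if no chain of length
  \<open>n\<close> existed all lengths would stay below \<open>n\<close>. Nonemptiness is there for
  \<open>n = 0\<close>: the empty family has supremum \<open>0\<close> but no chain at all.\<close>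

lemma max_chain_length_chainE:
  assumes "enat n \<le> max_chain_length \<F>" "\<F> \<noteq> {}"
  obtains F where "\<And>i. i \<le> n \<Longrightarrow> F i \<in> \<F>" "\<And>i. i < n \<Longrightarrow> F i \<subset> F (Suc i)"
proof (cases n)
  case 0
  from assms(2) obtain X where "X \<in> \<F>" by blast
  then show ?thesis using that[of "\<lambda>_. X"] 0 by auto
next
  case (Suc m)
  show ?thesis
  proof (rule ccontr)
    assume no: "\<not> thesis"
    have "max_chain_length \<F> \<le> enat m"
    proof (rule max_chain_length_le)
      fix k and F :: "nat \<Rightarrow> _"
      assume F: "\<And>i. i \<le> k \<Longrightarrow> F i \<in> \<F>" "\<And>i. i < k \<Longrightarrow> F i \<subset> F (Suc i)"
      show "enat k \<le> enat m"
      proof (rule ccontr)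
        assume "\<not> enat k \<le> enat m"
        then have "n \<le> k" using Suc by simp
        then show False using no that[of F] F by simp
      qed
    qed
    then show False using assms(1) Suc by (metis Suc_n_not_le_n enat_ord_simps(1) order_trans)
  qed
qed

text \<open>Testing a sum on finite minorants treats infinite lengths along with finite ones: an
  infinite summand has finite minorants beyond any finite \<open>z\<close>.\<close>

lemma enat_add_leI:
  fixes x y z :: enat
  assumes "\<And>a b. \<lbrakk>enat a \<le> x; enat b \<le> y\<rbrakk> \<Longrightarrow> enat (a + b) \<le> z"
  shows "x + y \<le> z"
proof (cases z)
  case (enat n)
  have "x \<noteq> \<infinity>" using assms[of "Suc n" 0] enat by (metis Suc_n_not_le_n add_0_right enat_ord_simps(1,3) i0_lb zero_enat_def)
  moreover have "y \<noteq> \<infinity>" using assms[of 0 "Suc n"] enat by (metis Suc_n_not_le_n add_0 enat_ord_simps(1,3) i0_lb zero_enat_def)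
  ultimately obtain a b where "x = enat a" "y = enat b" by (metis not_infinity_eq)
  then show ?thesis using assms by force
qed auto

subsection \<open>Submodules and saturation\<close>

text \<open>For a submodule \<open>K\<close> this is the preimage of \<open>K_P\<close> under
  \<open>M \<rightarrow> M_P\<close>. Equality of saturations is therefore equality of localized
  submodules.\<close>

definition psat :: "('a, 'c) ring_scheme \<Rightarrow> ('a, 'b, 'd) module_scheme \<Rightarrow> 'a set \<Rightarrow> 'b set \<Rightarrow> 'b set" where
  "psat R M P K = {x \<in> carrier M. \<exists>s\<in>carrier R - P. s \<odot>\<^bsub>M\<^esub> x \<in> K}"

text \<open>Only the upper end is saturated explicitly: a saturated \<open>N\<close> that contains
  \<open>K\<close> also contains the saturation of \<open>K\<close>.\<close>

definition satfam ::
    "('a, 'c) ring_scheme \<Rightarrow> ('a, 'b, 'd) module_scheme \<Rightarrow> 'a set \<Rightarrow> 'b set \<Rightarrow> 'b set \<Rightarrow> 'b set set" where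
  "satfam R M P K L = {N. submodule N R M \<and> psat R M P N = N \<and> K \<subseteq> N \<and> N \<subseteq> psat R M P L}"

text \<open>The length over \<open>R\<^sub>P\<close> of \<open>L\<^sub>P / K\<^sub>P\<close>: the submodules of \<open>M\<^sub>P\<close> correspond to the submodules
  of \<open>M\<close> that are saturated with respect to the complement of \<open>P\<close>.\<close>

definition len ::
    "('a, 'c) ring_scheme \<Rightarrow> ('a, 'b, 'd) module_scheme \<Rightarrow> 'a set \<Rightarrow> 'b set \<Rightarrow> 'b set \<Rightarrow> enat" where
  "len R M P K L = max_chain_length (satfam R M P K L)"

text \<open>Linear maps are bare functions constrained on carriers, so one and the same function can
  be linear between two modules and also between their restrictions of scalars.\<close>

definition mlin ::
    "('a, 'c) ring_scheme \<Rightarrow> ('a, 'b, 'd) module_scheme \<Rightarrow> ('a, 'e, 'f) module_scheme \<Rightarrow> ('b \<Rightarrow> 'e) \<Rightarrow> bool" where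
  "mlin R N M h \<longleftrightarrow> (\<forall>x\<in>carrier N. h x \<in> carrier M)
     \<and> (\<forall>x\<in>carrier N. \<forall>y\<in>carrier N. h (x \<oplus>\<^bsub>N\<^esub> y) = h x \<oplus>\<^bsub>M\<^esub> h y)
     \<and> (\<forall>r\<in>carrier R. \<forall>x\<in>carrier N. h (r \<odot>\<^bsub>N\<^esub> x) = r \<odot>\<^bsub>M\<^esub> h x)"

definition cyc :: "('a, 'c) ring_scheme \<Rightarrow> ('a, 'b, 'd) module_scheme \<Rightarrow> 'b \<Rightarrow> 'b set" where
  "cyc R M x = (\<lambda>r. r \<odot>\<^bsub>M\<^esub> x) ` carrier R"

lemma set_add_iff: "z \<in> A <+>\<^bsub>M\<^esub> B \<longleftrightarrow> (\<exists>x\<in>A. \<exists>y\<in>B. z = x \<oplus>\<^bsub>M\<^esub> y)"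
  by (auto simp: set_add_def')

lemma primeideal_mult_notin:
  assumes "primeideal P R" "s \<in> carrier R - P" "t \<in> carrier R - P"
  shows "s \<otimes>\<^bsub>R\<^esub> t \<in> carrier R - P"
proof -
  interpret primeideal P R by fact
  show ?thesis using assms I_prime by (auto dest: I_prime)
qed

lemma primeideal_one_notin: "primeideal P R \<Longrightarrow> \<one>\<^bsub>R\<^esub> \<in> carrier R - P"
proof -
  assume "primeideal P R"
  then interpret primeideal P R .
  show ?thesis using I_notcarr one_imp_carrier by auto
qed

lemma primeideal_pow_notin:
  assumes "primeideal P R" "s \<in> carrier R - P"
  shows "s [^]\<^bsub>R\<^esub> (n::nat) \<in> carrier R - P"
proof (induction n)
  case 0
  then show ?case using primeideal_one_notin[OF assms(1)] by simp
next
  case (Suc n)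
  then show ?case using primeideal_mult_notin[OF assms(1) Suc assms(2)] by simp
qed

lemma primeideal_pow_mem:
  assumes "primeideal P R" "s \<in> carrier R" "s [^]\<^bsub>R\<^esub> (n::nat) \<in> P"
  shows "s \<in> P"
  using primeideal_pow_notin[OF assms(1), of s n] assms by auto

context module
begin

lemma submodule_carrier: "submodule N R M \<Longrightarrow> x \<in> N \<Longrightarrow> x \<in> carrier M"
  using submoduleE(1) by blast

lemma submodule_zero: "submodule N R M \<Longrightarrow> \<zero>\<^bsub>M\<^esub> \<in> N"
  using subgroup.one_closed submodule.axioms(1) by fastforce

lemma submodule_smult: "submodule N R M \<Longrightarrow> r \<in> carrier R \<Longrightarrow> x \<in> N \<Longrightarrow> r \<odot>\<^bsub>M\<^esub> x \<in> N"
  using submoduleE(4) by blast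

lemma submodule_add: "submodule N R M \<Longrightarrow> x \<in> N \<Longrightarrow> y \<in> N \<Longrightarrow> x \<oplus>\<^bsub>M\<^esub> y \<in> N"
  using submoduleE(5) by blast

lemma submodule_diff: "submodule N R M \<Longrightarrow> x \<in> N \<Longrightarrow> y \<in> N \<Longrightarrow> x \<ominus>\<^bsub>M\<^esub> y \<in> N"
  unfolding a_minus_def using submoduleE(3,5) by blast

lemmas submodule_rules = submodule_zero submodule_smult submodule_add submodule_diff

lemma submodule_add_cancel:
  assumes "submodule N R M" "x \<oplus>\<^bsub>M\<^esub> y \<in> N" "x \<in> N" "y \<in> carrier M"
  shows "y \<in> N"
proof -
  have "y = (x \<oplus>\<^bsub>M\<^esub> y) \<ominus>\<^bsub>M\<^esub> x"
    using assms submodule_carrier[OF assms(1)]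
    by (simp add: a_minus_def M.a_comm[of x y] M.a_assoc M.r_neg)
  then show ?thesis using submodule_diff[OF assms(1,2,3)] by simp
qed

lemma submodule_add_cancel':
  assumes "submodule N R M" "y \<oplus>\<^bsub>M\<^esub> x \<in> N" "x \<in> N" "y \<in> carrier M"
  shows "y \<in> N"
  using assms submodule_add_cancel[of N x y] submodule_carrier by (metis M.a_comm)

lemma submoduleI':
  assumes "H \<subseteq> carrier M" "\<zero>\<^bsub>M\<^esub> \<in> H"
    "\<And>x y. \<lbrakk>x \<in> H; y \<in> H\<rbrakk> \<Longrightarrow> x \<oplus>\<^bsub>M\<^esub> y \<in> H"
    "\<And>r x. \<lbrakk>r \<in> carrier R; x \<in> H\<rbrakk> \<Longrightarrow> r \<odot>\<^bsub>M\<^esub> x \<in> H"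
  shows "submodule H R M"
proof (rule submoduleI)
  fix a assume a: "a \<in> H"
  have "\<ominus>\<^bsub>M\<^esub> a = (\<ominus> \<one>) \<odot>\<^bsub>M\<^esub> a"
    using a assms(1) smult_l_minus[of \<one> a] by auto
  then show "\<ominus>\<^bsub>M\<^esub> a \<in> H" using assms(4)[of "\<ominus> \<one>" a] a by simp
qed (use assms in auto)

lemma submodule_Int: "submodule K R M \<Longrightarrow> submodule L R M \<Longrightarrow> submodule (K \<inter> L) R M"
  by (rule submoduleI') (auto intro: submodule_rules dest: submodule_carrier)

lemma submodule_zero_set: "submodule {\<zero>\<^bsub>M\<^esub>} R M"
  by (rule submoduleI') auto

lemma submodule_sum:
  assumes "submodule K R M" "submodule L R M"
  shows "submodule (K <+>\<^bsub>M\<^esub> L) R M"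
proof (rule submoduleI')
  show "K <+>\<^bsub>M\<^esub> L \<subseteq> carrier M"
    using assms by (fastforce simp: set_add_iff dest: submodule_carrier)
  show "\<zero>\<^bsub>M\<^esub> \<in> K <+>\<^bsub>M\<^esub> L"
    using submodule_zero[OF assms(1)] submodule_zero[OF assms(2)] by (force simp: set_add_iff)
next
  fix x y assume "x \<in> K <+>\<^bsub>M\<^esub> L" "y \<in> K <+>\<^bsub>M\<^esub> L"
  then obtain k l k' l' where *: "k \<in> K" "l \<in> L" "k' \<in> K" "l' \<in> L" "x = k \<oplus>\<^bsub>M\<^esub> l" "y = k' \<oplus>\<^bsub>M\<^esub> l'"
    by (auto simp: set_add_iff)
  have "x \<oplus>\<^bsub>M\<^esub> y = (k \<oplus>\<^bsub>M\<^esub> k') \<oplus>\<^bsub>M\<^esub> (l \<oplus>\<^bsub>M\<^esub> l')"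
    using * assms by (simp add: submodule_carrier M.a_ac)
  then show "x \<oplus>\<^bsub>M\<^esub> y \<in> K <+>\<^bsub>M\<^esub> L"
    using * assms by (auto simp: set_add_iff intro: submodule_add)
next
  fix r x assume r: "r \<in> carrier R" and "x \<in> K <+>\<^bsub>M\<^esub> L"
  then obtain k l where *: "k \<in> K" "l \<in> L" "x = k \<oplus>\<^bsub>M\<^esub> l"
    by (auto simp: set_add_iff)
  then show "r \<odot>\<^bsub>M\<^esub> x \<in> K <+>\<^bsub>M\<^esub> L"
    using r assms by (auto simp: set_add_iff smult_r_distr submodule_carrier intro!: bexI submodule_smult)
qed

lemma sum_upper1: "submodule K R M \<Longrightarrow> submodule L R M \<Longrightarrow> K \<subseteq> K <+>\<^bsub>M\<^esub> L"
  by (metis (no_types, lifting) set_add_iff M.r_zero submodule_zero submodule_carrier subsetI)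

lemma sum_upper2: "submodule K R M \<Longrightarrow> submodule L R M \<Longrightarrow> L \<subseteq> K <+>\<^bsub>M\<^esub> L"
  by (metis (no_types, lifting) set_add_iff M.l_zero submodule_zero submodule_carrier subsetI)

lemma sum_least: "submodule N R M \<Longrightarrow> K \<subseteq> N \<Longrightarrow> L \<subseteq> N \<Longrightarrow> K <+>\<^bsub>M\<^esub> L \<subseteq> N"
  by (fastforce simp: set_add_iff intro: submodule_add)

lemma sum_mono: "K \<subseteq> K' \<Longrightarrow> L \<subseteq> L' \<Longrightarrow> K <+>\<^bsub>M\<^esub> L \<subseteq> K' <+>\<^bsub>M\<^esub> L'"
  by (auto simp: set_add_iff) blast

lemma submodule_cyc: assumes "x \<in> carrier M" shows "submodule (cyc R M x) R M"
proof (rule submoduleI')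
  show "cyc R M x \<subseteq> carrier M" using assms by (auto simp: cyc_def)
  show "\<zero>\<^bsub>M\<^esub> \<in> cyc R M x" using assms by (force simp: cyc_def image_iff)
next
  fix y z assume "y \<in> cyc R M x" "z \<in> cyc R M x"
  then obtain r t where "r \<in> carrier R" "t \<in> carrier R" "y = r \<odot>\<^bsub>M\<^esub> x" "z = t \<odot>\<^bsub>M\<^esub> x"
    by (auto simp: cyc_def)
  then show "y \<oplus>\<^bsub>M\<^esub> z \<in> cyc R M x"
    using assms by (auto simp: cyc_def smult_l_distr[symmetric])
next
  fix r y assume "r \<in> carrier R" "y \<in> cyc R M x"
  then show "r \<odot>\<^bsub>M\<^esub> y \<in> cyc R M x"
    using assms by (auto simp: cyc_def smult_assoc1[symmetric])
qed

lemma cyc_self: "x \<in> carrier M \<Longrightarrow> x \<in> cyc R M x"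
  by (auto simp: cyc_def intro!: image_eqI[of _ _ \<one>])

lemma cyc_least: "submodule N R M \<Longrightarrow> x \<in> N \<Longrightarrow> cyc R M x \<subseteq> N"
  by (auto simp: cyc_def intro: submodule_smult)

lemma submodule_ideal_quot:
  assumes "submodule K R M" "x \<in> carrier M"
  shows "ideal {r \<in> carrier R. r \<odot>\<^bsub>M\<^esub> x \<in> K} R"
proof (rule idealI)
  show "ring R" by (rule R.ring_axioms)
  show "subgroup {r \<in> carrier R. r \<odot>\<^bsub>M\<^esub> x \<in> K} (add_monoid R)"
  proof (rule R.add.subgroupI)
    fix a b assume a: "a \<in> {r \<in> carrier R. r \<odot>\<^bsub>M\<^esub> x \<in> K}" and b: "b \<in> {r \<in> carrier R. r \<odot>\<^bsub>M\<^esub> x \<in> K}"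
    show "a \<oplus> b \<in> {r \<in> carrier R. r \<odot>\<^bsub>M\<^esub> x \<in> K}"
      using a b assms by (auto simp: smult_l_distr intro: submodule_add)
    show "\<ominus> a \<in> {r \<in> carrier R. r \<odot>\<^bsub>M\<^esub> x \<in> K}"
      using a assms by (auto simp: smult_l_minus intro: submoduleE(3))
  qed (use assms submodule_zero[OF assms(1)] in \<open>auto intro!: exI[of _ \<zero>]\<close>)
  fix a b assume "a \<in> {r \<in> carrier R. r \<odot>\<^bsub>M\<^esub> x \<in> K}" "b \<in> carrier R"
  then show "b \<otimes> a \<in> {r \<in> carrier R. r \<odot>\<^bsub>M\<^esub> x \<in> K}"
    using assms by (auto simp: smult_assoc1 intro: submodule_smult)
  then show "a \<otimes> b \<in> {r \<in> carrier R. r \<odot>\<^bsub>M\<^esub> x \<in> K}"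
    using \<open>a \<in> _\<close> \<open>b \<in> _\<close> by (simp add: R.m_comm)
qed

lemma psatI: "x \<in> carrier M \<Longrightarrow> s \<in> carrier R - P \<Longrightarrow> s \<odot>\<^bsub>M\<^esub> x \<in> K \<Longrightarrow> x \<in> psat R M P K"
  by (auto simp: psat_def)

lemma psat_mono: "K \<subseteq> L \<Longrightarrow> psat R M P K \<subseteq> psat R M P L"
  by (auto simp: psat_def)

lemma psat_carrier: "psat R M P K \<subseteq> carrier M"
  by (auto simp: psat_def)

lemma psat_upper:
  assumes "primeideal P R" "K \<subseteq> carrier M" shows "K \<subseteq> psat R M P K"
proof
  fix x assume "x \<in> K"
  then show "x \<in> psat R M P K"
    using assms primeideal_one_notin[OF assms(1)] by (intro psatI[of x \<one>]) auto
qed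

lemma psat_idem:
  assumes "primeideal P R" "K \<subseteq> carrier M" shows "psat R M P (psat R M P K) = psat R M P K"
proof
  show "psat R M P (psat R M P K) \<subseteq> psat R M P K"
  proof
    fix x assume "x \<in> psat R M P (psat R M P K)"
    then obtain s t where st: "x \<in> carrier M" "s \<in> carrier R - P" "t \<in> carrier R - P" "t \<odot>\<^bsub>M\<^esub> (s \<odot>\<^bsub>M\<^esub> x) \<in> K"
      by (auto simp: psat_def)
    then show "x \<in> psat R M P K"
      using primeideal_mult_notin[OF assms(1) st(3,2)] by (intro psatI[of x "t \<otimes> s"]) (auto simp: smult_assoc1)
  qed
qed (rule psat_upper[OF assms(1) psat_carrier])

lemma psat_least:
  assumes "primeideal P R" "K \<subseteq> psat R M P L" "L \<subseteq> carrier M" shows "psat R M P K \<subseteq> psat R M P L"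
  using psat_mono[OF assms(2)] psat_idem[OF assms(1,3)] by blast

lemma submodule_psat:
  assumes P: "primeideal P R" and K: "submodule K R M"
  shows "submodule (psat R M P K) R M"
proof (rule submoduleI')
  show "psat R M P K \<subseteq> carrier M" by (rule psat_carrier)
  show "\<zero>\<^bsub>M\<^esub> \<in> psat R M P K"
    using psat_upper[OF P] K submodule_zero[OF K] submodule_carrier[OF K] by blast
next
  fix x y assume "x \<in> psat R M P K" "y \<in> psat R M P K"
  then obtain s t where st: "x \<in> carrier M" "y \<in> carrier M" "s \<in> carrier R - P" "t \<in> carrier R - P"
    "s \<odot>\<^bsub>M\<^esub> x \<in> K" "t \<odot>\<^bsub>M\<^esub> y \<in> K"
    by (auto simp: psat_def)
  have "(t \<otimes> s) \<odot>\<^bsub>M\<^esub> (x \<oplus>\<^bsub>M\<^esub> y) = t \<odot>\<^bsub>M\<^esub> (s \<odot>\<^bsub>M\<^esub> x) \<oplus>\<^bsub>M\<^esub> s \<odot>\<^bsub>M\<^esub> (t \<odot>\<^bsub>M\<^esub> y)"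
    using st R.m_comm[of t s] by (simp add: smult_r_distr smult_assoc1[symmetric])
  also have "\<dots> \<in> K" using st by (intro submodule_add[OF K]) (auto intro: submodule_smult[OF K])
  finally show "x \<oplus>\<^bsub>M\<^esub> y \<in> psat R M P K"
    using st primeideal_mult_notin[OF P st(4,3)] by (intro psatI[of _ "t \<otimes> s"]) auto
next
  fix r x assume r: "r \<in> carrier R" and "x \<in> psat R M P K"
  then obtain s where st: "x \<in> carrier M" "s \<in> carrier R - P" "s \<odot>\<^bsub>M\<^esub> x \<in> K"
    by (auto simp: psat_def)
  have "s \<odot>\<^bsub>M\<^esub> (r \<odot>\<^bsub>M\<^esub> x) = r \<odot>\<^bsub>M\<^esub> (s \<odot>\<^bsub>M\<^esub> x)"
    using st r R.m_comm[of s r] by (simp add: smult_assoc1[symmetric])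
  then show "r \<odot>\<^bsub>M\<^esub> x \<in> psat R M P K" using st r K by (intro psatI[of _ s]) (auto intro: submodule_smult)
qed

lemma psat_mem_iff:
  assumes "primeideal P R" "psat R M P N = N" "submodule N R M" "s \<in> carrier R - P" "x \<in> carrier M"
  shows "s \<odot>\<^bsub>M\<^esub> x \<in> N \<longleftrightarrow> x \<in> N"
  using assms psatI[of x s P N] submodule_smult[OF assms(3)] by auto

lemma psat_Int_saturated:
  assumes "primeideal P R" "submodule N R M" "psat R M P N = N" "submodule L R M" "psat R M P L = L"
  shows "psat R M P (N \<inter> L) = N \<inter> L"
proof
  show "psat R M P (N \<inter> L) \<subseteq> N \<inter> L" using psat_mono[of "N \<inter> L"] assms by blast
  show "N \<inter> L \<subseteq> psat R M P (N \<inter> L)"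
    using psat_upper[OF assms(1), of "N \<inter> L"] submodule_carrier[OF assms(2)] by blast
qed

lemma psat_zero_full: assumes "primeideal P R" shows "psat R M P (carrier M) = carrier M"
  using psat_upper[OF assms subset_refl] psat_carrier by blast

subsection \<open>Length of localized subquotients\<close>

lemma satfamI:
  assumes "submodule N R M" "psat R M P N = N" "K \<subseteq> N" "N \<subseteq> psat R M P L"
  shows "N \<in> satfam R M P K L"
  using assms by (auto simp: satfam_def)

lemma psat_in_satfam:
  assumes "primeideal P R" "submodule K R M" "submodule L R M" "K \<subseteq> psat R M P L"
  shows "psat R M P K \<in> satfam R M P K L"
  using assms submodule_carrier psat_upper[OF assms(1)]
  by (intro satfamI submodule_psat psat_idem psat_least) blast+

text \<open>Modular law: a chain between \<open>K\<close> and \<open>L\<close> is traced on the two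
  parts by intersecting its members with \<open>H\<close> and by adding \<open>H\<close> to them.
  Every strict step of the chain is seen by at least one of the two traces.\<close>

lemma len_add_le:
  assumes P: "primeideal P R" and sub: "submodule K R M" "submodule H R M" "submodule L R M"
    and le: "K \<subseteq> psat R M P H" "H \<subseteq> psat R M P L"
  shows "len R M P K L \<le> len R M P K H + len R M P H L"
  unfolding len_def[of _ _ _ K L]
proof (rule max_chain_length_le)
  fix n and F :: "nat \<Rightarrow> _"
  assume F: "\<And>i. i \<le> n \<Longrightarrow> F i \<in> satfam R M P K L" "\<And>i. i < n \<Longrightarrow> F i \<subset> F (Suc i)"
  note carr = submodule_carrier
  define A where "A i = F i \<inter> psat R M P H" for i
  define B where "B i = psat R M P (F i <+>\<^bsub>M\<^esub> H)" for i
  have Fs: "submodule (F i) R M" "psat R M P (F i) = F i" "K \<subseteq> F i" "F i \<subseteq> psat R M P L" if "i \<le> n" for i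
    using F(1)[OF that] by (auto simp: satfam_def)
  have sH: "submodule (psat R M P H) R M" "psat R M P (psat R M P H) = psat R M P H"
    using submodule_psat[OF P sub(2)] psat_idem[OF P] carr[OF sub(2)] by blast+
  have HsatH: "H \<subseteq> psat R M P H" using psat_upper[OF P] carr[OF sub(2)] by blast
  have A: "A i \<in> satfam R M P K H" if "i \<le> n" for i
    unfolding A_def using Fs[OF that] sH le psat_Int_saturated[OF P Fs(1,2)[OF that] sH]
    by (intro satfamI submodule_Int) auto
  have B: "B i \<in> satfam R M P H L" if "i \<le> n" for i
  proof -
    have s: "submodule (F i <+>\<^bsub>M\<^esub> H) R M" using Fs[OF that] sub by (intro submodule_sum)
    have c: "F i <+>\<^bsub>M\<^esub> H \<subseteq> carrier M" using carr[OF s] by blast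
    have "F i <+>\<^bsub>M\<^esub> H \<subseteq> psat R M P L"
      using Fs[OF that] le by (intro sum_least submodule_psat P sub)
    then have "B i \<subseteq> psat R M P L"
      unfolding B_def using carr[OF sub(3)] by (intro psat_least P) blast+
    moreover have "H \<subseteq> B i"
      unfolding B_def using sum_upper2[OF Fs(1)[OF that] sub(2)] psat_upper[OF P c] by blast
    ultimately show ?thesis
      unfolding B_def by (intro satfamI submodule_psat P s psat_idem c)
  qed
  have sumA: "enat (card {i. i < n \<and> A i \<noteq> A (Suc i)}) \<le> len R M P K H"
    unfolding len_def by (rule max_chain_length_ge_weak) (use A F in \<open>auto simp: A_def\<close>)
  have sumB: "enat (card {i. i < n \<and> B i \<noteq> B (Suc i)}) \<le> len R M P H L"
    unfolding len_def
  proof (rule max_chain_length_ge_weak)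
    fix i assume "i < n"
    then show "B i \<subseteq> B (Suc i)"
      unfolding B_def using F(2)[of i] by (intro psat_mono sum_mono) auto
  qed (use B in auto)
  \<comment> \<open>If both traces stand still, an element of the larger member is locally
    \<open>f + h\<close> with \<open>f\<close> in the smaller member and \<open>h \<in> H\<close>.
    Then \<open>h\<close> lies in the intersection with \<open>H\<close>, which did not grow, so the
    element was in the smaller member already.\<close>
  have "{i. i < n} \<subseteq> {i. i < n \<and> A i \<noteq> A (Suc i)} \<union> {i. i < n \<and> B i \<noteq> B (Suc i)}"
  proof (rule subsetI, rule ccontr)
    fix i assume i: "i \<in> {i. i < n}" and "i \<notin> {i. i < n \<and> A i \<noteq> A (Suc i)} \<union> {i. i < n \<and> B i \<noteq> B (Suc i)}"
    then have eq: "A i = A (Suc i)" "B i = B (Suc i)" and le': "i \<le> n" "Suc i \<le> n" by auto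
    note F0 = Fs[OF le'(1)] and F1 = Fs[OF le'(2)]
    have "F (Suc i) \<subseteq> F i"
    proof
      fix x assume x: "x \<in> F (Suc i)"
      have xc: "x \<in> carrier M" using carr[OF F1(1) x] .
      have "F (Suc i) \<subseteq> B (Suc i)"
        unfolding B_def using sum_upper1[OF F1(1) sub(2)] psat_upper[OF P] carr[OF submodule_sum[OF F1(1) sub(2)]] by blast
      then have "x \<in> psat R M P (F i <+>\<^bsub>M\<^esub> H)" using x eq unfolding B_def by auto
      then obtain s f h where s: "s \<in> carrier R - P" "f \<in> F i" "h \<in> H" "s \<odot>\<^bsub>M\<^esub> x = f \<oplus>\<^bsub>M\<^esub> h"
        by (auto simp: psat_def set_add_iff)
      have "f \<oplus>\<^bsub>M\<^esub> h \<in> F (Suc i)" using submodule_smult[OF F1(1) _ x, of s] s by auto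
      moreover have "f \<in> F (Suc i)" using s(2) F(2)[of i] i by auto
      ultimately have "h \<in> F (Suc i)"
        using submodule_add_cancel[OF F1(1)] carr[OF sub(2) s(3)] by blast
      then have "h \<in> A (Suc i)" using s(3) HsatH by (auto simp: A_def)
      then have "h \<in> F i" using eq by (auto simp: A_def)
      then have "s \<odot>\<^bsub>M\<^esub> x \<in> F i" using s submodule_add[OF F0(1)] by auto
      then show "x \<in> F i" using psat_mem_iff[OF P F0(2,1) s(1) xc] by simp
    qed
    then show False using F(2)[of i] i by auto
  qed
  then have "card {i. i < n} \<le> card ({i. i < n \<and> A i \<noteq> A (Suc i)} \<union> {i. i < n \<and> B i \<noteq> B (Suc i)})"
    by (intro card_mono) auto
  also have "\<dots> \<le> card {i. i < n \<and> A i \<noteq> A (Suc i)} + card {i. i < n \<and> B i \<noteq> B (Suc i)}"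
    by (rule card_Un_le)
  finally have "enat n \<le> enat (card {i. i < n \<and> A i \<noteq> A (Suc i)}) + enat (card {i. i < n \<and> B i \<noteq> B (Suc i)})"
    by simp
  also have "\<dots> \<le> len R M P K H + len R M P H L" using sumA sumB by (intro add_mono)
  finally show "enat n \<le> len R M P K H + len R M P H L" .
qed

lemma len_add_ge:
  assumes P: "primeideal P R" and sub: "submodule K R M" "submodule H R M" "submodule L R M"
    and le: "K \<subseteq> psat R M P H" "H \<subseteq> psat R M P L"
  shows "len R M P K H + len R M P H L \<le> len R M P K L"
proof (rule enat_add_leI)
  fix a b assume "enat a \<le> len R M P K H" "enat b \<le> len R M P H L"
  moreover have "satfam R M P K H \<noteq> {}" "satfam R M P H L \<noteq> {}"
    using psat_in_satfam[OF P sub(1,2) le(1)] psat_in_satfam[OF P sub(2,3) le(2)] by auto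
  ultimately obtain F G where
    F: "\<And>i. i \<le> a \<Longrightarrow> F i \<in> satfam R M P K H" "\<And>i. i < a \<Longrightarrow> F i \<subset> F (Suc i)" and
    G: "\<And>i. i \<le> b \<Longrightarrow> G i \<in> satfam R M P H L" "\<And>i. i < b \<Longrightarrow> G i \<subset> G (Suc i)"
    unfolding len_def by (metis max_chain_length_chainE)
  have HG: "psat R M P H \<subseteq> G i" if "i \<le> b" for i
    using G(1)[OF that] psat_mono[of H "G i"] by (auto simp: satfam_def)
  \<comment> \<open>The chains are glued without \<open>G 0\<close>. Both \<open>F a\<close> and
    \<open>G 0\<close> may equal \<open>psat R M P H\<close>, but \<open>G 1\<close> is strictly
    above it.\<close>
  define E where "E i = (if i \<le> a then F i else G (i - a))" for i
  have 1: "satfam R M P K H \<subseteq> satfam R M P K L"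
    using psat_least[OF P le(2) submoduleE(1)[OF sub(3)]] by (auto simp: satfam_def)
  have 2: "G i \<in> satfam R M P K L" if "i \<le> b" for i
    using G(1)[OF that] HG[OF that] le by (auto simp: satfam_def)
  show "enat (a + b) \<le> len R M P K L"
    unfolding len_def
  proof (rule max_chain_length_ge[of _ E])
    fix i assume "i \<le> a + b"
    then show "E i \<in> satfam R M P K L" using F(1)[of i] 1 2[of "i - a"] by (auto simp: E_def)
  next
    fix i assume i: "i < a + b"
    consider "i < a" | "i = a" | "i > a" by linarith
    then show "E i \<subset> E (Suc i)"
    proof cases
      case 1 then show ?thesis using F(2) by (auto simp: E_def)
    next
      case 2
      then have "F a \<subseteq> psat R M P H" "0 < b" using F(1)[of a] i by (auto simp: satfam_def)
      then show ?thesis using HG[of 0] G(2)[of 0] 2 by (auto simp: E_def)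
    next
      case 3
      then show ?thesis using G(2)[of "i - a"] i by (auto simp: E_def Suc_diff_le)
    qed
  qed
qed

lemma len_add:
  assumes "primeideal P R" "submodule K R M" "submodule H R M" "submodule L R M"
    "K \<subseteq> psat R M P H" "H \<subseteq> psat R M P L"
  shows "len R M P K L = len R M P K H + len R M P H L"
  using len_add_le[OF assms] len_add_ge[OF assms] by (rule antisym)

end

section \<open>Lengths along linear maps, and subquotients of length one\<close>

text \<open>Localized, \<open>hK\<close> says that \<open>h\<close> sends \<open>K\<close> into
  \<open>K'\<close>, and \<open>hL\<close> that \<open>K' + h(L)\<close> covers \<open>L'\<close>.
  Pulling back saturated submodules along \<open>h\<close> preserves strict inclusions, because an
  element that separates two of them can be multiplied by a denominator and then moved into
  \<open>h(L)\<close> modulo \<open>K'\<close>.\<close>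

lemma len_surj:
  assumes N: "module R N" and M: "module R M" and P: "primeideal P R" and h: "mlin R N M h"
    and sub: "submodule K R N" "submodule L R N" "submodule K' R M" "submodule L' R M"
    and KL: "K \<subseteq> psat R N P L"
    and hK: "\<And>x. x \<in> K \<Longrightarrow> h x \<in> psat R M P K'"
    and hL: "\<And>y. y \<in> L' \<Longrightarrow> \<exists>s\<in>carrier R - P. \<exists>k\<in>K'. \<exists>l\<in>L. s \<odot>\<^bsub>M\<^esub> y = k \<oplus>\<^bsub>M\<^esub> h l"
  shows "len R M P K' L' \<le> len R N P K L"
proof -
  interpret N: module R N by fact
  interpret M: module R M by fact
  define f where "f X = {x \<in> psat R N P L. h x \<in> X}" for X
  have hc: "h x \<in> carrier M" if "x \<in> carrier N" for x using h that by (auto simp: mlin_def)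
  have hadd: "h (x \<oplus>\<^bsub>N\<^esub> y) = h x \<oplus>\<^bsub>M\<^esub> h y" if "x \<in> carrier N" "y \<in> carrier N" for x y
    using h that by (auto simp: mlin_def)
  have hs: "h (r \<odot>\<^bsub>N\<^esub> x) = r \<odot>\<^bsub>M\<^esub> h x" if "x \<in> carrier N" "r \<in> carrier R" for r x
    using h that by (auto simp: mlin_def)
  have h0: "h \<zero>\<^bsub>N\<^esub> = \<zero>\<^bsub>M\<^esub>"
    using hs[of "\<zero>\<^bsub>N\<^esub>" "\<zero>\<^bsub>R\<^esub>"] hc[of "\<zero>\<^bsub>N\<^esub>"] by simp
  have sL: "submodule (psat R N P L) R N" by (rule N.submodule_psat[OF P sub(2)])
  have f: "f X \<in> satfam R N P K L" if X: "X \<in> satfam R M P K' L'" for X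
  proof (rule N.satfamI)
    have X': "submodule X R M" "psat R M P X = X" "K' \<subseteq> X" "X \<subseteq> psat R M P L'"
      using X by (auto simp: satfam_def)
    show 1: "submodule (f X) R N"
    proof (rule N.submoduleI')
      show "f X \<subseteq> carrier N" using N.psat_carrier by (auto simp: f_def)
      show "\<zero>\<^bsub>N\<^esub> \<in> f X" using N.submodule_zero[OF sL] M.submodule_zero[OF X'(1)] h0 by (simp add: f_def)
    next
      fix x y assume "x \<in> f X" "y \<in> f X"
      then show "x \<oplus>\<^bsub>N\<^esub> y \<in> f X"
        using N.submodule_add[OF sL] M.submodule_add[OF X'(1)] hadd N.submodule_carrier[OF sL]
        by (auto simp: f_def)
    next
      fix r x assume "r \<in> carrier R" "x \<in> f X"
      then show "r \<odot>\<^bsub>N\<^esub> x \<in> f X"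
        using N.submodule_smult[OF sL] M.submodule_smult[OF X'(1)] hs N.submodule_carrier[OF sL]
        by (auto simp: f_def)
    qed
    show "psat R N P (f X) = f X"
    proof
      show "psat R N P (f X) \<subseteq> f X"
      proof
        fix x assume x: "x \<in> psat R N P (f X)"
        then obtain s where s: "x \<in> carrier N" "s \<in> carrier R - P" "s \<odot>\<^bsub>N\<^esub> x \<in> f X"
          by (auto simp: psat_def)
        then have "s \<odot>\<^bsub>M\<^esub> h x \<in> X" using hs by (auto simp: f_def)
        then have "h x \<in> X" using M.psat_mem_iff[OF P X'(2,1) s(2) hc[OF s(1)]] by simp
        moreover have "x \<in> psat R N P L"
          using x N.psat_mono[of "f X" "psat R N P L" P] N.psat_idem[OF P] N.submodule_carrier[OF sub(2)]
          by (auto simp: f_def)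
        ultimately show "x \<in> f X" by (simp add: f_def)
      qed
      show "f X \<subseteq> psat R N P (f X)"
        using N.psat_upper[OF P] N.submodule_carrier[OF 1] by blast
    qed
    show "K \<subseteq> f X"
      using KL hK M.psat_mono[OF X'(3), of P] X'(2) by (auto simp: f_def)
    show "f X \<subseteq> psat R N P L" by (auto simp: f_def)
  qed
  show ?thesis
    unfolding len_def
  proof (rule max_chain_length_map[OF f])
    fix X Y assume X: "X \<in> satfam R M P K' L'" and Y: "Y \<in> satfam R M P K' L'" and XY: "X \<subset> Y"
    have X': "submodule X R M" "psat R M P X = X" "K' \<subseteq> X" "X \<subseteq> psat R M P L'"
      using X by (auto simp: satfam_def)
    have Y': "submodule Y R M" "psat R M P Y = Y" "K' \<subseteq> Y" "Y \<subseteq> psat R M P L'"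
      using Y by (auto simp: satfam_def)
    obtain y where y: "y \<in> Y" "y \<notin> X" using XY by blast
    have yc: "y \<in> carrier M" using M.submodule_carrier[OF Y'(1) y(1)] .
    obtain t where t: "t \<in> carrier R - P" "t \<odot>\<^bsub>M\<^esub> y \<in> L'" using y Y'(4) by (auto simp: psat_def)
    obtain s k l where s: "s \<in> carrier R - P" "k \<in> K'" "l \<in> L" "s \<odot>\<^bsub>M\<^esub> (t \<odot>\<^bsub>M\<^esub> y) = k \<oplus>\<^bsub>M\<^esub> h l"
      using hL[OF t(2)] by blast
    have lc: "l \<in> carrier N" "h l \<in> carrier M" using N.submodule_carrier[OF sub(2) s(3)] hc by auto
    have iff: "s \<odot>\<^bsub>M\<^esub> (t \<odot>\<^bsub>M\<^esub> y) \<in> Z \<longleftrightarrow> y \<in> Z" if "submodule Z R M" "psat R M P Z = Z" for Z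
      using M.psat_mem_iff[OF P that(2,1)] s(1) t(1) yc by simp
    have "h l \<in> Y" using iff[OF Y'(1,2)] s y M.submodule_add_cancel[OF Y'(1)] Y'(3) lc by auto
    moreover have "h l \<notin> X" using iff[OF X'(1,2)] s y M.submodule_add[OF X'(1)] X'(3) by auto
    moreover have "l \<in> psat R N P L" using N.psat_upper[OF P] s(3) N.submodule_carrier[OF sub(2)] by blast
    ultimately have "l \<in> f Y" "l \<notin> f X" by (auto simp: f_def)
    then show "f X \<subset> f Y" using XY by (auto simp: f_def)
  qed
qed

text \<open>Dual to \<open>len_surj\<close>: the last hypothesis makes the map induced on localized
  subquotients injective, and chains are pushed forward instead. An image is enlarged by
  \<open>K'\<close> and saturated so that it belongs to the target family.\<close>

lemma len_inj:
  assumes N: "module R N" and M: "module R M" and P: "primeideal P R" and h: "mlin R N M h"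
    and sub: "submodule K R N" "submodule L R N" "submodule K' R M" "submodule L' R M"
    and KL: "K' \<subseteq> psat R M P L'"
    and hL: "\<And>x. x \<in> L \<Longrightarrow> h x \<in> psat R M P L'"
    and inj: "\<And>x. \<lbrakk>x \<in> L; h x \<in> psat R M P K'\<rbrakk> \<Longrightarrow> x \<in> psat R N P K"
  shows "len R N P K L \<le> len R M P K' L'"
proof -
  interpret N: module R N by fact
  interpret M: module R M by fact
  have hc: "h x \<in> carrier M" if "x \<in> carrier N" for x using h that by (auto simp: mlin_def)
  have hadd: "h (x \<oplus>\<^bsub>N\<^esub> y) = h x \<oplus>\<^bsub>M\<^esub> h y" if "x \<in> carrier N" "y \<in> carrier N" for x y
    using h that by (auto simp: mlin_def)
  have hs: "h (r \<odot>\<^bsub>N\<^esub> x) = r \<odot>\<^bsub>M\<^esub> h x" if "x \<in> carrier N" "r \<in> carrier R" for r x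
    using h that by (auto simp: mlin_def)
  have h0: "h \<zero>\<^bsub>N\<^esub> = \<zero>\<^bsub>M\<^esub>"
    using hs[of "\<zero>\<^bsub>N\<^esub>" "\<zero>\<^bsub>R\<^esub>"] hc[of "\<zero>\<^bsub>N\<^esub>"] by simp
  have img: "submodule (h ` X) R M" if X: "submodule X R N" for X
  proof (rule M.submoduleI')
    show "h ` X \<subseteq> carrier M" using hc N.submodule_carrier[OF X] by auto
    show "\<zero>\<^bsub>M\<^esub> \<in> h ` X" using h0 N.submodule_zero[OF X] by force
  next
    fix x y assume "x \<in> h ` X" "y \<in> h ` X"
    then obtain a b where "a \<in> X" "b \<in> X" "x = h a" "y = h b" by blast
    then show "x \<oplus>\<^bsub>M\<^esub> y \<in> h ` X"
      using hadd[of a b] N.submodule_carrier[OF X] N.submodule_add[OF X, of a b] by (metis imageI)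
  next
    fix r x assume r: "r \<in> carrier R" and "x \<in> h ` X"
    then obtain a where "a \<in> X" "x = h a" by blast
    then show "r \<odot>\<^bsub>M\<^esub> x \<in> h ` X"
      using hs[of a r] r N.submodule_carrier[OF X] N.submodule_smult[OF X r, of a] by (metis imageI)
  qed
  define f where "f X = psat R M P (h ` (X \<inter> L) <+>\<^bsub>M\<^esub> K')" for X
  have s: "submodule (h ` (X \<inter> L) <+>\<^bsub>M\<^esub> K') R M" if "submodule X R N" for X
    using that sub by (intro M.submodule_sum img N.submodule_Int)
  have f: "f X \<in> satfam R M P K' L'" if X: "X \<in> satfam R N P K L" for X
  proof -
    have X': "submodule X R N" using X by (auto simp: satfam_def)
    note c = M.submoduleE(1)[OF s[OF X']]
    have "h ` (X \<inter> L) <+>\<^bsub>M\<^esub> K' \<subseteq> psat R M P L'"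
      using hL KL by (intro M.sum_least M.submodule_psat P sub) auto
    then have "f X \<subseteq> psat R M P L'"
      unfolding f_def by (intro M.psat_least P M.submoduleE(1)[OF sub(4)])
    moreover have "K' \<subseteq> f X"
      unfolding f_def using M.psat_upper[OF P c] M.sum_upper2[OF img[OF N.submodule_Int[OF X' sub(2)]] sub(3)] by blast
    ultimately show ?thesis
      unfolding f_def by (intro M.satfamI M.submodule_psat P s X' M.psat_idem c)
  qed
  show ?thesis
    unfolding len_def
  proof (rule max_chain_length_map[OF f])
    fix X Y assume X: "X \<in> satfam R N P K L" and Y: "Y \<in> satfam R N P K L" and XY: "X \<subset> Y"
    have X': "submodule X R N" "psat R N P X = X" "K \<subseteq> X" "X \<subseteq> psat R N P L"
      using X by (auto simp: satfam_def)
    have Y': "submodule Y R N" "psat R N P Y = Y" "K \<subseteq> Y" "Y \<subseteq> psat R N P L"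
      using Y by (auto simp: satfam_def)
    have "f X \<subseteq> f Y" unfolding f_def using XY by (intro M.psat_mono M.sum_mono) auto
    obtain y where y: "y \<in> Y" "y \<notin> X" using XY by blast
    have yc: "y \<in> carrier N" using N.submodule_carrier[OF Y'(1) y(1)] .
    obtain t where t: "t \<in> carrier R - P" "t \<odot>\<^bsub>N\<^esub> y \<in> L" using y Y'(4) by (auto simp: psat_def)
    define x where "x = t \<odot>\<^bsub>N\<^esub> y"
    have x: "x \<in> Y" "x \<notin> X" "x \<in> L" "x \<in> carrier N"
      using t y yc N.psat_mem_iff[OF P X'(2,1)] N.submodule_smult[OF Y'(1)] by (auto simp: x_def)
    have "h x \<in> h ` (Y \<inter> L) <+>\<^bsub>M\<^esub> K'"
      using x M.sum_upper1[OF img[OF N.submodule_Int[OF Y'(1) sub(2)]] sub(3)] by blast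
    then have hx: "h x \<in> f Y" unfolding f_def using M.psat_upper[OF P M.submoduleE(1)[OF s[OF Y'(1)]]] by blast
    have "h x \<notin> f X"
    proof
      assume "h x \<in> f X"
      then obtain u z k where u: "u \<in> carrier R - P" "z \<in> X" "z \<in> L" "k \<in> K'" "u \<odot>\<^bsub>M\<^esub> h x = h z \<oplus>\<^bsub>M\<^esub> k"
        by (auto simp: f_def psat_def set_add_iff)
      \<comment> \<open>\<open>w\<close> is the part of \<open>u x\<close> not accounted for by
        \<open>z \<in> X\<close>. Its image is \<open>k \<in> K'\<close>, so injectivity puts
        \<open>w\<close> into the saturation of \<open>K\<close>, hence into
        \<open>X\<close>.\<close>
      define w where "w = u \<odot>\<^bsub>N\<^esub> x \<ominus>\<^bsub>N\<^esub> z"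
      have zc: "z \<in> carrier N" using N.submodule_carrier[OF X'(1) u(2)] .
      have w: "w \<in> L" "w \<in> carrier N" using u x zc sub
        by (auto simp: w_def intro!: N.submodule_diff N.submodule_smult)
      have "u \<odot>\<^bsub>N\<^esub> x = z \<oplus>\<^bsub>N\<^esub> w"
        using u x zc by (simp add: w_def a_minus_def N.M.a_comm[of "u \<odot>\<^bsub>N\<^esub> x"] N.M.r_neg2)
      then have "h z \<oplus>\<^bsub>M\<^esub> h w = h z \<oplus>\<^bsub>M\<^esub> k" using u(5) hs[of x u] hadd[OF zc w(2)] x u(1) by simp
      then have "h w = k" using hc zc w M.submodule_carrier[OF sub(3) u(4)] by simp
      then have "w \<in> psat R N P K"
        using inj[OF w(1)] u(4) M.psat_upper[OF P M.submoduleE(1)[OF sub(3)]] by blast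
      then have "w \<in> X" using N.psat_mono[OF X'(3), of P] X'(2) by blast
      then have "u \<odot>\<^bsub>N\<^esub> x \<in> X"
        using \<open>u \<odot>\<^bsub>N\<^esub> x = z \<oplus>\<^bsub>N\<^esub> w\<close> N.submodule_add[OF X'(1)] u by simp
      then show False using N.psat_mem_iff[OF P X'(2,1) u(1)] x by simp
    qed
    then show "f X \<subset> f Y" using hx \<open>f X \<subseteq> f Y\<close> by blast
  qed
qed

lemma mlin_id: "mlin R M M (\<lambda>x. x)"
  by (auto simp: mlin_def)

context module
begin

lemma mlin_smult: "s \<in> carrier R \<Longrightarrow> mlin R M M (\<lambda>x. s \<odot>\<^bsub>M\<^esub> x)"
  by (auto simp: mlin_def smult_r_distr smult_assoc1[symmetric] R.m_comm)

lemma len_mono: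
  assumes P: "primeideal P R" and sub: "submodule K R M" "submodule L R M" "submodule K' R M" "submodule L' R M"
    and "K \<subseteq> psat R M P L" "K \<subseteq> psat R M P K'" "L' \<subseteq> psat R M P L"
  shows "len R M P K' L' \<le> len R M P K L"
proof (rule len_surj[OF module_axioms module_axioms P mlin_id sub])
  fix y assume "y \<in> L'"
  then obtain s where s: "s \<in> carrier R - P" "s \<odot>\<^bsub>M\<^esub> y \<in> L" using assms(8) by (auto simp: psat_def)
  then have "s \<odot>\<^bsub>M\<^esub> y = \<zero>\<^bsub>M\<^esub> \<oplus>\<^bsub>M\<^esub> s \<odot>\<^bsub>M\<^esub> y" using submodule_carrier[OF sub(2)] by simp
  then show "\<exists>s\<in>carrier R - P. \<exists>k\<in>K'. \<exists>l\<in>L. s \<odot>\<^bsub>M\<^esub> y = k \<oplus>\<^bsub>M\<^esub> l"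
    using s submodule_zero[OF sub(3)] by blast
qed (use assms in auto)

lemma len_cong:
  assumes "primeideal P R" "submodule K R M" "submodule L R M" "submodule K' R M" "submodule L' R M"
    and "K \<subseteq> psat R M P L" "psat R M P K = psat R M P K'" "psat R M P L = psat R M P L'"
  shows "len R M P K L = len R M P K' L'"
proof -
  have *: "K \<subseteq> psat R M P K'" "K' \<subseteq> psat R M P K" "L \<subseteq> psat R M P L'" "L' \<subseteq> psat R M P L"
    using assms psat_upper[OF assms(1)] submoduleE(1) by blast+
  have "K' \<subseteq> psat R M P L'"
    using *(2) psat_least[OF assms(1,6) submoduleE(1)[OF assms(3)]] assms(8) by blast
  then show ?thesis using * assms by (intro antisym len_mono) auto
qed

lemma len_zero_iff:
  assumes P: "primeideal P R" and sub: "submodule K R M" "submodule L R M" and KL: "K \<subseteq> psat R M P L"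
  shows "len R M P K L = 0 \<longleftrightarrow> L \<subseteq> psat R M P K"
proof
  assume L: "L \<subseteq> psat R M P K"
  have "N = psat R M P K" if "N \<in> satfam R M P K L" for N
  proof -
    have "psat R M P K \<subseteq> N" using that psat_mono[of K N P] by (auto simp: satfam_def)
    moreover have "N \<subseteq> psat R M P K"
      using that psat_least[OF P L submoduleE(1)[OF sub(1)]] by (auto simp: satfam_def)
    ultimately show ?thesis by blast
  qed
  note * = this
  have "len R M P K L \<le> 0"
    unfolding len_def
  proof (rule max_chain_length_le)
    fix n and F :: "nat \<Rightarrow> _"
    assume F: "\<And>i. i \<le> n \<Longrightarrow> F i \<in> satfam R M P K L" "\<And>i. i < n \<Longrightarrow> F i \<subset> F (Suc i)"
    show "enat n \<le> 0"
    proof (cases n)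
      case (Suc m)
      then show ?thesis using F(2)[of 0] *[OF F(1)[of 0]] *[OF F(1)[of 1]] by simp
    qed (simp add: zero_enat_def)
  qed
  then show "len R M P K L = 0" by simp
next
  assume 0: "len R M P K L = 0"
  show "L \<subseteq> psat R M P K"
  proof (rule ccontr)
    assume no: "\<not> L \<subseteq> psat R M P K"
    have "psat R M P K \<subset> psat R M P L"
      using psat_least[OF P KL submoduleE(1)[OF sub(2)]] no psat_upper[OF P submoduleE(1)[OF sub(2)]] by blast
    moreover have "psat R M P K \<in> satfam R M P K L" by (rule psat_in_satfam[OF P sub KL])
    moreover have "psat R M P L \<in> satfam R M P K L"
      by (intro satfamI submodule_psat P sub psat_idem submoduleE(1)[OF sub(2)] KL subset_refl)
    ultimately have "enat 1 \<le> len R M P K L"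
      unfolding len_def
      by (intro max_chain_length_ge[of _ "\<lambda>i. if i = 0 then psat R M P K else psat R M P L"]) auto
    then show False using 0 by (simp add: zero_enat_def)
  qed
qed

lemma len_zero: "primeideal P R \<Longrightarrow> submodule K R M \<Longrightarrow> submodule L R M \<Longrightarrow> K \<subseteq> psat R M P L
    \<Longrightarrow> L \<subseteq> psat R M P K \<Longrightarrow> len R M P K L = 0"
  using len_zero_iff by blast

text \<open>\<open>H\<close> is the second member of a longest chain. It lies properly above
  \<open>K\<close> and still has \<open>n\<close> steps above it, so additivity turns both lower
  bounds into equalities.\<close>

lemma len_split_Suc:
  assumes P: "primeideal P R" and sub: "submodule K R M" "submodule L R M" and KL: "K \<subseteq> psat R M P L"
    and len: "len R M P K L = enat (Suc n)"
  obtains H where "submodule H R M" "psat R M P H = H" "K \<subseteq> H" "H \<subseteq> psat R M P L"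
    "len R M P K H = 1" "len R M P H L = enat n"
proof -
  have "satfam R M P K L \<noteq> {}" using psat_in_satfam[OF P sub KL] by blast
  moreover have "enat (Suc n) \<le> max_chain_length (satfam R M P K L)" using len by (simp add: len_def)
  ultimately obtain F where F: "\<And>i. i \<le> Suc n \<Longrightarrow> F i \<in> satfam R M P K L" "\<And>i. i < Suc n \<Longrightarrow> F i \<subset> F (Suc i)"
    using max_chain_length_chainE[of "Suc n" "satfam R M P K L"] by blast
  define H where "H = F 1"
  have H: "submodule H R M" "psat R M P H = H" "K \<subseteq> H" "H \<subseteq> psat R M P L"
    using F(1)[of 1] by (auto simp: H_def satfam_def)
  have F': "submodule (F i) R M" "psat R M P (F i) = F i" "K \<subseteq> F i" "F i \<subseteq> psat R M P L" if "i \<le> Suc n" for i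
    using F(1)[OF that] by (auto simp: satfam_def)
  have KH: "K \<subseteq> psat R M P H" using H by blast
  have "\<not> H \<subseteq> psat R M P K" using F'[of 0] psat_mono[of K "F 0" P] F(2)[of 0] by (auto simp: H_def)
  then have 1: "len R M P K H \<noteq> 0" using len_zero_iff[OF P sub(1) H(1) KH] by blast
  have Hle: "H \<subseteq> F (Suc i)" if "i \<le> n" for i
    using that
  proof (induction i)
    case (Suc i)
    then show ?case using F(2)[of "Suc i"] by auto
  qed (simp add: H_def)
  have 2: "enat n \<le> len R M P H L"
    unfolding len_def
  proof (rule max_chain_length_ge[of _ "\<lambda>i. F (Suc i)"])
    fix i assume "i \<le> n"
    then show "F (Suc i) \<in> satfam R M P H L"
      using F'[of "Suc i"] Hle by (intro satfamI) auto
  qed (use F in auto)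
  have sum: "len R M P K H + len R M P H L = enat (Suc n)"
    using len_add[OF P sub(1) H(1) sub(2) KH H(4)] len by simp
  then obtain a b where ab: "len R M P K H = enat a" "len R M P H L = enat b"
    by (cases "len R M P K H"; cases "len R M P H L") auto
  then have "a \<noteq> 0" "n \<le> b" "a + b = Suc n" using 1 2 sum by (auto simp: zero_enat_def)
  then have "a = 1" "b = n" by auto
  then show thesis using that[OF H] ab by (simp add: one_enat_def)
qed

lemma submodule_sum_cyc: "submodule K R M \<Longrightarrow> x \<in> carrier M \<Longrightarrow> submodule (K <+>\<^bsub>M\<^esub> cyc R M x) R M"
  by (intro submodule_sum submodule_cyc)

lemma sum_cyc_iff: "z \<in> K <+>\<^bsub>M\<^esub> cyc R M x \<longleftrightarrow> (\<exists>k\<in>K. \<exists>r\<in>carrier R. z = k \<oplus>\<^bsub>M\<^esub> r \<odot>\<^bsub>M\<^esub> x)"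
  by (auto simp: set_add_iff cyc_def)

lemma sum_cyc_upper: "submodule K R M \<Longrightarrow> x \<in> carrier M \<Longrightarrow> K \<subseteq> K <+>\<^bsub>M\<^esub> cyc R M x"
  by (intro sum_upper1 submodule_cyc)

lemma sum_cyc_self: "submodule K R M \<Longrightarrow> x \<in> carrier M \<Longrightarrow> x \<in> K <+>\<^bsub>M\<^esub> cyc R M x"
  using sum_upper2[of K "cyc R M x"] submodule_cyc cyc_self by blast

text \<open>A subquotient of length one over \<open>R_P\<close> is simple: any element outside
  \<open>K_P\<close> generates it, and it is a copy of the residue field.\<close>

lemma len_simple:
  assumes P: "primeideal P R" and sub: "submodule K R M" "submodule H R M" and KH: "K \<subseteq> psat R M P H"
    and len: "len R M P K H = 1"
  obtains x where "x \<in> H" "H \<subseteq> psat R M P (K <+>\<^bsub>M\<^esub> cyc R M x)"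
    "\<And>r. r \<in> carrier R \<Longrightarrow> r \<odot>\<^bsub>M\<^esub> x \<in> psat R M P K \<longleftrightarrow> r \<in> P"
proof -
  interpret P: primeideal P R by fact
  have "\<not> H \<subseteq> psat R M P K" using len_zero_iff[OF P sub KH] len by auto
  then obtain x where x: "x \<in> H" "x \<notin> psat R M P K" by blast
  have xc: "x \<in> carrier M" using submodule_carrier[OF sub(2) x(1)] .
  have sK: "submodule (psat R M P K) R M" by (rule submodule_psat[OF P sub(1)])
  \<comment> \<open>By additivity along \<open>K \<subseteq> A \<subseteq> B \<subseteq> H\<close>,
    the steps from \<open>A\<close> to \<open>B\<close> and from \<open>B\<close> to
    \<open>H\<close> cannot both be proper when the total length is one.\<close>
  have rule: "B \<subseteq> psat R M P A \<or> H \<subseteq> psat R M P B"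
    if "submodule A R M" "submodule B R M" "K \<subseteq> A" "A \<subseteq> B" "B \<subseteq> psat R M P H" for A B
  proof (rule ccontr)
    assume no: "\<not> ?thesis"
    have AB: "A \<subseteq> psat R M P B" using that(4) psat_upper[OF P submoduleE(1)[OF that(2)]] by blast
    have KB: "K \<subseteq> psat R M P B" using AB that by blast
    have "len R M P A B \<noteq> 0" "len R M P B H \<noteq> 0"
      using no len_zero_iff[OF P that(1,2) AB] len_zero_iff[OF P that(2) sub(2) that(5)] by blast+
    moreover have "len R M P K H = len R M P K B + len R M P B H"
      by (rule len_add[OF P sub(1) that(2) sub(2) KB that(5)])
    moreover have "len R M P K B = len R M P K A + len R M P A B"
      using that(3) psat_upper[OF P submoduleE(1)[OF that(1)]] by (intro len_add[OF P sub(1) that(1,2) _ AB]) blast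
    ultimately show False using len
      by (cases "len R M P A B"; cases "len R M P B H"; cases "len R M P K A")
        (simp_all add: one_enat_def zero_enat_def)
  qed
  define B where "B = K <+>\<^bsub>M\<^esub> cyc R M x"
  have B: "submodule B R M" "K \<subseteq> B" "x \<in> B" "B \<subseteq> psat R M P H"
    unfolding B_def using submodule_sum_cyc[OF sub(1) xc] sum_cyc_upper[OF sub(1) xc] sum_cyc_self[OF sub(1) xc]
      sum_least[OF submodule_psat[OF P sub(2)] KH cyc_least[OF submodule_psat[OF P sub(2)]]]
      psat_upper[OF P submoduleE(1)[OF sub(2)]] x(1) by blast+
  have HB: "H \<subseteq> psat R M P B"
    using rule[OF sub(1) B(1) subset_refl B(2,4)] B(3) x(2) by blast
  have "r \<odot>\<^bsub>M\<^esub> x \<in> psat R M P K" if r: "r \<in> P" for r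
  proof (rule ccontr)
    assume no: "r \<odot>\<^bsub>M\<^esub> x \<notin> psat R M P K"
    have rc: "r \<in> carrier R" using P.Icarr[OF r] .
    define A where "A = K <+>\<^bsub>M\<^esub> cyc R M (r \<odot>\<^bsub>M\<^esub> x)"
    have rxc: "r \<odot>\<^bsub>M\<^esub> x \<in> carrier M" using rc xc by simp
    have A: "submodule A R M" "K \<subseteq> A" "r \<odot>\<^bsub>M\<^esub> x \<in> A" "A \<subseteq> B"
      unfolding A_def using submodule_sum_cyc[OF sub(1) rxc] sum_cyc_upper[OF sub(1) rxc] sum_cyc_self[OF sub(1) rxc]
        sum_least[OF B(1,2) cyc_least[OF B(1) submodule_smult[OF B(1) rc B(3)]]] by blast+
    have AB: "A \<subseteq> psat R M P H" using A(4) B(4) by blast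
    have "H \<subseteq> psat R M P A" using rule[OF sub(1) A(1) subset_refl A(2) AB] A(3) no by blast
    then obtain s k t where s: "s \<in> carrier R - P" "k \<in> K" "t \<in> carrier R" "s \<odot>\<^bsub>M\<^esub> x = k \<oplus>\<^bsub>M\<^esub> t \<odot>\<^bsub>M\<^esub> (r \<odot>\<^bsub>M\<^esub> x)"
      using x(1) unfolding A_def psat_def by (auto simp: sum_cyc_iff)
    have tr: "t \<otimes> r \<in> P" using r s(3) by (simp add: P.I_l_closed)
    define u where "u = s \<ominus> t \<otimes> r"
    have u: "u \<in> carrier R" "s = u \<oplus> t \<otimes> r"
      using s(1,3) rc by (auto simp: u_def a_minus_def R.a_assoc R.l_neg)
    have "u \<notin> P" using u tr s(1) by auto
    have "u \<odot>\<^bsub>M\<^esub> x \<oplus>\<^bsub>M\<^esub> (t \<otimes> r) \<odot>\<^bsub>M\<^esub> x = k \<oplus>\<^bsub>M\<^esub> (t \<otimes> r) \<odot>\<^bsub>M\<^esub> x"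
      using s(4) u(1) s(3) rc xc by (simp add: u(2) smult_l_distr smult_assoc1)
    then have "u \<odot>\<^bsub>M\<^esub> x = k" using u(1) s(3) rc xc submodule_carrier[OF sub(1) s(2)] by simp
    then show False using x(2) psatI[OF xc, of u P K] u(1) \<open>u \<notin> P\<close> s(2) by blast
  qed
  moreover have "r \<in> P" if "r \<in> carrier R" "r \<odot>\<^bsub>M\<^esub> x \<in> psat R M P K" for r
    using that x(2) psatI[OF xc, of r P "psat R M P K"] psat_idem[OF P submoduleE(1)[OF sub(1)]] by blast
  ultimately show thesis using that[OF x(1)] HB unfolding B_def by blast
qed

end

subsection \<open>Frobenius\<close>

lemma (in cring) binomial_nat_pow:
  assumes x: "x \<in> carrier R" and y: "y \<in> carrier R"
  shows "(x \<oplus> y) [^] n = (\<Oplus>k\<in>{..n}. [(n choose k)] \<cdot> (x [^] k \<otimes> y [^] (n - k)))"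
proof (induction n)
  case 0
  then show ?case using x y by simp
next
  case (Suc n)
  define t where "t k j = x [^] (k::nat) \<otimes> y [^] (j::nat)" for k j
  have t [simp]: "t k j \<in> carrier R" for k j using x y by (simp add: t_def)
  have tx: "t k j \<otimes> x = t (Suc k) j" and ty: "t k j \<otimes> y = t k (Suc j)" for k j
    using x y by (simp_all add: t_def m_ac)
  have "(x \<oplus> y) [^] Suc n = (\<Oplus>k\<in>{..n}. [(n choose k)] \<cdot> t k (n - k)) \<otimes> (x \<oplus> y)"
    using Suc x y by (simp add: t_def)
  also have "\<dots> = (\<Oplus>k\<in>{..n}. [(n choose k)] \<cdot> t k (n - k)) \<otimes> x \<oplus> (\<Oplus>k\<in>{..n}. [(n choose k)] \<cdot> t k (n - k)) \<otimes> y"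
    using x y by (intro r_distr) auto
  also have "(\<Oplus>k\<in>{..n}. [(n choose k)] \<cdot> t k (n - k)) \<otimes> x = (\<Oplus>k\<in>{..n}. [(n choose k)] \<cdot> t (Suc k) (n - k))"
    using x by (subst finsum_ldistr) (auto intro!: finsum_cong' simp: add_pow_ldistr tx)
  also have "(\<Oplus>k\<in>{..n}. [(n choose k)] \<cdot> t k (n - k)) \<otimes> y = (\<Oplus>k\<in>{..n}. [(n choose k)] \<cdot> t k (Suc n - k))"
    using y by (subst finsum_ldistr) (auto intro!: finsum_cong' simp: add_pow_ldistr ty Suc_diff_le)
  also have "\<dots> = (\<Oplus>k\<in>{..Suc n}. [(n choose k)] \<cdot> t k (Suc n - k))"
    by (subst finsum_Suc) (auto simp: binomial_eq_0)
  also have "\<dots> = (\<Oplus>k\<in>{..n}. [(n choose (Suc k))] \<cdot> t (Suc k) (n - k)) \<oplus> [(n choose 0)] \<cdot> t 0 (Suc n)"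
    by (subst finsum_Suc2) auto
  also have "(\<Oplus>k\<in>{..n}. [(n choose k)] \<cdot> t (Suc k) (n - k)) \<oplus> \<dots>
    = (\<Oplus>k\<in>{..n}. [(n choose k)] \<cdot> t (Suc k) (n - k) \<oplus> [(n choose (Suc k))] \<cdot> t (Suc k) (n - k)) \<oplus> [(n choose 0)] \<cdot> t 0 (Suc n)"
    by (subst finsum_addf) (auto simp: a_assoc)
  also have "\<dots> = (\<Oplus>k\<in>{..n}. [(Suc n choose Suc k)] \<cdot> t (Suc k) (Suc n - Suc k)) \<oplus> [(Suc n choose 0)] \<cdot> t 0 (Suc n - 0)"
    by (auto intro!: arg_cong2[of _ _ _ _ "(\<oplus>)"] finsum_cong' simp: add.nat_pow_mult)
  also have "\<dots> = (\<Oplus>k\<in>{..Suc n}. [(Suc n choose k)] \<cdot> t k (Suc n - k))"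
    by (subst finsum_Suc2) auto
  finally show ?case by (simp add: t_def)
qed

locale prime_char_ring = cring R for R (structure) +
  fixes p :: nat
  assumes p_prime: "Factorial_Ring.prime p" and char_p: "[p] \<cdot> \<one> = \<zero>"
begin

lemma char_mult: "x \<in> carrier R \<Longrightarrow> p dvd n \<Longrightarrow> [n] \<cdot> x = \<zero>"
proof (elim dvdE)
  fix k assume x: "x \<in> carrier R" and n: "n = p * k"
  have "[p] \<cdot> x = [p] \<cdot> (\<one> \<otimes> x)" using x by simp
  also have "\<dots> = ([p] \<cdot> \<one>) \<otimes> x" using x add_pow_ldistr[of \<one> x p] by simp
  finally have "[p] \<cdot> x = \<zero>" using char_p x by simp
  then show "[n] \<cdot> x = \<zero>" using add.nat_pow_pow[OF x, of k p] by (simp add: n mult.commute)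
qed

lemma frob_add:
  assumes x: "x \<in> carrier R" and y: "y \<in> carrier R"
  shows "(x \<oplus> y) [^] p = x [^] p \<oplus> y [^] p"
proof -
  obtain m where m: "p = Suc m" using p_prime by (metis not0_implies_Suc not_prime_0)
  define T where "T k = [(p choose k)] \<cdot> (x [^] k \<otimes> y [^] (p - k))" for k
  have T: "T k \<in> carrier R" for k using x y by (simp add: T_def)
  have T0: "T k = \<zero>" if "0 < k" "k < p" for k
    using dvd_choose_prime[of k p] that p_prime x y char_mult by (simp add: T_def)
  have "(x \<oplus> y) [^] p = finsum R T {..Suc m}"
    using binomial_nat_pow[OF x y, of p] unfolding T_def m .
  also have "\<dots> = finsum R (\<lambda>i. T (Suc i)) {..m} \<oplus> T 0" using T by (intro finsum_Suc2) auto
  also have "finsum R (\<lambda>i. T (Suc i)) {..m} = T p"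
  proof (cases m)
    case 0 then show ?thesis using T m by simp
  next
    case (Suc l)
    have "finsum R (\<lambda>i. T (Suc i)) {..Suc l} = T (Suc (Suc l)) \<oplus> finsum R (\<lambda>i. T (Suc i)) {..l}"
      using T by (intro finsum_Suc) auto
    also have "finsum R (\<lambda>i. T (Suc i)) {..l} = finsum R (\<lambda>i. \<zero>) {..l}"
      using T0 T by (intro finsum_cong') (auto simp: m Suc)
    finally show ?thesis using T by (simp add: m Suc)
  qed
  finally show ?thesis using x y by (simp add: T_def)
qed

lemma frobe_add:
  assumes "x \<in> carrier R" "y \<in> carrier R"
  shows "(x \<oplus> y) [^] (p ^ e) = x [^] (p ^ e) \<oplus> y [^] (p ^ e)"
  by (induction e) (use assms in \<open>simp_all add: nat_pow_pow[symmetric] mult.commute[of p] frob_add\<close>)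

end

section \<open>Restriction of scalars along Frobenius\<close>

lemma self_module_simps [simp]:
  "carrier (self_module R) = carrier R" "smult (self_module R) = mult R" "add (self_module R) = add R"
  "zero (self_module R) = zero R" "mult (self_module R) = mult R" "one (self_module R) = one R"
  by (simp_all add: self_module_def)

text \<open>Updating nothing but the scalar multiplication keeps carrier and addition, so the same
  sets can be compared in \<open>M\<close> and in all its restrictions.\<close>

definition tw :: "('a, 'c) ring_scheme \<Rightarrow> nat \<Rightarrow> ('a, 'b, 'd) module_scheme \<Rightarrow> ('a, 'b, 'd) module_scheme" where
  "tw R p M = M\<lparr>smult := \<lambda>r x. (r [^]\<^bsub>R\<^esub> p) \<odot>\<^bsub>M\<^esub> x\<rparr>"

text \<open>The module obtained by restricting scalars along the \<open>e\<close>-th power of Frobenius.\<close>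

definition fpush :: "('a, 'c) ring_scheme \<Rightarrow> nat \<Rightarrow> nat \<Rightarrow> ('a, 'b, 'd) module_scheme \<Rightarrow> ('a, 'b, 'd) module_scheme" where
  "fpush R p e M = (tw R p ^^ e) M"

lemma tw_simps [simp]:
  "carrier (tw R p M) = carrier M" "add (tw R p M) = add M" "zero (tw R p M) = zero M"
  "r \<odot>\<^bsub>tw R p M\<^esub> x = (r [^]\<^bsub>R\<^esub> p) \<odot>\<^bsub>M\<^esub> x"
  by (simp_all add: tw_def)

lemma fpush_0 [simp]: "fpush R p 0 M = M"
  by (simp add: fpush_def)

lemma fpush_Suc: "fpush R p (Suc e) M = tw R p (fpush R p e M)"
  by (simp add: fpush_def)

lemma fpush_tw: "fpush R p e (tw R p M) = fpush R p (Suc e) M"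
  by (simp add: fpush_def funpow_swap1)

lemma fpush_fpush: "fpush R p e (fpush R p e' M) = fpush R p (e + e') M"
  by (simp add: fpush_def funpow_add)

lemma fpush_simps [simp]:
  "carrier (fpush R p e M) = carrier M" "add (fpush R p e M) = add M" "zero (fpush R p e M) = zero M"
  by (induction e) (simp_all add: fpush_Suc)

lemma set_add_fpush [simp]: "set_add (fpush R p e M) = set_add M"
  by (intro ext) (simp add: set_add_def')

lemma set_add_self: "set_add (self_module R) = set_add R"
  by (intro ext) (simp add: set_add_def')

lemma (in cring) fpush_smult:
  "r \<in> carrier R \<Longrightarrow> r \<odot>\<^bsub>fpush R p e M\<^esub> x = (r [^] (p ^ e)) \<odot>\<^bsub>M\<^esub> x"
  by (induction e arbitrary: r) (simp_all add: fpush_Suc nat_pow_pow)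

lemma (in cring) module_self: "module R (self_module R)"
proof (rule moduleI)
  show "abelian_group (self_module R)"
    by (rule abelian_groupI) (auto simp: a_ac intro!: bexI[of _ "\<ominus> _"] l_neg)
qed (auto simp: is_cring l_distr r_distr m_assoc)

lemma (in cring) submodule_self_iff: "submodule I R (self_module R) \<longleftrightarrow> ideal I R"
proof
  assume I: "submodule I R (self_module R)"
  interpret S: module R "self_module R" by (rule module_self)
  have "ideal {r \<in> carrier R. r \<odot>\<^bsub>self_module R\<^esub> \<one> \<in> I} R"
    using S.submodule_ideal_quot[OF I, of \<one>] by simp
  moreover have "{r \<in> carrier R. r \<odot>\<^bsub>self_module R\<^esub> \<one> \<in> I} = I"
    using S.submodule_carrier[OF I] by auto
  ultimately show "ideal I R" by simp
next
  assume I: "ideal I R"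
  then interpret ideal I R .
  interpret S: module R "self_module R" by (rule module_self)
  show "submodule I R (self_module R)"
    by (rule S.submoduleI') (auto simp: I_l_closed)
qed

lemma (in prime_char_ring) module_fpush:
  assumes "module R M" shows "module R (fpush R p e M)"
proof -
  interpret M: module R M by fact
  show ?thesis
  proof (rule moduleI)
    show "abelian_group (fpush R p e M)"
      by (rule abelian_groupI) (auto simp: M.a_ac intro!: bexI[of _ "\<ominus>\<^bsub>M\<^esub> _"] M.l_neg)
  qed (auto simp: is_cring fpush_smult frobe_add M.smult_l_distr M.smult_r_distr nat_pow_distrib M.smult_assoc1)
qed

lemma (in prime_char_ring) submodule_fpush:
  assumes "module R M" "submodule K R M" shows "submodule K R (fpush R p e M)"
proof -
  interpret M: module R M by fact
  interpret F: module R "fpush R p e M" by (rule module_fpush[OF assms(1)])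
  show ?thesis
    by (rule F.submoduleI')
      (use M.submodule_carrier[OF assms(2)] M.submodule_rules[OF assms(2)] in \<open>auto simp: fpush_smult\<close>)
qed

text \<open>Denominators may be replaced by their \<open>q\<close>-th powers: the complement of
  \<open>P\<close> is closed under powers, and \<open>s x \<in> K\<close> implies
  \<open>s^q x \<in> K\<close>. The latter uses that \<open>K\<close> is stable under all of
  \<open>R\<close>, not just under \<open>q\<close>-th powers.\<close>

lemma (in prime_char_ring) psat_fpush:
  assumes M: "module R M" and K: "submodule K R M" and P: "primeideal P R"
  shows "psat R (fpush R p e M) P K = psat R M P K"
proof -
  interpret M: module R M by fact
  have p0: "p ^ e \<noteq> 0" using p_prime by (simp add: prime_gt_0_nat)
  show ?thesis
  proof (intro Set.set_eqI iffI)
    fix x assume "x \<in> psat R (fpush R p e M) P K"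
    then obtain s where "x \<in> carrier M" "s \<in> carrier R - P" "(s [^] (p ^ e)) \<odot>\<^bsub>M\<^esub> x \<in> K"
      by (auto simp: psat_def fpush_smult)
    then show "x \<in> psat R M P K"
      using primeideal_pow_notin[OF P, of s "p ^ e"] by (intro M.psatI[of x "s [^] (p ^ e)"]) auto
  next
    fix x assume "x \<in> psat R M P K"
    then obtain s where s: "x \<in> carrier M" "s \<in> carrier R - P" "s \<odot>\<^bsub>M\<^esub> x \<in> K"
      by (auto simp: psat_def)
    obtain n where n: "p ^ e = Suc n" using p0 not0_implies_Suc by blast
    have "(s [^] (p ^ e)) \<odot>\<^bsub>M\<^esub> x = (s [^] n) \<odot>\<^bsub>M\<^esub> (s \<odot>\<^bsub>M\<^esub> x)"
      using s by (simp add: n M.smult_assoc1)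
    also have "\<dots> \<in> K" using s M.submodule_smult[OF K] by simp
    finally show "x \<in> psat R (fpush R p e M) P K"
      using s by (auto simp: psat_def fpush_smult)
  qed
qed

lemma (in prime_char_ring) mlin_orbit:
  assumes "module R M" "x \<in> carrier M"
  shows "mlin R (fpush R p e (self_module R)) (fpush R p e M) (\<lambda>r. r \<odot>\<^bsub>M\<^esub> x)"
proof -
  interpret M: module R M by fact
  show ?thesis using assms(2) by (auto simp: mlin_def fpush_smult M.smult_l_distr M.smult_assoc1)
qed

text \<open>\<open>(K + R x) / K\<close> is isomorphic to \<open>R / (K : x)\<close>, also after restriction of scalars.\<close>

lemma (in prime_char_ring) len_cyc:
  assumes M: "module R M" and K: "submodule K R M" and x: "x \<in> carrier M" and P: "primeideal P R"
  shows "len R (fpush R p e M) P K (K <+>\<^bsub>M\<^esub> cyc R M x)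
    = len R (fpush R p e (self_module R)) P {r \<in> carrier R. r \<odot>\<^bsub>M\<^esub> x \<in> K} (carrier R)"
proof -
  interpret M: module R M by fact
  let ?A = "{r \<in> carrier R. r \<odot>\<^bsub>M\<^esub> x \<in> K}"
  interpret S: module R "self_module R" by (rule module_self)
  interpret FS: module R "fpush R p e (self_module R)" by (rule module_fpush[OF module_self])
  interpret FM: module R "fpush R p e M" by (rule module_fpush[OF M])
  note sub = submodule_fpush[OF M] submodule_fpush[OF module_self]
  have KL: "submodule (K <+>\<^bsub>M\<^esub> cyc R M x) R M" by (rule M.submodule_sum_cyc[OF K x])
  have A: "submodule ?A R (self_module R)"
    using M.submodule_ideal_quot[OF K x] by (simp add: submodule_self_iff)
  have C: "submodule (carrier R) R (self_module R)" using S.carrier_is_submodule by simp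
  show ?thesis
  proof (rule antisym)
    show "len R (fpush R p e M) P K (K <+>\<^bsub>M\<^esub> cyc R M x)
      \<le> len R (fpush R p e (self_module R)) P ?A (carrier R)"
    proof (rule len_surj[OF FS.module_axioms FM.module_axioms P mlin_orbit[OF M x] sub(2)[OF A] sub(2)[OF C] sub(1)[OF K] sub(1)[OF KL]])
      show "?A \<subseteq> psat R (fpush R p e (self_module R)) P (carrier R)"
        using FS.psat_zero_full[OF P] by simp
      show "r \<odot>\<^bsub>M\<^esub> x \<in> psat R (fpush R p e M) P K" if "r \<in> ?A" for r
        using that FM.psat_upper[OF P, of K] M.submodule_carrier[OF K] by auto
    next
      fix y assume "y \<in> K <+>\<^bsub>M\<^esub> cyc R M x"
      then obtain k r where "k \<in> K" "r \<in> carrier R" "y = k \<oplus>\<^bsub>M\<^esub> r \<odot>\<^bsub>M\<^esub> x"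
        by (auto simp: M.sum_cyc_iff)
      then show "\<exists>s\<in>carrier R - P. \<exists>k\<in>K. \<exists>l\<in>carrier R. s \<odot>\<^bsub>fpush R p e M\<^esub> y = k \<oplus>\<^bsub>fpush R p e M\<^esub> l \<odot>\<^bsub>M\<^esub> x"
        using primeideal_one_notin[OF P] x M.submodule_carrier[OF K]
        by (intro bexI[of _ \<one>] bexI[of _ k] bexI[of _ r]) (auto simp: fpush_smult)
    qed
    show "len R (fpush R p e (self_module R)) P ?A (carrier R)
      \<le> len R (fpush R p e M) P K (K <+>\<^bsub>M\<^esub> cyc R M x)"
    proof (rule len_inj[OF FS.module_axioms FM.module_axioms P mlin_orbit[OF M x] sub(2)[OF A] sub(2)[OF C] sub(1)[OF K] sub(1)[OF KL]])
      show "K \<subseteq> psat R (fpush R p e M) P (K <+>\<^bsub>M\<^esub> cyc R M x)"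
        using FM.psat_upper[OF P, of "K <+>\<^bsub>M\<^esub> cyc R M x"] M.sum_cyc_upper[OF K x] M.submodule_carrier[OF KL] by auto
      fix r assume r: "r \<in> carrier R"
      have "r \<odot>\<^bsub>M\<^esub> x \<in> K <+>\<^bsub>M\<^esub> cyc R M x"
        using M.sum_upper2[OF K M.submodule_cyc[OF x]] r by (auto simp: cyc_def)
      then show "r \<odot>\<^bsub>M\<^esub> x \<in> psat R (fpush R p e M) P (K <+>\<^bsub>M\<^esub> cyc R M x)"
        using FM.psat_upper[OF P, of "K <+>\<^bsub>M\<^esub> cyc R M x"] M.submodule_carrier[OF KL] by auto
      assume "r \<odot>\<^bsub>M\<^esub> x \<in> psat R (fpush R p e M) P K"
      then obtain s where s: "s \<in> carrier R - P" "(s [^] (p ^ e)) \<odot>\<^bsub>M\<^esub> (r \<odot>\<^bsub>M\<^esub> x) \<in> K"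
        by (auto simp: psat_def fpush_smult)
      then have "s [^] (p ^ e) \<otimes> r \<in> ?A" using r x by (simp add: M.smult_assoc1)
      then show "r \<in> psat R (fpush R p e (self_module R)) P ?A"
        using s(1) r by (intro FS.psatI[of r s]) (auto simp: fpush_smult)
    qed
  qed
qed

lemma (in prime_char_ring) len_cyc0:
  assumes M: "module R M" and K: "submodule K R M" and x: "x \<in> carrier M" and P: "primeideal P R"
  shows "len R M P K (K <+>\<^bsub>M\<^esub> cyc R M x)
    = len R (self_module R) P {r \<in> carrier R. r \<odot>\<^bsub>M\<^esub> x \<in> K} (carrier R)"
  using len_cyc[OF assms, of 0] by simp

lemma (in prime_char_ring) len_ring_zero:
  assumes P: "primeideal P R" and I: "ideal I R" and "\<not> I \<subseteq> P"
  shows "len R (fpush R p e (self_module R)) P I (carrier R) = 0"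
proof -
  interpret S: module R "self_module R" by (rule module_self)
  interpret FS: module R "fpush R p e (self_module R)" by (rule module_fpush[OF module_self])
  interpret I: ideal I R by fact
  note sub = submodule_fpush[OF module_self]
  obtain s where s: "s \<in> I" "s \<notin> P" using assms by blast
  have Is: "submodule I R (self_module R)" using I by (simp add: submodule_self_iff)
  have "carrier R \<subseteq> psat R (self_module R) P I"
    using s I.Icarr by (auto simp: psat_def I.I_r_closed intro!: bexI[of _ s])
  then have "carrier R \<subseteq> psat R (fpush R p e (self_module R)) P I"
    using psat_fpush[OF module_self Is P] by simp
  then show ?thesis
    using FS.len_zero[OF P sub[OF Is] FS.carrier_is_submodule] FS.psat_zero_full[OF P] I.a_subset
    by auto
qed

lemma (in cring) psat_prime:
  assumes P: "primeideal P R" shows "psat R (self_module R) P P = P"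
proof -
  interpret primeideal P R by fact
  interpret S: module R "self_module R" by (rule module_self)
  have "psat R (self_module R) P P \<subseteq> P" using I_prime by (auto simp: psat_def)
  then show ?thesis using S.psat_upper[OF P, of P] a_subset by simp
qed

lemma (in cring) len_residue_field:
  assumes P: "primeideal P R"
  shows "len R (self_module R) P P (carrier R) = 1"
proof -
  interpret primeideal P R by fact
  interpret S: module R "self_module R" by (rule module_self)
  have s: "submodule P R (self_module R)" using is_ideal by (simp add: submodule_self_iff)
  have c: "submodule (carrier R) R (self_module R)" using S.carrier_is_submodule by simp
  have le: "P \<subseteq> psat R (self_module R) P (carrier R)" using S.psat_zero_full[OF P] a_subset by auto
  have "\<not> carrier R \<subseteq> psat R (self_module R) P P" using psat_prime[OF P] I_notcarr a_subset by auto
  then have 0: "len R (self_module R) P P (carrier R) \<noteq> 0" using S.len_zero_iff[OF P s c le] by simp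
  have 1: "len R (self_module R) P P (carrier R) \<le> enat 1"
    unfolding len_def
  proof (rule max_chain_length_le)
    fix n and F :: "nat \<Rightarrow> _"
    assume F: "\<And>i. i \<le> n \<Longrightarrow> F i \<in> satfam R (self_module R) P P (carrier R)" "\<And>i. i < n \<Longrightarrow> F i \<subset> F (Suc i)"
    show "enat n \<le> enat 1"
    proof (rule ccontr)
      assume "\<not> enat n \<le> enat 1"
      then have n: "2 \<le> n" by simp
      have F1: "submodule (F 1) R (self_module R)" "psat R (self_module R) P (F 1) = F 1"
        using F(1)[of 1] n by (simp_all add: satfam_def)
      have "P \<subseteq> F 0" using F(1)[of 0] by (simp add: satfam_def)
      moreover have "F 0 \<subset> F 1" using F(2)[of 0] n by simp
      ultimately have "P \<subset> F 1" by blast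
      then obtain s where s: "s \<in> F 1" "s \<notin> P" by blast
      have sc: "s \<in> carrier R" using S.submodule_carrier[OF F1(1) s(1)] by simp
      have "carrier R \<subseteq> F 1"
      proof
        fix r assume r: "r \<in> carrier R"
        have "s \<otimes> r \<in> F 1" using S.submodule_smult[OF F1(1) _ s(1), of r] r sc by (simp add: m_comm)
        then show "r \<in> F 1" using S.psat_mem_iff[OF P F1(2,1), of s r] s sc r by simp
      qed
      moreover have "F 1 \<subset> F 2" using F(2)[of 1] n by (simp add: numeral_2_eq_2)
      moreover have "F 2 \<subseteq> psat R (self_module R) P (carrier R)" using F(1)[of 2] n by (simp add: satfam_def)
      then have "F 2 \<subseteq> carrier R" by (auto simp: psat_def)
      ultimately show False by blast
    qed
  qed
  obtain m where m: "len R (self_module R) P P (carrier R) = enat m"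
    using enat_ile[OF 1] by blast
  have "m = 1" using 0 1 unfolding m zero_enat_def by simp
  then show ?thesis using m by (simp add: one_enat_def)
qed

subsection \<open>Prime filtrations\<close>

lemma (in noetherian_ring) ideal_wf: "wf {(J, I). ideal I R \<and> ideal J R \<and> I \<subset> J}"
  unfolding wf_iff_no_infinite_down_chain
proof
  assume "\<exists>f. \<forall>i. (f (Suc i), f i) \<in> {(J, I). ideal I R \<and> ideal J R \<and> I \<subset> J}"
  then obtain f where f: "\<And>i. ideal (f i) R" "\<And>i. f i \<subset> f (Suc i)" by blast
  have mono: "f i \<subseteq> f j" if "i \<le> j" for i j
    using f(2) by (intro lift_Suc_mono_le[OF _ that]) blast
  have "\<Union>(range f) \<in> range f"
  proof (rule ideal_chain_is_trivial)
    show "subset.chain {I. ideal I R} (range f)"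
      unfolding pred_on.chain_def
    proof (intro conjI ballI)
      show "range f \<subseteq> {I. ideal I R}" using f(1) by blast
      fix x y assume "x \<in> range f" "y \<in> range f"
      then obtain i j where "x = f i" "y = f j" by blast
      then have "x \<subseteq> y \<or> y \<subseteq> x" using mono[of i j] mono[of j i] nat_le_linear[of i j] by blast
      then show "(\<subset>)\<^sup>=\<^sup>= x y \<or> (\<subset>)\<^sup>=\<^sup>= y x" by blast
    qed
  qed simp
  then obtain i where "\<Union>(range f) = f i" by blast
  then show False using f(2)[of i] by blast
qed

text \<open>A filtration from \<open>K\<close> to \<open>L\<close> with cyclic factors \<open>R / Q\<close>, where \<open>Q\<close> runs through the list.\<close>

inductive pfilt ::
    "('a, 'c) ring_scheme \<Rightarrow> ('a, 'b, 'd) module_scheme \<Rightarrow> 'b set \<Rightarrow> 'a set list \<Rightarrow> 'b set \<Rightarrow> bool"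
  for R M K where
  Nil: "pfilt R M K [] K"
| Cons: "\<lbrakk>pfilt R M K Qs L; x \<in> carrier M; {r \<in> carrier R. r \<odot>\<^bsub>M\<^esub> x \<in> L} = Q; primeideal Q R\<rbrakk>
    \<Longrightarrow> pfilt R M K (Q # Qs) (L <+>\<^bsub>M\<^esub> cyc R M x)"

lemma pfilt_append: "pfilt R M L Qs' L' \<Longrightarrow> pfilt R M K Qs L \<Longrightarrow> pfilt R M K (Qs' @ Qs) L'"
proof (induction rule: pfilt.induct)
  case (Cons Qs' L' x Q)
  then show ?case using pfilt.Cons by fastforce
qed simp

text \<open>Generation is expressed relative to the ambient \<open>M\<close>, through the submodules
  that contain the generators, so a submodule never has to be turned into a module of its
  own.\<close>

definition fg_sub :: "('a, 'c) ring_scheme \<Rightarrow> ('a, 'b, 'd) module_scheme \<Rightarrow> 'b set \<Rightarrow> bool" where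
  "fg_sub R M L \<longleftrightarrow> submodule L R M \<and>
     (\<exists>B. finite B \<and> B \<subseteq> L \<and> (\<forall>N. submodule N R M \<and> B \<subseteq> N \<longrightarrow> L \<subseteq> N))"

context module
begin

lemma pfilt_submodule: "pfilt R M K Qs L \<Longrightarrow> submodule K R M \<Longrightarrow> submodule L R M \<and> K \<subseteq> L"
proof (induction rule: pfilt.induct)
  case (Cons Qs L x Q)
  then show ?case using submodule_sum_cyc[of L x] sum_cyc_upper[of L x] by blast
qed simp

lemma pfilt_primes: "pfilt R M K Qs L \<Longrightarrow> Q \<in> set Qs \<Longrightarrow> primeideal Q R"
  by (induction rule: pfilt.induct) auto

text \<open>Every factor is a subquotient of \<open>L / K\<close>, so an element killing
  \<open>L / K\<close> lies in each filtration prime. This is how lower bounds for the filtration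
  primes are obtained throughout.\<close>

lemma pfilt_ann:
  assumes "pfilt R M K Qs L" "submodule K R M" "a \<in> carrier R" "\<And>x. x \<in> L \<Longrightarrow> a \<odot>\<^bsub>M\<^esub> x \<in> K" "Q \<in> set Qs"
  shows "a \<in> Q"
  using assms
proof (induction rule: pfilt.induct)
  case (Cons Qs L x Q')
  have L: "submodule L R M" "K \<subseteq> L" using pfilt_submodule[OF Cons.hyps(1)] Cons.prems by auto
  have up: "L \<subseteq> L <+>\<^bsub>M\<^esub> cyc R M x" "x \<in> L <+>\<^bsub>M\<^esub> cyc R M x"
    using sum_cyc_upper[OF L(1)] sum_cyc_self[OF L(1)] Cons.hyps(2) by auto
  show ?case
  proof (cases "Q = Q'")
    case True
    have "a \<odot>\<^bsub>M\<^esub> x \<in> L" using Cons.prems(3)[OF up(2)] L(2) by blast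
    then have "a \<in> {r \<in> carrier R. r \<odot>\<^bsub>M\<^esub> x \<in> L}" using Cons.prems(2) by simp
    then show ?thesis unfolding Cons.hyps(3) True .
  next
    case False
    then have Q: "Q \<in> set Qs" using Cons.prems(4) by simp
    have "a \<odot>\<^bsub>M\<^esub> z \<in> K" if "z \<in> L" for z using Cons.prems(3) up(1) that by blast
    then show ?thesis using Cons.IH[OF Cons.prems(1,2) _ Q] by blast
  qed
qed simp

lemma sum_cyc_absorb: "submodule K R M \<Longrightarrow> x \<in> K \<Longrightarrow> K <+>\<^bsub>M\<^esub> cyc R M x = K"
  using sum_least[of K K "cyc R M x"] cyc_least[of K x] sum_cyc_upper[of K x] submodule_carrier[of K x] by blast

text \<open>Noetherian induction on the ideal \<open>K : x\<close>. If it is proper and not prime,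
  there is a product \<open>a b\<close> in it with both factors outside, and the step is split at
  \<open>K + R a x\<close>: the ideal \<open>K : a x\<close> has gained \<open>b\<close>, and
  \<open>(K + R a x) : x\<close> has gained \<open>a\<close>.\<close>

lemma pfilt_cyclic:
  assumes "noetherian_ring R" "submodule K R M" "x \<in> carrier M"
  shows "\<exists>Qs. pfilt R M K Qs (K <+>\<^bsub>M\<^esub> cyc R M x)"
proof -
  interpret noetherian_ring R by fact
  have "\<forall>K x. submodule K R M \<longrightarrow> x \<in> carrier M \<longrightarrow> {r \<in> carrier R. r \<odot>\<^bsub>M\<^esub> x \<in> K} = A \<longrightarrow>
    (\<exists>Qs. pfilt R M K Qs (K <+>\<^bsub>M\<^esub> cyc R M x))" for A
  proof (induction A rule: wf_induct_rule[OF ideal_wf])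
    case (1 A)
    show ?case
    proof (intro allI impI)
      fix K x assume K: "submodule K R M" and x: "x \<in> carrier M" and A: "{r \<in> carrier R. r \<odot>\<^bsub>M\<^esub> x \<in> K} = A"
      have iA: "ideal A R" using submodule_ideal_quot[OF K x] A by simp
      consider "carrier R = A" | "primeideal A R" | "carrier R \<noteq> A" "\<not> primeideal A R" by blast
      then show "\<exists>Qs. pfilt R M K Qs (K <+>\<^bsub>M\<^esub> cyc R M x)"
      proof cases
        case 1
        then have "\<one> \<odot>\<^bsub>M\<^esub> x \<in> K" using A by blast
        then have "x \<in> K" using x by simp
        then show ?thesis using pfilt.Nil[of R M K] sum_cyc_absorb[OF K] by auto
      next
        case 2
        then show ?thesis using pfilt.Cons[OF pfilt.Nil x A] by blast
      next
        case 3
        then obtain a b where ab: "a \<in> carrier R" "b \<in> carrier R" "a \<otimes> b \<in> A" "a \<notin> A" "b \<notin> A"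
          using primeidealI[OF iA R.is_cring] by blast
        define y where "y = a \<odot>\<^bsub>M\<^esub> x"
        have y: "y \<in> carrier M" using ab x by (simp add: y_def)
        define K1 where "K1 = K <+>\<^bsub>M\<^esub> cyc R M y"
        have K1: "submodule K1 R M" "K \<subseteq> K1" "y \<in> K1"
          unfolding K1_def using submodule_sum_cyc[OF K y] sum_cyc_upper[OF K y] sum_cyc_self[OF K y] by auto
        define A1 where "A1 = {r \<in> carrier R. r \<odot>\<^bsub>M\<^esub> y \<in> K}"
        define A2 where "A2 = {r \<in> carrier R. r \<odot>\<^bsub>M\<^esub> x \<in> K1}"
        have i1: "ideal A1 R" unfolding A1_def by (rule submodule_ideal_quot[OF K y])
        have i2: "ideal A2 R" unfolding A2_def by (rule submodule_ideal_quot[OF K1(1) x])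
        have "A \<subseteq> A1"
        proof
          fix r assume "r \<in> A"
          then have r: "r \<in> carrier R" "r \<odot>\<^bsub>M\<^esub> x \<in> K" using A by auto
          have "r \<odot>\<^bsub>M\<^esub> y = a \<odot>\<^bsub>M\<^esub> (r \<odot>\<^bsub>M\<^esub> x)"
            using r ab x by (simp add: y_def smult_assoc1[symmetric] R.m_comm)
          then show "r \<in> A1" using r submodule_smult[OF K ab(1) r(2)] by (simp add: A1_def)
        qed
        moreover have "b \<in> A1"
        proof -
          have "(a \<otimes> b) \<odot>\<^bsub>M\<^esub> x \<in> K" using ab(3) A by blast
          then show ?thesis using ab x by (simp add: A1_def y_def smult_assoc1[symmetric] R.m_comm)
        qed
        ultimately have "A \<subset> A1" using ab by blast
        then obtain Qs1 where Q1: "pfilt R M K Qs1 K1"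
          using 1 i1 iA K y unfolding K1_def A1_def by blast
        have "A \<subset> A2" using ab A K1(2,3) by (auto simp: A2_def y_def)
        then obtain Qs2 where Q2: "pfilt R M K1 Qs2 (K1 <+>\<^bsub>M\<^esub> cyc R M x)"
          using 1 i2 iA K1(1) x unfolding A2_def by blast
        have "K1 <+>\<^bsub>M\<^esub> cyc R M x = K <+>\<^bsub>M\<^esub> cyc R M x"
        proof
          have s: "submodule (K <+>\<^bsub>M\<^esub> cyc R M x) R M" by (rule submodule_sum_cyc[OF K x])
          have xs: "x \<in> K <+>\<^bsub>M\<^esub> cyc R M x" by (rule sum_cyc_self[OF K x])
          have ys: "y \<in> K <+>\<^bsub>M\<^esub> cyc R M x" unfolding y_def by (rule submodule_smult[OF s ab(1) xs])
          have "K1 \<subseteq> K <+>\<^bsub>M\<^esub> cyc R M x"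
            unfolding K1_def by (intro sum_least[OF s] sum_cyc_upper[OF K x] cyc_least[OF s ys])
          then show "K1 <+>\<^bsub>M\<^esub> cyc R M x \<subseteq> K <+>\<^bsub>M\<^esub> cyc R M x"
            by (intro sum_least[OF s] cyc_least[OF s xs])
          show "K <+>\<^bsub>M\<^esub> cyc R M x \<subseteq> K1 <+>\<^bsub>M\<^esub> cyc R M x"
            by (intro sum_mono K1(2) subset_refl)
        qed
        then show ?thesis using pfilt_append[OF Q2 Q1] by auto
      qed
    qed
  qed
  then show ?thesis using assms by blast
qed

lemma pfilt_finite:
  assumes noeth: "noetherian_ring R" and K: "submodule K R M" and B: "finite B" "B \<subseteq> carrier M"
  shows "\<exists>Qs L. pfilt R M K Qs L \<and> B \<subseteq> L \<and> (\<forall>N. submodule N R M \<and> K \<subseteq> N \<and> B \<subseteq> N \<longrightarrow> L \<subseteq> N)"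
  using B
proof (induction rule: finite_induct)
  case empty
  then show ?case using pfilt.Nil by blast
next
  case (insert x B)
  have "B \<subseteq> carrier M" using insert.prems by simp
  from insert.IH[OF this] obtain Qs L where L: "pfilt R M K Qs L" "B \<subseteq> L"
    "\<forall>N. submodule N R M \<and> K \<subseteq> N \<and> B \<subseteq> N \<longrightarrow> L \<subseteq> N"
    by (elim exE conjE)
  have sL: "submodule L R M" using pfilt_submodule[OF L(1) K] by blast
  have x: "x \<in> carrier M" using insert by blast
  obtain Qs' where Q: "pfilt R M L Qs' (L <+>\<^bsub>M\<^esub> cyc R M x)" using pfilt_cyclic[OF noeth sL x] by blast
  show ?case
  proof (intro exI conjI allI impI)
    show "pfilt R M K (Qs' @ Qs) (L <+>\<^bsub>M\<^esub> cyc R M x)" by (rule pfilt_append[OF Q L(1)])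
    show "insert x B \<subseteq> L <+>\<^bsub>M\<^esub> cyc R M x"
      using L(2) sum_cyc_upper[OF sL x] sum_cyc_self[OF sL x] by blast
    fix N assume "submodule N R M \<and> K \<subseteq> N \<and> insert x B \<subseteq> N"
    then have N: "submodule N R M" "K \<subseteq> N" "B \<subseteq> N" "x \<in> N" by simp_all
    then have "L \<subseteq> N" using L(3) by blast
    then show "L <+>\<^bsub>M\<^esub> cyc R M x \<subseteq> N" by (rule sum_least[OF N(1) _ cyc_least[OF N(1,4)]])
  qed
qed

lemma fg_sub_pfilt:
  assumes "noetherian_ring R" "submodule K R M" "fg_sub R M L" "K \<subseteq> L"
  shows "\<exists>Qs. pfilt R M K Qs L"
proof -
  obtain B where B: "finite B" "B \<subseteq> L" "\<forall>N. submodule N R M \<and> B \<subseteq> N \<longrightarrow> L \<subseteq> N" and L: "submodule L R M"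
    using assms(3) unfolding fg_sub_def by (elim conjE exE)
  have "B \<subseteq> carrier M" using B(2) submoduleE(1)[OF L] by blast
  from pfilt_finite[OF assms(1,2) B(1) this] obtain Qs L' where L': "pfilt R M K Qs L'" "B \<subseteq> L'"
    "\<forall>N. submodule N R M \<and> K \<subseteq> N \<and> B \<subseteq> N \<longrightarrow> L' \<subseteq> N"
    by (elim exE conjE)
  have "L' \<subseteq> L" using L'(3) L assms(4) B(2) by blast
  moreover have "L \<subseteq> L'" using B(3) L'(2) pfilt_submodule[OF L'(1) assms(2)] by simp
  ultimately have "L' = L" by (rule antisym)
  then show ?thesis using L'(1) by blast
qed

lemma fg_sub_carrier: "finitely_generated R M \<Longrightarrow> fg_sub R M (carrier M)"
  unfolding finitely_generated_def fg_sub_def module_span_def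
  using carrier_is_submodule by (metis (mono_tags, lifting) Inter_lower mem_Collect_eq)

lemma fg_sub_sum_cyc:
  assumes "fg_sub R M L" "x \<in> carrier M" shows "fg_sub R M (L <+>\<^bsub>M\<^esub> cyc R M x)"
proof -
  obtain B where B: "finite B" "B \<subseteq> L" "\<forall>N. submodule N R M \<and> B \<subseteq> N \<longrightarrow> L \<subseteq> N" and L: "submodule L R M"
    using assms(1) unfolding fg_sub_def by (elim conjE exE)
  show ?thesis
    unfolding fg_sub_def
  proof (intro conjI exI[of _ "insert x B"] allI impI)
    show "submodule (L <+>\<^bsub>M\<^esub> cyc R M x) R M" by (rule submodule_sum_cyc[OF L assms(2)])
    show "insert x B \<subseteq> L <+>\<^bsub>M\<^esub> cyc R M x"
      using B(2) sum_cyc_upper[OF L assms(2)] sum_cyc_self[OF L assms(2)] by blast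
    fix N assume "submodule N R M \<and> insert x B \<subseteq> N"
    then have N: "submodule N R M" "B \<subseteq> N" "x \<in> N" by simp_all
    show "L <+>\<^bsub>M\<^esub> cyc R M x \<subseteq> N" using B(3) N by (intro sum_least cyc_least) simp_all
  qed (use B in auto)
qed

lemma fg_sub_zero: "fg_sub R M {\<zero>\<^bsub>M\<^esub>}"
  unfolding fg_sub_def using submodule_zero_set submodule_zero by (intro conjI exI[of _ "{}"]) auto

end

context prime_char_ring
begin

abbreviation "Rm \<equiv> self_module R"

text \<open>The filtration is one of \<open>R\<close>-modules, but its length is taken after
  restriction of scalars; \<open>len_cyc\<close> identifies the cyclic factors in that setting too.
  With \<open>e = 0\<close> this is the usual sum over the factors.\<close>

lemma len_pfilt:
  assumes M: "module R M" and P: "primeideal P R" and K: "submodule K R M" and "pfilt R M K Qs L"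
  shows "len R (fpush R p e M) P K L = (\<Sum>Q\<leftarrow>Qs. len R (fpush R p e Rm) P Q (carrier R))"
  using assms(4)
proof (induction rule: pfilt.induct)
  case Nil
  interpret F: module R "fpush R p e M" by (rule module_fpush[OF M])
  show ?case
    using F.len_zero[OF P submodule_fpush[OF M K] submodule_fpush[OF M K]]
      F.psat_upper[OF P F.submoduleE(1)[OF submodule_fpush[OF M K]]] by simp
next
  case (Cons Qs L x Q)
  interpret M: module R M by fact
  interpret F: module R "fpush R p e M" by (rule module_fpush[OF M])
  have L: "submodule L R M" "K \<subseteq> L" using M.pfilt_submodule[OF Cons.hyps(1) K] by auto
  let ?L = "L <+>\<^bsub>M\<^esub> cyc R M x"
  have L': "submodule ?L R M" by (rule M.submodule_sum_cyc[OF L(1) Cons.hyps(2)])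
  have le: "L \<subseteq> ?L" by (rule M.sum_cyc_upper[OF L(1) Cons.hyps(2)])
  note sub = submodule_fpush[OF M]
  note up = F.psat_upper[OF P F.submoduleE(1)[OF sub]]
  have "len R (fpush R p e M) P K ?L = len R (fpush R p e M) P K L + len R (fpush R p e M) P L ?L"
    using L(2) le up[OF L(1)] up[OF L']
    by (intro F.len_add[OF P sub[OF K] sub[OF L(1)] sub[OF L']]) blast+
  also have "len R (fpush R p e M) P L ?L = len R (fpush R p e Rm) P Q (carrier R)"
    using len_cyc[OF M L(1) Cons.hyps(2) P, of e] Cons.hyps(3) by simp
  finally show ?case using Cons.IH by (simp add: add.commute)
qed

text \<open>At \<open>P\<close>, a factor \<open>R / Q\<close> vanishes if \<open>Q\<close> is not
  contained in \<open>P\<close> and is the residue field if \<open>Q = P\<close>. The hypothesis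
  \<open>ne\<close> excludes the remaining case, where the length would be infinite.\<close>

lemma len_quot_prime:
  assumes P: "primeideal P R" and Q: "primeideal Q R" and ne: "Q \<subset> P \<Longrightarrow> False"
  shows "len R Rm P Q (carrier R) = (if Q = P then 1 else 0)"
  using len_residue_field[OF P] len_ring_zero[OF P primeideal.axioms(1)[OF Q], of 0] ne by (cases "Q = P") auto

end

text \<open>The degree of the residue field of \<open>P\<close> over its subfield of \<open>p\<close>-th powers.\<close>

definition (in prime_char_ring) fdeg :: "'a set \<Rightarrow> nat" where
  "fdeg P = the_enat (len R (tw R p (self_module R)) P P (carrier R))"

section \<open>F-finite rings: boundedness of \<open>fdeg\<close> and its effect on lengths\<close>

locale ffinite_ring = prime_char_ring R p + noetherian_ring R for R (structure) and p +
  assumes ffin: "finitely_generated R (tw R p (self_module R))"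

lemma (in cring) submodule_self_ideal: "ideal I R \<Longrightarrow> submodule I R (self_module R)"
  by (simp add: submodule_self_iff)

lemma (in cring) submodule_self_carrier: "submodule (carrier R) R (self_module R)"
  using module.carrier_is_submodule[OF module_self] by simp

lemma (in cring) fg_sub_self: "fg_sub R (self_module R) (carrier R)"
proof -
  have "carrier R \<subseteq> N" if "submodule N R (self_module R) \<and> {\<one>} \<subseteq> N" for N
    using that ideal.one_imp_carrier[of N R] by (simp add: submodule_self_iff)
  then show ?thesis
    unfolding fg_sub_def using submodule_self_carrier by (intro conjI exI[of _ "{\<one>}"]) auto
qed

lemma (in cring) submodule_self_prime: "primeideal P R \<Longrightarrow> submodule P R (self_module R)"
  by (rule submodule_self_ideal[OF primeideal.axioms(1)])

lemma (in prime_char_ring) module_tw: "module R M \<Longrightarrow> module R (tw R p M)"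
  using module_fpush[of M 1] by (simp add: fpush_Suc[of R p 0, simplified])

lemma (in prime_char_ring) submodule_tw: "module R M \<Longrightarrow> submodule K R M \<Longrightarrow> submodule K R (tw R p M)"
  using submodule_fpush[of M K 1] by (simp add: fpush_Suc[of R p 0, simplified])

lemma fpush_1: "fpush R p 1 M = tw R p M"
  using fpush_Suc[of R p 0 M] by simp

lemma (in prime_char_ring) psat_tw:
  "module R M \<Longrightarrow> submodule K R M \<Longrightarrow> primeideal P R \<Longrightarrow> psat R (tw R p M) P K = psat R M P K"
  using psat_fpush[of M K P 1] by (simp only: fpush_1)

context ffinite_ring
begin

lemma fg_tw_self: "fg_sub R (tw R p Rm) (carrier R)"
  using module.fg_sub_carrier[OF module_tw[OF module_self] ffin] by simp

text \<open>The bound is the number of generators of \<open>R\<close> over its \<open>p\<close>-th powers.\<close>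

lemma len_tw_bound: "\<exists>m. \<forall>P. primeideal P R \<longrightarrow> len R (tw R p Rm) P P (carrier R) \<le> enat m"
proof -
  let ?N = "tw R p Rm"
  interpret N: module R ?N by (rule module_tw[OF module_self])
  interpret S: module R Rm by (rule module_self)
  have "submodule (carrier R) R ?N" using N.carrier_is_submodule by simp
  obtain B where B: "finite B" "B \<subseteq> carrier R" "\<forall>N. submodule N R ?N \<and> B \<subseteq> N \<longrightarrow> carrier R \<subseteq> N"
    using fg_tw_self unfolding fg_sub_def by (elim conjE exE)
  have "len R ?N P P (carrier R) \<le> enat (card B)" if P: "primeideal P R" for P
  proof -
    have sP: "submodule P R ?N" by (rule submodule_tw[OF module_self submodule_self_prime[OF P]])
    have "\<exists>L. submodule L R ?N \<and> P \<subseteq> L \<and> B' \<subseteq> L \<and> len R ?N P P L \<le> enat (card B')" if "finite B'" "B' \<subseteq> carrier R" for B'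
      using that
    proof (induction rule: finite_induct)
      case empty
      have "len R ?N P P P = 0" using N.psat_upper[OF P N.submoduleE(1)[OF sP]] by (intro N.len_zero[OF P sP sP])
      then show ?case using sP by (auto simp: zero_enat_def)
    next
      case (insert x B')
      then obtain L where L: "submodule L R ?N" "P \<subseteq> L" "B' \<subseteq> L" "len R ?N P P L \<le> enat (card B')" by auto
      have x: "x \<in> carrier ?N" using insert by simp
      let ?L = "L <+>\<^bsub>?N\<^esub> cyc R ?N x"
      let ?A = "{r \<in> carrier R. r \<odot>\<^bsub>?N\<^esub> x \<in> L}"
      have sL: "submodule ?L R ?N" by (rule N.submodule_sum_cyc[OF L(1) x])
      have up: "L \<subseteq> ?L" "x \<in> ?L" using N.sum_cyc_upper[OF L(1) x] N.sum_cyc_self[OF L(1) x] by auto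
      interpret Pi: primeideal P R by (rule P)
      \<comment> \<open>Each further generator contributes a quotient of \<open>R / P\<close>: an
        element \<open>r \<in> P\<close> acts as \<open>r^p\<close>, which maps everything into
        \<open>P \<subseteq> L\<close>.\<close>
      have "P \<subseteq> ?A"
      proof
        fix r assume r: "r \<in> P"
        have rc: "r \<in> carrier R" using r Pi.Icarr by blast
        obtain k where k: "p = Suc k" using p_prime by (metis not0_implies_Suc not_prime_0)
        have "r [^] p \<in> P" using r rc Pi.I_l_closed[OF r, of "r [^] k"] by (simp add: k)
        then have "r [^] p \<otimes> x \<in> P" using x Pi.I_r_closed by simp
        then show "r \<in> ?A" using rc L(2) by auto
      qed
      have iA: "ideal ?A R" by (rule N.submodule_ideal_quot[OF L(1) x])
      have "len R ?N P P ?L = len R ?N P P L + len R ?N P L ?L"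
        using L(2) up(1) N.psat_upper[OF P N.submoduleE(1)[OF L(1)]] N.psat_upper[OF P N.submoduleE(1)[OF sL]]
        by (intro N.len_add[OF P sP L(1) sL]) blast+
      also have "len R ?N P L ?L = len R Rm P ?A (carrier R)"
        by (rule len_cyc0[OF N.module_axioms L(1) x P])
      also have "\<dots> \<le> len R Rm P P (carrier R)"
      proof (rule S.len_mono[OF P submodule_self_prime[OF P] submodule_self_carrier submodule_self_ideal[OF iA] submodule_self_carrier])
        show "P \<subseteq> psat R Rm P (carrier R)" using S.psat_zero_full[OF P] Pi.a_subset by simp
        show "carrier R \<subseteq> psat R Rm P (carrier R)" using S.psat_zero_full[OF P] by simp
        show "P \<subseteq> psat R Rm P ?A" using \<open>P \<subseteq> ?A\<close> S.psat_upper[OF P, of ?A] by auto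
      qed
      also have "len R Rm P P (carrier R) = 1" by (rule len_residue_field[OF P])
      finally have "len R ?N P P ?L \<le> enat (card B') + 1" using L(4) add_mono[of "len R ?N P P L" "enat (card B')"] by (meson add_left_mono add_right_mono order_trans)
      moreover have "enat (card B') + 1 = enat (card (insert x B'))" using insert.hyps by (simp add: one_enat_def)
      ultimately show ?case using sL up L(2,3) by (intro exI[of _ ?L]) auto
    qed
    then obtain L where L: "submodule L R ?N" "B \<subseteq> L" "len R ?N P P L \<le> enat (card B)"
      using B(1,2) by blast
    have "L = carrier R" using B(3) L(1,2) N.submoduleE(1)[OF L(1)] by (simp add: subset_antisym)
    then show ?thesis using L(3) by simp
  qed
  then show ?thesis by blast
qed

lemma len_fdeg: "primeideal P R \<Longrightarrow> len R (tw R p Rm) P P (carrier R) = enat (fdeg P)"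
  using len_tw_bound enat_ile unfolding fdeg_def by (metis the_enat.simps)

lemma fdeg_bound: "\<exists>m. \<forall>P. primeideal P R \<longrightarrow> fdeg P \<le> m"
  using len_tw_bound len_fdeg by (metis enat_ord_simps(1))

lemma fdeg_pos: assumes P: "primeideal P R" shows "0 < fdeg P"
proof (rule ccontr)
  assume "\<not> 0 < fdeg P"
  then have 0: "len R (tw R p Rm) P P (carrier R) = 0" using len_fdeg[OF P] by (simp add: zero_enat_def)
  interpret N: module R "tw R p Rm" by (rule module_tw[OF module_self])
  interpret Pi: primeideal P R by (rule P)
  have sP: "submodule P R (tw R p Rm)" by (rule submodule_tw[OF module_self submodule_self_prime[OF P]])
  have sc: "submodule (carrier R) R (tw R p Rm)" using N.carrier_is_submodule by simp
  have "P \<subseteq> psat R (tw R p Rm) P (carrier R)" using N.psat_zero_full[OF P] Pi.a_subset by simp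
  then have "carrier R \<subseteq> psat R (tw R p Rm) P P" using N.len_zero_iff[OF P sP sc] 0 by blast
  then have "carrier R \<subseteq> P"
    using psat_tw[OF module_self submodule_self_prime[OF P] P] psat_prime[OF P] by simp
  then show False using Pi.I_notcarr Pi.a_subset by blast
qed

end

text \<open>Saturated submodules of \<open>M\<close> remain saturated submodules of the restriction,
  which may have others besides. The inequality settles the case of infinite length in
  \<open>len_tw\<close>.\<close>

lemma (in prime_char_ring) len_le_len_tw:
  assumes M: "module R M" and K: "submodule K R M" and L: "submodule L R M" and P: "primeideal P R"
  shows "len R M P K L \<le> len R (tw R p M) P K L"
  unfolding len_def
proof (rule max_chain_length_mono, rule subsetI)
  fix N assume N: "N \<in> satfam R M P K L"
  then have s: "submodule N R M" by (simp add: satfam_def)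
  show "N \<in> satfam R (tw R p M) P K L"
    using N submodule_tw[OF M s] psat_tw[OF M s P] psat_tw[OF M L P] by (simp add: satfam_def)
qed

text \<open>For \<open>L\<^sub>P / K\<^sub>P\<close> of length one, \<open>r \<mapsto> r x\<close> induces an isomorphism from the residue field,
  so restriction of scalars multiplies lengths by \<open>fdeg P\<close>.\<close>

lemma (in ffinite_ring) len_tw:
  assumes M: "module R M" and K: "submodule K R M" and L: "submodule L R M" and P: "primeideal P R"
    and KL: "K \<subseteq> psat R M P L"
  shows "len R (tw R p M) P K L = enat (fdeg P) * len R M P K L"
proof (cases "len R M P K L")
  case (enat n)
  then show ?thesis using K KL
  proof (induction n arbitrary: K)
    case 0
    interpret M: module R M by fact
    interpret N: module R "tw R p M" by (rule module_tw[OF M])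
    have "L \<subseteq> psat R M P K" using M.len_zero_iff[OF P 0(2) L 0(3)] 0(1) by (simp add: zero_enat_def)
    then have "len R (tw R p M) P K L = 0"
      using N.len_zero[OF P submodule_tw[OF M 0(2)] submodule_tw[OF M L]] 0(3)
      by (simp add: psat_tw[OF M L P] psat_tw[OF M 0(2) P])
    then show ?case using 0(1) by (simp add: zero_enat_def)
  next
    case (Suc n)
    interpret M: module R M by fact
    interpret N: module R "tw R p M" by (rule module_tw[OF M])
    interpret Pi: primeideal P R by (rule P)
    obtain H where H: "submodule H R M" "psat R M P H = H" "K \<subseteq> H" "H \<subseteq> psat R M P L"
      "len R M P K H = 1" "len R M P H L = enat n"
      using M.len_split_Suc[OF P Suc(3) L Suc(4,2)] by blast
    have KH: "K \<subseteq> psat R M P H" using H by simp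
    obtain x where x: "x \<in> H" "H \<subseteq> psat R M P (K <+>\<^bsub>M\<^esub> cyc R M x)"
      "\<And>r. r \<in> carrier R \<Longrightarrow> r \<odot>\<^bsub>M\<^esub> x \<in> psat R M P K \<longleftrightarrow> r \<in> P"
      using M.len_simple[OF P Suc(3) H(1) KH H(5)] by blast
    have xc: "x \<in> carrier M" using M.submodule_carrier[OF H(1) x(1)] .
    \<comment> \<open>The ideal \<open>K : x\<close> equals \<open>P\<close> only locally. After
      saturating \<open>K\<close> it is \<open>P\<close> itself, so \<open>len_cyc\<close> yields
      literally the length that defines \<open>fdeg P\<close>.\<close>
    let ?K = "psat R M P K"
    have sK: "submodule ?K R M" by (rule M.submodule_psat[OF P Suc(3)])
    have PA: "{r \<in> carrier R. r \<odot>\<^bsub>M\<^esub> x \<in> ?K} = P" using x(3) Pi.Icarr by auto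
    let ?L = "?K <+>\<^bsub>M\<^esub> cyc R M x"
    have sL: "submodule ?L R M" by (rule M.submodule_sum_cyc[OF sK xc])
    have L1: "?L \<subseteq> H"
      using M.psat_mono[OF H(3), of P] H(2) by (intro M.sum_least[OF H(1)] M.cyc_least[OF H(1) x(1)]) simp
    have "K <+>\<^bsub>M\<^esub> cyc R M x \<subseteq> ?L"
      by (intro M.sum_mono M.psat_upper[OF P] subset_refl M.submoduleE(1)[OF Suc(3)])
    then have L2: "H \<subseteq> psat R M P ?L" using x(2) M.psat_mono[of _ ?L P] by blast
    have eqL: "psat R M P ?L = psat R M P H"
      using M.psat_mono[OF L1, of P] M.psat_mono[OF L2, of P] M.psat_idem[OF P M.submoduleE(1)[OF sL]] by blast
    note sub = submodule_tw[OF M]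
    have "len R (tw R p M) P K H = len R (tw R p M) P ?K ?L"
    proof (rule N.len_cong[OF P sub[OF Suc(3)] sub[OF H(1)] sub[OF sK] sub[OF sL]])
      show "K \<subseteq> psat R (tw R p M) P H" using KH by (simp add: psat_tw[OF M H(1) P])
      show "psat R (tw R p M) P K = psat R (tw R p M) P ?K"
        using M.psat_idem[OF P M.submoduleE(1)[OF Suc(3)]] by (simp add: psat_tw[OF M _ P] Suc(3) sK)
      show "psat R (tw R p M) P H = psat R (tw R p M) P ?L"
        using eqL by (simp add: psat_tw[OF M _ P] H(1) sL)
    qed
    also have "\<dots> = enat (fdeg P)"
      using len_cyc[OF M sK xc P, of 1] unfolding fpush_1 PA len_fdeg[OF P] .
    finally have 1: "len R (tw R p M) P K H = enat (fdeg P)" .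
    have 2: "len R (tw R p M) P H L = enat (fdeg P) * enat n"
      using Suc.IH[OF H(6) H(1,4)] H(6) by simp
    have "len R (tw R p M) P K L = len R (tw R p M) P K H + len R (tw R p M) P H L"
      using KH H(4) by (intro N.len_add[OF P sub[OF Suc(3)] sub[OF H(1)] sub[OF L]])
        (simp_all add: psat_tw[OF M _ P] H(1) L)
    then show ?case unfolding 1 2 Suc(2) by simp
  qed
next
  case infinity
  then have "len R (tw R p M) P K L = \<infinity>" using len_le_len_tw[OF M K L P] by simp
  then show ?thesis using infinity fdeg_pos[OF P] by (simp add: enat_0_iff)
qed

lemma (in ffinite_ring) len_fpush:
  assumes M: "module R M" and K: "submodule K R M" and L: "submodule L R M" and P: "primeideal P R"
    and KL: "K \<subseteq> psat R M P L"
  shows "len R (fpush R p e M) P K L = enat (fdeg P ^ e) * len R M P K L"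
proof (induction e)
  case (Suc e)
  have "len R (tw R p (fpush R p e M)) P K L = enat (fdeg P) * len R (fpush R p e M) P K L"
    using KL by (intro len_tw[OF module_fpush[OF M] submodule_fpush[OF M K] submodule_fpush[OF M L] P])
      (simp add: psat_fpush[OF M L P])
  then show ?case unfolding fpush_Suc Suc by (simp add: mult.assoc[symmetric])
qed (simp add: one_enat_def[symmetric] del: One_nat_def)

subsection \<open>Products of ideals and submodules\<close>

text \<open>Taken in \<open>fpush R p e M\<close>, the generators are the elements
  \<open>b^q x\<close>; for an ideal \<open>B\<close> and a submodule \<open>L\<close> the result is
  \<open>B^[q] L\<close>, without forming the Frobenius power. With \<open>L\<close> the whole
  module it is \<open>ideal_smult\<close>.\<close>

definition isub ::
    "('a, 'c) ring_scheme \<Rightarrow> ('a, 'b, 'd) module_scheme \<Rightarrow> 'a set \<Rightarrow> 'b set \<Rightarrow> 'b set" where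
  "isub R M B L = module_span R M {a \<odot>\<^bsub>M\<^esub> x | a x. a \<in> B \<and> x \<in> L}"

context module
begin

lemma module_span_least: "submodule N R M \<Longrightarrow> A \<subseteq> N \<Longrightarrow> module_span R M A \<subseteq> N"
  unfolding module_span_def by blast

lemma module_span_upper: "A \<subseteq> module_span R M A"
  unfolding module_span_def by blast

lemma module_span_submodule:
  assumes "A \<subseteq> carrier M" shows "submodule (module_span R M A) R M"
proof (rule submoduleI')
  show "module_span R M A \<subseteq> carrier M"
    by (rule module_span_least[OF carrier_is_submodule assms])
qed (auto simp: module_span_def submodule_rules)

lemma isub_submodule:
  assumes "B \<subseteq> carrier R" "L \<subseteq> carrier M" shows "submodule (isub R M B L) R M"
  unfolding isub_def by (rule module_span_submodule) (use assms in auto)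

lemma isub_mem: "a \<in> B \<Longrightarrow> x \<in> L \<Longrightarrow> a \<odot>\<^bsub>M\<^esub> x \<in> isub R M B L"
  unfolding isub_def by (rule subsetD[OF module_span_upper]) blast

lemma isub_least:
  assumes "submodule N R M" "\<And>a x. \<lbrakk>a \<in> B; x \<in> L\<rbrakk> \<Longrightarrow> a \<odot>\<^bsub>M\<^esub> x \<in> N"
  shows "isub R M B L \<subseteq> N"
  unfolding isub_def by (rule module_span_least[OF assms(1)]) (use assms(2) in auto)

lemma isub_le: "submodule L R M \<Longrightarrow> B \<subseteq> carrier R \<Longrightarrow> isub R M B L \<subseteq> L"
  by (rule isub_least) (auto intro: submodule_smult)

lemma isub_mono:
  assumes "B \<subseteq> B'" "L \<subseteq> L'" shows "isub R M B L \<subseteq> isub R M B' L'"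
  unfolding isub_def module_span_def using assms by blast

lemma isub_sum:
  assumes "submodule K R M" "submodule L R M" "B \<subseteq> carrier R"
  shows "isub R M B (K <+>\<^bsub>M\<^esub> L) \<subseteq> isub R M B K <+>\<^bsub>M\<^esub> isub R M B L"
proof (rule isub_least)
  have s: "submodule (isub R M B K) R M" "submodule (isub R M B L) R M"
    using isub_submodule assms submoduleE(1) by blast+
  show "submodule (isub R M B K <+>\<^bsub>M\<^esub> isub R M B L) R M" by (rule submodule_sum[OF s])
  fix a x assume a: "a \<in> B" and "x \<in> K <+>\<^bsub>M\<^esub> L"
  then obtain k l where kl: "k \<in> K" "l \<in> L" "x = k \<oplus>\<^bsub>M\<^esub> l" by (auto simp: set_add_iff)
  have "a \<odot>\<^bsub>M\<^esub> x = a \<odot>\<^bsub>M\<^esub> k \<oplus>\<^bsub>M\<^esub> a \<odot>\<^bsub>M\<^esub> l"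
    using kl a assms submodule_carrier by (auto simp: smult_r_distr)
  then show "a \<odot>\<^bsub>M\<^esub> x \<in> isub R M B K <+>\<^bsub>M\<^esub> isub R M B L"
    using isub_mem[OF a kl(1)] isub_mem[OF a kl(2)] by (auto simp: set_add_iff)
qed

lemma isub_single:
  assumes "submodule L R M" "y \<in> carrier R"
  shows "isub R M {y} L = (\<lambda>x. y \<odot>\<^bsub>M\<^esub> x) ` L"
proof
  have c: "x \<in> carrier M" if "x \<in> L" for x using submodule_carrier[OF assms(1) that] .
  have "submodule ((\<lambda>x. y \<odot>\<^bsub>M\<^esub> x) ` L) R M"
  proof (rule submoduleI')
    show "(\<lambda>x. y \<odot>\<^bsub>M\<^esub> x) ` L \<subseteq> carrier M" using assms(2) c by auto
    show "\<zero>\<^bsub>M\<^esub> \<in> (\<lambda>x. y \<odot>\<^bsub>M\<^esub> x) ` L"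
      by (rule image_eqI[OF _ submodule_zero[OF assms(1)]]) (use assms(2) in simp)
  next
    fix u v assume "u \<in> (\<lambda>x. y \<odot>\<^bsub>M\<^esub> x) ` L" "v \<in> (\<lambda>x. y \<odot>\<^bsub>M\<^esub> x) ` L"
    then obtain a b where ab: "a \<in> L" "b \<in> L" "u = y \<odot>\<^bsub>M\<^esub> a" "v = y \<odot>\<^bsub>M\<^esub> b" by blast
    show "u \<oplus>\<^bsub>M\<^esub> v \<in> (\<lambda>x. y \<odot>\<^bsub>M\<^esub> x) ` L"
      by (rule image_eqI[OF _ submodule_add[OF assms(1) ab(1,2)]]) (use ab c assms(2) in \<open>simp add: smult_r_distr\<close>)
  next
    fix r u assume r: "r \<in> carrier R" and "u \<in> (\<lambda>x. y \<odot>\<^bsub>M\<^esub> x) ` L"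
    then obtain a where a: "a \<in> L" "u = y \<odot>\<^bsub>M\<^esub> a" by blast
    show "r \<odot>\<^bsub>M\<^esub> u \<in> (\<lambda>x. y \<odot>\<^bsub>M\<^esub> x) ` L"
      by (rule image_eqI[OF _ submodule_smult[OF assms(1) r a(1)]])
        (use a c r assms(2) in \<open>simp add: smult_assoc1[symmetric] R.m_comm\<close>)
  qed
  then show "isub R M {y} L \<subseteq> (\<lambda>x. y \<odot>\<^bsub>M\<^esub> x) ` L" by (rule isub_least) auto
  show "(\<lambda>x. y \<odot>\<^bsub>M\<^esub> x) ` L \<subseteq> isub R M {y} L" by (auto intro: isub_mem)
qed

end

lemma mlin_vimage_submodule:
  assumes N: "module R N" and M: "module R M" and h: "mlin R N M h" and X: "submodule X R M"
  shows "submodule {x \<in> carrier N. h x \<in> X} R N"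
proof -
  interpret N: module R N by fact
  interpret M: module R M by fact
  have hc: "h x \<in> carrier M" if "x \<in> carrier N" for x using h that by (auto simp: mlin_def)
  have hs: "h (r \<odot>\<^bsub>N\<^esub> x) = r \<odot>\<^bsub>M\<^esub> h x" if "x \<in> carrier N" "r \<in> carrier R" for r x
    using h that by (auto simp: mlin_def)
  have h0: "h \<zero>\<^bsub>N\<^esub> = \<zero>\<^bsub>M\<^esub>"
    using hs[of "\<zero>\<^bsub>N\<^esub>" "\<zero>\<^bsub>R\<^esub>"] hc[of "\<zero>\<^bsub>N\<^esub>"] by simp
  show ?thesis
    by (rule N.submoduleI') (use h h0 M.submodule_rules[OF X] in \<open>auto simp: mlin_def\<close>)
qed

lemma mlin_isub:
  assumes N: "module R N" and M: "module R M" and h: "mlin R N M h"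
    and B: "B \<subseteq> carrier R" and L: "L \<subseteq> carrier N" and L': "L' \<subseteq> carrier M" "h ` L \<subseteq> L'"
    and x: "x \<in> isub R N B L"
  shows "h x \<in> isub R M B L'"
proof -
  interpret N: module R N by fact
  interpret M: module R M by fact
  have s: "submodule {x \<in> carrier N. h x \<in> isub R M B L'} R N"
    by (rule mlin_vimage_submodule[OF N M h M.isub_submodule[OF B L'(1)]])
  have "isub R N B L \<subseteq> {x \<in> carrier N. h x \<in> isub R M B L'}"
  proof (rule N.isub_least[OF s])
    fix a x assume a: "a \<in> B" "x \<in> L"
    then have "a \<in> carrier R" "x \<in> carrier N" using B L by blast+
    then have "h (a \<odot>\<^bsub>N\<^esub> x) = a \<odot>\<^bsub>M\<^esub> h x" using h by (simp add: mlin_def)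
    then show "a \<odot>\<^bsub>N\<^esub> x \<in> {x \<in> carrier N. h x \<in> isub R M B L'}"
      using a B L L' M.isub_mem[of a B "h x" L'] by auto
  qed
  then show ?thesis using x by blast
qed

context prime_char_ring
begin

text \<open>By construction the product is stable under \<open>q\<close>-th powers only.
  Multiplication by any \<open>r \<in> R\<close> is however linear over the restricted scalars and
  maps \<open>L\<close> into itself, hence it preserves the product.\<close>

lemma isub_fpush_submodule:
  assumes M: "module R M" and B: "B \<subseteq> carrier R" and L: "submodule L R M"
  shows "submodule (isub R (fpush R p e M) B L) R M"
proof -
  interpret M: module R M by fact
  interpret F: module R "fpush R p e M" by (rule module_fpush[OF M])
  have Lc: "L \<subseteq> carrier M" by (rule M.submoduleE(1)[OF L])
  have s: "submodule (isub R (fpush R p e M) B L) R (fpush R p e M)"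
    by (rule F.isub_submodule[OF B]) (use Lc in simp)
  show ?thesis
  proof (rule M.submoduleI')
    show "isub R (fpush R p e M) B L \<subseteq> carrier M" using F.submoduleE(1)[OF s] by simp
    show "\<zero>\<^bsub>M\<^esub> \<in> isub R (fpush R p e M) B L" using F.submodule_zero[OF s] by simp
    show "x \<oplus>\<^bsub>M\<^esub> y \<in> isub R (fpush R p e M) B L"
      if "x \<in> isub R (fpush R p e M) B L" "y \<in> isub R (fpush R p e M) B L" for x y
      using F.submodule_add[OF s that] by simp
    fix r x assume r: "r \<in> carrier R" and x: "x \<in> isub R (fpush R p e M) B L"
    have h: "mlin R (fpush R p e M) (fpush R p e M) (\<lambda>x. r \<odot>\<^bsub>M\<^esub> x)"
      using r by (auto simp: mlin_def fpush_smult M.smult_r_distr M.smult_assoc1[symmetric] m_comm)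
    show "r \<odot>\<^bsub>M\<^esub> x \<in> isub R (fpush R p e M) B L"
      by (rule mlin_isub[OF F.module_axioms F.module_axioms h B _ _ _ x])
        (use Lc M.submodule_smult[OF L r] in auto)
  qed
qed

lemma isub_fpush_le:
  assumes M: "module R M" and B: "B \<subseteq> carrier R" and L: "submodule L R M"
  shows "isub R (fpush R p e M) B L \<subseteq> L"
  by (rule module.isub_le[OF module_fpush[OF M] submodule_fpush[OF M L] B])

text \<open>Over \<open>R\<^sub>P\<close>, the length of \<open>L / (K + B\<^bsup>[q]\<^esup> L)\<close> as a module over \<open>R\<close> via \<open>r \<mapsto> r\<^bsup>q\<^esup>\<close>,
  where \<open>q = p ^ e\<close>.\<close>

definition gam where
  "gam e M P K B L = len R (fpush R p e M) P (K <+>\<^bsub>M\<^esub> isub R (fpush R p e M) B L) L"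

lemma gam_sub:
  assumes "module R M" "B \<subseteq> carrier R" "submodule K R M" "submodule L R M" "K \<subseteq> L"
  shows "submodule (K <+>\<^bsub>M\<^esub> isub R (fpush R p e M) B L) R M" "K <+>\<^bsub>M\<^esub> isub R (fpush R p e M) B L \<subseteq> L"
proof -
  interpret M: module R M by fact
  show "submodule (K <+>\<^bsub>M\<^esub> isub R (fpush R p e M) B L) R M"
    by (intro M.submodule_sum isub_fpush_submodule assms)
  show "K <+>\<^bsub>M\<^esub> isub R (fpush R p e M) B L \<subseteq> L"
    by (intro M.sum_least isub_fpush_le assms)
qed

text \<open>The functor \<open>N \<mapsto> N / B^[q] N\<close> is right exact, so along a filtration
  the lengths of the quotients add up to at least the length of the quotient of the whole.\<close>

lemma gam_pfilt_le:
  assumes M: "module R M" and P: "primeideal P R" and K: "submodule K R M" and B: "B \<subseteq> carrier R"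
    and "pfilt R M K Qs L"
  shows "gam e M P K B L \<le> (\<Sum>Q\<leftarrow>Qs. gam e Rm P Q B (carrier R))"
  using assms(5)
proof (induction rule: pfilt.induct)
  case Nil
  interpret M: module R M by fact
  interpret F: module R "fpush R p e M" by (rule module_fpush[OF M])
  note g = gam_sub[OF M B K K subset_refl, of e]
  have "K \<subseteq> K <+>\<^bsub>M\<^esub> isub R (fpush R p e M) B K"
    by (intro M.sum_upper1 K isub_fpush_submodule[OF M B K])
  moreover have "K <+>\<^bsub>M\<^esub> isub R (fpush R p e M) B K = K" using g(2) calculation by blast
  ultimately have "gam e M P K B K = 0"
    unfolding gam_def using F.psat_upper[OF P F.submoduleE(1)[OF submodule_fpush[OF M K]]]
    by (simp add: F.len_zero[OF P submodule_fpush[OF M K] submodule_fpush[OF M K]])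
  then show ?case by simp
next
  case (Cons Qs L x Q)
  interpret M: module R M by fact
  interpret F: module R "fpush R p e M" by (rule module_fpush[OF M])
  interpret FS: module R "fpush R p e Rm" by (rule module_fpush[OF module_self])
  interpret S: module R Rm by (rule module_self)
  let ?F = "fpush R p e M" and ?L = "L <+>\<^bsub>M\<^esub> cyc R M x"
  have L: "submodule L R M" "K \<subseteq> L" using M.pfilt_submodule[OF Cons.hyps(1) K] by auto
  have sL: "submodule ?L R M" by (rule M.submodule_sum_cyc[OF L(1) Cons.hyps(2)])
  have LL: "L \<subseteq> ?L" "x \<in> ?L" using M.sum_cyc_upper[OF L(1) Cons.hyps(2)] M.sum_cyc_self[OF L(1) Cons.hyps(2)] by auto
  have KL: "K \<subseteq> ?L" using L(2) LL(1) by blast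
  define K0 where "K0 = K <+>\<^bsub>M\<^esub> isub R ?F B L"
  define K1 where "K1 = K <+>\<^bsub>M\<^esub> isub R ?F B ?L"
  \<comment> \<open>\<open>H\<close> cuts \<open>?L / K1\<close> into two pieces: below it lies an
    image of \<open>L / K0\<close>, above it a quotient of \<open>R / (Q + B^[q])\<close>.\<close>
  define H where "H = L <+>\<^bsub>M\<^esub> isub R ?F B ?L"
  have K0: "submodule K0 R M" "K0 \<subseteq> L" unfolding K0_def by (rule gam_sub[OF M B K L])+
  have K1: "submodule K1 R M" "K1 \<subseteq> ?L" unfolding K1_def by (rule gam_sub[OF M B K sL KL])+
  have H: "submodule H R M" "H \<subseteq> ?L" unfolding H_def by (rule gam_sub[OF M B L(1) sL LL(1)])+
  have K1H: "K1 \<subseteq> H" unfolding K1_def H_def by (intro M.sum_mono L(2) subset_refl)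
  have LH: "L \<subseteq> H" unfolding H_def by (intro M.sum_upper1 L(1) isub_fpush_submodule[OF M B sL])
  have K01: "K0 \<subseteq> K1" unfolding K0_def K1_def by (intro M.sum_mono subset_refl F.isub_mono LL(1))
  note sub = submodule_fpush[OF M]
  note up = F.psat_upper[OF P F.submoduleE(1)[OF sub]]
  have 1: "gam e M P K B ?L = len R ?F P K1 H + len R ?F P H ?L"
    unfolding gam_def K1_def[symmetric] using K1H H(2) up[OF H(1)] up[OF sL]
    by (intro F.len_add[OF P sub[OF K1(1)] sub[OF H(1)] sub[OF sL]]) blast+
  have 2: "len R ?F P K1 H \<le> gam e M P K B L"
    unfolding gam_def K0_def[symmetric]
  proof (rule len_surj[OF F.module_axioms F.module_axioms P mlin_id sub[OF K0(1)] sub[OF L(1)] sub[OF K1(1)] sub[OF H(1)]])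
    show "K0 \<subseteq> psat R ?F P L" using K0(2) up[OF L(1)] by blast
    show "z \<in> psat R ?F P K1" if "z \<in> K0" for z using that K01 up[OF K1(1)] by blast
    fix y assume "y \<in> H"
    then obtain l b where lb: "l \<in> L" "b \<in> isub R ?F B ?L" "y = l \<oplus>\<^bsub>M\<^esub> b" by (auto simp: H_def set_add_iff)
    have bK: "b \<in> K1" unfolding K1_def using M.sum_upper2[OF K isub_fpush_submodule[OF M B sL]] lb(2) by blast
    have "\<one> \<odot>\<^bsub>?F\<^esub> y = b \<oplus>\<^bsub>?F\<^esub> l"
      using lb bK M.submodule_carrier[OF K1(1)] M.submodule_carrier[OF L(1)] by (simp add: fpush_smult M.a_comm)
    then show "\<exists>s\<in>carrier R - P. \<exists>k\<in>K1. \<exists>l\<in>L. s \<odot>\<^bsub>?F\<^esub> y = k \<oplus>\<^bsub>?F\<^esub> l"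
      using primeideal_one_notin[OF P] bK lb(1) by blast
  qed
  have 3: "len R ?F P H ?L \<le> gam e Rm P Q B (carrier R)"
  proof -
    let ?A = "{r \<in> carrier R. r \<odot>\<^bsub>M\<^esub> x \<in> H}"
    have "H <+>\<^bsub>M\<^esub> cyc R M x = ?L"
    proof
      show "H <+>\<^bsub>M\<^esub> cyc R M x \<subseteq> ?L" by (intro M.sum_least[OF sL H(2)] M.cyc_least[OF sL LL(2)])
      show "?L \<subseteq> H <+>\<^bsub>M\<^esub> cyc R M x" by (intro M.sum_mono LH subset_refl)
    qed
    then have "len R ?F P H ?L = len R (fpush R p e Rm) P ?A (carrier R)"
      using len_cyc[OF M H(1) Cons.hyps(2) P, of e] by simp
    also have "\<dots> \<le> gam e Rm P Q B (carrier R)"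
      unfolding gam_def
    proof (rule FS.len_mono[OF P])
      have Qi: "submodule Q R Rm" by (rule submodule_self_prime[OF Cons.hyps(4)])
      have Qc: "Q \<subseteq> carrier R" using S.submoduleE(1)[OF Qi] by simp
      have iA: "submodule ?A R Rm" by (rule submodule_self_ideal[OF M.submodule_ideal_quot[OF H(1) Cons.hyps(2)]])
      note g = gam_sub[OF module_self B Qi submodule_self_carrier Qc, of e]
      show "submodule (Q <+>\<^bsub>Rm\<^esub> isub R (fpush R p e Rm) B (carrier R)) R (fpush R p e Rm)"
        by (rule submodule_fpush[OF module_self g(1)])
      show "submodule (carrier R) R (fpush R p e Rm)" "submodule (carrier R) R (fpush R p e Rm)"
        by (rule submodule_fpush[OF module_self submodule_self_carrier])+
      show sA: "submodule ?A R (fpush R p e Rm)" by (rule submodule_fpush[OF module_self iA])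
      have full: "psat R (fpush R p e Rm) P (carrier R) = carrier R"
        using FS.psat_zero_full[OF P] by simp
      show "Q <+>\<^bsub>Rm\<^esub> isub R (fpush R p e Rm) B (carrier R) \<subseteq> psat R (fpush R p e Rm) P (carrier R)"
        using g(2) full by simp
      show "carrier R \<subseteq> psat R (fpush R p e Rm) P (carrier R)" using full by simp
      have "Q <+>\<^bsub>Rm\<^esub> isub R (fpush R p e Rm) B (carrier R) \<subseteq> ?A"
      proof (rule S.sum_least[OF iA])
        show "Q \<subseteq> ?A" using Cons.hyps(3) LH by blast
        show "isub R (fpush R p e Rm) B (carrier R) \<subseteq> ?A"
        proof (rule FS.isub_least[OF sA])
          fix b r assume b: "b \<in> B" and r: "r \<in> carrier R"
          have bc: "b \<in> carrier R" using b B by blast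
          have "r \<odot>\<^bsub>M\<^esub> x \<in> ?L" by (rule M.submodule_smult[OF sL r LL(2)])
          then have "b \<odot>\<^bsub>?F\<^esub> (r \<odot>\<^bsub>M\<^esub> x) \<in> isub R ?F B ?L" by (rule F.isub_mem[OF b])
          then have "b \<odot>\<^bsub>?F\<^esub> (r \<odot>\<^bsub>M\<^esub> x) \<in> H"
            unfolding H_def using M.sum_upper2[OF L(1) isub_fpush_submodule[OF M B sL]] by blast
          then show "b \<odot>\<^bsub>fpush R p e Rm\<^esub> r \<in> ?A"
            using bc r Cons.hyps(2) by (simp add: fpush_smult M.smult_assoc1)
        qed
      qed
      then show "Q <+>\<^bsub>Rm\<^esub> isub R (fpush R p e Rm) B (carrier R) \<subseteq> psat R (fpush R p e Rm) P ?A"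
        using FS.psat_upper[OF P FS.submoduleE(1)[OF sA]] by blast
    qed
    finally show ?thesis .
  qed
  have "gam e M P K B ?L \<le> (\<Sum>Q\<leftarrow>Qs. gam e Rm P Q B (carrier R)) + gam e Rm P Q B (carrier R)"
    unfolding 1 by (intro add_mono order_trans[OF 2 Cons.IH] 3)
  then show ?case by (simp add: add.commute)
qed

end

subsection \<open>Residue field degrees along chains of primes\<close>

lemma set_add_tw: "set_add (tw R p M) = set_add M"
  using set_add_fpush[of R p 1 M] by (simp only: fpush_1)

text \<open>The ideal \<open>Q + y R\<close>. It is written as an image under left multiplication
  because \<open>isub_single\<close> produces this form for the product of \<open>{y}\<close> with
  the whole ring.\<close>

definition princ :: "('a, 'c) ring_scheme \<Rightarrow> 'a set \<Rightarrow> 'a \<Rightarrow> 'a set" where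
  "princ R Q y = Q <+>\<^bsub>R\<^esub> (\<lambda>r. y \<otimes>\<^bsub>R\<^esub> r) ` carrier R"

lemma enat_eq_of_le: "x \<le> enat n \<Longrightarrow> \<exists>m. x = enat m \<and> m \<le> n"
  by (cases x) auto

context prime_char_ring
begin

lemma princ_iff: "z \<in> princ R Q y \<longleftrightarrow> (\<exists>q\<in>Q. \<exists>r\<in>carrier R. z = q \<oplus> y \<otimes> r)"
  by (auto simp: princ_def set_add_iff)

lemma gam0_self:
  assumes "y \<in> carrier R"
  shows "gam 0 Rm P Q {y} (carrier R) = len R Rm P (princ R Q y) (carrier R)"
  using module.isub_single[OF module_self submodule_self_carrier assms]
  by (simp add: gam_def princ_def set_add_self)

lemma gam0_tw:
  assumes "y \<in> carrier R"
  shows "gam 0 (tw R p Rm) P Q {y} (carrier R) = len R (tw R p Rm) P (princ R Q (y [^] p)) (carrier R)"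
  using module.isub_single[OF module_tw[OF module_self] submodule_tw[OF module_self submodule_self_carrier] assms]
  by (simp add: gam_def princ_def set_add_self set_add_tw)

lemma princ_ideal:
  assumes "ideal Q R" "y \<in> carrier R" shows "ideal (princ R Q y) R" "Q \<subseteq> princ R Q y" "y \<in> princ R Q y"
proof -
  interpret S: module R Rm by (rule module_self)
  have Q: "submodule Q R Rm" by (rule submodule_self_ideal[OF assms(1)])
  have eq: "princ R Q y = Q <+>\<^bsub>Rm\<^esub> cyc R Rm y"
    using assms(2) by (auto simp: princ_def cyc_def set_add_self m_comm intro!: arg_cong2[of _ _ _ _ "set_add R"])
  have y: "y \<in> carrier Rm" using assms(2) by simp
  show "ideal (princ R Q y) R" "Q \<subseteq> princ R Q y" "y \<in> princ R Q y"
    using S.submodule_sum_cyc[OF Q y] S.sum_cyc_upper[OF Q y] S.sum_cyc_self[OF Q y]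
    by (simp_all add: eq submodule_self_iff)
qed

lemma princ_cyc:
  assumes "y \<in> carrier R" shows "princ R Q y = Q <+>\<^bsub>Rm\<^esub> cyc R Rm y"
  using assms by (auto simp: princ_def cyc_def set_add_self m_comm intro!: arg_cong2[of _ _ _ _ "set_add R"])

text \<open>\<open>x\<close> is a nonzerodivisor modulo the prime \<open>Q\<close>, so every layer
  \<open>(Q + x^n R) / (Q + x^(n+1) R)\<close> is a copy of \<open>R / (Q + x R)\<close>.\<close>

lemma princ_pow_len:
  assumes P: "primeideal P R" and Q: "primeideal Q R" and x: "x \<in> carrier R" "x \<notin> Q"
  shows "len R Rm P (princ R Q (x [^] n)) (carrier R) = enat n * len R Rm P (princ R Q x) (carrier R)"
proof (induction n)
  case 0
  interpret S: module R Rm by (rule module_self)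
  have i: "ideal (princ R Q (x [^] (0::nat))) R" "\<one> \<in> princ R Q (x [^] (0::nat))"
    using princ_ideal[OF primeideal.axioms(1)[OF Q], of \<one>] by auto
  then have "princ R Q (x [^] (0::nat)) = carrier R" by (rule ideal.one_imp_carrier)
  then have "len R Rm P (princ R Q (x [^] (0::nat))) (carrier R) = 0"
    using S.len_zero[OF P submodule_self_carrier submodule_self_carrier] S.psat_zero_full[OF P] by simp
  then show ?case by (simp add: zero_enat_def[symmetric])
next
  case (Suc n)
  interpret S: module R Rm by (rule module_self)
  interpret Q: primeideal Q R by (rule Q)
  let ?y = "x [^] n" and ?K = "princ R Q (x [^] Suc n)"
  have y: "?y \<in> carrier R" "?y \<in> carrier Rm" "x [^] Suc n \<in> carrier R" using x by simp_all
  note K = princ_ideal[OF Q.is_ideal y(3)]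
  note L = princ_ideal[OF Q.is_ideal y(1)]
  note X = princ_ideal[OF Q.is_ideal x(1)]
  have sK: "submodule ?K R Rm" by (rule submodule_self_ideal[OF K(1)])
  have sL: "submodule (princ R Q ?y) R Rm" by (rule submodule_self_ideal[OF L(1)])
  have yq: "?y \<notin> Q" using primeideal_pow_mem[OF Q x(1)] x(2) by blast
  have KL: "?K \<subseteq> princ R Q ?y"
  proof
    fix z assume "z \<in> ?K"
    then obtain q r where qr: "q \<in> Q" "r \<in> carrier R" "z = q \<oplus> (?y \<otimes> x) \<otimes> r" by (auto simp: princ_iff)
    then have "z = q \<oplus> ?y \<otimes> (x \<otimes> r)" using x y by (simp add: m_assoc)
    then show "z \<in> princ R Q ?y" unfolding princ_iff using qr x(1) by blast
  qed
  have "?K <+>\<^bsub>Rm\<^esub> cyc R Rm ?y = princ R Q ?y"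
  proof
    show "?K <+>\<^bsub>Rm\<^esub> cyc R Rm ?y \<subseteq> princ R Q ?y"
      by (intro S.sum_least[OF sL KL] S.cyc_least[OF sL L(3)])
    show "princ R Q ?y \<subseteq> ?K <+>\<^bsub>Rm\<^esub> cyc R Rm ?y"
      unfolding princ_cyc[OF y(1)] by (intro S.sum_mono K(2) subset_refl)
  qed
  moreover have "{r \<in> carrier R. r \<otimes> ?y \<in> ?K} = princ R Q x"
  proof (intro Set.set_eqI iffI)
    fix r assume "r \<in> {r \<in> carrier R. r \<otimes> ?y \<in> ?K}"
    then obtain q t where r: "r \<in> carrier R" "q \<in> Q" "t \<in> carrier R" "r \<otimes> ?y = q \<oplus> (?y \<otimes> x) \<otimes> t"
      by (auto simp: princ_iff)
    have qc: "q \<in> carrier R" using Q.Icarr r(2) by blast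
    define u where "u = r \<ominus> x \<otimes> t"
    have u: "u \<in> carrier R" "r = u \<oplus> x \<otimes> t" using r x by (simp_all add: u_def a_minus_def a_assoc l_neg)
    have "(x \<otimes> t) \<otimes> ?y = (?y \<otimes> x) \<otimes> t" using r(3) x y(1) by (simp add: m_ac)
    then have "r \<otimes> ?y = u \<otimes> ?y \<oplus> (?y \<otimes> x) \<otimes> t"
      unfolding u(2) using u(1) r(3) x y(1) by (simp add: l_distr)
    then have "u \<otimes> ?y = q" using r(3,4) qc u(1) x y(1) by simp
    then have "u \<in> Q" using r(2) u(1) y(1) yq Q.I_prime[of u ?y] by auto
    then show "r \<in> princ R Q x" unfolding princ_iff using u(2) r(3) by blast
  next
    fix r assume "r \<in> princ R Q x"
    then obtain q t where r: "q \<in> Q" "t \<in> carrier R" "r = q \<oplus> x \<otimes> t" by (auto simp: princ_iff)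
    have qc: "q \<in> carrier R" using Q.Icarr r(1) by blast
    have "(x \<otimes> t) \<otimes> ?y = (?y \<otimes> x) \<otimes> t" using r(2) x y(1) by (simp add: m_ac)
    then have "r \<otimes> ?y = q \<otimes> ?y \<oplus> (?y \<otimes> x) \<otimes> t"
      unfolding r(3) using qc r(2) x(1) y(1) by (simp add: l_distr)
    moreover have "q \<otimes> ?y \<in> Q" using Q.I_r_closed[OF r(1) y(1)] .
    ultimately have "r \<otimes> ?y \<in> ?K" unfolding princ_iff using r(2) by auto
    then show "r \<in> {r \<in> carrier R. r \<otimes> ?y \<in> ?K}" using qc r(2,3) x by simp
  qed
  ultimately have 1: "len R Rm P ?K (princ R Q ?y) = len R Rm P (princ R Q x) (carrier R)"
    using len_cyc0[OF module_self sK y(2) P] by simp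
  have c: "princ R Q ?y \<subseteq> carrier R" using S.submoduleE(1)[OF sL] by simp
  have "len R Rm P ?K (carrier R) = len R Rm P ?K (princ R Q ?y) + len R Rm P (princ R Q ?y) (carrier R)"
    using KL S.psat_upper[OF P S.submoduleE(1)[OF sL]] S.psat_zero_full[OF P] c
    by (intro S.len_add[OF P sK sL submodule_self_carrier]) auto
  then show ?case unfolding 1 Suc by (simp add: distrib_right[symmetric] one_enat_def[symmetric] eSuc_enat[symmetric] mult_eSuc del: One_nat_def)
qed

text \<open>Complements the upper bound \<open>gam_pfilt_le\<close> in the case of one element
  \<open>x\<close>. A factor \<open>R / Q\<close>, on which \<open>x\<close> is injective,
  contributes its full length modulo \<open>x\<close>. A factor of finite length at \<open>P\<close>
  cannot lower the total, because the growth of the denominator is an image of that factor under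
  \<open>x\<close>.\<close>

lemma gam_pfilt_ge:
  assumes M: "module R M" and P: "primeideal P R" and K: "submodule K R M"
    and Q: "primeideal Q R" and x: "x \<in> carrier R" "x \<notin> Q"
    and "pfilt R M K Qs L"
    and fin: "\<And>Q'. Q' \<in> set Qs \<Longrightarrow> Q' = Q \<or> len R Rm P Q' (carrier R) \<noteq> \<infinity>"
  shows "enat (count_list Qs Q) * len R Rm P (princ R Q x) (carrier R) \<le> gam 0 M P K {x} L"
  using assms(7,8)
proof (induction rule: pfilt.induct)
  case Nil
  then show ?case by (simp add: zero_enat_def[symmetric])
next
  case (Cons Qs L y Q')
  interpret M: module R M by fact
  interpret Q: primeideal Q R by (rule Q)
  let ?L = "L <+>\<^bsub>M\<^esub> cyc R M y"
  have xB: "{x} \<subseteq> carrier R" using x by simp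
  have y: "y \<in> carrier M" by (rule Cons.hyps(2))
  have L: "submodule L R M" "K \<subseteq> L" using M.pfilt_submodule[OF Cons.hyps(1) K] by auto
  have sL: "submodule ?L R M" by (rule M.submodule_sum_cyc[OF L(1) y])
  have LL: "L \<subseteq> ?L" "y \<in> ?L" using M.sum_cyc_upper[OF L(1) y] M.sum_cyc_self[OF L(1) y] by auto
  have KL: "K \<subseteq> ?L" using L(2) LL(1) by blast
  define K0 where "K0 = K <+>\<^bsub>M\<^esub> isub R M {x} L"
  define K1 where "K1 = K <+>\<^bsub>M\<^esub> isub R M {x} ?L"
  define H where "H = L <+>\<^bsub>M\<^esub> isub R M {x} ?L"
  have K0: "submodule K0 R M" "K0 \<subseteq> L" unfolding K0_def using gam_sub[OF M xB K L, of 0] by simp_all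
  have K1: "submodule K1 R M" "K1 \<subseteq> ?L" unfolding K1_def using gam_sub[OF M xB K sL KL, of 0] by simp_all
  have H: "submodule H R M" "H \<subseteq> ?L" unfolding H_def using gam_sub[OF M xB L(1) sL LL(1), of 0] by simp_all
  have sx: "submodule (isub R M {x} ?L) R M" using M.isub_submodule[OF xB M.submoduleE(1)[OF sL]] .
  have K1H: "K1 \<subseteq> H" unfolding K1_def H_def by (intro M.sum_mono L(2) subset_refl)
  have LH: "L \<subseteq> H" unfolding H_def by (intro M.sum_upper1 L(1) sx)
  have K01: "K0 \<subseteq> K1" unfolding K0_def K1_def by (intro M.sum_mono subset_refl M.isub_mono LL(1))
  note up = M.psat_upper[OF P M.submoduleE(1)]
  have g0: "gam 0 M P K {x} L = len R M P K0 L" by (simp add: gam_def K0_def)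
  have g1: "gam 0 M P K {x} ?L = len R M P K1 ?L" by (simp add: gam_def K1_def)
  have IH: "enat (count_list Qs Q) * len R Rm P (princ R Q x) (carrier R) \<le> len R M P K0 L"
    using Cons.IH Cons.prems unfolding g0 by simp
  show ?case
  proof (cases "Q' = Q")
    case True
    have LQ: "r \<in> Q \<longleftrightarrow> r \<odot>\<^bsub>M\<^esub> y \<in> L" if "r \<in> carrier R" for r
      using Cons.hyps(3) True that by blast
    have 1: "len R M P K1 ?L = len R M P K1 H + len R M P H ?L"
      using K1H H(2) up[OF H(1)] up[OF sL] by (intro M.len_add[OF P K1(1) H(1) sL]) blast+
    \<comment> \<open>Injectivity of \<open>x\<close> on \<open>?L / L\<close>, a copy of
      \<open>R / Q\<close>, gives locally \<open>L \<inter> (K + x ?L) = K + x L\<close>. Thus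
      \<open>L / K0\<close> embeds into \<open>H / K1\<close>.\<close>
    have 2: "len R M P K0 L \<le> len R M P K1 H"
    proof (rule len_inj[OF M M P mlin_id K0(1) L(1) K1(1) H(1)])
      show "K1 \<subseteq> psat R M P H" using K1H up[OF H(1)] by blast
      fix z assume z: "z \<in> L"
      show "z \<in> psat R M P H" using z LH up[OF H(1)] by blast
      assume "z \<in> psat R M P K1"
      then obtain s k w where s: "z \<in> carrier M" "s \<in> carrier R - P" "k \<in> K" "w \<in> ?L" "s \<odot>\<^bsub>M\<^esub> z = k \<oplus>\<^bsub>M\<^esub> x \<odot>\<^bsub>M\<^esub> w"
        unfolding psat_def K1_def M.isub_single[OF sL x(1)] by (auto simp: set_add_iff)
      obtain l t where w: "l \<in> L" "t \<in> carrier R" "w = l \<oplus>\<^bsub>M\<^esub> t \<odot>\<^bsub>M\<^esub> y" using s(4) by (auto simp: M.sum_cyc_iff)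
      have c: "k \<in> carrier M" "l \<in> carrier M" using M.submodule_carrier K L(1) s(3) w(1) by blast+
      have "k \<oplus>\<^bsub>M\<^esub> x \<odot>\<^bsub>M\<^esub> w = (k \<oplus>\<^bsub>M\<^esub> x \<odot>\<^bsub>M\<^esub> l) \<oplus>\<^bsub>M\<^esub> (x \<otimes> t) \<odot>\<^bsub>M\<^esub> y"
        using c w(2) x y by (simp add: w(3) M.smult_r_distr M.smult_assoc1 M.a_assoc)
      moreover have "k \<oplus>\<^bsub>M\<^esub> x \<odot>\<^bsub>M\<^esub> w \<in> L" unfolding s(5)[symmetric] using M.submodule_smult[OF L(1)] s(2) z by simp
      moreover have "k \<oplus>\<^bsub>M\<^esub> x \<odot>\<^bsub>M\<^esub> l \<in> L"
        using M.submodule_add[OF L(1)] M.submodule_smult[OF L(1)] s(3) L(2) w(1) x(1) by blast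
      ultimately have "(x \<otimes> t) \<odot>\<^bsub>M\<^esub> y \<in> L" using M.submodule_add_cancel[OF L(1)] x w(2) y by simp
      then have "x \<otimes> t \<in> Q" using LQ[of "x \<otimes> t"] x w(2) by simp
      then have "t \<in> Q" using Q.I_prime[OF x(1) w(2)] x(2) by blast
      then have "w \<in> L" unfolding w(3) using LQ[OF w(2)] M.submodule_add[OF L(1) w(1)] by blast
      then have "s \<odot>\<^bsub>M\<^esub> z \<in> K0" unfolding K0_def M.isub_single[OF L(1) x(1)] s(5) using s(3) by (auto simp: set_add_iff)
      then show "z \<in> psat R M P K0" by (rule M.psatI[OF s(1,2)])
    qed
    let ?A = "{r \<in> carrier R. r \<odot>\<^bsub>M\<^esub> y \<in> H}"
    have "H <+>\<^bsub>M\<^esub> cyc R M y = ?L"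
    proof
      show "H <+>\<^bsub>M\<^esub> cyc R M y \<subseteq> ?L" by (intro M.sum_least[OF sL H(2)] M.cyc_least[OF sL LL(2)])
      show "?L \<subseteq> H <+>\<^bsub>M\<^esub> cyc R M y" by (intro M.sum_mono LH subset_refl)
    qed
    then have 3: "len R M P H ?L = len R Rm P ?A (carrier R)"
      using len_cyc0[OF M H(1) y P] by simp
    have "?A = princ R Q x"
    proof (intro Set.set_eqI iffI)
      fix r assume "r \<in> ?A"
      then obtain l w where r: "r \<in> carrier R" "l \<in> L" "w \<in> ?L" "r \<odot>\<^bsub>M\<^esub> y = l \<oplus>\<^bsub>M\<^esub> x \<odot>\<^bsub>M\<^esub> w"
        unfolding H_def M.isub_single[OF sL x(1)] by (auto simp: set_add_iff)
      obtain l2 t where w: "l2 \<in> L" "t \<in> carrier R" "w = l2 \<oplus>\<^bsub>M\<^esub> t \<odot>\<^bsub>M\<^esub> y" using r(3) by (auto simp: M.sum_cyc_iff)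
      have c: "l \<in> carrier M" "l2 \<in> carrier M" using M.submodule_carrier L(1) r(2) w(1) by blast+
      define u where "u = r \<ominus> x \<otimes> t"
      have u: "u \<in> carrier R" "r = u \<oplus> x \<otimes> t" using r x w by (simp_all add: u_def a_minus_def a_assoc l_neg)
      have "u \<odot>\<^bsub>M\<^esub> y \<oplus>\<^bsub>M\<^esub> (x \<otimes> t) \<odot>\<^bsub>M\<^esub> y = (l \<oplus>\<^bsub>M\<^esub> x \<odot>\<^bsub>M\<^esub> l2) \<oplus>\<^bsub>M\<^esub> (x \<otimes> t) \<odot>\<^bsub>M\<^esub> y"
        using r(4) c w(2) x y u(1) by (simp add: u(2) w(3) M.smult_l_distr M.smult_r_distr M.smult_assoc1 M.a_assoc)
      then have "u \<odot>\<^bsub>M\<^esub> y = l \<oplus>\<^bsub>M\<^esub> x \<odot>\<^bsub>M\<^esub> l2" using c w(2) x y u(1) by simp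
      then have "u \<odot>\<^bsub>M\<^esub> y \<in> L" using M.submodule_add[OF L(1)] M.submodule_smult[OF L(1)] r(2) w(1) x(1) by simp
      then have "u \<in> Q" using LQ[OF u(1)] by blast
      then show "r \<in> princ R Q x" unfolding princ_iff using u(2) w(2) by blast
    next
      fix r assume "r \<in> princ R Q x"
      then obtain q t where r: "q \<in> Q" "t \<in> carrier R" "r = q \<oplus> x \<otimes> t" by (auto simp: princ_iff)
      have qc: "q \<in> carrier R" using Q.Icarr r(1) by blast
      have "q \<odot>\<^bsub>M\<^esub> y \<in> H" using LQ[OF qc] r(1) LH by blast
      moreover have "x \<odot>\<^bsub>M\<^esub> (t \<odot>\<^bsub>M\<^esub> y) \<in> H"
        using M.isub_mem[of x "{x}" "t \<odot>\<^bsub>M\<^esub> y" ?L] M.submodule_smult[OF sL r(2) LL(2)] M.sum_upper2[OF L(1) sx]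
        unfolding H_def by blast
      ultimately have "r \<odot>\<^bsub>M\<^esub> y \<in> H"
        using M.submodule_add[OF H(1)] qc r(2) x y by (simp add: r(3) M.smult_l_distr M.smult_assoc1)
      then show "r \<in> ?A" using r x qc by simp
    qed
    then have 4: "len R M P H ?L = len R Rm P (princ R Q x) (carrier R)" using 3 by simp
    have "enat (count_list Qs Q) * len R Rm P (princ R Q x) (carrier R) + len R Rm P (princ R Q x) (carrier R)
      \<le> gam 0 M P K {x} ?L"
      unfolding g1 1 4 by (intro add_mono order_trans[OF IH 2] order_refl)
    then show ?thesis using True by (simp add: eSuc_enat[symmetric] mult_eSuc add.commute)
  next
    case False
    have "len R M P L ?L = len R Rm P Q' (carrier R)"
      using len_cyc0[OF M L(1) y P] Cons.hyps(3) by simp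
    then obtain f where f: "len R M P L ?L = enat f" using Cons.prems[of Q'] False by auto
    \<comment> \<open>\<open>?L / K0\<close> is decomposed through \<open>L\<close> and through
      \<open>K1\<close>. Since \<open>K1 / K0\<close> is an image of \<open>?L / L\<close> under
      \<open>x\<close>, its length at \<open>P\<close> is at most \<open>f\<close>, and the finite
      number \<open>f\<close> cancels.\<close>
    have a: "len R M P K0 ?L = len R M P K0 L + enat f"
      unfolding f[symmetric] using K0(2) LL(1) up[OF L(1)] up[OF sL] by (intro M.len_add[OF P K0(1) L(1) sL]) blast+
    have b: "len R M P K0 ?L = len R M P K0 K1 + len R M P K1 ?L"
      using K01 K1(2) up[OF K1(1)] up[OF sL] by (intro M.len_add[OF P K0(1) K1(1) sL]) blast+
    have "len R M P K0 K1 \<le> len R M P L ?L"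
    proof (rule len_surj[OF M M P M.mlin_smult[OF x(1)] L(1) sL K0(1) K1(1)])
      show "L \<subseteq> psat R M P ?L" using LL(1) up[OF sL] by blast
      fix z assume z: "z \<in> L"
      have sx0: "submodule (isub R M {x} L) R M" using M.isub_submodule[OF xB M.submoduleE(1)[OF L(1)]] .
      have "x \<odot>\<^bsub>M\<^esub> z \<in> K0" unfolding K0_def using M.isub_mem[of x "{x}" z L] z M.sum_upper2[OF K sx0] by blast
      then show "x \<odot>\<^bsub>M\<^esub> z \<in> psat R M P K0" using up[OF K0(1)] by blast
    next
      fix z assume z: "z \<in> K1"
      then obtain k w where w: "k \<in> K" "w \<in> ?L" "z = k \<oplus>\<^bsub>M\<^esub> x \<odot>\<^bsub>M\<^esub> w"
        unfolding K1_def M.isub_single[OF sL x(1)] by (auto simp: set_add_iff)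
      have sx0: "submodule (isub R M {x} L) R M" using M.isub_submodule[OF xB M.submoduleE(1)[OF L(1)]] .
      have "k \<in> K0" unfolding K0_def using w(1) M.sum_upper1[OF K sx0] by blast
      moreover have "\<one> \<odot>\<^bsub>M\<^esub> z = k \<oplus>\<^bsub>M\<^esub> x \<odot>\<^bsub>M\<^esub> w" using w z M.submodule_carrier[OF K1(1)] by simp
      ultimately show "\<exists>s\<in>carrier R - P. \<exists>k\<in>K0. \<exists>l\<in>?L. s \<odot>\<^bsub>M\<^esub> z = k \<oplus>\<^bsub>M\<^esub> x \<odot>\<^bsub>M\<^esub> l"
        using primeideal_one_notin[OF P] w(2) by blast
    qed
    then have "len R M P K0 L + enat f \<le> enat f + len R M P K1 ?L"
      unfolding a[symmetric] b f by (intro add_mono order_refl)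
    then have "len R M P K0 L \<le> len R M P K1 ?L"
      by (cases "len R M P K0 L"; cases "len R M P K1 ?L") simp_all
    then show ?thesis using IH False unfolding g1 by simp
  qed
qed

end

context ffinite_ring
begin

lemma pfilt_tw_ge:
  assumes Q: "primeideal Q R" and f: "pfilt R (tw R p Rm) Q Qs (carrier R)" and Q': "Q' \<in> set Qs"
  shows "Q \<subseteq> Q'"
proof
  interpret N: module R "tw R p Rm" by (rule module_tw[OF module_self])
  interpret Q: primeideal Q R by (rule Q)
  fix a assume a: "a \<in> Q"
  have ac: "a \<in> carrier R" using a Q.Icarr by blast
  obtain k where k: "p = Suc k" using p_prime by (metis not0_implies_Suc not_prime_0)
  have ap: "a [^] p \<in> Q" using a ac Q.I_l_closed[OF a, of "a [^] k"] by (simp add: k)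
  show "a \<in> Q'"
    by (rule N.pfilt_ann[OF f submodule_tw[OF module_self submodule_self_prime[OF Q]] ac _ Q'])
      (use ap Q.I_r_closed in simp)
qed

lemma sum_list_if_count:
  "(\<Sum>x\<leftarrow>xs. if x = y then (1::enat) else 0) = enat (count_list xs y)"
  by (induction xs) (simp_all add: zero_enat_def one_enat_def)

text \<open>Localization at \<open>Q\<close> itself removes the factors with strictly larger primes
  and makes each \<open>R / Q\<close> count one, while the total is \<open>fdeg Q\<close> by
  definition. So \<open>fdeg Q\<close> is also the rank of the restriction of \<open>R / Q\<close>
  along Frobenius, which can then be weighed at any other prime \<open>P\<close>.\<close>

lemma fdeg_eq_count:
  assumes Q: "primeideal Q R" and f: "pfilt R (tw R p Rm) Q Qs (carrier R)"
  shows "count_list Qs Q = fdeg Q"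
proof -
  interpret N: module R "tw R p Rm" by (rule module_tw[OF module_self])
  have sQ: "submodule Q R (tw R p Rm)" by (rule submodule_tw[OF module_self submodule_self_prime[OF Q]])
  have "enat (fdeg Q) = (\<Sum>Q'\<leftarrow>Qs. len R Rm Q Q' (carrier R))"
    using len_pfilt[OF N.module_axioms Q sQ f, of 0] len_fdeg[OF Q] by simp
  also have "(\<Sum>Q'\<leftarrow>Qs. len R Rm Q Q' (carrier R)) = (\<Sum>Q'\<leftarrow>Qs. if Q' = Q then 1 else 0)"
  proof (rule arg_cong[of _ _ sum_list], rule map_cong[OF refl])
    fix Q' assume Q': "Q' \<in> set Qs"
    show "len R Rm Q Q' (carrier R) = (if Q' = Q then 1 else 0)"
      using pfilt_tw_ge[OF Q f Q'] by (intro len_quot_prime[OF Q N.pfilt_primes[OF f Q']]) blast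
  qed
  finally show ?thesis by (simp add: sum_list_if_count)
qed

lemma pfilt_tw_exists: assumes "primeideal Q R" shows "\<exists>Qs. pfilt R (tw R p Rm) Q Qs (carrier R)"
proof (rule module.fg_sub_pfilt[OF module_tw[OF module_self] noetherian_ring_axioms _ fg_tw_self])
  show "submodule Q R (tw R p Rm)" by (rule submodule_tw[OF module_self submodule_self_prime[OF assms]])
  interpret Qi: primeideal Q R by (rule assms)
  show "Q \<subseteq> carrier R" by (rule Qi.a_subset)
qed

text \<open>The length at \<open>P\<close> of the restriction of \<open>R / Q\<close> modulo
  \<open>x^n\<close> is computed twice. Directly it is \<open>fdeg P * (p * n * c)\<close>, where
  \<open>c\<close> is the length of \<open>R / (Q + x R)\<close> at \<open>P\<close>. Through a
  filtration with \<open>fdeg Q\<close> factors \<open>R / Q\<close> it is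
  \<open>fdeg Q * (n * c)\<close> up to an error independent of \<open>n\<close>. Adjacency of
  \<open>Q\<close> and \<open>P\<close> makes \<open>c\<close> and the lengths of the other factors
  finite.\<close>

lemma fdeg_adjacent:
  assumes P: "primeideal P R" and Q: "primeideal Q R" and QP: "Q \<subset> P"
    and adj: "\<And>N. \<lbrakk>primeideal N R; Q \<subset> N; N \<subset> P\<rbrakk> \<Longrightarrow> False"
  shows "fdeg Q = p * fdeg P"
proof -
  interpret S: module R Rm by (rule module_self)
  interpret N: module R "tw R p Rm" by (rule module_tw[OF module_self])
  interpret Pi: primeideal P R by (rule P)
  interpret Qi: primeideal Q R by (rule Q)
  obtain x where x: "x \<in> P" "x \<notin> Q" using QP by blast
  have xc: "x \<in> carrier R" using x(1) Pi.Icarr by blast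
  note I = princ_ideal[OF Qi.is_ideal xc]
  have sI: "submodule (princ R Q x) R Rm" by (rule submodule_self_ideal[OF I(1)])
  have fin: "len R Rm P Q' (carrier R) \<le> 1" if "primeideal Q' R" "Q \<subset> Q'" for Q'
  proof -
    have "len R Rm P Q' (carrier R) = (if Q' = P then 1 else 0)"
      by (rule len_quot_prime[OF P that(1) adj[OF that]])
    then show ?thesis by simp
  qed
  obtain Rs where Rs: "pfilt R Rm (princ R Q x) Rs (carrier R)"
    using S.fg_sub_pfilt[OF noetherian_ring_axioms sI fg_sub_self] S.submoduleE(1)[OF sI] by auto
  have Rs': "Q \<subset> Q'" if Q': "Q' \<in> set Rs" for Q'
  proof -
    have "princ R Q x \<subseteq> Q'"
    proof
      fix a assume a: "a \<in> princ R Q x"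
      have "a \<in> carrier R" using a S.submodule_carrier[OF sI] by simp
      then show "a \<in> Q'"
        by (rule S.pfilt_ann[OF Rs sI _ _ Q']) (use ideal.I_r_closed[OF I(1) a] in simp)
    qed
    then show ?thesis using I(2,3) x(2) by blast
  qed
  have "len R Rm P (princ R Q x) (carrier R) = (\<Sum>Q'\<leftarrow>Rs. len R Rm P Q' (carrier R))"
    using len_pfilt[OF module_self P sI Rs, of 0] by simp
  also have "\<dots> \<le> (\<Sum>Q'\<leftarrow>Rs. 1)"
    by (rule sum_list_mono) (use fin Rs' S.pfilt_primes[OF Rs] in blast)
  also have "\<dots> = enat (length Rs)" by (induction Rs) (simp_all add: zero_enat_def one_enat_def)
  finally obtain c where c: "len R Rm P (princ R Q x) (carrier R) = enat c" using enat_eq_of_le by blast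
  have IP: "princ R Q x \<subseteq> P"
  proof
    fix z assume "z \<in> princ R Q x"
    then obtain q r where z: "q \<in> Q" "r \<in> carrier R" "z = q \<oplus> x \<otimes> r" by (auto simp: princ_iff)
    then show "z \<in> P" using QP Pi.a_closed[of q "x \<otimes> r"] Pi.I_r_closed[OF x(1)] by auto
  qed
  have c0: "0 < c"
  proof (rule ccontr)
    assume "\<not> 0 < c"
    then have "len R Rm P (princ R Q x) (carrier R) = 0" using c by (simp add: zero_enat_def)
    moreover have "princ R Q x \<subseteq> psat R Rm P (carrier R)" using S.psat_zero_full[OF P] S.submoduleE(1)[OF sI] by simp
    ultimately have "carrier R \<subseteq> psat R Rm P (princ R Q x)"
      using S.len_zero_iff[OF P sI submodule_self_carrier] by blast
    then have "carrier R \<subseteq> P" using S.psat_mono[OF IP, of P] psat_prime[OF P] by blast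
    then show False using Pi.I_notcarr Pi.a_subset by blast
  qed
  have pow: "len R Rm P (princ R Q (x [^] n)) (carrier R) = enat (n * c)" for n
    using princ_pow_len[OF P Q xc x(2), of n] c by simp
  \<comment> \<open>On the restriction \<open>x^n\<close> acts as \<open>x^(n p)\<close>; this is
    the source of the factor \<open>p\<close>. The factor \<open>fdeg P\<close> comes from
    \<open>len_tw\<close>.\<close>
  have tw: "gam 0 (tw R p Rm) P Q {x [^] n} (carrier R) = enat (fdeg P * (p * n * c))" for n :: nat
  proof -
    have xn: "x [^] n \<in> carrier R" "x [^] (n * p) \<in> carrier R" using xc by simp_all
    have "gam 0 (tw R p Rm) P Q {x [^] n} (carrier R) = len R (tw R p Rm) P (princ R Q (x [^] (n * p))) (carrier R)"
      using gam0_tw[OF xn(1)] xc by (simp add: nat_pow_pow)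
    also have "\<dots> = enat (fdeg P) * len R Rm P (princ R Q (x [^] (n * p))) (carrier R)"
      using princ_ideal[OF Qi.is_ideal xn(2)] S.psat_zero_full[OF P] S.submoduleE(1)[OF submodule_self_ideal[OF princ_ideal(1)[OF Qi.is_ideal xn(2)]]]
      by (intro len_tw[OF module_self submodule_self_ideal submodule_self_carrier P]) auto
    finally show ?thesis by (simp add: pow mult.commute mult.left_commute)
  qed
  obtain Qs where Qs: "pfilt R (tw R p Rm) Q Qs (carrier R)" using pfilt_tw_exists[OF Q] by blast
  have sQ: "submodule Q R (tw R p Rm)" by (rule submodule_tw[OF module_self submodule_self_prime[OF Q]])
  have cnt: "count_list Qs Q = fdeg Q" by (rule fdeg_eq_count[OF Q Qs])
  have gt: "Q' = Q \<or> len R Rm P Q' (carrier R) \<le> 1" if Q': "Q' \<in> set Qs" for Q'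
    using pfilt_tw_ge[OF Q Qs Q'] fin[OF N.pfilt_primes[OF Qs Q']] by blast
  \<comment> \<open>The lower estimate through the filtration has no error term, so
    \<open>n = 1\<close> suffices here. The upper estimate \<open>ub\<close> has the error
    \<open>length Qs\<close> and is exploited for large \<open>n\<close>.\<close>
  have "enat (count_list Qs Q) * len R Rm P (princ R Q x) (carrier R) \<le> gam 0 (tw R p Rm) P Q {x} (carrier R)"
    by (rule gam_pfilt_ge[OF N.module_axioms P sQ Q xc x(2) Qs]) (use gt in force)
  then have "fdeg Q * c \<le> fdeg P * (p * 1 * c)" using tw[of 1] xc cnt c by simp
  then have le: "fdeg Q \<le> p * fdeg P" using c0 by (simp add: mult.assoc[symmetric] mult.commute)
  have ub: "fdeg P * (p * n * c) \<le> fdeg Q * (n * c) + length Qs" for n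
  proof -
    have xn: "x [^] n \<in> carrier R" "{x [^] n} \<subseteq> carrier R" using xc by simp_all
    have 1: "gam 0 Rm P Q' {x [^] n} (carrier R) \<le> enat (if Q' = Q then n * c else 1)" if Q': "Q' \<in> set Qs" for Q'
    proof (cases "Q' = Q")
      case True
      then show ?thesis using gam0_self[OF xn(1)] pow by simp
    next
      case False
      have pQ': "primeideal Q' R" by (rule N.pfilt_primes[OF Qs Q'])
      note J = princ_ideal[OF primeideal.axioms(1)[OF pQ'] xn(1)]
      have "gam 0 Rm P Q' {x [^] n} (carrier R) = len R Rm P (princ R Q' (x [^] n)) (carrier R)"
        by (rule gam0_self[OF xn(1)])
      also have "\<dots> \<le> len R Rm P Q' (carrier R)"
      proof (rule S.len_mono[OF P submodule_self_prime[OF pQ'] submodule_self_carrier submodule_self_ideal[OF J(1)] submodule_self_carrier])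
        show "Q' \<subseteq> psat R Rm P (carrier R)" using S.psat_zero_full[OF P] S.submoduleE(1)[OF submodule_self_prime[OF pQ']] by simp
        show "carrier R \<subseteq> psat R Rm P (carrier R)" using S.psat_zero_full[OF P] by simp
        show "Q' \<subseteq> psat R Rm P (princ R Q' (x [^] n))"
          using J(2) S.psat_upper[OF P S.submoduleE(1)[OF submodule_self_ideal[OF J(1)]]] by blast
      qed
      also have "\<dots> \<le> 1" using gt[OF Q'] False by blast
      finally show ?thesis using False by (simp add: one_enat_def)
    qed
    have "gam 0 (tw R p Rm) P Q {x [^] n} (carrier R) \<le> (\<Sum>Q'\<leftarrow>Qs. gam 0 Rm P Q' {x [^] n} (carrier R))"
      by (rule gam_pfilt_le[OF N.module_axioms P sQ xn(2) Qs])
    also have "\<dots> \<le> (\<Sum>Q'\<leftarrow>Qs. enat (if Q' = Q then n * c else 1))"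
      by (rule sum_list_mono) (rule 1)
    also have "\<dots> \<le> enat (count_list Qs Q * (n * c) + length Qs)"
      by (induction Qs) (auto simp: zero_enat_def add_mono elim!: order_trans[OF add_left_mono])
    finally show ?thesis unfolding tw cnt by simp
  qed
  have "p * fdeg P \<le> fdeg Q"
  proof (rule ccontr)
    assume "\<not> p * fdeg P \<le> fdeg Q"
    then have "fdeg Q + 1 \<le> p * fdeg P" by simp
    \<comment> \<open>The choice \<open>n = length Qs + 1\<close> makes a deficit of one unit of
      degree, worth at least \<open>n\<close>, exceed the error \<open>length Qs\<close>.\<close>
    then have "(fdeg Q + 1) * (Suc (length Qs) * c) \<le> (p * fdeg P) * (Suc (length Qs) * c)" by (rule mult_right_mono) simp
    also have "\<dots> = fdeg P * (p * Suc (length Qs) * c)" by (simp only: mult_ac)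
    also have "\<dots> \<le> fdeg Q * (Suc (length Qs) * c) + length Qs" by (rule ub)
    finally have "Suc (length Qs) * c \<le> length Qs" by (simp only: distrib_right mult_1 add_le_cancel_left)
    moreover have "Suc (length Qs) * 1 \<le> Suc (length Qs) * c" using c0 by (intro mult_left_mono) simp_all
    ultimately show False by simp
  qed
  then show ?thesis using le by simp
qed

end

lemma sum_list_enat: "(\<Sum>x\<leftarrow>xs. enat (f x)) = enat (\<Sum>x\<leftarrow>xs. f x)"
  by (induction xs) (simp_all add: zero_enat_def)

lemma primeideal_subset: "primeideal P R \<Longrightarrow> P \<subseteq> carrier R"
  using primeideal.axioms(1) ideal.axioms(1) additive_subgroup.a_subset by blast

context ffinite_ring
begin

text \<open>A prime that is maximal among those strictly below \<open>P\<close> and above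
  \<open>Q\<close> is adjacent to \<open>P\<close>, and its degree is \<open>p\<close> times that of
  \<open>P\<close>. Degrees are bounded, so the descent ends at \<open>Q\<close>. The chain is
  returned along with the exponent because the Krull dimension will bound its length.\<close>

lemma prime_chain:
  assumes "primeideal P R" "primeideal Q R" "Q \<subseteq> P"
  shows "\<exists>k F. F 0 = Q \<and> F k = P \<and> (\<forall>i\<le>k. primeideal (F i) R) \<and> (\<forall>i<k. F i \<subset> F (Suc i))
    \<and> fdeg Q = p ^ k * fdeg P"
proof -
  obtain m where m: "\<And>P. primeideal P R \<Longrightarrow> fdeg P \<le> m" using fdeg_bound by blast
  show ?thesis
    using assms
  proof (induction "m - fdeg P" arbitrary: P rule: less_induct)
    case less
    note P = less.prems(1) and Q = less.prems(2) and QP = less.prems(3)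
    show ?case
    proof (cases "Q = P")
      case True
      then show ?thesis using P by (intro exI[of _ 0] exI[of _ "\<lambda>_. P"]) simp
    next
      case False
      let ?S = "{N. primeideal N R \<and> Q \<subseteq> N \<and> N \<subset> P}"
      have "Q \<in> ?S" using Q QP False by blast
      then obtain N where N: "N \<in> ?S" "\<And>N'. (N', N) \<in> {(J, I). ideal I R \<and> ideal J R \<and> I \<subset> J} \<Longrightarrow> N' \<notin> ?S"
        using wfE_min[OF ideal_wf, of Q ?S] by blast
      have pN: "primeideal N R" "Q \<subseteq> N" "N \<subset> P" using N(1) by auto
      have "fdeg N = p * fdeg P"
      proof (rule fdeg_adjacent[OF P pN(1,3)])
        fix N' assume N': "primeideal N' R" "N \<subset> N'" "N' \<subset> P"
        have "N' \<notin> ?S" by (rule N(2)) (use N' pN(1) primeideal.axioms(1) in blast)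
        moreover have "N' \<in> ?S" using N' pN(2) by blast
        ultimately show False by blast
      qed
      moreover have "fdeg P < p * fdeg P" using fdeg_pos[OF P] prime_gt_1_nat[OF p_prime] by simp
      ultimately have "m - fdeg N < m - fdeg P" using m[OF pN(1)] by linarith
      then obtain k F where F: "F 0 = Q" "F k = N" "\<forall>i\<le>k. primeideal (F i) R" "\<forall>i<k. F i \<subset> F (Suc i)"
        "fdeg Q = p ^ k * fdeg N"
        using less.hyps[OF _ pN(1) Q pN(2)] by blast
      define G where "G i = (if i \<le> k then F i else P)" for i
      have "G 0 = Q" "G (Suc k) = P" using F(1) by (simp_all add: G_def)
      moreover have "\<forall>i\<le>Suc k. primeideal (G i) R" using F(3) P by (simp add: G_def)
      moreover have "\<forall>i<Suc k. G i \<subset> G (Suc i)"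
      proof (intro allI impI)
        fix i assume "i < Suc k"
        then consider "i < k" | "i = k" by linarith
        then show "G i \<subset> G (Suc i)"
          by cases (use F(2,4) pN(3) in \<open>simp_all add: G_def\<close>)
      qed
      moreover have "fdeg Q = p ^ Suc k * fdeg P" using F(5) \<open>fdeg N = p * fdeg P\<close> by simp
      ultimately show ?thesis by blast
    qed
  qed
qed

lemma fdeg_strict:
  assumes "primeideal P R" "primeideal Q R" "Q \<subset> P" shows "p * fdeg P \<le> fdeg Q"
proof -
  obtain k F where F: "F 0 = Q" "F k = P" "fdeg Q = p ^ k * fdeg P"
    using prime_chain[of P Q] assms by blast
  have "k \<noteq> 0" using F assms(3) by (cases k) auto
  then obtain j where "k = Suc j" using not0_implies_Suc by blast
  then show ?thesis using F(3) prime_gt_0_nat[OF p_prime] by simp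
qed

lemma fdeg_chain:
  assumes "\<And>i. i \<le> n \<Longrightarrow> primeideal (F i) R" "\<And>i. i < n \<Longrightarrow> F i \<subset> F (Suc i)"
  shows "p ^ n * fdeg (F n) \<le> fdeg (F 0)"
  using assms
proof (induction n)
  case (Suc n)
  have "p ^ Suc n * fdeg (F (Suc n)) = p ^ n * (p * fdeg (F (Suc n)))" by simp
  also have "\<dots> \<le> p ^ n * fdeg (F n)"
    by (intro mult_le_mono2 fdeg_strict) (use Suc.prems in simp_all)
  also have "\<dots> \<le> fdeg (F 0)" using Suc by simp
  finally show ?case .
qed simp

subsection \<open>Uniform bounds for Hilbert--Kunz functions\<close>

lemma gam_ring_zero:
  assumes P: "primeideal P R" and I: "ideal I R" and "\<not> I \<subseteq> P" and B: "B \<subseteq> carrier R"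
  shows "gam e Rm P I B (carrier R) = 0"
proof -
  interpret S: module R Rm by (rule module_self)
  have sI: "submodule I R Rm" by (rule submodule_self_ideal[OF I])
  have Ic: "I \<subseteq> carrier R" using S.submoduleE(1)[OF sI] by simp
  let ?J = "I <+>\<^bsub>Rm\<^esub> isub R (fpush R p e Rm) B (carrier R)"
  have J: "submodule ?J R Rm" by (rule gam_sub[OF module_self B sI submodule_self_carrier Ic])
  have "I \<subseteq> ?J" by (intro S.sum_upper1 sI isub_fpush_submodule[OF module_self B submodule_self_carrier])
  then show ?thesis
    unfolding gam_def using assms(3) J by (intro len_ring_zero[OF P]) (auto simp: submodule_self_iff)
qed

lemma gam_0_le:
  assumes P: "primeideal P R" and Q: "primeideal Q R"
  shows "gam 0 Rm P Q P (carrier R) \<le> 1"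
proof -
  interpret S: module R Rm by (rule module_self)
  interpret Pi: primeideal P R by (rule P)
  interpret Qi: primeideal Q R by (rule Q)
  have sQ: "submodule Q R Rm" and sP: "submodule P R Rm" by (rule submodule_self_prime; fact)+
  let ?J = "Q <+>\<^bsub>Rm\<^esub> isub R Rm P (carrier R)"
  have iP: "submodule (isub R Rm P (carrier R)) R Rm" by (rule S.isub_submodule) (use Pi.a_subset in simp_all)
  have J: "submodule ?J R Rm" by (rule S.submodule_sum[OF sQ iP])
  have "P \<subseteq> isub R Rm P (carrier R)"
  proof
    fix a assume a: "a \<in> P"
    then have "a \<odot>\<^bsub>Rm\<^esub> \<one> \<in> isub R Rm P (carrier R)" by (rule S.isub_mem) simp
    then show "a \<in> isub R Rm P (carrier R)" using a Pi.Icarr by simp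
  qed
  then have PJ: "P \<subseteq> ?J" using S.sum_upper2[OF sQ iP] by blast
  have "gam 0 Rm P Q P (carrier R) = len R Rm P ?J (carrier R)" by (simp add: gam_def)
  also have "\<dots> \<le> len R Rm P P (carrier R)"
  proof (rule S.len_mono[OF P sP submodule_self_carrier J submodule_self_carrier])
    show "P \<subseteq> psat R Rm P (carrier R)" using S.psat_zero_full[OF P] Pi.a_subset by simp
    show "carrier R \<subseteq> psat R Rm P (carrier R)" using S.psat_zero_full[OF P] by simp
    show "P \<subseteq> psat R Rm P ?J" using PJ S.psat_upper[OF P S.submoduleE(1)[OF J]] by blast
  qed
  finally show ?thesis using len_residue_field[OF P] by simp
qed

text \<open>The inhomogeneous term grows at half the rate of the homogeneous solution, so relative
  to \<open>A ^ e\<close> its total effect is a convergent geometric series.\<close>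

lemma geometric_recurrence:
  fixes w :: "nat \<Rightarrow> real"
  assumes "w 0 \<le> 1" "A \<ge> 1" "D \<ge> 0" "\<And>e. w (Suc e) \<le> A * w e + D * (A / 2) ^ e"
  shows "w e \<le> (1 + 2 * D) * A ^ e"
proof -
  \<comment> \<open>The stronger bound leaves the room \<open>2 * D * (1/2) ^ e\<close>, and each
    step of the induction spends half of what is left.\<close>
  have "w e \<le> A ^ e * (1 + 2 * D * (1 - (1/2) ^ e))"
  proof (induction e)
    case (Suc e)
    have "w (Suc e) \<le> A * w e + D * (A / 2) ^ e" by (rule assms)
    also have "\<dots> \<le> A * (A ^ e * (1 + 2 * D * (1 - (1/2) ^ e))) + D * (A / 2) ^ e"
      using Suc assms(2) by (intro add_right_mono mult_left_mono) simp_all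
    also have "D * (A / 2) ^ e \<le> A * (D * (A / 2) ^ e)"
      using mult_right_mono[OF assms(2), of "D * (A / 2) ^ e"] assms(2,3) by simp
    also have "A * (A ^ e * (1 + 2 * D * (1 - (1/2) ^ e))) + A * (D * (A / 2) ^ e)
      = A ^ Suc e * (1 + 2 * D * (1 - (1/2) ^ Suc e))"
      by (simp add: power_divide field_simps)
    finally show ?case by simp
  qed (use assms in simp)
  also have "\<dots> \<le> A ^ e * (1 + 2 * D)"
  proof (rule mult_left_mono)
    have "2 * D * (1 - (1/2) ^ e) \<le> 2 * D * 1" using assms(3) by (intro mult_left_mono) simp_all
    then show "1 + 2 * D * (1 - (1/2) ^ e) \<le> 1 + 2 * D" by simp
  qed (use assms in simp)
  finally show ?thesis by (simp add: mult.commute)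
qed

text \<open>The restriction of \<open>R / Q\<close> along Frobenius has \<open>fdeg Q\<close>
  factors \<open>R / Q\<close>, and further factors with strictly larger primes, whose degrees are
  at most \<open>fdeg Q / p\<close>. Induction on the degree turns this into a recurrence in
  \<open>e\<close>. The constant depends on one filtration chosen over \<open>R\<close>, hence not
  on \<open>P\<close>. For \<open>fdeg Q = p ^ k * fdeg P\<close> the bound says that
  \<open>R / (Q + P^[q])\<close> has length at most \<open>C * q ^ k\<close> at
  \<open>P\<close>.\<close>

lemma gam_prime_bound:
  assumes "primeideal Q R"
  shows "\<exists>C::nat. \<forall>P e. primeideal P R \<longrightarrow> gam e Rm P Q P (carrier R) \<le> enat (C * fdeg Q ^ e)"
  using assms
proof (induction "fdeg Q" arbitrary: Q rule: less_induct)
  case less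
  note Q = less.prems
  interpret N: module R "tw R p Rm" by (rule module_tw[OF module_self])
  have sQ: "submodule Q R (tw R p Rm)" by (rule submodule_tw[OF module_self submodule_self_prime[OF Q]])
  obtain Qs where Qs: "pfilt R (tw R p Rm) Q Qs (carrier R)" using pfilt_tw_exists[OF Q] by blast
  have cnt: "count_list Qs Q = fdeg Q" by (rule fdeg_eq_count[OF Q Qs])
  have big: "primeideal Q' R \<and> p * fdeg Q' \<le> fdeg Q" if "Q' \<in> set Qs" "Q' \<noteq> Q" for Q'
  proof -
    have pQ': "primeideal Q' R" by (rule N.pfilt_primes[OF Qs that(1)])
    then show ?thesis using fdeg_strict[OF pQ' Q] pfilt_tw_ge[OF Q Qs that(1)] that(2) by blast
  qed
  have "\<exists>C::nat. \<forall>P e. primeideal P R \<longrightarrow> gam e Rm P Q' P (carrier R) \<le> enat (C * fdeg Q' ^ e)"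
    if "Q' \<in> set Qs" "Q' \<noteq> Q" for Q'
  proof -
    have b: "primeideal Q' R" "p * fdeg Q' \<le> fdeg Q" using big[OF that] by blast+
    have "fdeg Q' < p * fdeg Q'" using fdeg_pos[OF b(1)] prime_gt_1_nat[OF p_prime] by simp
    then have "fdeg Q' < fdeg Q" using b(2) by (rule less_le_trans)
    then show ?thesis by (rule less.hyps[OF _ b(1)])
  qed
  then obtain C :: "_ \<Rightarrow> nat" where C: "\<And>Q' P e. \<lbrakk>Q' \<in> set Qs; Q' \<noteq> Q; primeideal P R\<rbrakk>
      \<Longrightarrow> gam e Rm P Q' P (carrier R) \<le> enat (C Q' * fdeg Q' ^ e)"
    by metis
  define D where "D = (\<Sum>Q'\<leftarrow>Qs. C Q')"
  show ?case
  proof (intro exI[of _ "1 + 2 * D"] allI impI)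
    fix P e assume P: "primeideal P R"
    \<comment> \<open>\<open>gam (Suc e)\<close> of \<open>R / Q\<close> is \<open>gam e\<close> of
      its restriction along Frobenius. The factors equal to \<open>R / Q\<close> give the main term,
      the induction hypothesis bounds the others.\<close>
    have step: "gam (Suc e) Rm P Q P (carrier R)
      \<le> enat (fdeg Q) * gam e Rm P Q P (carrier R) + (\<Sum>Q'\<leftarrow>Qs. enat (if Q' = Q then 0 else C Q' * fdeg Q' ^ e))" for e
    proof -
      have PB: "P \<subseteq> carrier R" by (rule primeideal_subset[OF P])
      have "gam (Suc e) Rm P Q P (carrier R) = gam e (tw R p Rm) P Q P (carrier R)"
        by (simp add: gam_def fpush_tw set_add_tw)
      also have "\<dots> \<le> (\<Sum>Q'\<leftarrow>Qs. gam e Rm P Q' P (carrier R))"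
        by (rule gam_pfilt_le[OF N.module_axioms P sQ PB Qs])
      also have "\<dots> \<le> (\<Sum>Q'\<leftarrow>Qs. (if Q' = Q then 1 else 0) * gam e Rm P Q P (carrier R)
          + enat (if Q' = Q then 0 else C Q' * fdeg Q' ^ e))"
      proof (rule sum_list_mono)
        fix Q' assume Q': "Q' \<in> set Qs"
        show "gam e Rm P Q' P (carrier R) \<le> (if Q' = Q then 1 else 0) * gam e Rm P Q P (carrier R)
          + enat (if Q' = Q then 0 else C Q' * fdeg Q' ^ e)"
        proof (cases "Q' = Q")
          case True
          then show ?thesis by (simp add: zero_enat_def[symmetric])
        next
          case False
          then show ?thesis using C[OF Q' False P, of e] by simp
        qed
      qed
      also have "\<dots> = (\<Sum>Q'\<leftarrow>Qs. if Q' = Q then 1 else 0) * gam e Rm P Q P (carrier R)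
          + (\<Sum>Q'\<leftarrow>Qs. enat (if Q' = Q then 0 else C Q' * fdeg Q' ^ e))"
        by (simp only: sum_list_addf sum_list_mult_const)
      finally show ?thesis unfolding sum_list_if_count cnt .
    qed
    have rest: "(\<Sum>Q'\<leftarrow>Qs. enat (if Q' = Q then 0 else C Q' * fdeg Q' ^ e))
      = enat (\<Sum>Q'\<leftarrow>Qs. if Q' = Q then 0 else C Q' * fdeg Q' ^ e)" for e
      by (rule sum_list_enat)
    \<comment> \<open>The recurrence itself shows inductively that all values are finite, which
      permits passing from \<open>enat\<close> to the reals.\<close>
    have "\<exists>n. gam e Rm P Q P (carrier R) = enat n" for e
    proof (induction e)
      case 0
      have "gam 0 Rm P Q P (carrier R) \<le> enat 1" using gam_0_le[OF P Q] by (simp only: one_enat_def)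
      then show ?case using enat_eq_of_le by blast
    next
      case (Suc e)
      then obtain n where "gam e Rm P Q P (carrier R) = enat n" by blast
      then have "gam (Suc e) Rm P Q P (carrier R)
        \<le> enat (fdeg Q * n + (\<Sum>Q'\<leftarrow>Qs. if Q' = Q then 0 else C Q' * fdeg Q' ^ e))"
        using step[of e] unfolding rest by simp
      then show ?case using enat_eq_of_le by blast
    qed
    then obtain w where w: "\<And>e. gam e Rm P Q P (carrier R) = enat (w e)" by metis
    have A: "1 \<le> real (fdeg Q)" using fdeg_pos[OF Q] by simp
    have "real (w e) \<le> (1 + 2 * real D) * real (fdeg Q) ^ e"
    proof (rule geometric_recurrence[of "\<lambda>e. real (w e)"])
      show "real (w 0) \<le> 1" using gam_0_le[OF P Q] unfolding w one_enat_def by simp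
    next
      fix e
      have "(\<Sum>Q'\<leftarrow>Qs. if Q' = Q then 0 else C Q' * fdeg Q' ^ e) \<le> (\<Sum>Q'\<leftarrow>Qs. C Q' * (fdeg Q div 2) ^ e)"
      proof (rule sum_list_mono)
        fix Q' assume Q': "Q' \<in> set Qs"
        show "(if Q' = Q then 0 else C Q' * fdeg Q' ^ e) \<le> C Q' * (fdeg Q div 2) ^ e"
        proof (cases "Q' = Q")
          case False
          \<comment> \<open>Relaxing \<open>fdeg Q / p\<close> to \<open>fdeg Q div 2\<close>
            produces the rate one half for which \<open>geometric_recurrence\<close> is stated, with
            a constant that does not involve \<open>p\<close>.\<close>
          have "2 * fdeg Q' \<le> p * fdeg Q'" using prime_ge_2_nat[OF p_prime] by simp
          then have "fdeg Q' \<le> fdeg Q div 2" using big[OF Q' False] by linarith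
          then show ?thesis using False by (simp add: power_mono)
        qed simp
      qed
      also have "\<dots> = D * (fdeg Q div 2) ^ e" by (simp add: D_def sum_list_mult_const)
      finally have 1: "w (Suc e) \<le> fdeg Q * w e + D * (fdeg Q div 2) ^ e"
        using step[of e] unfolding w rest by simp
      have "real (fdeg Q div 2) ^ e \<le> (real (fdeg Q) / 2) ^ e" by (intro power_mono) simp_all
      then have "real D * real (fdeg Q div 2) ^ e \<le> real D * (real (fdeg Q) / 2) ^ e" by (intro mult_left_mono) simp_all
      moreover have "real (w (Suc e)) \<le> real (fdeg Q) * real (w e) + real D * real (fdeg Q div 2) ^ e"
        using 1 by (metis of_nat_le_iff of_nat_add of_nat_mult of_nat_power)
      ultimately show "real (w (Suc e)) \<le> real (fdeg Q) * real (w e) + real D * (real (fdeg Q) / 2) ^ e" by linarith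
    qed (use A in simp_all)
    then have "real (w e) \<le> real ((1 + 2 * D) * fdeg Q ^ e)"
      by (simp only: of_nat_mult of_nat_add of_nat_power of_nat_1 of_nat_numeral)
    then show "gam e Rm P Q P (carrier R) \<le> enat ((1 + 2 * D) * fdeg Q ^ e)"
      unfolding w by (simp only: of_nat_le_iff enat_ord_simps)
  qed
qed

text \<open>The number \<open>c\<close> records by which factor the degrees stay below
  \<open>T\<close>. The value \<open>c = 1\<close> gives the plain bound; \<open>c = p\<close>,
  available for primes strictly above minimal ones, gives the saving \<open>p ^ e\<close> on which
  the final exponent rests. Primes not contained in \<open>P\<close> contribute zero and are exempt
  from the condition.\<close>

lemma gam_list_bound:
  assumes "\<And>Q. Q \<in> set Qs \<Longrightarrow> primeideal Q R"
  shows "\<exists>C::nat. \<forall>P e T c. primeideal P R \<longrightarrow> (\<forall>Q\<in>set Qs. Q \<subseteq> P \<longrightarrow> c * fdeg Q \<le> T) \<longrightarrow>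
    enat (c ^ e) * (\<Sum>Q\<leftarrow>Qs. gam e Rm P Q P (carrier R)) \<le> enat (C * T ^ e)"
  using assms
proof (induction Qs)
  case Nil
  then show ?case by (intro exI[of _ 0]) (simp add: zero_enat_def[symmetric])
next
  case (Cons Q Qs)
  have "\<exists>C::nat. \<forall>P e T c. primeideal P R \<longrightarrow> (\<forall>Q\<in>set Qs. Q \<subseteq> P \<longrightarrow> c * fdeg Q \<le> T) \<longrightarrow>
    enat (c ^ e) * (\<Sum>Q\<leftarrow>Qs. gam e Rm P Q P (carrier R)) \<le> enat (C * T ^ e)"
    by (rule Cons.IH) (use Cons.prems in simp)
  then obtain C where C: "\<forall>P e T c. primeideal P R \<longrightarrow> (\<forall>Q\<in>set Qs. Q \<subseteq> P \<longrightarrow> c * fdeg Q \<le> T) \<longrightarrow>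
    enat (c ^ e) * (\<Sum>Q\<leftarrow>Qs. gam e Rm P Q P (carrier R)) \<le> enat (C * T ^ e)"
    by (elim exE)
  have Q: "primeideal Q R" using Cons.prems by simp
  obtain D where D: "\<forall>P e. primeideal P R \<longrightarrow> gam e Rm P Q P (carrier R) \<le> enat (D * fdeg Q ^ e)"
    using gam_prime_bound[OF Q] by blast
  show ?case
  proof (intro exI[of _ "D + C"] allI impI)
    fix P e T c assume P: "primeideal P R" and T: "\<forall>Q\<in>set (Q # Qs). Q \<subseteq> P \<longrightarrow> c * fdeg Q \<le> T"
    have 1: "enat (c ^ e) * (\<Sum>Q\<leftarrow>Qs. gam e Rm P Q P (carrier R)) \<le> enat (C * T ^ e)"
      by (rule C[rule_format, OF P]) (use T in simp)
    have 2: "enat (c ^ e) * gam e Rm P Q P (carrier R) \<le> enat (D * T ^ e)"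
    proof (cases "Q \<subseteq> P")
      case True
      have "enat (c ^ e) * gam e Rm P Q P (carrier R) \<le> enat (c ^ e) * enat (D * fdeg Q ^ e)"
        by (intro mult_left_mono D[rule_format, OF P]) simp
      also have "\<dots> = enat (D * (c * fdeg Q) ^ e)" by (simp add: power_mult_distrib)
      also have "\<dots> \<le> enat (D * T ^ e)" using T True by (simp add: power_mono)
      finally show ?thesis .
    next
      case False
      have PB: "P \<subseteq> carrier R" by (rule primeideal_subset[OF P])
      show ?thesis using gam_ring_zero[OF P primeideal.axioms(1)[OF Q] False PB] by simp
    qed
    show "enat (c ^ e) * (\<Sum>Q\<leftarrow>Q # Qs. gam e Rm P Q P (carrier R)) \<le> enat ((D + C) * T ^ e)"
      using add_mono[OF 2 1] by (simp add: distrib_left distrib_right)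
  qed
qed

end

subsection \<open>Comparing modules along linear maps\<close>

lemma mlin_image_submodule:
  assumes N: "module R N" and M: "module R M" and h: "mlin R N M h" and X: "submodule X R N"
  shows "submodule (h ` X) R M"
proof -
  interpret N: module R N by fact
  interpret M: module R M by fact
  have hc: "h x \<in> carrier M" if "x \<in> carrier N" for x using h that by (auto simp: mlin_def)
  have hadd: "h (x \<oplus>\<^bsub>N\<^esub> y) = h x \<oplus>\<^bsub>M\<^esub> h y" if "x \<in> carrier N" "y \<in> carrier N" for x y
    using h that by (auto simp: mlin_def)
  have hs: "h (r \<odot>\<^bsub>N\<^esub> x) = r \<odot>\<^bsub>M\<^esub> h x" if "x \<in> carrier N" "r \<in> carrier R" for r x
    using h that by (auto simp: mlin_def)
  have h0: "h \<zero>\<^bsub>N\<^esub> = \<zero>\<^bsub>M\<^esub>"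
    using hs[of "\<zero>\<^bsub>N\<^esub>" "\<zero>\<^bsub>R\<^esub>"] hc[of "\<zero>\<^bsub>N\<^esub>"] by simp
  show ?thesis
  proof (rule M.submoduleI')
    show "h ` X \<subseteq> carrier M" using hc N.submodule_carrier[OF X] by auto
    show "\<zero>\<^bsub>M\<^esub> \<in> h ` X" using h0 N.submodule_zero[OF X] by force
  next
    fix x y assume "x \<in> h ` X" "y \<in> h ` X"
    then obtain a b where "a \<in> X" "b \<in> X" "x = h a" "y = h b" by blast
    then show "x \<oplus>\<^bsub>M\<^esub> y \<in> h ` X"
      using hadd[of a b] N.submodule_carrier[OF X] N.submodule_add[OF X, of a b] by (metis imageI)
  next
    fix r x assume r: "r \<in> carrier R" and "x \<in> h ` X"
    then obtain a where "a \<in> X" "x = h a" by blast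
    then show "r \<odot>\<^bsub>M\<^esub> x \<in> h ` X"
      using hs[of a r] r N.submodule_carrier[OF X] N.submodule_smult[OF X r, of a] by (metis imageI)
  qed
qed

lemma (in cring) mlin_fpush:
  assumes "mlin R N M h" shows "mlin R (fpush R p e N) (fpush R p e M) h"
  using assms by (simp add: mlin_def fpush_smult)

text \<open>Ideals saturated at \<open>P\<close> with \<open>J\<^sub>P / I\<^sub>P\<close> generated by \<open>u\<close> and killed by \<open>P\<close>.\<close>

definition simple_step :: "('a, 'c) ring_scheme \<Rightarrow> 'a set \<Rightarrow> 'a set \<Rightarrow> 'a set \<Rightarrow> 'a \<Rightarrow> bool" where
  "simple_step R P I J u \<longleftrightarrow> ideal I R \<and> ideal J R \<and> I \<subseteq> J \<and> u \<in> J
     \<and> (\<forall>a\<in>P. a \<otimes>\<^bsub>R\<^esub> u \<in> I)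
     \<and> (\<forall>j\<in>J. \<exists>s\<in>carrier R - P. \<exists>i\<in>I. \<exists>r\<in>carrier R. s \<otimes>\<^bsub>R\<^esub> j = i \<oplus>\<^bsub>R\<^esub> u \<otimes>\<^bsub>R\<^esub> r)"

context prime_char_ring
begin

text \<open>With \<open>N = L / K\<close> this measures \<open>J^[q] N / I^[q] N\<close>, written as
  a subquotient of \<open>M\<close> so that quotient modules are not formed. The length is the one
  over restricted scalars, so it carries the factor \<open>fdeg P ^ e\<close>.\<close>

definition rPhi where
  "rPhi e M P I J K L = len R (fpush R p e M) P
     (K <+>\<^bsub>M\<^esub> isub R (fpush R p e M) I L) (K <+>\<^bsub>M\<^esub> isub R (fpush R p e M) J L)"

text \<open>The second term bounds the length of \<open>J\<^bsup>[q]\<^esup> L' / (I\<^bsup>[q]\<^esup> L' + J\<^bsup>[q]\<^esup> h(L))\<close>,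
  a quotient of \<open>L' / (h(L) + P\<^bsup>[q]\<^esup> L')\<close> via multiplication by \<open>u\<^bsup>q\<^esup>\<close>.\<close>

lemma rPhi_map_le:
  assumes N: "module R N" and M: "module R M" and P: "primeideal P R" and h: "mlin R N M h"
    and st: "simple_step R P I J u"
    and K: "submodule K R N" and L: "submodule L R N" and KL: "K \<subseteq> L"
    and K': "submodule K' R M" and L': "submodule L' R M" and KL': "K' \<subseteq> L'"
    and hK: "h ` K \<subseteq> K'" and hL: "h ` L \<subseteq> L'"
  shows "rPhi e M P I J K' L' \<le> rPhi e N P I J K L + gam e M P (K' <+>\<^bsub>M\<^esub> h ` L) P L'"
proof -
  interpret N: module R N by fact
  interpret M: module R M by fact
  let ?F = "fpush R p e M" and ?G = "fpush R p e N"
  interpret F: module R ?F by (rule module_fpush[OF M])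
  interpret G: module R ?G by (rule module_fpush[OF N])
  interpret Pi: primeideal P R by (rule P)
  have IJ: "ideal I R" "ideal J R" "I \<subseteq> J" "u \<in> J" using st by (auto simp: simple_step_def)
  have Ic: "I \<subseteq> carrier R" and Jc: "J \<subseteq> carrier R"
    using IJ ideal.axioms(1) additive_subgroup.a_subset by blast+
  have Pc: "P \<subseteq> carrier R" by (rule Pi.a_subset)
  have uc: "u \<in> carrier R" using IJ Jc by blast
  have hF: "mlin R ?G ?F h" by (rule mlin_fpush[OF h])
  have hL1: "submodule (h ` L) R M" by (rule mlin_image_submodule[OF N M h L])
  note sF = submodule_fpush[OF M] and sG = submodule_fpush[OF N]
  let ?IL = "isub R ?F I L'" and ?JL = "isub R ?F J L'" and ?IN = "isub R ?G I L" and ?JN = "isub R ?G J L"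
  have sIL: "submodule ?IL R M" "submodule ?JL R M"
    by (rule isub_fpush_submodule[OF M _ L'], rule Ic, rule isub_fpush_submodule[OF M _ L'], rule Jc)
  have sIN: "submodule ?IN R N" "submodule ?JN R N"
    by (rule isub_fpush_submodule[OF N _ L], rule Ic, rule isub_fpush_submodule[OF N _ L], rule Jc)
  have hJ: "submodule (h ` ?JN) R M" by (rule mlin_image_submodule[OF N M h sIN(2)])
  define A where "A = K' <+>\<^bsub>M\<^esub> ?IL"
  define C where "C = K' <+>\<^bsub>M\<^esub> ?JL"
  \<comment> \<open>From \<open>A\<close> to \<open>H\<close> the subquotient is an image of the one
    formed in \<open>N\<close>; from \<open>H\<close> to \<open>C\<close> it consists of what
    \<open>h\<close> fails to reach.\<close>
  define H where "H = A <+>\<^bsub>M\<^esub> h ` ?JN"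
  define A0 where "A0 = K <+>\<^bsub>N\<^esub> ?IN"
  define C0 where "C0 = K <+>\<^bsub>N\<^esub> ?JN"
  have sA: "submodule A R M" unfolding A_def by (rule M.submodule_sum[OF K' sIL(1)])
  have sC: "submodule C R M" unfolding C_def by (rule M.submodule_sum[OF K' sIL(2)])
  have sH: "submodule H R M" unfolding H_def by (rule M.submodule_sum[OF sA hJ])
  have sA0: "submodule A0 R N" unfolding A0_def by (rule N.submodule_sum[OF K sIN(1)])
  have sC0: "submodule C0 R N" unfolding C0_def by (rule N.submodule_sum[OF K sIN(2)])
  have Lc': "L' \<subseteq> carrier M" and Lc: "L \<subseteq> carrier N" by (rule M.submoduleE(1)[OF L'], rule N.submoduleE(1)[OF L])
  have hIL: "h x \<in> isub R ?F B L'" if "B \<subseteq> carrier R" "x \<in> isub R ?G B L" for B x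
    by (rule mlin_isub[OF G.module_axioms F.module_axioms hF that(1) _ _ hL that(2)]) (use Lc Lc' in simp_all)
  have AH: "A \<subseteq> H" unfolding H_def by (rule M.sum_upper1[OF sA hJ])
  have AC: "A \<subseteq> C" unfolding A_def C_def by (intro M.sum_mono subset_refl F.isub_mono IJ(3))
  have JC: "?JL \<subseteq> C" unfolding C_def by (rule M.sum_upper2[OF K' sIL(2)])
  have HC: "H \<subseteq> C" unfolding H_def
    by (rule M.sum_least[OF sC AC]) (use hIL[OF Jc] JC in blast)
  note up = F.psat_upper[OF P F.submoduleE(1)[OF sF]]
  have add: "rPhi e M P I J K' L' = len R ?F P A H + len R ?F P H C"
    unfolding rPhi_def A_def[symmetric] C_def[symmetric]
    using AH HC up[OF sH] up[OF sC] by (intro F.len_add[OF P sF[OF sA] sF[OF sH] sF[OF sC]]) blast+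
  have 1: "len R ?F P A H \<le> rPhi e N P I J K L"
    unfolding rPhi_def A0_def[symmetric] C0_def[symmetric]
  proof (rule len_surj[OF G.module_axioms F.module_axioms P hF sG[OF sA0] sG[OF sC0] sF[OF sA] sF[OF sH]])
    have "A0 \<subseteq> C0" unfolding A0_def C0_def by (intro N.sum_mono subset_refl G.isub_mono IJ(3))
    then show "A0 \<subseteq> psat R ?G P C0" using G.psat_upper[OF P G.submoduleE(1)[OF sG[OF sC0]]] by blast
    fix x assume "x \<in> A0"
    then obtain k i where x: "k \<in> K" "i \<in> ?IN" "x = k \<oplus>\<^bsub>N\<^esub> i" by (auto simp: A0_def set_add_iff)
    have "h x = h k \<oplus>\<^bsub>M\<^esub> h i" using h x N.submodule_carrier[OF K] N.submodule_carrier[OF sIN(1)] by (simp add: mlin_def)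
    then have "h x \<in> A" unfolding A_def set_add_iff using hK x(1) hIL[OF Ic x(2)] by blast
    then show "h x \<in> psat R ?F P A" using up[OF sA] by blast
  next
    fix y assume y: "y \<in> H"
    then obtain a j where aj: "a \<in> A" "j \<in> ?JN" "y = a \<oplus>\<^bsub>M\<^esub> h j" by (auto simp: H_def set_add_iff)
    have "j \<in> C0" unfolding C0_def using N.sum_upper2[OF K sIN(2)] aj(2) by blast
    moreover have "\<one> \<odot>\<^bsub>?F\<^esub> y = a \<oplus>\<^bsub>?F\<^esub> h j" using y aj(3) M.submodule_carrier[OF sH] by (simp add: fpush_smult)
    ultimately show "\<exists>s\<in>carrier R - P. \<exists>k\<in>A. \<exists>l\<in>C0. s \<odot>\<^bsub>?F\<^esub> y = k \<oplus>\<^bsub>?F\<^esub> h l"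
      using primeideal_one_notin[OF P] aj(1) by blast
  qed
  let ?PL = "isub R ?F P L'"
  have sPL: "submodule ?PL R M" by (rule isub_fpush_submodule[OF M Pc L'])
  have sg: "submodule (K' <+>\<^bsub>M\<^esub> h ` L) R M" by (rule M.submodule_sum[OF K' hL1])
  have gL: "K' <+>\<^bsub>M\<^esub> h ` L \<subseteq> L'" by (rule M.sum_least[OF L' KL' hL])
  define B where "B = (K' <+>\<^bsub>M\<^esub> h ` L) <+>\<^bsub>M\<^esub> ?PL"
  have sB: "submodule B R M" "B \<subseteq> L'" unfolding B_def by (rule gam_sub[OF M Pc sg L' gL])+
  have uF: "mlin R ?F ?F (\<lambda>z. u \<odot>\<^bsub>?F\<^esub> z)" by (rule F.mlin_smult[OF uc])
  have 2: "len R ?F P H C \<le> gam e M P (K' <+>\<^bsub>M\<^esub> h ` L) P L'"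
    unfolding gam_def B_def[symmetric]
  proof (rule len_surj[OF F.module_axioms F.module_axioms P uF sF[OF sB(1)] sF[OF L'] sF[OF sH] sF[OF sC]])
    show "B \<subseteq> psat R ?F P L'" using sB(2) up[OF L'] by blast
    have V: "submodule {z \<in> carrier ?F. u \<odot>\<^bsub>?F\<^esub> z \<in> H} R ?F"
      by (rule mlin_vimage_submodule[OF F.module_axioms F.module_axioms uF sF[OF sH]])
    have "B \<subseteq> {z \<in> carrier ?F. u \<odot>\<^bsub>?F\<^esub> z \<in> H}"
    proof -
      have "K' \<subseteq> {z \<in> carrier ?F. u \<odot>\<^bsub>?F\<^esub> z \<in> H}"
        using F.submodule_smult[OF sF[OF K'] uc] M.submodule_carrier[OF K'] AH M.sum_upper1[OF K' sIL(1)]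
        unfolding A_def by auto
      moreover have "h ` L \<subseteq> {z \<in> carrier ?F. u \<odot>\<^bsub>?F\<^esub> z \<in> H}"
      proof
        fix z assume "z \<in> h ` L"
        then obtain l where l: "l \<in> L" "z = h l" by blast
        have "u \<odot>\<^bsub>?F\<^esub> z = h (u \<odot>\<^bsub>?G\<^esub> l)" using hF l uc Lc by (auto simp: mlin_def)
        moreover have "u \<odot>\<^bsub>?G\<^esub> l \<in> ?JN" by (rule G.isub_mem[OF IJ(4) l(1)])
        ultimately have "u \<odot>\<^bsub>?F\<^esub> z \<in> H" unfolding H_def using M.sum_upper2[OF sA hJ] by blast
        then show "z \<in> {z \<in> carrier ?F. u \<odot>\<^bsub>?F\<^esub> z \<in> H}" using l hL Lc' by auto
      qed
      moreover have "?PL \<subseteq> {z \<in> carrier ?F. u \<odot>\<^bsub>?F\<^esub> z \<in> H}"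
      proof (rule F.isub_least[OF V])
        fix a x assume a: "a \<in> P" and x: "x \<in> L'"
        have ac: "a \<in> carrier R" and xc: "x \<in> carrier ?F" using a Pc x Lc' by auto
        have "u \<odot>\<^bsub>?F\<^esub> (a \<odot>\<^bsub>?F\<^esub> x) = (a \<otimes> u) \<odot>\<^bsub>?F\<^esub> x"
          using F.smult_assoc1[OF uc ac xc] uc ac by (simp add: m_comm)
        moreover have "(a \<otimes> u) \<odot>\<^bsub>?F\<^esub> x \<in> ?IL"
          by (rule F.isub_mem[OF _ x]) (use st a in \<open>auto simp: simple_step_def\<close>)
        moreover have "?IL \<subseteq> H" using AH M.sum_upper2[OF K' sIL(1)] unfolding A_def by blast
        ultimately show "a \<odot>\<^bsub>?F\<^esub> x \<in> {z \<in> carrier ?F. u \<odot>\<^bsub>?F\<^esub> z \<in> H}"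
          using F.smult_closed[OF ac xc] by auto
      qed
      ultimately show ?thesis
        unfolding B_def using F.sum_least[OF V F.sum_least[OF V]] by simp
    qed
    then show "u \<odot>\<^bsub>?F\<^esub> x \<in> psat R ?F P H" if "x \<in> B" for x using that up[OF sH] by blast
    fix y assume "y \<in> C"
    then obtain k j where y: "k \<in> K'" "j \<in> ?JL" "y = k \<oplus>\<^bsub>M\<^esub> j" by (auto simp: C_def set_add_iff)
    \<comment> \<open>Locally \<open>J = I + u R\<close>, and Frobenius is additive, so
      \<open>J^[q] L'\<close> is locally contained in the sum \<open>X\<close> of
      \<open>I^[q] L'\<close> and \<open>u^q L'\<close>.\<close>
    define X where "X = ?IL <+>\<^bsub>?F\<^esub> isub R ?F {u} L'"
    have uB: "{u} \<subseteq> carrier R" using uc by simp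
    have suL: "submodule (isub R ?F {u} L') R ?F" by (rule F.isub_submodule[OF uB]) (use Lc' in simp)
    have sX: "submodule X R ?F" unfolding X_def by (rule F.submodule_sum[OF sF[OF sIL(1)] suL])
    have "?JL \<subseteq> psat R ?F P X"
    proof (rule F.isub_least[OF F.submodule_psat[OF P sX]])
      fix j x assume j: "j \<in> J" and x: "x \<in> L'"
      have jc: "j \<in> carrier R" and xc: "x \<in> carrier ?F" using j Jc x Lc' by auto
      obtain s i r where s: "s \<in> carrier R - P" "i \<in> I" "r \<in> carrier R" "s \<otimes> j = i \<oplus> u \<otimes> r"
        using st j unfolding simple_step_def by blast
      have ic: "i \<in> carrier R" "s \<in> carrier R" using s Ic by auto
      have "s \<odot>\<^bsub>?F\<^esub> (j \<odot>\<^bsub>?F\<^esub> x) = (i \<oplus> u \<otimes> r) \<odot>\<^bsub>?F\<^esub> x"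
        using F.smult_assoc1[OF ic(2) jc xc] s(4) by simp
      also have "\<dots> = i \<odot>\<^bsub>?F\<^esub> x \<oplus>\<^bsub>?F\<^esub> u \<odot>\<^bsub>?F\<^esub> (r \<odot>\<^bsub>?F\<^esub> x)"
        using F.smult_l_distr[OF ic(1) _ xc, of "u \<otimes> r"] F.smult_assoc1[OF uc s(3) xc] uc s(3) by simp
      also have "\<dots> \<in> X"
        unfolding X_def set_add_iff
        using F.isub_mem[OF s(2) x] F.isub_mem[of u "{u}" "r \<odot>\<^bsub>?F\<^esub> x" L'] F.submodule_smult[OF sF[OF L'] s(3) x] by blast
      finally show "j \<odot>\<^bsub>?F\<^esub> x \<in> psat R ?F P X"
        using F.psatI[OF F.smult_closed[OF jc xc] s(1)] by blast
    qed
    then have "j \<in> psat R ?F P X" using y(2) by blast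
    then obtain s a l where s: "s \<in> carrier R - P" "a \<in> ?IL" "l \<in> L'" "s \<odot>\<^bsub>?F\<^esub> j = a \<oplus>\<^bsub>?F\<^esub> u \<odot>\<^bsub>?F\<^esub> l"
      unfolding psat_def X_def F.isub_single[OF sF[OF L'] uc] by (auto simp: set_add_iff)
    have sc: "s \<in> carrier R" using s(1) by blast
    have c: "k \<in> carrier ?F" "j \<in> carrier ?F" "a \<in> carrier ?F" "l \<in> carrier ?F"
      using M.submodule_carrier[OF K' y(1)] M.submodule_carrier[OF sIL(2) y(2)] M.submodule_carrier[OF sIL(1) s(2)] s(3) Lc' by auto
    have "s \<odot>\<^bsub>?F\<^esub> y = s \<odot>\<^bsub>?F\<^esub> k \<oplus>\<^bsub>?F\<^esub> s \<odot>\<^bsub>?F\<^esub> j"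
      using F.smult_r_distr[OF sc c(1,2)] y(3) by simp
    also have "\<dots> = (s \<odot>\<^bsub>?F\<^esub> k \<oplus>\<^bsub>?F\<^esub> a) \<oplus>\<^bsub>?F\<^esub> u \<odot>\<^bsub>?F\<^esub> l"
      unfolding s(4) using F.M.a_assoc[OF F.smult_closed[OF sc c(1)] c(3) F.smult_closed[OF uc c(4)]] by simp
    finally have eq: "s \<odot>\<^bsub>?F\<^esub> y = (s \<odot>\<^bsub>?F\<^esub> k \<oplus>\<^bsub>?F\<^esub> a) \<oplus>\<^bsub>?F\<^esub> u \<odot>\<^bsub>?F\<^esub> l" .
    have "s \<odot>\<^bsub>?F\<^esub> k \<oplus>\<^bsub>?F\<^esub> a \<in> A"
      unfolding A_def set_add_iff using F.submodule_smult[OF sF[OF K'] sc y(1)] s(2) by auto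
    then show "\<exists>s\<in>carrier R - P. \<exists>k\<in>H. \<exists>l\<in>L'. s \<odot>\<^bsub>?F\<^esub> y = k \<oplus>\<^bsub>?F\<^esub> u \<odot>\<^bsub>?F\<^esub> l"
      using eq s(1,3) AH by blast
  qed
  show ?thesis unfolding add by (rule add_mono[OF 1 2])
qed

text \<open>This is \<open>rPhi_map_le\<close> for the inclusion of the zero subquotient
  \<open>K / K\<close>: nothing is reached from it, so the cokernel term alone bounds the
  length.\<close>

lemma rPhi_le_gam:
  assumes M: "module R M" and P: "primeideal P R" and st: "simple_step R P I J u"
    and K: "submodule K R M" and L: "submodule L R M" and KL: "K \<subseteq> L"
  shows "rPhi e M P I J K L \<le> gam e M P K P L"
proof -
  interpret M: module R M by fact
  interpret F: module R "fpush R p e M" by (rule module_fpush[OF M])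
  have IJ: "ideal I R" "ideal J R" using st by (auto simp: simple_step_def)
  have B: "K <+>\<^bsub>M\<^esub> isub R (fpush R p e M) B K = K" if "ideal B R" for B
  proof -
    have Bc: "B \<subseteq> carrier R" using that ideal.axioms(1) additive_subgroup.a_subset by blast
    show ?thesis
      by (intro antisym M.sum_least M.sum_upper1 isub_fpush_le isub_fpush_submodule K M Bc subset_refl)
  qed
  have KK: "K <+>\<^bsub>M\<^esub> K = K" by (intro antisym M.sum_least M.sum_upper1 K subset_refl)
  have "rPhi e M P I J K K = 0"
    unfolding rPhi_def B[OF IJ(1)] B[OF IJ(2)]
    using F.psat_upper[OF P F.submoduleE(1)[OF submodule_fpush[OF M K]]]
    by (intro F.len_zero[OF P submodule_fpush[OF M K] submodule_fpush[OF M K]])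
  then show ?thesis
    using rPhi_map_le[OF M M P mlin_id st K K subset_refl K L KL, of e] KL by (simp add: KK)
qed

end

subsection \<open>Split filtrations\<close>

text \<open>The last condition makes every extension split: \<open>Q = (L : x)\<close> kills
  \<open>x\<close>, hence \<open>L \<inter> R x = 0\<close> and \<open>R x\<close> is a copy of
  \<open>R / Q\<close>. The module reached is an internal direct sum of modules
  \<open>R / Q\<close>.\<close>

inductive sfilt ::
    "('a, 'c) ring_scheme \<Rightarrow> ('a, 'b, 'd) module_scheme \<Rightarrow> 'a set list \<Rightarrow> 'b set \<Rightarrow> bool"
  for R M where
  Nil: "sfilt R M [] {\<zero>\<^bsub>M\<^esub>}"
| Cons: "\<lbrakk>sfilt R M Qs L; x \<in> carrier M; {r \<in> carrier R. r \<odot>\<^bsub>M\<^esub> x \<in> L} = Q; primeideal Q R;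
      \<forall>r\<in>Q. r \<odot>\<^bsub>M\<^esub> x = \<zero>\<^bsub>M\<^esub>\<rbrakk> \<Longrightarrow> sfilt R M (Q # Qs) (L <+>\<^bsub>M\<^esub> cyc R M x)"

lemma sfilt_pfilt: "sfilt R M Qs L \<Longrightarrow> pfilt R M {\<zero>\<^bsub>M\<^esub>} Qs L"
  by (induction rule: sfilt.induct) (auto intro: pfilt.intros)

lemma (in module) sfilt_fg_sub: "sfilt R M Qs L \<Longrightarrow> fg_sub R M L"
  by (induction rule: sfilt.induct) (auto intro: fg_sub_zero fg_sub_sum_cyc)

text \<open>A product of elements outside the prime \<open>Q\<close>, one from each of the given
  ideals, stays outside \<open>Q\<close> and lies in all of them.\<close>

lemma (in cring) prime_avoiding:
  assumes "finite \<S>" "primeideal Q R" "\<And>Q'. Q' \<in> \<S> \<Longrightarrow> ideal Q' R" "\<And>Q'. Q' \<in> \<S> \<Longrightarrow> \<not> Q' \<subseteq> Q"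
  shows "\<exists>c\<in>carrier R - Q. \<forall>Q'\<in>\<S>. c \<in> Q'"
  using assms(1,3,4)
proof (induction rule: finite_induct)
  case empty
  then show ?case using primeideal_one_notin[OF assms(2)] by blast
next
  case (insert A \<S>)
  have "\<exists>c\<in>carrier R - Q. \<forall>Q'\<in>\<S>. c \<in> Q'" by (rule insert.IH) (use insert.prems in simp_all)
  then obtain c where c: "c \<in> carrier R - Q" "\<forall>Q'\<in>\<S>. c \<in> Q'" by blast
  have "ideal A R" "\<not> A \<subseteq> Q" using insert.prems by simp_all
  then interpret A: ideal A R by simp
  obtain a where a: "a \<in> A" "a \<notin> Q" using \<open>\<not> A \<subseteq> Q\<close> by blast
  have ac: "a \<in> carrier R - Q" using a A.Icarr by blast
  have "c \<otimes> a \<in> Q'" if "Q' \<in> insert A \<S>" for Q'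
  proof (cases "Q' = A")
    case True
    then show ?thesis using A.I_l_closed[OF a(1)] c(1) by simp
  next
    case False
    then have Q': "ideal Q' R" "c \<in> Q'" using that insert.prems c(2) by simp_all
    then show ?thesis using ideal.I_r_closed[OF Q'] ac by simp
  qed
  then show ?case using primeideal_mult_notin[OF assms(2) c(1) ac] by blast
qed

text \<open>A common denominator: the product of denominators of finitely many generators works for
  the module they generate.\<close>

lemma (in module) fg_sub_psat_uniform:
  assumes P: "primeideal P R" and K: "submodule K R M" and fg: "fg_sub R M L" and LK: "L \<subseteq> psat R M P K"
  shows "\<exists>s\<in>carrier R - P. \<forall>x\<in>L. s \<odot>\<^bsub>M\<^esub> x \<in> K"
proof -
  obtain B where B: "finite B" "B \<subseteq> L" "\<forall>N. submodule N R M \<and> B \<subseteq> N \<longrightarrow> L \<subseteq> N" and L: "submodule L R M"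
    using fg unfolding fg_sub_def by (elim conjE exE)
  have "\<exists>s\<in>carrier R - P. \<forall>x\<in>B'. s \<odot>\<^bsub>M\<^esub> x \<in> K" if "finite B'" "B' \<subseteq> L" for B'
    using that
  proof (induction rule: finite_induct)
    case empty
    then show ?case using primeideal_one_notin[OF P] by blast
  next
    case (insert b B')
    have "\<exists>s\<in>carrier R - P. \<forall>x\<in>B'. s \<odot>\<^bsub>M\<^esub> x \<in> K" by (rule insert.IH) (use insert.prems in simp)
    then obtain s where s: "s \<in> carrier R - P" "\<forall>x\<in>B'. s \<odot>\<^bsub>M\<^esub> x \<in> K" by blast
    have "b \<in> psat R M P K" using insert.prems LK by blast
    then obtain t where t: "t \<in> carrier R - P" "t \<odot>\<^bsub>M\<^esub> b \<in> K" by (auto simp: psat_def)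
    have "(t \<otimes> s) \<odot>\<^bsub>M\<^esub> x \<in> K" if x: "x \<in> insert b B'" for x
    proof (cases "x = b")
      case True
      have "(t \<otimes> s) \<odot>\<^bsub>M\<^esub> b = s \<odot>\<^bsub>M\<^esub> (t \<odot>\<^bsub>M\<^esub> b)"
        using s(1) t(1) insert.prems submodule_carrier[OF L] by (simp add: R.m_comm[of t s] smult_assoc1)
      then show ?thesis using submodule_smult[OF K _ t(2), of s] s(1) True by simp
    next
      case False
      then have "s \<odot>\<^bsub>M\<^esub> x \<in> K" "x \<in> carrier M" using x s(2) insert.prems submodule_carrier[OF L] by auto
      then show ?thesis using submodule_smult[OF K, of t "s \<odot>\<^bsub>M\<^esub> x"] s(1) t(1) by (simp add: smult_assoc1)
    qed
    then show ?case using primeideal_mult_notin[OF P t(1) s(1)] by blast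
  qed
  then obtain s where s: "s \<in> carrier R - P" "\<forall>x\<in>B. s \<odot>\<^bsub>M\<^esub> x \<in> K" using B(1,2) by blast
  have sc: "s \<in> carrier R" using s(1) by blast
  have "submodule {x \<in> carrier M. s \<odot>\<^bsub>M\<^esub> x \<in> K} R M"
    by (rule mlin_vimage_submodule[OF module_axioms module_axioms mlin_smult[OF sc] K])
  moreover have "B \<subseteq> {x \<in> carrier M. s \<odot>\<^bsub>M\<^esub> x \<in> K}" using s(2) B(2) submodule_carrier[OF L] by blast
  ultimately have "L \<subseteq> {x \<in> carrier M. s \<odot>\<^bsub>M\<^esub> x \<in> K}" using B(3) by blast
  then show ?thesis using s(1) by blast
qed

context prime_char_ring
begin

abbreviation "Phi e M P I J L \<equiv> rPhi e M P I J {\<zero>\<^bsub>M\<^esub>} L"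

lemma zero_add_submodule:
  assumes "module R M" "submodule X R M" shows "{\<zero>\<^bsub>M\<^esub>} <+>\<^bsub>M\<^esub> X = X"
proof -
  interpret M: module R M by fact
  have "x = \<zero>\<^bsub>M\<^esub> \<oplus>\<^bsub>M\<^esub> x" if "x \<in> X" for x using M.submodule_carrier[OF assms(2) that] by simp
  then show ?thesis using M.submodule_carrier[OF assms(2)] by (force simp: set_add_iff)
qed

lemma Phi_eq:
  assumes M: "module R M" and L: "submodule L R M" and IJ: "I \<subseteq> carrier R" "J \<subseteq> carrier R"
  shows "Phi e M P I J L = len R (fpush R p e M) P (isub R (fpush R p e M) I L) (isub R (fpush R p e M) J L)"
  unfolding rPhi_def
  using zero_add_submodule[OF M isub_fpush_submodule[OF M IJ(1) L]]
    zero_add_submodule[OF M isub_fpush_submodule[OF M IJ(2) L]] by simp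

text \<open>Multiplication by an ideal commutes with direct sums, so on a split filtration the
  lengths add up exactly, where a general filtration only gives the inequality of
  \<open>gam_pfilt_le\<close>. This is why the comparison passes through direct sums.\<close>

lemma Phi_sfilt:
  assumes M: "module R M" and P: "primeideal P R" and I: "ideal I R" and J: "ideal J R" and IJ: "I \<subseteq> J"
    and "sfilt R M Qs L"
  shows "Phi e M P I J L = (\<Sum>Q\<leftarrow>Qs. rPhi e Rm P I J Q (carrier R))"
  using assms(6)
proof (induction rule: sfilt.induct)
  case Nil
  interpret M: module R M by fact
  let ?F = "fpush R p e M"
  interpret F: module R ?F by (rule module_fpush[OF M])
  have Ic: "I \<subseteq> carrier R" and Jc: "J \<subseteq> carrier R"
    using I J ideal.axioms(1) additive_subgroup.a_subset by blast+
  note Z = M.submodule_zero_set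
  have "isub R ?F B {\<zero>\<^bsub>M\<^esub>} = {\<zero>\<^bsub>M\<^esub>}" if "B \<subseteq> carrier R" for B
    using isub_fpush_le[OF M that Z] M.submodule_zero[OF isub_fpush_submodule[OF M that Z]] by blast
  then have "Phi e M P I J {\<zero>\<^bsub>M\<^esub>} = len R ?F P {\<zero>\<^bsub>M\<^esub>} {\<zero>\<^bsub>M\<^esub>}"
    using Phi_eq[OF M Z Ic Jc] Ic Jc by simp
  also have "\<dots> = 0"
    using F.psat_upper[OF P F.submoduleE(1)[OF submodule_fpush[OF M Z]]]
    by (intro F.len_zero[OF P submodule_fpush[OF M Z] submodule_fpush[OF M Z]])
  finally show ?case by simp
next
  case (Cons Qs L x Q)
  interpret M: module R M by fact
  interpret S: module R Rm by (rule module_self)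
  let ?F = "fpush R p e M" and ?G = "fpush R p e Rm"
  interpret F: module R ?F by (rule module_fpush[OF M])
  interpret G: module R ?G by (rule module_fpush[OF module_self])
  have Ic: "I \<subseteq> carrier R" and Jc: "J \<subseteq> carrier R"
    using I J ideal.axioms(1) additive_subgroup.a_subset by blast+
  have x: "x \<in> carrier M" by (rule Cons.hyps(2))
  have Q: "primeideal Q R" by (rule Cons.hyps(4))
  have L: "submodule L R M" using M.pfilt_submodule[OF sfilt_pfilt[OF Cons.hyps(1)] M.submodule_zero_set] by blast
  define D where "D = cyc R M x"
  have D: "submodule D R M" "x \<in> D" unfolding D_def by (rule M.submodule_cyc[OF x], rule M.cyc_self[OF x])
  let ?L = "L <+>\<^bsub>M\<^esub> D"
  have sL: "submodule ?L R M" unfolding D_def by (rule M.submodule_sum_cyc[OF L x])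
  have LL: "L \<subseteq> ?L" "D \<subseteq> ?L" by (rule M.sum_upper1[OF L D(1)], rule M.sum_upper2[OF L D(1)])
  define h where "h r = r \<odot>\<^bsub>M\<^esub> x" for r
  have h: "mlin R ?G ?F h" unfolding h_def by (rule mlin_orbit[OF M x])
  have hR: "h ` carrier R = D" by (auto simp: h_def D_def cyc_def)
  have hQ: "r \<in> Q \<longleftrightarrow> h r \<in> L" if "r \<in> carrier R" for r using Cons.hyps(3) that by (auto simp: h_def)
  have hQ0: "h r = \<zero>\<^bsub>M\<^esub>" if "r \<in> Q" for r using Cons.hyps(5) that by (simp add: h_def)
  have Qc: "Q \<subseteq> carrier R" by (rule primeideal_subset[OF Q])
  \<comment> \<open>Directness of the sum \<open>L + R x\<close>: if \<open>r x \<in> L\<close> then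
    \<open>r \<in> Q\<close>, and then \<open>r x = 0\<close>.\<close>
  have LD: "d = \<zero>\<^bsub>M\<^esub>" if dL: "d \<in> L" and dD: "d \<in> D" for d
  proof -
    obtain r where r: "r \<in> carrier R" "d = h r" using dD by (auto simp: D_def cyc_def h_def)
    then show ?thesis using hQ[OF r(1)] hQ0 dL by simp
  qed
  note sF = submodule_fpush[OF M] and sG = submodule_fpush[OF module_self]
  note up = F.psat_upper[OF P F.submoduleE(1)[OF sF]]
  have s: "submodule (isub R ?F B X) R M" if "B \<subseteq> carrier R" "submodule X R M" for B X
    by (rule isub_fpush_submodule[OF M that])
  have sR: "submodule (isub R ?G B (carrier R)) R Rm" if "B \<subseteq> carrier R" for B
    by (rule isub_fpush_submodule[OF module_self that submodule_self_carrier])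
  have dist: "isub R ?F B ?L \<subseteq> isub R ?F B L <+>\<^bsub>M\<^esub> isub R ?F B D" if "B \<subseteq> carrier R" for B
    using F.isub_sum[OF sF[OF L] sF[OF D(1)] that] by simp
  have distE: "\<exists>a\<in>isub R ?F B L. \<exists>d\<in>isub R ?F B D. z = a \<oplus>\<^bsub>M\<^esub> d" if "B \<subseteq> carrier R" "z \<in> isub R ?F B ?L" for B z
    using subsetD[OF dist[OF that(1)] that(2)] unfolding set_add_iff .
  have hI: "h r \<in> isub R ?F B D" if "B \<subseteq> carrier R" "r \<in> isub R ?G B (carrier R)" for B r
    by (rule mlin_isub[OF G.module_axioms F.module_axioms h that(1) _ _ _ that(2)])
      (use hR M.submoduleE(1)[OF D(1)] in simp_all)
  have hI': "isub R ?F B D \<subseteq> h ` isub R ?G B (carrier R)" if B: "B \<subseteq> carrier R" for B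
  proof (rule F.isub_least)
    show "submodule (h ` isub R ?G B (carrier R)) R ?F"
      by (rule mlin_image_submodule[OF G.module_axioms F.module_axioms h sG[OF sR[OF B]]])
    fix b d assume b: "b \<in> B" and "d \<in> D"
    then obtain r where r: "r \<in> carrier R" "d = h r" using hR by blast
    have "b \<odot>\<^bsub>?F\<^esub> d = h (b \<odot>\<^bsub>?G\<^esub> r)" using h b B r by (auto simp: mlin_def)
    then show "b \<odot>\<^bsub>?F\<^esub> d \<in> h ` isub R ?G B (carrier R)" using G.isub_mem[OF b r(1)] by blast
  qed
  define A where "A = isub R ?F I ?L"
  define C where "C = isub R ?F J ?L"
  \<comment> \<open>Below \<open>H\<close> only the summand \<open>L\<close> contributes, and above
    it only \<open>R x\<close>; each piece is identified with its counterpart by inequalities in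
    both directions.\<close>
  define H where "H = isub R ?F J L <+>\<^bsub>M\<^esub> A"
  have sA: "submodule A R M" and sC: "submodule C R M" unfolding A_def C_def by (rule s[OF Ic sL], rule s[OF Jc sL])
  have sH: "submodule H R M" unfolding H_def by (rule M.submodule_sum[OF s[OF Jc L] sA])
  have AC: "A \<subseteq> C" unfolding A_def C_def by (rule F.isub_mono[OF IJ subset_refl])
  have JC: "isub R ?F J L \<subseteq> C" unfolding C_def by (rule F.isub_mono[OF subset_refl LL(1)])
  have JDC: "isub R ?F J D \<subseteq> C" unfolding C_def by (rule F.isub_mono[OF subset_refl LL(2)])
  have ILA: "isub R ?F I L \<subseteq> A" unfolding A_def by (rule F.isub_mono[OF subset_refl LL(1)])
  have IDA: "isub R ?F I D \<subseteq> A" unfolding A_def by (rule F.isub_mono[OF subset_refl LL(2)])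
  have AH: "A \<subseteq> H" unfolding H_def by (rule M.sum_upper2[OF s[OF Jc L] sA])
  have JH: "isub R ?F J L \<subseteq> H" unfolding H_def by (rule M.sum_upper1[OF s[OF Jc L] sA])
  have HC: "H \<subseteq> C" unfolding H_def by (rule M.sum_least[OF sC JC AC])
  have IJL: "isub R ?F I L \<subseteq> isub R ?F J L" by (rule F.isub_mono[OF IJ subset_refl])
  have JL: "isub R ?F J L \<subseteq> L" "isub R ?F I L \<subseteq> L" by (rule isub_fpush_le[OF M Jc L], rule isub_fpush_le[OF M Ic L])
  have add: "Phi e M P I J ?L = len R ?F P A H + len R ?F P H C"
    unfolding Phi_eq[OF M sL Ic Jc] A_def[symmetric] C_def[symmetric]
    using AH HC up[OF sH] up[OF sC] by (intro F.len_add[OF P sF[OF sA] sF[OF sH] sF[OF sC]]) blast+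
  have 1: "len R ?F P A H = Phi e M P I J L"
    unfolding Phi_eq[OF M L Ic Jc]
  proof (rule antisym)
    show "len R ?F P A H \<le> len R ?F P (isub R ?F I L) (isub R ?F J L)"
    proof (rule len_surj[OF F.module_axioms F.module_axioms P mlin_id sF[OF s[OF Ic L]] sF[OF s[OF Jc L]] sF[OF sA] sF[OF sH]])
      show "isub R ?F I L \<subseteq> psat R ?F P (isub R ?F J L)" using IJL up[OF s[OF Jc L]] by blast
      show "z \<in> psat R ?F P A" if "z \<in> isub R ?F I L" for z using that ILA up[OF sA] by blast
      fix y assume y: "y \<in> H"
      then obtain b a where ba: "b \<in> isub R ?F J L" "a \<in> A" "y = b \<oplus>\<^bsub>M\<^esub> a" by (auto simp: H_def set_add_iff)
      have "\<one> \<odot>\<^bsub>?F\<^esub> y = a \<oplus>\<^bsub>?F\<^esub> b"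
        using ba M.submodule_carrier[OF s[OF Jc L] ba(1)] M.submodule_carrier[OF sA ba(2)]
        by (simp add: fpush_smult M.a_comm)
      then show "\<exists>s\<in>carrier R - P. \<exists>k\<in>A. \<exists>l\<in>isub R ?F J L. s \<odot>\<^bsub>?F\<^esub> y = k \<oplus>\<^bsub>?F\<^esub> l"
        using primeideal_one_notin[OF P] ba(1,2) by blast
    qed
    show "len R ?F P (isub R ?F I L) (isub R ?F J L) \<le> len R ?F P A H"
    proof (rule len_inj[OF F.module_axioms F.module_axioms P mlin_id sF[OF s[OF Ic L]] sF[OF s[OF Jc L]] sF[OF sA] sF[OF sH]])
      show "A \<subseteq> psat R ?F P H" using AH up[OF sH] by blast
      fix z assume z: "z \<in> isub R ?F J L"
      show "z \<in> psat R ?F P H" using z JH up[OF sH] by blast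
      assume "z \<in> psat R ?F P A"
      then obtain t where t: "z \<in> carrier ?F" "t \<in> carrier R - P" "t \<odot>\<^bsub>?F\<^esub> z \<in> A" by (auto simp: psat_def)
      then obtain a d where ad: "a \<in> isub R ?F I L" "d \<in> isub R ?F I D" "t \<odot>\<^bsub>?F\<^esub> z = a \<oplus>\<^bsub>M\<^esub> d"
        unfolding A_def using distE[OF Ic] by blast
      have dD: "d \<in> D" using ad(2) isub_fpush_le[OF M Ic D(1)] by blast
      have tc: "t \<in> carrier R" using t(2) by blast
      have zL: "z \<in> L" using z JL by blast
      have "a \<oplus>\<^bsub>M\<^esub> d \<in> L" unfolding ad(3)[symmetric] by (rule F.submodule_smult[OF sF[OF L] tc zL])
      then have "d \<in> L" using M.submodule_add_cancel[OF L] ad(1) JL(2) M.submodule_carrier[OF D(1) dD] by blast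
      then have "d = \<zero>\<^bsub>M\<^esub>" using LD dD by blast
      then have "t \<odot>\<^bsub>?F\<^esub> z \<in> isub R ?F I L" using ad(1,3) M.submodule_carrier[OF s[OF Ic L] ad(1)] by simp
      then show "z \<in> psat R ?F P (isub R ?F I L)" by (rule F.psatI[OF t(1,2)])
    qed
  qed
  have sQ: "submodule Q R Rm" by (rule submodule_self_prime[OF Q])
  define A0 where "A0 = Q <+>\<^bsub>Rm\<^esub> isub R ?G I (carrier R)"
  define C0 where "C0 = Q <+>\<^bsub>Rm\<^esub> isub R ?G J (carrier R)"
  have sA0: "submodule A0 R Rm" unfolding A0_def by (rule S.submodule_sum[OF sQ sR[OF Ic]])
  have sC0: "submodule C0 R Rm" unfolding C0_def by (rule S.submodule_sum[OF sQ sR[OF Jc]])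
  have AC0: "A0 \<subseteq> C0" unfolding A0_def C0_def by (intro S.sum_mono subset_refl G.isub_mono IJ)
  have hsum: "h r \<in> isub R ?F B D" if B: "B \<subseteq> carrier R" and rB: "r \<in> Q <+>\<^bsub>Rm\<^esub> isub R ?G B (carrier R)" for B r
  proof -
    obtain q i where r: "q \<in> Q" "i \<in> isub R ?G B (carrier R)" "r = q \<oplus> i"
      using rB by (auto simp: set_add_iff)
    have ic: "i \<in> carrier R" using S.submodule_carrier[OF sR[OF B] r(2)] by simp
    have hi: "h i \<in> isub R ?F B D" by (rule hI[OF B r(2)])
    have "h r = h q \<oplus>\<^bsub>M\<^esub> h i" using h r Qc ic by (auto simp: mlin_def)
    also have "\<dots> = h i" using hQ0[OF r(1)] M.submodule_carrier[OF s[OF B D(1)] hi] by simp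
    finally show ?thesis using hi by simp
  qed
  have 2: "len R ?F P H C = rPhi e Rm P I J Q (carrier R)"
    unfolding rPhi_def A0_def[symmetric] C0_def[symmetric]
  proof (rule antisym)
    show "len R ?F P H C \<le> len R ?G P A0 C0"
    proof (rule len_surj[OF G.module_axioms F.module_axioms P h sG[OF sA0] sG[OF sC0] sF[OF sH] sF[OF sC]])
      show "A0 \<subseteq> psat R ?G P C0" using AC0 G.psat_upper[OF P G.submoduleE(1)[OF sG[OF sC0]]] by blast
      show "h r \<in> psat R ?F P H" if "r \<in> A0" for r
        using hsum[OF Ic that[unfolded A0_def]] IDA AH up[OF sH] by blast
      fix y assume y: "y \<in> C"
      then obtain b d where bd: "b \<in> isub R ?F J L" "d \<in> isub R ?F J D" "y = b \<oplus>\<^bsub>M\<^esub> d"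
        unfolding C_def using distE[OF Jc] by blast
      obtain j where j: "j \<in> isub R ?G J (carrier R)" "d = h j" using hI'[OF Jc] bd(2) by blast
      have "j \<in> C0" unfolding C0_def using S.sum_upper2[OF sQ sR[OF Jc]] j(1) by blast
      moreover have "\<one> \<odot>\<^bsub>?F\<^esub> y = b \<oplus>\<^bsub>?F\<^esub> h j" using bd(3) j(2) M.submodule_carrier[OF sC y] by (simp add: fpush_smult)
      ultimately show "\<exists>s\<in>carrier R - P. \<exists>k\<in>H. \<exists>l\<in>C0. s \<odot>\<^bsub>?F\<^esub> y = k \<oplus>\<^bsub>?F\<^esub> h l"
        using primeideal_one_notin[OF P] bd(1) JH by blast
    qed
    show "len R ?G P A0 C0 \<le> len R ?F P H C"
    proof (rule len_inj[OF G.module_axioms F.module_axioms P h sG[OF sA0] sG[OF sC0] sF[OF sH] sF[OF sC]])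
      show "H \<subseteq> psat R ?F P C" using HC up[OF sC] by blast
      fix r assume r: "r \<in> C0"
      have rc: "r \<in> carrier R" using S.submodule_carrier[OF sC0 r] by simp
      show "h r \<in> psat R ?F P C" using hsum[OF Jc r[unfolded C0_def]] JDC up[OF sC] by blast
      assume "h r \<in> psat R ?F P H"
      then obtain t where t: "t \<in> carrier R - P" "t \<odot>\<^bsub>?F\<^esub> h r \<in> H" by (auto simp: psat_def)
      then obtain b a where ba: "b \<in> isub R ?F J L" "a \<in> A" "t \<odot>\<^bsub>?F\<^esub> h r = b \<oplus>\<^bsub>M\<^esub> a" by (auto simp: H_def set_add_iff)
      obtain a1 d where ad: "a1 \<in> isub R ?F I L" "d \<in> isub R ?F I D" "a = a1 \<oplus>\<^bsub>M\<^esub> d"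
        using distE[OF Ic] ba(2) unfolding A_def by blast
      obtain i where i: "i \<in> isub R ?G I (carrier R)" "d = h i" using hI'[OF Ic] ad(2) by blast
      have ic: "i \<in> carrier R" using S.submodule_carrier[OF sR[OF Ic] i(1)] by simp
      have tc: "t \<in> carrier R" using t(1) by blast
      define w where "w = t \<odot>\<^bsub>?G\<^esub> r"
      have wc: "w \<in> carrier R" using G.smult_closed[OF tc, of r] rc by (simp add: w_def)
      define v where "v = w \<ominus> i"
      have v: "v \<in> carrier R" "w = v \<oplus> i" using wc ic by (simp_all add: v_def a_minus_def a_assoc l_neg)
      have c: "h v \<in> carrier M" "h i \<in> carrier M" using h v(1) ic by (auto simp: mlin_def)
      have bL: "b \<in> L" "a1 \<in> L" using ba(1) ad(1) JL by blast+
      have bc: "b \<in> carrier M" "a1 \<in> carrier M" using bL M.submodule_carrier[OF L] by blast+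
      have "h w = t \<odot>\<^bsub>?F\<^esub> h r" using h tc rc by (simp add: mlin_def w_def)
      moreover have "h w = h v \<oplus>\<^bsub>M\<^esub> h i" using h v ic by (simp add: mlin_def)
      ultimately have "h v \<oplus>\<^bsub>M\<^esub> h i = (b \<oplus>\<^bsub>M\<^esub> a1) \<oplus>\<^bsub>M\<^esub> h i"
        unfolding ba(3) ad(3) i(2) using bc c by (simp add: M.a_assoc)
      then have "h v = b \<oplus>\<^bsub>M\<^esub> a1" using bc c by simp
      then have "h v \<in> L" using M.submodule_add[OF L bL] by simp
      then have "v \<in> Q" using hQ[OF v(1)] by simp
      then have "w \<in> A0" unfolding A0_def set_add_iff v(2) using i(1) by auto
      then show "r \<in> psat R ?G P A0" unfolding w_def using G.psatI[OF _ t(1)] rc by simp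
    qed
  qed
  have "Phi e M P I J ?L = Phi e M P I J L + rPhi e Rm P I J Q (carrier R)" unfolding add 1 2 ..
  then show ?case using Cons.IH unfolding D_def by (simp add: add.commute)
qed

end

section \<open>Modules killed by an intersection of incomparable primes\<close>

lemma (in cring) prime_contains:
  assumes "finite \<Q>" "\<And>Q. Q \<in> \<Q> \<Longrightarrow> primeideal Q R" "primeideal E R"
    and "\<And>r. \<lbrakk>r \<in> carrier R; \<forall>Q\<in>\<Q>. r \<in> Q\<rbrakk> \<Longrightarrow> r \<in> E"
  shows "\<exists>Q\<in>\<Q>. Q \<subseteq> E"
proof (rule ccontr)
  assume no: "\<not> (\<exists>Q\<in>\<Q>. Q \<subseteq> E)"
  have "\<exists>c\<in>carrier R - E. \<forall>Q\<in>\<Q>. c \<in> Q"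
    by (rule prime_avoiding[OF assms(1,3)]) (use no assms(2) primeideal.axioms(1) in blast)+
  then show False using assms(4) by blast
qed

lemma sum_list_count_enat:
  assumes "set xs \<subseteq> X" "finite X"
  shows "(\<Sum>x\<leftarrow>xs. f x) = (\<Sum>x\<in>X. count_list xs x * (f x :: nat))"
  using assms sum_list_map_eq_sum_count2[of xs X f] by simp

context ffinite_ring
begin

text \<open>Products of generators of \<open>R\<close> over its \<open>p\<close>-th powers with
  generators of \<open>M\<close> generate the restriction of \<open>M\<close>.\<close>

lemma fg_tw:
  assumes M: "module R M" and fg: "fg_sub R M (carrier M)" shows "fg_sub R (tw R p M) (carrier M)"
proof -
  interpret M: module R M by fact
  interpret N: module R "tw R p M" by (rule module_tw[OF M])
  obtain B where B: "finite B" "B \<subseteq> carrier M" "\<forall>N. submodule N R M \<and> B \<subseteq> N \<longrightarrow> carrier M \<subseteq> N"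
    using fg unfolding fg_sub_def by (elim conjE exE)
  obtain G where G: "finite G" "G \<subseteq> carrier R" "\<forall>N. submodule N R (tw R p Rm) \<and> G \<subseteq> N \<longrightarrow> carrier R \<subseteq> N"
    using fg_tw_self unfolding fg_sub_def by (elim conjE exE)
  let ?X = "(\<lambda>(g, b). g \<odot>\<^bsub>M\<^esub> b) ` (G \<times> B)"
  have gen: "carrier M \<subseteq> N" if N: "submodule N R (tw R p M)" and XN: "?X \<subseteq> N" for N
  proof -
    have 1: "r \<odot>\<^bsub>M\<^esub> b \<in> N" if b: "b \<in> B" and r: "r \<in> carrier R" for r b
    proof -
      have bc: "b \<in> carrier M" using b B(2) by blast
      have h: "mlin R (tw R p Rm) (tw R p M) (\<lambda>r. r \<odot>\<^bsub>M\<^esub> b)"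
        using mlin_orbit[OF M bc, of 1] by (simp only: fpush_1)
      have "submodule {r \<in> carrier (tw R p Rm). r \<odot>\<^bsub>M\<^esub> b \<in> N} R (tw R p Rm)"
        by (rule mlin_vimage_submodule[OF module_tw[OF module_self] N.module_axioms h N])
      moreover have "G \<subseteq> {r \<in> carrier (tw R p Rm). r \<odot>\<^bsub>M\<^esub> b \<in> N}"
      proof
        fix g assume g: "g \<in> G"
        have "g \<odot>\<^bsub>M\<^esub> b \<in> ?X" by (rule image_eqI[of _ _ "(g, b)"]) (use g b in simp_all)
        then show "g \<in> {r \<in> carrier (tw R p Rm). r \<odot>\<^bsub>M\<^esub> b \<in> N}" using XN g G(2) by auto
      qed
      ultimately have "carrier R \<subseteq> {r \<in> carrier (tw R p Rm). r \<odot>\<^bsub>M\<^esub> b \<in> N}" using G(3) by simp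
      then show ?thesis using r by blast
    qed
    \<comment> \<open>\<open>N\<close> is stable under \<open>p\<close>-th powers only.
      \<open>Y\<close> is the largest \<open>R\<close>-submodule inside \<open>N\<close>, to which
      the generating property of \<open>B\<close> over \<open>R\<close> applies.\<close>
    define Y where "Y = {x \<in> carrier M. \<forall>r\<in>carrier R. r \<odot>\<^bsub>M\<^esub> x \<in> N}"
    have "submodule Y R M"
    proof (rule M.submoduleI')
      show "Y \<subseteq> carrier M" by (auto simp: Y_def)
      show "\<zero>\<^bsub>M\<^esub> \<in> Y" using N.submodule_zero[OF N] by (simp add: Y_def)
      show "x \<oplus>\<^bsub>M\<^esub> y \<in> Y" if "x \<in> Y" "y \<in> Y" for x y
        using that N.submodule_add[OF N] by (simp add: Y_def M.smult_r_distr)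
      show "r \<odot>\<^bsub>M\<^esub> x \<in> Y" if "r \<in> carrier R" "x \<in> Y" for r x
        using that by (simp add: Y_def M.smult_assoc1[symmetric])
    qed
    moreover have "B \<subseteq> Y" using 1 B(2) by (auto simp: Y_def)
    ultimately have Y: "carrier M \<subseteq> Y" using B(3) by blast
    show ?thesis
    proof
      fix x assume x: "x \<in> carrier M"
      then have "\<one> \<odot>\<^bsub>M\<^esub> x \<in> N" using Y unfolding Y_def by blast
      then show "x \<in> N" using x by simp
    qed
  qed
  show ?thesis
    unfolding fg_sub_def
  proof (intro conjI exI[of _ ?X] allI impI)
    show "finite ?X" using B(1) G(1) by simp
    show "?X \<subseteq> carrier M"
    proof
      fix z assume "z \<in> ?X"
      then obtain g b where "g \<in> G" "b \<in> B" "z = g \<odot>\<^bsub>M\<^esub> b" by auto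
      then show "z \<in> carrier M" using B(2) G(2) M.smult_closed[of g b] by blast
    qed
    show "submodule (carrier M) R (tw R p M)" using N.carrier_is_submodule by simp
    show "carrier M \<subseteq> N" if "submodule N R (tw R p M) \<and> ?X \<subseteq> N" for N
      using that by (intro gen) simp_all
  qed
qed

lemma fg_fpush:
  assumes M: "module R M" and fg: "fg_sub R M (carrier M)" shows "fg_sub R (fpush R p e M) (carrier M)"
proof (induction e)
  case (Suc e)
  then show ?case using fg_tw[OF module_fpush[OF M], of e] by (simp add: fpush_Suc)
qed (use fg in simp)

text \<open>At each \<open>Q \<in> \<Q>\<close> the localization of \<open>M\<close> is a vector
  space over the residue field, since the other members of \<open>\<Q>\<close> are not contained in
  \<open>Q\<close>. Copies of \<open>R / Q\<close> are collected inside \<open>M\<close> until they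
  span all these vector spaces; \<open>K\<close> is their direct sum and \<open>s\<close> a
  denominator valid for all of \<open>\<Q>\<close>. The multiplicities are the dimensions of the
  vector spaces.\<close>

lemma quasi_basis:
  assumes M: "module R M" and fg: "fg_sub R M (carrier M)" and fin: "finite \<Q>"
    and pr: "\<And>Q. Q \<in> \<Q> \<Longrightarrow> primeideal Q R"
    and inc: "\<And>Q Q'. \<lbrakk>Q \<in> \<Q>; Q' \<in> \<Q>; Q \<subseteq> Q'\<rbrakk> \<Longrightarrow> Q = Q'"
    and ann: "\<And>r x. \<lbrakk>r \<in> carrier R; \<forall>Q\<in>\<Q>. r \<in> Q; x \<in> carrier M\<rbrakk> \<Longrightarrow> r \<odot>\<^bsub>M\<^esub> x = \<zero>\<^bsub>M\<^esub>"
  shows "\<exists>Qs K s. sfilt R M Qs K \<and> set Qs \<subseteq> \<Q> \<and> s \<in> carrier R \<and> (\<forall>Q\<in>\<Q>. s \<notin> Q)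
    \<and> (\<forall>x\<in>carrier M. s \<odot>\<^bsub>M\<^esub> x \<in> K) \<and> (\<forall>Q\<in>\<Q>. enat (count_list Qs Q) = len R M Q {\<zero>\<^bsub>M\<^esub>} (carrier M))"
proof -
  interpret M: module R M by fact
  note Z = M.submodule_zero_set
  note W = M.carrier_is_submodule
  have full: "psat R M Q (carrier M) = carrier M" if "Q \<in> \<Q>" for Q by (rule M.psat_zero_full[OF pr[OF that]])
  \<comment> \<open>Any filtration prime of \<open>M\<close> contains some member of
    \<open>\<Q>\<close>. If it is contained in \<open>Q\<close>, incomparability forces it to equal
    \<open>Q\<close>, so every factor has length at most one at \<open>Q\<close>.\<close>
  have finlen: "\<exists>n. len R M Q {\<zero>\<^bsub>M\<^esub>} (carrier M) = enat n" if Q: "Q \<in> \<Q>" for Q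
  proof -
    obtain Es where Es: "pfilt R M {\<zero>\<^bsub>M\<^esub>} Es (carrier M)"
      using M.fg_sub_pfilt[OF noetherian_ring_axioms Z fg M.submoduleE(1)[OF Z]] by blast
    have "len R Rm Q E (carrier R) \<le> enat 1" if E: "E \<in> set Es" for E
    proof -
      have pE: "primeideal E R" by (rule M.pfilt_primes[OF Es E])
      have "\<exists>Q'\<in>\<Q>. Q' \<subseteq> E"
      proof (rule prime_contains[OF fin pr pE])
        fix r assume r: "r \<in> carrier R" "\<forall>Q\<in>\<Q>. r \<in> Q"
        show "r \<in> E" by (rule M.pfilt_ann[OF Es Z r(1) _ E]) (use ann[OF r] in simp)
      qed
      then have ne: "E \<subset> Q \<Longrightarrow> False" using inc[OF _ Q] by blast
      have "len R Rm Q E (carrier R) = (if E = Q then 1 else 0)" by (rule len_quot_prime[OF pr[OF Q] pE ne])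
      then show ?thesis by (simp add: one_enat_def)
    qed
    then have "(\<Sum>E\<leftarrow>Es. len R Rm Q E (carrier R)) \<le> (\<Sum>E\<leftarrow>Es. enat 1)" by (intro sum_list_mono)
    then show ?thesis
      using len_pfilt[OF M pr[OF Q] Z Es, of 0] enat_eq_of_le unfolding sum_list_enat by fastforce
  qed
  have finK: "\<exists>n. len R M Q K (carrier M) = enat n" if K: "submodule K R M" and Q: "Q \<in> \<Q>" for K Q
  proof -
    obtain n where "len R M Q {\<zero>\<^bsub>M\<^esub>} (carrier M) = enat n" using finlen[OF Q] by blast
    moreover have "len R M Q K (carrier M) \<le> len R M Q {\<zero>\<^bsub>M\<^esub>} (carrier M)"
    proof (rule M.len_mono[OF pr[OF Q] Z W K W])
      show "{\<zero>\<^bsub>M\<^esub>} \<subseteq> psat R M Q K" using M.submodule_zero[OF M.submodule_psat[OF pr[OF Q] K]] by simp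
    qed (use full[OF Q] in simp_all)
    ultimately have "len R M Q K (carrier M) \<le> enat n" by simp
    then show ?thesis using enat_eq_of_le by blast
  qed
  have avoid: "\<exists>c\<in>carrier R - Q. \<forall>Q'\<in>\<Q> - {Q}. c \<in> Q'" if Q: "Q \<in> \<Q>" for Q
  proof (rule prime_avoiding[OF _ pr[OF Q]])
    show "finite (\<Q> - {Q})" using fin by simp
    show "ideal Q' R" if "Q' \<in> \<Q> - {Q}" for Q' using pr primeideal.axioms(1) that by blast
    show "\<not> Q' \<subseteq> Q" if Q': "Q' \<in> \<Q> - {Q}" for Q'
    proof
      assume "Q' \<subseteq> Q"
      then have "Q' = Q" by (rule inc[rotated -1]) (use Q Q' in simp_all)
      then show False using Q' by simp
    qed
  qed
  \<comment> \<open>The induction runs on the sum over \<open>\<Q>\<close> of the lengths of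
    \<open>M / K\<close>. A new summand \<open>R / Q\<close> lowers the term at \<open>Q\<close> by
    one and raises none.\<close>
  have greedy: "\<exists>Qs' K'. sfilt R M Qs' K' \<and> set Qs' \<subseteq> \<Q> \<and> (\<forall>Q\<in>\<Q>. carrier M \<subseteq> psat R M Q K')"
    if "sfilt R M Qs K" "set Qs \<subseteq> \<Q>" for Qs K
    using that
  proof (induction "\<Sum>Q\<in>\<Q>. the_enat (len R M Q K (carrier M))" arbitrary: Qs K rule: less_induct)
    case less
    have K: "submodule K R M" using M.pfilt_submodule[OF sfilt_pfilt[OF less.prems(1)] Z] by blast
    show ?case
    proof (cases "\<forall>Q\<in>\<Q>. carrier M \<subseteq> psat R M Q K")
      case True
      then show ?thesis using less.prems by blast
    next
      case False
      then obtain Q y where Q: "Q \<in> \<Q>" and y: "y \<in> carrier M" "y \<notin> psat R M Q K" by blast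
      have pQ: "primeideal Q R" by (rule pr[OF Q])
      obtain c where c: "c \<in> carrier R - Q" "\<forall>Q'\<in>\<Q> - {Q}. c \<in> Q'" using avoid[OF Q] by blast
      have cc: "c \<in> carrier R" using c(1) by blast
      \<comment> \<open>\<open>c\<close> lies in every other member of \<open>\<Q>\<close>, so
        \<open>Q c\<close> lies in their common intersection and kills \<open>y\<close>. Multiplying
        by \<open>c\<close> thus makes \<open>Q\<close> kill the element, and since \<open>c\<close>
        avoids \<open>Q\<close> it stays outside \<open>K\<close> at \<open>Q\<close>.\<close>
      define x where "x = c \<odot>\<^bsub>M\<^esub> y"
      have x: "x \<in> carrier M" using cc y(1) by (simp add: x_def)
      have kill: "r \<odot>\<^bsub>M\<^esub> x = \<zero>\<^bsub>M\<^esub>" if r: "r \<in> Q" for r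
      proof -
        have rc: "r \<in> carrier R" using r primeideal_subset[OF pQ] by blast
        have "r \<otimes> c \<in> Q'" if Q': "Q' \<in> \<Q>" for Q'
        proof (cases "Q' = Q")
          case True
          then show ?thesis using ideal.I_r_closed[OF primeideal.axioms(1)[OF pQ] r cc] by simp
        next
          case False
          then have "c \<in> Q'" using c(2) Q' by blast
          then show ?thesis using ideal.I_l_closed[OF primeideal.axioms(1)[OF pr[OF Q']] _ rc] by blast
        qed
        then have "(r \<otimes> c) \<odot>\<^bsub>M\<^esub> y = \<zero>\<^bsub>M\<^esub>" using rc cc y(1) by (intro ann) simp_all
        then show ?thesis using rc cc y(1) by (simp add: x_def M.smult_assoc1)
      qed
      have A: "{r \<in> carrier R. r \<odot>\<^bsub>M\<^esub> x \<in> K} = Q"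
      proof (intro Set.set_eqI iffI)
        fix r assume r: "r \<in> {r \<in> carrier R. r \<odot>\<^bsub>M\<^esub> x \<in> K}"
        show "r \<in> Q"
        proof (rule ccontr)
          assume "r \<notin> Q"
          then have rc: "r \<otimes> c \<in> carrier R - Q" using primeideal_mult_notin[OF pQ _ c(1)] r by blast
          have "(r \<otimes> c) \<odot>\<^bsub>M\<^esub> y \<in> K" using r cc y(1) by (simp add: x_def M.smult_assoc1)
          then show False using M.psatI[OF y(1) rc] y(2) by blast
        qed
      next
        fix r assume "r \<in> Q"
        then show "r \<in> {r \<in> carrier R. r \<odot>\<^bsub>M\<^esub> x \<in> K}"
          using kill M.submodule_zero[OF K] primeideal_subset[OF pQ] by auto
      qed
      let ?K = "K <+>\<^bsub>M\<^esub> cyc R M x"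
      have sf: "sfilt R M (Q # Qs) ?K" by (rule sfilt.Cons[OF less.prems(1) x A pQ]) (use kill in blast)
      have sK: "submodule ?K R M" by (rule M.submodule_sum_cyc[OF K x])
      have KK: "K \<subseteq> ?K" by (rule M.sum_cyc_upper[OF K x])
      have up: "K \<subseteq> psat R M Q' ?K" if "Q' \<in> \<Q>" for Q'
        using KK M.psat_upper[OF pr[OF that] M.submoduleE(1)[OF sK]] by blast
      have le: "the_enat (len R M Q' ?K (carrier M)) \<le> the_enat (len R M Q' K (carrier M))" if Q': "Q' \<in> \<Q>" for Q'
      proof -
        have "len R M Q' ?K (carrier M) \<le> len R M Q' K (carrier M)"
          by (rule M.len_mono[OF pr[OF Q'] K W sK W])
            (use full[OF Q'] up[OF Q'] M.submoduleE(1)[OF K] in simp_all)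
        moreover obtain a b where "len R M Q' ?K (carrier M) = enat a" "len R M Q' K (carrier M) = enat b"
          using finK[OF sK Q'] finK[OF K Q'] by blast
        ultimately show ?thesis by simp
      qed
      have lt: "the_enat (len R M Q ?K (carrier M)) < the_enat (len R M Q K (carrier M))"
      proof -
        have "len R M Q K (carrier M) = len R M Q K ?K + len R M Q ?K (carrier M)"
          using up[OF Q] full[OF Q] M.submoduleE(1)[OF sK] by (intro M.len_add[OF pQ K sK W]) simp_all
        also have "len R M Q K ?K = enat 1"
          using len_cyc0[OF M K x pQ] len_residue_field[OF pQ] unfolding A one_enat_def by simp
        finally have eq: "len R M Q K (carrier M) = enat 1 + len R M Q ?K (carrier M)" .
        obtain a where "len R M Q ?K (carrier M) = enat a" using finK[OF sK Q] by blast
        then show ?thesis using eq by simp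
      qed
      have "(\<Sum>Q'\<in>\<Q>. the_enat (len R M Q' ?K (carrier M))) < (\<Sum>Q'\<in>\<Q>. the_enat (len R M Q' K (carrier M)))"
        using le lt Q by (intro sum_strict_mono_ex1[OF fin]) blast+
      moreover have "set (Q # Qs) \<subseteq> \<Q>" using less.prems(2) Q by simp
      ultimately show ?thesis using less.hyps[OF _ sf] by blast
    qed
  qed
  have "\<exists>Qs K. sfilt R M Qs K \<and> set Qs \<subseteq> \<Q> \<and> (\<forall>Q\<in>\<Q>. carrier M \<subseteq> psat R M Q K)"
    by (rule greedy[OF sfilt.Nil]) simp
  then obtain Qs K where sf: "sfilt R M Qs K" "set Qs \<subseteq> \<Q>" "\<forall>Q\<in>\<Q>. carrier M \<subseteq> psat R M Q K"
    by (elim exE conjE)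
  have K: "submodule K R M" using M.pfilt_submodule[OF sfilt_pfilt[OF sf(1)] Z] by blast
  \<comment> \<open>The denominator is assembled one prime at a time. It is kept inside the primes
    not yet treated, and the summand \<open>c t\<close> added next lies in every member of
    \<open>\<Q>\<close> except the new one, so only membership there changes.\<close>
  have ex: "\<exists>s\<in>carrier R. (\<forall>x\<in>carrier M. s \<odot>\<^bsub>M\<^esub> x \<in> K) \<and> (\<forall>Q\<in>\<S>. s \<notin> Q) \<and> (\<forall>Q\<in>\<Q> - \<S>. s \<in> Q)"
    if "finite \<S>" "\<S> \<subseteq> \<Q>" for \<S>
    using that
  proof (induction rule: finite_induct)
    case empty
    have "\<zero> \<in> Q" if "Q \<in> \<Q>" for Q
      using pr[OF that] primeideal.axioms(1) ideal.axioms(1) additive_subgroup.zero_closed by blast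
    then show ?case using M.submodule_zero[OF K] by (intro bexI[of _ \<zero>]) simp_all
  next
    case (insert Q \<S>)
    have "\<exists>s\<in>carrier R. (\<forall>x\<in>carrier M. s \<odot>\<^bsub>M\<^esub> x \<in> K) \<and> (\<forall>Q\<in>\<S>. s \<notin> Q) \<and> (\<forall>Q\<in>\<Q> - \<S>. s \<in> Q)"
      by (rule insert.IH) (use insert.prems in simp)
    then obtain s where s: "s \<in> carrier R" "\<forall>x\<in>carrier M. s \<odot>\<^bsub>M\<^esub> x \<in> K" "\<forall>Q\<in>\<S>. s \<notin> Q" "\<forall>Q\<in>\<Q> - \<S>. s \<in> Q"
      by blast
    have Q: "Q \<in> \<Q>" using insert.prems by simp
    obtain t where t: "t \<in> carrier R - Q" "\<forall>x\<in>carrier M. t \<odot>\<^bsub>M\<^esub> x \<in> K"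
      using M.fg_sub_psat_uniform[OF pr[OF Q] K fg] sf(3) Q by blast
    obtain c where c: "c \<in> carrier R - Q" "\<forall>Q'\<in>\<Q> - {Q}. c \<in> Q'" using avoid[OF Q] by blast
    have ct: "c \<otimes> t \<in> carrier R - Q" by (rule primeideal_mult_notin[OF pr[OF Q] c(1) t(1)])
    have ct': "c \<otimes> t \<in> Q'" if "Q' \<in> \<Q> - {Q}" for Q'
      using ideal.I_r_closed[OF primeideal.axioms(1)[OF pr], of Q' c t] that c(2) t(1) by blast
    have add: "c \<otimes> t \<in> Q' \<Longrightarrow> s \<oplus> c \<otimes> t \<in> Q' \<longleftrightarrow> s \<in> Q'" and add': "s \<in> Q' \<Longrightarrow> s \<oplus> c \<otimes> t \<in> Q' \<longleftrightarrow> c \<otimes> t \<in> Q'"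
      if Q': "Q' \<in> \<Q>" for Q'
    proof -
      interpret S: module R Rm by (rule module_self)
      have sQ: "submodule Q' R Rm" by (rule submodule_self_prime[OF pr[OF Q']])
      have ctc: "c \<otimes> t \<in> carrier R" using ct by blast
      show "s \<oplus> c \<otimes> t \<in> Q' \<longleftrightarrow> s \<in> Q'" if "c \<otimes> t \<in> Q'"
        using S.submodule_add[OF sQ _ that, of s] S.submodule_add_cancel'[OF sQ, of s "c \<otimes> t"] that s(1) by auto
      show "s \<oplus> c \<otimes> t \<in> Q' \<longleftrightarrow> c \<otimes> t \<in> Q'" if "s \<in> Q'"
        using S.submodule_add[OF sQ that, of "c \<otimes> t"] S.submodule_add_cancel[OF sQ, of s "c \<otimes> t"] that ctc by auto
    qed
    show ?case
    proof (intro bexI[of _ "s \<oplus> c \<otimes> t"] conjI ballI)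
      show "s \<oplus> c \<otimes> t \<in> carrier R" using s(1) ct by simp
      show "(s \<oplus> c \<otimes> t) \<odot>\<^bsub>M\<^esub> x \<in> K" if x: "x \<in> carrier M" for x
      proof -
        have "(s \<oplus> c \<otimes> t) \<odot>\<^bsub>M\<^esub> x = s \<odot>\<^bsub>M\<^esub> x \<oplus>\<^bsub>M\<^esub> c \<odot>\<^bsub>M\<^esub> (t \<odot>\<^bsub>M\<^esub> x)"
          using s(1) c(1) t(1) x by (simp add: M.smult_l_distr M.smult_assoc1)
        moreover have "c \<odot>\<^bsub>M\<^esub> (t \<odot>\<^bsub>M\<^esub> x) \<in> K" using M.submodule_smult[OF K, of c] t(2) x c(1) by blast
        ultimately show ?thesis using M.submodule_add[OF K] s(2) x by simp
      qed
      show "s \<oplus> c \<otimes> t \<notin> Q'" if Q': "Q' \<in> insert Q \<S>" for Q'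
      proof (cases "Q' = Q")
        case True
        then have "s \<in> Q'" using s(4) Q insert.hyps(2) by blast
        then show ?thesis using add'[of Q'] Q ct True by blast
      next
        case False
        then have "Q' \<in> \<S>" "Q' \<in> \<Q>" using Q' insert.prems by blast+
        then show ?thesis using add[of Q'] ct'[of Q'] False s(3) by blast
      qed
      show "s \<oplus> c \<otimes> t \<in> Q'" if Q': "Q' \<in> \<Q> - insert Q \<S>" for Q'
        using add[of Q'] ct'[of Q'] s(4) Q' by blast
    qed
  qed
  obtain s where s: "s \<in> carrier R" "\<forall>x\<in>carrier M. s \<odot>\<^bsub>M\<^esub> x \<in> K" "\<forall>Q\<in>\<Q>. s \<notin> Q"
    using ex[OF fin subset_refl] by (elim bexE conjE)
  have cnt: "enat (count_list Qs Q) = len R M Q {\<zero>\<^bsub>M\<^esub>} (carrier M)" if Q: "Q \<in> \<Q>" for Q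
  proof -
    have pQ: "primeideal Q R" by (rule pr[OF Q])
    have "len R M Q {\<zero>\<^bsub>M\<^esub>} K = (\<Sum>E\<leftarrow>Qs. len R Rm Q E (carrier R))"
      using len_pfilt[OF M pQ Z sfilt_pfilt[OF sf(1)], of 0] by simp
    also have "\<dots> = (\<Sum>E\<leftarrow>Qs. if E = Q then 1 else 0)"
    proof (rule arg_cong[of _ _ sum_list], rule map_cong[OF refl])
      fix E assume "E \<in> set Qs"
      then have E: "E \<in> \<Q>" using sf(2) by blast
      show "len R Rm Q E (carrier R) = (if E = Q then 1 else 0)"
      proof (rule len_quot_prime[OF pQ pr[OF E]])
        assume EQ: "E \<subset> Q"
        then have "E = Q" by (intro inc[OF E Q]) simp
        then show False using EQ by simp
      qed
    qed
    finally have 1: "len R M Q {\<zero>\<^bsub>M\<^esub>} K = enat (count_list Qs Q)" by (simp add: sum_list_if_count)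
    have KW: "K \<subseteq> psat R M Q (carrier M)" using full[OF Q] M.submoduleE(1)[OF K] by simp
    have 2: "len R M Q K (carrier M) = 0" by (rule M.len_zero[OF pQ K W KW]) (use sf(3) Q in blast)
    have "{\<zero>\<^bsub>M\<^esub>} \<subseteq> psat R M Q K" using M.submodule_zero[OF M.submodule_psat[OF pQ K]] by simp
    then have "len R M Q {\<zero>\<^bsub>M\<^esub>} (carrier M) = len R M Q {\<zero>\<^bsub>M\<^esub>} K + len R M Q K (carrier M)"
      using KW by (intro M.len_add[OF pQ Z K W])
    then show ?thesis unfolding 1 2 by simp
  qed
  show ?thesis using sf(1,2) s cnt by blast
qed

end

subsection \<open>The main comparison\<close>

lemma enat_cancel_finite:
  assumes "enat c * x \<le> enat n" "0 < c" shows "\<exists>m. x = enat m"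
  using assms by (cases x) simp_all

context ffinite_ring
begin

text \<open>The inclusion of the direct sum \<open>K\<close> into \<open>M\<close> and
  multiplication by \<open>s\<close> from \<open>M\<close> to \<open>K\<close> compare the two in
  both directions. Both cokernels are killed by \<open>s\<close>, which avoids every member of
  \<open>\<Q>\<close>, so their filtration primes lie strictly above members of \<open>\<Q>\<close>;
  the condition on \<open>c\<close> and \<open>T\<close> concerns just these. The constant depends
  on the two cokernel filtrations and not on \<open>P\<close>.\<close>

lemma reduced_compare:
  assumes M: "module R M" and fg: "fg_sub R M (carrier M)" and fin: "finite \<Q>"
    and pr': "\<forall>Q\<in>\<Q>. primeideal Q R"
    and inc': "\<forall>Q\<in>\<Q>. \<forall>Q'\<in>\<Q>. Q \<subseteq> Q' \<longrightarrow> Q = Q'"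
    and ann': "\<forall>r\<in>carrier R. (\<forall>Q\<in>\<Q>. r \<in> Q) \<longrightarrow> (\<forall>x\<in>carrier M. r \<odot>\<^bsub>M\<^esub> x = \<zero>\<^bsub>M\<^esub>)"
  shows "\<exists>Qs D. set Qs \<subseteq> \<Q> \<and> (\<forall>Q\<in>\<Q>. enat (count_list Qs Q) = len R M Q {\<zero>\<^bsub>M\<^esub>} (carrier M)) \<and>
    (\<forall>P e T c I J u. primeideal P R \<longrightarrow> simple_step R P I J u \<longrightarrow>
      (\<forall>Q'. primeideal Q' R \<longrightarrow> Q' \<subseteq> P \<longrightarrow> (\<exists>Q\<in>\<Q>. Q \<subset> Q') \<longrightarrow> c * fdeg Q' \<le> T) \<longrightarrow>
      enat (c ^ e) * Phi e M P I J (carrier M)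
        \<le> enat (c ^ e) * (\<Sum>Q\<leftarrow>Qs. rPhi e Rm P I J Q (carrier R)) + enat (D * T ^ e) \<and>
      enat (c ^ e) * (\<Sum>Q\<leftarrow>Qs. rPhi e Rm P I J Q (carrier R))
        \<le> enat (c ^ e) * Phi e M P I J (carrier M) + enat (D * T ^ e))"
proof -
  have pr: "primeideal Q R" if "Q \<in> \<Q>" for Q using pr' that by (rule bspec)
  have ann: "r \<odot>\<^bsub>M\<^esub> x = \<zero>\<^bsub>M\<^esub>" if "r \<in> carrier R" "\<forall>Q\<in>\<Q>. r \<in> Q" "x \<in> carrier M" for r x
    using ann' that by simp
  interpret M: module R M by fact
  have inc: "Q = Q'" if "Q \<in> \<Q>" "Q' \<in> \<Q>" "Q \<subseteq> Q'" for Q Q' using inc' that by simp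
  note Z = M.submodule_zero_set
  note W = M.carrier_is_submodule
  obtain Qs K s where Q: "sfilt R M Qs K" "set Qs \<subseteq> \<Q>" "s \<in> carrier R" "\<forall>Q\<in>\<Q>. s \<notin> Q"
    "\<forall>x\<in>carrier M. s \<odot>\<^bsub>M\<^esub> x \<in> K" "\<forall>Q\<in>\<Q>. enat (count_list Qs Q) = len R M Q {\<zero>\<^bsub>M\<^esub>} (carrier M)"
  proof -
    have "\<exists>Qs K s. sfilt R M Qs K \<and> set Qs \<subseteq> \<Q> \<and> s \<in> carrier R \<and> (\<forall>Q\<in>\<Q>. s \<notin> Q)
      \<and> (\<forall>x\<in>carrier M. s \<odot>\<^bsub>M\<^esub> x \<in> K) \<and> (\<forall>Q\<in>\<Q>. enat (count_list Qs Q) = len R M Q {\<zero>\<^bsub>M\<^esub>} (carrier M))"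
      by (rule quasi_basis[OF M fg fin]) (fact pr, fact inc, fact ann)
    then show thesis by (elim exE conjE) (rule that)
  qed
  have K: "submodule K R M" using M.pfilt_submodule[OF sfilt_pfilt[OF Q(1)] Z] by blast
  have Kc: "K \<subseteq> carrier M" by (rule M.submoduleE(1)[OF K])
  define h where "h x = s \<odot>\<^bsub>M\<^esub> x" for x
  have h: "mlin R M M h" unfolding h_def by (rule M.mlin_smult[OF Q(3)])
  have hW: "submodule (h ` carrier M) R M" by (rule mlin_image_submodule[OF M M h W])
  have hWK: "h ` carrier M \<subseteq> K" using Q(5) by (auto simp: h_def)
  obtain E1 where E1: "pfilt R M K E1 (carrier M)"
    using M.fg_sub_pfilt[OF noetherian_ring_axioms K fg Kc] by blast
  obtain E2 where E2: "pfilt R M (h ` carrier M) E2 K"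
    using M.fg_sub_pfilt[OF noetherian_ring_axioms hW M.sfilt_fg_sub[OF Q(1)] hWK] by blast
  have small: "\<exists>Q\<in>\<Q>. Q \<subset> E" if pE: "primeideal E R" and sE: "s \<in> E"
    and aE: "\<And>r. \<lbrakk>r \<in> carrier R; \<forall>Q\<in>\<Q>. r \<in> Q\<rbrakk> \<Longrightarrow> r \<in> E" for E
  proof -
    obtain Q' where "Q' \<in> \<Q>" "Q' \<subseteq> E" using prime_contains[OF fin pr pE aE] by blast
    then show ?thesis using sE Q(4) by blast
  qed
  have E1s: "primeideal E R \<and> (\<exists>Q\<in>\<Q>. Q \<subset> E)" if E: "E \<in> set E1" for E
  proof -
    have pE: "primeideal E R" by (rule M.pfilt_primes[OF E1 E])
    have "s \<in> E" by (rule M.pfilt_ann[OF E1 K Q(3) _ E]) (use Q(5) in blast)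
    moreover have "r \<in> E" if r: "r \<in> carrier R" "\<forall>Q\<in>\<Q>. r \<in> Q" for r
      by (rule M.pfilt_ann[OF E1 K r(1) _ E]) (use ann[OF r] M.submodule_zero[OF K] in simp)
    ultimately show ?thesis using pE small[OF pE] by blast
  qed
  have E2s: "primeideal E R \<and> (\<exists>Q\<in>\<Q>. Q \<subset> E)" if E: "E \<in> set E2" for E
  proof -
    have pE: "primeideal E R" by (rule M.pfilt_primes[OF E2 E])
    have "s \<in> E" by (rule M.pfilt_ann[OF E2 hW Q(3) _ E]) (use Kc in \<open>auto simp: h_def\<close>)
    moreover have "r \<in> E" if r: "r \<in> carrier R" "\<forall>Q\<in>\<Q>. r \<in> Q" for r
      by (rule M.pfilt_ann[OF E2 hW r(1) _ E]) (use ann[OF r] M.submodule_zero[OF hW] Kc in auto)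
    ultimately show ?thesis using pE small[OF pE] by blast
  qed
  have "\<exists>C::nat. \<forall>P e T c. primeideal P R \<longrightarrow> (\<forall>Q\<in>set E1. Q \<subseteq> P \<longrightarrow> c * fdeg Q \<le> T) \<longrightarrow>
    enat (c ^ e) * (\<Sum>Q\<leftarrow>E1. gam e Rm P Q P (carrier R)) \<le> enat (C * T ^ e)"
    by (rule gam_list_bound) (use E1s in blast)
  then obtain D1 where D1: "\<forall>P e T c. primeideal P R \<longrightarrow> (\<forall>Q\<in>set E1. Q \<subseteq> P \<longrightarrow> c * fdeg Q \<le> T) \<longrightarrow>
    enat (c ^ e) * (\<Sum>Q\<leftarrow>E1. gam e Rm P Q P (carrier R)) \<le> enat (D1 * T ^ e)" by (elim exE)
  have "\<exists>C::nat. \<forall>P e T c. primeideal P R \<longrightarrow> (\<forall>Q\<in>set E2. Q \<subseteq> P \<longrightarrow> c * fdeg Q \<le> T) \<longrightarrow>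
    enat (c ^ e) * (\<Sum>Q\<leftarrow>E2. gam e Rm P Q P (carrier R)) \<le> enat (C * T ^ e)"
    by (rule gam_list_bound) (use E2s in blast)
  then obtain D2 where D2: "\<forall>P e T c. primeideal P R \<longrightarrow> (\<forall>Q\<in>set E2. Q \<subseteq> P \<longrightarrow> c * fdeg Q \<le> T) \<longrightarrow>
    enat (c ^ e) * (\<Sum>Q\<leftarrow>E2. gam e Rm P Q P (carrier R)) \<le> enat (D2 * T ^ e)" by (elim exE)
  show ?thesis
  proof (rule exI[of _ Qs], rule exI[of _ "D1 + D2"], intro conjI allI impI)
    show "set Qs \<subseteq> \<Q>" by (rule Q(2))
    show "\<forall>Q\<in>\<Q>. enat (count_list Qs Q) = len R M Q {\<zero>\<^bsub>M\<^esub>} (carrier M)" by (rule Q(6))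
    fix P e T c I J u
    assume P: "primeideal P R" and st: "simple_step R P I J u"
      and T: "\<forall>Q'. primeideal Q' R \<longrightarrow> Q' \<subseteq> P \<longrightarrow> (\<exists>Q\<in>\<Q>. Q \<subset> Q') \<longrightarrow> c * fdeg Q' \<le> T"
    have IJ: "ideal I R" "ideal J R" "I \<subseteq> J" using st by (simp_all add: simple_step_def)
    have Pc: "P \<subseteq> carrier R" by (rule primeideal_subset[OF P])
    have S: "(\<Sum>Q\<leftarrow>Qs. rPhi e Rm P I J Q (carrier R)) = Phi e M P I J K"
      by (rule Phi_sfilt[OF M P IJ Q(1), symmetric])
    have zs: "{\<zero>\<^bsub>M\<^esub>} \<subseteq> X" if "submodule X R M" for X using M.submodule_zero[OF that] by simp
    have h0: "h ` {\<zero>\<^bsub>M\<^esub>} \<subseteq> {\<zero>\<^bsub>M\<^esub>}" using Q(3) by (simp add: h_def)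
    have "Phi e M P I J (carrier M) \<le> Phi e M P I J K + gam e M P K P (carrier M)"
      using rPhi_map_le[OF M M P mlin_id st Z K zs[OF K] Z W zs[OF W], of e] Kc
      by (simp add: zero_add_submodule[OF M K])
    then have 1: "Phi e M P I J (carrier M) \<le> Phi e M P I J K + (\<Sum>Q\<leftarrow>E1. gam e Rm P Q P (carrier R))"
      by (rule order_trans[OF _ add_left_mono[OF gam_pfilt_le[OF M P K Pc E1]]])
    have "Phi e M P I J K \<le> Phi e M P I J (carrier M) + gam e M P (h ` carrier M) P K"
      using rPhi_map_le[OF M M P h st Z W zs[OF W] Z K zs[OF K] h0 hWK, of e]
      by (simp add: zero_add_submodule[OF M hW])
    then have 2: "Phi e M P I J K \<le> Phi e M P I J (carrier M) + (\<Sum>Q\<leftarrow>E2. gam e Rm P Q P (carrier R))"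
      by (rule order_trans[OF _ add_left_mono[OF gam_pfilt_le[OF M P hW Pc E2]]])
    have 3: "enat (c ^ e) * (\<Sum>Q\<leftarrow>E1. gam e Rm P Q P (carrier R)) \<le> enat ((D1 + D2) * T ^ e)"
    proof -
      have "c * fdeg Q \<le> T" if "Q \<in> set E1" "Q \<subseteq> P" for Q
        using T[rule_format, OF _ that(2)] E1s[OF that(1)] by blast
      then have "enat (c ^ e) * (\<Sum>Q\<leftarrow>E1. gam e Rm P Q P (carrier R)) \<le> enat (D1 * T ^ e)"
        by (rule D1[rule_format, OF P])
      also have "\<dots> \<le> enat ((D1 + D2) * T ^ e)"
        unfolding enat_ord_simps by (rule mult_right_mono) simp_all
      finally show ?thesis .
    qed
    have 4: "enat (c ^ e) * (\<Sum>Q\<leftarrow>E2. gam e Rm P Q P (carrier R)) \<le> enat ((D1 + D2) * T ^ e)"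
    proof -
      have "c * fdeg Q \<le> T" if "Q \<in> set E2" "Q \<subseteq> P" for Q
        using T[rule_format, OF _ that(2)] E2s[OF that(1)] by blast
      then have "enat (c ^ e) * (\<Sum>Q\<leftarrow>E2. gam e Rm P Q P (carrier R)) \<le> enat (D2 * T ^ e)"
        by (rule D2[rule_format, OF P])
      also have "\<dots> \<le> enat ((D1 + D2) * T ^ e)"
        unfolding enat_ord_simps by (rule mult_right_mono) simp_all
      finally show ?thesis .
    qed
    have "enat (c ^ e) * Phi e M P I J (carrier M)
      \<le> enat (c ^ e) * (Phi e M P I J K + (\<Sum>Q\<leftarrow>E1. gam e Rm P Q P (carrier R)))"
      by (rule mult_left_mono[OF 1]) simp
    also have "\<dots> \<le> enat (c ^ e) * Phi e M P I J K + enat ((D1 + D2) * T ^ e)"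
      unfolding distrib_left by (rule add_left_mono[OF 3])
    finally show "enat (c ^ e) * Phi e M P I J (carrier M)
        \<le> enat (c ^ e) * (\<Sum>Q\<leftarrow>Qs. rPhi e Rm P I J Q (carrier R)) + enat ((D1 + D2) * T ^ e)" unfolding S .
    have "enat (c ^ e) * Phi e M P I J K
      \<le> enat (c ^ e) * (Phi e M P I J (carrier M) + (\<Sum>Q\<leftarrow>E2. gam e Rm P Q P (carrier R)))"
      by (rule mult_left_mono[OF 2]) simp
    also have "\<dots> \<le> enat (c ^ e) * Phi e M P I J (carrier M) + enat ((D1 + D2) * T ^ e)"
      unfolding distrib_left by (rule add_left_mono[OF 4])
    finally show "enat (c ^ e) * (\<Sum>Q\<leftarrow>Qs. rPhi e Rm P I J Q (carrier R))
        \<le> enat (c ^ e) * Phi e M P I J (carrier M) + enat ((D1 + D2) * T ^ e)" unfolding S .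
  qed
qed

lemma rPhi_prime_bound:
  assumes "primeideal Q R"
  shows "\<exists>C::nat. \<forall>P e I J u. primeideal P R \<longrightarrow> simple_step R P I J u \<longrightarrow>
    rPhi e Rm P I J Q (carrier R) \<le> enat (C * fdeg Q ^ e) \<and> (\<not> Q \<subseteq> P \<longrightarrow> rPhi e Rm P I J Q (carrier R) = 0)"
proof -
  obtain C where C: "\<forall>P e. primeideal P R \<longrightarrow> gam e Rm P Q P (carrier R) \<le> enat (C * fdeg Q ^ e)"
    using gam_prime_bound[OF assms] by blast
  show ?thesis
  proof (intro exI[of _ C] allI impI)
    fix P e I J u assume P: "primeideal P R" and st: "simple_step R P I J u"
    have 1: "rPhi e Rm P I J Q (carrier R) \<le> gam e Rm P Q P (carrier R)"
      by (rule rPhi_le_gam[OF module_self P st submodule_self_prime[OF assms] submodule_self_carrier primeideal_subset[OF assms]])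
    have 2: "gam e Rm P Q P (carrier R) \<le> enat (C * fdeg Q ^ e)" by (rule C[rule_format, OF P])
    have 3: "rPhi e Rm P I J Q (carrier R) = 0" if "\<not> Q \<subseteq> P"
      using 1 gam_ring_zero[OF P primeideal.axioms(1)[OF assms] that primeideal_subset[OF P], of e] by simp
    show "rPhi e Rm P I J Q (carrier R) \<le> enat (C * fdeg Q ^ e) \<and> (\<not> Q \<subseteq> P \<longrightarrow> rPhi e Rm P I J Q (carrier R) = 0)"
      using order_trans[OF 1 2] 3 by blast
  qed
qed

text \<open>\<open>M\<close> and its restriction along Frobenius are both compared with direct sums;
  the multiplicity of \<open>R / Q\<close> in the second is \<open>fdeg Q\<close> times that in the
  first. The degree \<open>T = p ^ d * fdeg P\<close> bounds all degrees in play. Summands with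
  \<open>fdeg Q = T\<close> match exactly after scaling by \<open>T\<close>, and for all others the
  saving \<open>p * fdeg Q \<le> T\<close> makes them part of the error. The factor
  \<open>p ^ e\<close> on both sides replaces a division of the error by \<open>q\<close>.\<close>

lemma reduced_main:
  assumes M: "module R M" and fg: "fg_sub R M (carrier M)" and fin: "finite \<Q>"
    and pr': "\<forall>Q\<in>\<Q>. primeideal Q R"
    and inc': "\<forall>Q\<in>\<Q>. \<forall>Q'\<in>\<Q>. Q \<subseteq> Q' \<longrightarrow> Q = Q'"
    and ann': "\<forall>r\<in>carrier R. (\<forall>Q\<in>\<Q>. r \<in> Q) \<longrightarrow> (\<forall>x\<in>carrier M. r \<odot>\<^bsub>M\<^esub> x = \<zero>\<^bsub>M\<^esub>)"
  shows "\<exists>D::nat. \<forall>P d e I J u. primeideal P R \<longrightarrow> simple_step R P I J u \<longrightarrow>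
      (\<forall>Q'. primeideal Q' R \<longrightarrow> Q' \<subseteq> P \<longrightarrow> (\<exists>Q\<in>\<Q>. Q \<subseteq> Q') \<longrightarrow> (\<exists>k\<le>d. fdeg Q' = p ^ k * fdeg P)) \<longrightarrow>
      enat (p ^ e) * Phi (Suc e) M P I J (carrier M)
        \<le> enat (p ^ e * (p ^ d * fdeg P)) * Phi e M P I J (carrier M) + enat (D * (p ^ d * fdeg P) ^ Suc e) \<and>
      enat (p ^ e * (p ^ d * fdeg P)) * Phi e M P I J (carrier M)
        \<le> enat (p ^ e) * Phi (Suc e) M P I J (carrier M) + enat (D * (p ^ d * fdeg P) ^ Suc e)"
proof -
  have pr: "primeideal Q R" if "Q \<in> \<Q>" for Q using pr' that by (rule bspec)
  have ann: "r \<odot>\<^bsub>M\<^esub> x = \<zero>\<^bsub>M\<^esub>" if "r \<in> carrier R" "\<forall>Q\<in>\<Q>. r \<in> Q" "x \<in> carrier M" for r x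
    using ann' that by simp
  interpret M: module R M by fact
  let ?N = "tw R p M"
  note N = module_tw[OF M]
  interpret N: module R ?N by (rule N)
  note Z = M.submodule_zero_set
  note W = M.carrier_is_submodule
  have annN: "r \<odot>\<^bsub>?N\<^esub> x = \<zero>\<^bsub>?N\<^esub>" if r: "r \<in> carrier R" "\<forall>Q\<in>\<Q>. r \<in> Q" and x: "x \<in> carrier ?N" for r x
  proof -
    obtain k where k: "p = Suc k" using p_prime by (metis not0_implies_Suc not_prime_0)
    have "r \<odot>\<^bsub>M\<^esub> x = \<zero>\<^bsub>M\<^esub>" by (rule ann[OF r]) (use x in simp)
    moreover have "(r [^] p) \<odot>\<^bsub>M\<^esub> x = (r [^] k) \<odot>\<^bsub>M\<^esub> (r \<odot>\<^bsub>M\<^esub> x)"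
      using r(1) x by (simp add: k M.smult_assoc1)
    ultimately show ?thesis using r(1) by simp
  qed
  have annN': "\<forall>r\<in>carrier R. (\<forall>Q\<in>\<Q>. r \<in> Q) \<longrightarrow> (\<forall>x\<in>carrier ?N. r \<odot>\<^bsub>?N\<^esub> x = \<zero>\<^bsub>?N\<^esub>)"
    by (intro ballI impI) (rule annN)
  have fgN: "fg_sub R ?N (carrier ?N)" using fg_tw[OF M fg] by simp
  obtain Q1 D1 where Q1: "set Q1 \<subseteq> \<Q>" "\<forall>Q\<in>\<Q>. enat (count_list Q1 Q) = len R M Q {\<zero>\<^bsub>M\<^esub>} (carrier M)"
    and D1: "\<forall>P e T c I J u. primeideal P R \<longrightarrow> simple_step R P I J u \<longrightarrow>
      (\<forall>Q'. primeideal Q' R \<longrightarrow> Q' \<subseteq> P \<longrightarrow> (\<exists>Q\<in>\<Q>. Q \<subset> Q') \<longrightarrow> c * fdeg Q' \<le> T) \<longrightarrow>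
      enat (c ^ e) * Phi e M P I J (carrier M)
        \<le> enat (c ^ e) * (\<Sum>Q\<leftarrow>Q1. rPhi e Rm P I J Q (carrier R)) + enat (D1 * T ^ e) \<and>
      enat (c ^ e) * (\<Sum>Q\<leftarrow>Q1. rPhi e Rm P I J Q (carrier R))
        \<le> enat (c ^ e) * Phi e M P I J (carrier M) + enat (D1 * T ^ e)"
    using reduced_compare[OF M fg fin pr' inc' ann'] by (elim exE conjE)
  obtain Q2 D2 where Q2: "set Q2 \<subseteq> \<Q>" "\<forall>Q\<in>\<Q>. enat (count_list Q2 Q) = len R ?N Q {\<zero>\<^bsub>?N\<^esub>} (carrier ?N)"
    and D2: "\<forall>P e T c I J u. primeideal P R \<longrightarrow> simple_step R P I J u \<longrightarrow>
      (\<forall>Q'. primeideal Q' R \<longrightarrow> Q' \<subseteq> P \<longrightarrow> (\<exists>Q\<in>\<Q>. Q \<subset> Q') \<longrightarrow> c * fdeg Q' \<le> T) \<longrightarrow>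
      enat (c ^ e) * Phi e ?N P I J (carrier ?N)
        \<le> enat (c ^ e) * (\<Sum>Q\<leftarrow>Q2. rPhi e Rm P I J Q (carrier R)) + enat (D2 * T ^ e) \<and>
      enat (c ^ e) * (\<Sum>Q\<leftarrow>Q2. rPhi e Rm P I J Q (carrier R))
        \<le> enat (c ^ e) * Phi e ?N P I J (carrier ?N) + enat (D2 * T ^ e)"
    using reduced_compare[OF N fgN fin pr' inc' annN'] by (elim exE conjE)
  have rank: "count_list Q2 Q = fdeg Q * count_list Q1 Q" if Q: "Q \<in> \<Q>" for Q
  proof -
    have "enat (count_list Q2 Q) = len R ?N Q {\<zero>\<^bsub>M\<^esub>} (carrier M)" using Q2(2) Q by simp
    also have "\<dots> = enat (fdeg Q) * len R M Q {\<zero>\<^bsub>M\<^esub>} (carrier M)"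
      by (rule len_tw[OF M Z W pr[OF Q]]) (simp add: M.psat_zero_full[OF pr[OF Q]])
    also have "len R M Q {\<zero>\<^bsub>M\<^esub>} (carrier M) = enat (count_list Q1 Q)" using Q1(2) Q by simp
    finally show ?thesis by simp
  qed
  have "\<forall>Q\<in>\<Q>. \<exists>C::nat. \<forall>P e I J u. primeideal P R \<longrightarrow> simple_step R P I J u \<longrightarrow>
    rPhi e Rm P I J Q (carrier R) \<le> enat (C * fdeg Q ^ e) \<and> (\<not> Q \<subseteq> P \<longrightarrow> rPhi e Rm P I J Q (carrier R) = 0)"
    using rPhi_prime_bound[OF pr] by (rule ballI)
  then obtain C where C: "\<forall>Q\<in>\<Q>. \<forall>P e I J u. primeideal P R \<longrightarrow> simple_step R P I J u \<longrightarrow>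
    rPhi e Rm P I J Q (carrier R) \<le> enat (C Q * fdeg Q ^ e) \<and> (\<not> Q \<subseteq> P \<longrightarrow> rPhi e Rm P I J Q (carrier R) = 0)"
    unfolding bchoice_iff by (elim exE)
  define D3 where "D3 = (\<Sum>Q\<in>\<Q>. count_list Q1 Q * C Q)"
  define D where "D = D1 + D2 + D3"
  show ?thesis
  proof (rule exI[of _ D], intro allI impI)
    fix P d e I J u
    assume P: "primeideal P R" and st: "simple_step R P I J u"
      and H: "\<forall>Q'. primeideal Q' R \<longrightarrow> Q' \<subseteq> P \<longrightarrow> (\<exists>Q\<in>\<Q>. Q \<subseteq> Q') \<longrightarrow> (\<exists>k\<le>d. fdeg Q' = p ^ k * fdeg P)"
    define T where "T = p ^ d * fdeg P"
    define X where "X = p ^ e"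
    have p0: "0 < p" "1 \<le> p" using prime_gt_0_nat[OF p_prime] by simp_all
    have X0: "0 < X" using p0 by (simp add: X_def)
    have T1: "1 \<le> T" using fdeg_pos[OF P] p0 by (simp add: T_def Suc_le_eq)
    have HT: "fdeg Q' \<le> T" if Q': "primeideal Q' R" "Q' \<subseteq> P" "\<exists>Q\<in>\<Q>. Q \<subseteq> Q'" for Q'
    proof -
      obtain k where "k \<le> d" "fdeg Q' = p ^ k * fdeg P" using H Q' by blast
      then show ?thesis unfolding T_def using p0 by (simp add: power_increasing)
    qed
    have small: "\<forall>Q'. primeideal Q' R \<longrightarrow> Q' \<subseteq> P \<longrightarrow> (\<exists>Q\<in>\<Q>. Q \<subset> Q') \<longrightarrow> p * fdeg Q' \<le> T"
    proof (intro allI impI)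
      fix Q' assume Q': "primeideal Q' R" "Q' \<subseteq> P" "\<exists>Q\<in>\<Q>. Q \<subset> Q'"
      then obtain Q where Q: "Q \<in> \<Q>" "Q \<subset> Q'" by blast
      have "p * fdeg Q' \<le> fdeg Q" by (rule fdeg_strict[OF Q'(1) pr[OF Q(1)] Q(2)])
      also have "\<dots> \<le> T" by (rule HT[OF pr[OF Q(1)]]) (use Q Q'(2) in blast)+
      finally show "p * fdeg Q' \<le> T" .
    qed
    have rfin: "\<exists>n. rPhi e Rm P I J Q (carrier R) = enat n" if "Q \<in> \<Q>" for Q
      using C P st that enat_eq_of_le by blast
    define \<phi> where "\<phi> Q = the_enat (rPhi e Rm P I J Q (carrier R))" for Q
    have \<phi>: "rPhi e Rm P I J Q (carrier R) = enat (\<phi> Q)" if "Q \<in> \<Q>" for Q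
      using rfin[OF that] by (auto simp: \<phi>_def)
    have \<phi>C: "\<phi> Q \<le> C Q * fdeg Q ^ e" if "Q \<in> \<Q>" for Q
      using C P st that \<phi>[OF that] by (metis enat_ord_simps(1))
    have \<phi>0: "\<phi> Q = 0" if "Q \<in> \<Q>" "\<not> Q \<subseteq> P" for Q
      using C P st that \<phi>[OF that(1)] by (metis enat.inject zero_enat_def)
    have sums: "(\<Sum>Q\<leftarrow>Qs. rPhi e Rm P I J Q (carrier R)) = enat (\<Sum>Q\<in>\<Q>. count_list Qs Q * \<phi> Q)"
      if Qs: "set Qs \<subseteq> \<Q>" for Qs
    proof -
      have "map (\<lambda>Q. rPhi e Rm P I J Q (carrier R)) Qs = map (\<lambda>Q. enat (\<phi> Q)) Qs"
        by (rule map_cong[OF refl]) (use \<phi> Qs in blast)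
      then show ?thesis using sum_list_count_enat[OF Qs fin, of \<phi>] by (simp only: sum_list_enat)
    qed
    define S1 where "S1 = (\<Sum>Q\<in>\<Q>. count_list Q1 Q * \<phi> Q)"
    define S2 where "S2 = (\<Sum>Q\<in>\<Q>. count_list Q2 Q * \<phi> Q)"
    have A: "enat X * Phi e M P I J (carrier M) \<le> enat X * enat S1 + enat (D1 * T ^ e)"
      "enat X * enat S1 \<le> enat X * Phi e M P I J (carrier M) + enat (D1 * T ^ e)"
      using D1[rule_format, OF P st, of p T e] small unfolding X_def S1_def sums[OF Q1(1)] by simp_all
    have Nphi: "Phi e ?N P I J (carrier ?N) = Phi (Suc e) M P I J (carrier M)"
      by (simp add: rPhi_def fpush_tw set_add_tw)
    have B: "enat X * Phi (Suc e) M P I J (carrier M) \<le> enat X * enat S2 + enat (D2 * T ^ e)"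
      "enat X * enat S2 \<le> enat X * Phi (Suc e) M P I J (carrier M) + enat (D2 * T ^ e)"
      using D2[rule_format, OF P st, of p T e] small unfolding X_def S2_def sums[OF Q2(1)] Nphi by simp_all
    obtain a where a: "Phi e M P I J (carrier M) = enat a"
      using enat_cancel_finite[of X _ "X * S1 + D1 * T ^ e"] A(1) X0 by auto
    obtain b where b: "Phi (Suc e) M P I J (carrier M) = enat b"
      using enat_cancel_finite[of X _ "X * S2 + D2 * T ^ e"] B(1) X0 by auto
    have A': "X * a \<le> X * S1 + D1 * T ^ e" "X * S1 \<le> X * a + D1 * T ^ e" using A by (simp_all add: a)
    have B': "X * b \<le> X * S2 + D2 * T ^ e" "X * S2 \<le> X * b + D2 * T ^ e" using B by (simp_all add: b)
    \<comment> \<open>One direction follows from \<open>fdeg Q \<le> T\<close> alone. The other,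
      \<open>S12\<close>, has to pay with \<open>D3\<close> for primes with
      \<open>fdeg Q < T\<close>, the components of smaller dimension.\<close>
    have S21: "S2 \<le> T * S1"
      unfolding S1_def S2_def sum_distrib_left
    proof (rule sum_mono)
      fix Q assume Q: "Q \<in> \<Q>"
      show "count_list Q2 Q * \<phi> Q \<le> T * (count_list Q1 Q * \<phi> Q)"
      proof (cases "Q \<subseteq> P")
        case True
        have "fdeg Q \<le> T" by (rule HT[OF pr[OF Q] True]) (use Q in blast)
        then have "fdeg Q * (count_list Q1 Q * \<phi> Q) \<le> T * (count_list Q1 Q * \<phi> Q)" by (rule mult_right_mono) simp
        then show ?thesis using rank[OF Q] by (simp add: mult.assoc)
      next
        case False
        then show ?thesis using \<phi>0[OF Q] by simp
      qed
    qed
    have S12: "X * (T * S1) \<le> X * S2 + D3 * T ^ Suc e"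
      unfolding S1_def S2_def D3_def sum_distrib_left sum_distrib_right sum.distrib[symmetric]
    proof (rule sum_mono)
      fix Q assume Q: "Q \<in> \<Q>"
      show "X * (T * (count_list Q1 Q * \<phi> Q)) \<le> X * (count_list Q2 Q * \<phi> Q) + count_list Q1 Q * C Q * T ^ Suc e"
      proof (cases "Q \<subseteq> P")
        case True
        obtain k where k: "k \<le> d" "fdeg Q = p ^ k * fdeg P" using H pr[OF Q] True Q by blast
        show ?thesis
        proof (cases "k = d")
          case True
          then have "T = fdeg Q" using k by (simp add: T_def)
          then show ?thesis using rank[OF Q] by (simp add: mult.assoc)
        next
          case False
          \<comment> \<open>Degrees are \<open>fdeg P\<close> times powers of \<open>p\<close>, so a
            degree below \<open>T\<close> is at most \<open>T / p\<close>. This gap of a full factor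
            \<open>p\<close> is what gains \<open>p ^ e\<close>.\<close>
          then have "Suc k \<le> d" using k(1) by simp
          then have "p ^ Suc k * fdeg P \<le> T" unfolding T_def using p0 by (intro mult_right_mono power_increasing) simp_all
          then have pT: "p * fdeg Q \<le> T" using k(2) by (simp add: mult.assoc)
          have "X * \<phi> Q \<le> X * (C Q * fdeg Q ^ e)" by (rule mult_left_mono[OF \<phi>C[OF Q]]) simp
          also have "\<dots> = C Q * (p * fdeg Q) ^ e" by (simp add: X_def power_mult_distrib mult_ac)
          also have "\<dots> \<le> C Q * T ^ e" by (intro mult_left_mono power_mono pT) simp_all
          finally have "(T * count_list Q1 Q) * (X * \<phi> Q) \<le> (T * count_list Q1 Q) * (C Q * T ^ e)" by (rule mult_left_mono) simp
          then have "X * (T * (count_list Q1 Q * \<phi> Q)) \<le> count_list Q1 Q * C Q * T ^ Suc e"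
            by (simp only: power_Suc mult_ac)
          then show ?thesis by (rule trans_le_add2)
        qed
      next
        case False
        then show ?thesis using \<phi>0[OF Q] by simp
      qed
    qed
    have Te: "T ^ e \<le> T ^ Suc e" using T1 by simp
    have "X * b \<le> X * S2 + D2 * T ^ e" by (rule B'(1))
    also have "\<dots> \<le> X * (T * S1) + D2 * T ^ Suc e" by (intro add_mono mult_left_mono S21 Te) simp_all
    also have "X * (T * S1) = T * (X * S1)" by simp
    also have "T * (X * S1) + D2 * T ^ Suc e \<le> T * (X * a + D1 * T ^ e) + D2 * T ^ Suc e"
      by (intro add_right_mono mult_left_mono A') simp
    also have "\<dots> = X * T * a + (D1 + D2) * T ^ Suc e" by (simp add: algebra_simps)
    also have "\<dots> \<le> X * T * a + D * T ^ Suc e" by (intro add_left_mono mult_right_mono) (simp_all add: D_def)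
    finally have F1: "X * b \<le> X * T * a + D * T ^ Suc e" .
    have "X * T * a = T * (X * a)" by simp
    also have "\<dots> \<le> T * (X * S1 + D1 * T ^ e)" by (intro mult_left_mono A') simp
    also have "\<dots> = X * (T * S1) + D1 * T ^ Suc e" by (simp add: algebra_simps)
    also have "\<dots> \<le> (X * S2 + D3 * T ^ Suc e) + D1 * T ^ Suc e" by (intro add_right_mono S12)
    also have "\<dots> \<le> ((X * b + D2 * T ^ Suc e) + D3 * T ^ Suc e) + D1 * T ^ Suc e"
    proof (intro add_right_mono)
      have "D2 * T ^ e \<le> D2 * T ^ Suc e" by (rule mult_left_mono[OF Te]) simp
      then show "X * S2 \<le> X * b + D2 * T ^ Suc e" using B'(2) by linarith
    qed
    also have "\<dots> = X * b + D * T ^ Suc e" by (simp add: algebra_simps D_def)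
    finally have F2: "X * T * a \<le> X * b + D * T ^ Suc e" .
    show "enat (p ^ e) * Phi (Suc e) M P I J (carrier M)
        \<le> enat (p ^ e * (p ^ d * fdeg P)) * Phi e M P I J (carrier M) + enat (D * (p ^ d * fdeg P) ^ Suc e) \<and>
      enat (p ^ e * (p ^ d * fdeg P)) * Phi e M P I J (carrier M)
        \<le> enat (p ^ e) * Phi (Suc e) M P I J (carrier M) + enat (D * (p ^ d * fdeg P) ^ Suc e)"
      using F1 F2 unfolding a b X_def T_def by (simp only: times_enat_simps plus_enat_simps enat_ord_simps simp_thms)
  qed
qed

end

section \<open>From one Frobenius step to all powers, all ideals and all modules\<close>

text \<open>Relative to the main growth \<open>b ^ d\<close>, the errors of successive steps
  decrease at least by the factor \<open>1/2\<close> because \<open>b \<ge> 2\<close>; their sum is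
  at most twice the first.\<close>

lemma telescope:
  fixes f :: "nat \<Rightarrow> real" and b :: real
  assumes b: "2 \<le> b" and X: "0 \<le> X"
    and step: "\<And>e. \<bar>b ^ d * f e - f (Suc e)\<bar> \<le> X * b ^ (d * Suc e) / b ^ e"
  shows "\<bar>b ^ (d * k) * f e - f (e + k)\<bar> \<le> 2 * X * b ^ (d * (e + k)) / b ^ e"
proof -
  \<comment> \<open>The error scale of step \<open>e\<close>, transported to level
    \<open>e + j\<close> by the growth factor \<open>b ^ d\<close>.\<close>
  define Y where "Y j = X * b ^ (d * (e + j)) / b ^ e" for j
  have Y0: "0 \<le> Y j" for j using b X by (simp add: Y_def)
  have YS: "Y (Suc j) = b ^ d * Y j" for j by (simp add: Y_def power_add)
  have "\<bar>b ^ (d * k) * f e - f (e + k)\<bar> \<le> Y k * (2 * (1 - (1/2) ^ k))"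
  proof (induction k)
    case (Suc k)
    have "X * b ^ (d * Suc (e + k)) / b ^ (e + k) = Y (Suc k) * (1 / b) ^ k"
      by (simp add: Y_def power_add power_divide)
    also have "\<dots> \<le> Y (Suc k) * (1/2) ^ k"
      using b by (intro mult_left_mono power_mono Y0) (simp_all add: field_simps)
    finally have 1: "\<bar>b ^ d * f (e + k) - f (Suc (e + k))\<bar> \<le> Y (Suc k) * (1/2) ^ k"
      using step[of "e + k"] by linarith
    have "b ^ (d * Suc k) * f e - f (e + Suc k)
      = b ^ d * (b ^ (d * k) * f e - f (e + k)) + (b ^ d * f (e + k) - f (Suc (e + k)))"
      by (simp add: power_add algebra_simps)
    then have "\<bar>b ^ (d * Suc k) * f e - f (e + Suc k)\<bar>
      \<le> \<bar>b ^ d * (b ^ (d * k) * f e - f (e + k))\<bar> + \<bar>b ^ d * f (e + k) - f (Suc (e + k))\<bar>"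
      by (simp only: abs_triangle_ineq)
    also have "\<bar>b ^ d * (b ^ (d * k) * f e - f (e + k))\<bar> = b ^ d * \<bar>b ^ (d * k) * f e - f (e + k)\<bar>"
      using b by (simp add: abs_mult)
    also have "\<dots> \<le> b ^ d * (Y k * (2 * (1 - (1/2) ^ k)))"
      using b by (intro mult_left_mono Suc) simp
    finally have "\<bar>b ^ (d * Suc k) * f e - f (e + Suc k)\<bar>
      \<le> Y (Suc k) * (2 * (1 - (1/2) ^ k)) + Y (Suc k) * (1/2) ^ k"
      using 1 unfolding YS by (simp add: mult.assoc)
    also have "\<dots> = Y (Suc k) * (2 * (1 - (1/2) ^ Suc k))" by (simp add: algebra_simps)
    finally show ?case .
  qed simp
  also have "\<dots> \<le> Y k * 2" by (intro mult_left_mono Y0) simp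
  finally show ?thesis by (simp add: Y_def mult_ac)
qed

text \<open>An element of all filtration primes moves each layer into the one below, so the number
  of layers is an exponent that kills the module modulo \<open>K\<close>.\<close>

lemma (in module) pfilt_pow_kill:
  assumes "pfilt R M K Es L" "submodule K R M" "r \<in> carrier R" "\<forall>E\<in>set Es. r \<in> E" "x \<in> L"
  shows "(r [^] length Es) \<odot>\<^bsub>M\<^esub> x \<in> K"
  using assms
proof (induction arbitrary: x rule: pfilt.induct)
  case Nil
  then show ?case using submodule_carrier by simp
next
  case (Cons Es L y Q)
  have L: "submodule L R M" using pfilt_submodule[OF Cons.hyps(1)] Cons.prems(1) by blast
  obtain l t where x: "l \<in> L" "t \<in> carrier R" "x = l \<oplus>\<^bsub>M\<^esub> t \<odot>\<^bsub>M\<^esub> y"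
    using Cons.prems(4) by (auto simp: sum_cyc_iff)
  have r: "r \<in> carrier R" "r \<in> Q" using Cons.prems by simp_all
  have yc: "y \<in> carrier M" "l \<in> carrier M" using Cons.hyps(2) submodule_carrier[OF L x(1)] by simp_all
  have ry: "r \<odot>\<^bsub>M\<^esub> y \<in> L" using r(2) Cons.hyps(3) by blast
  have "r \<odot>\<^bsub>M\<^esub> x = r \<odot>\<^bsub>M\<^esub> l \<oplus>\<^bsub>M\<^esub> t \<odot>\<^bsub>M\<^esub> (r \<odot>\<^bsub>M\<^esub> y)"
    using r(1) x(2) yc by (simp add: x(3) smult_r_distr smult_assoc1[symmetric] R.m_comm)
  then have "r \<odot>\<^bsub>M\<^esub> x \<in> L"
    using submodule_add[OF L submodule_smult[OF L r(1) x(1)] submodule_smult[OF L x(2) ry]] by simp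
  then have "(r [^] length Es) \<odot>\<^bsub>M\<^esub> (r \<odot>\<^bsub>M\<^esub> x) \<in> K"
    by (intro Cons.IH) (use Cons.prems in simp_all)
  moreover have "x \<in> carrier M" using x(2,3) yc by simp
  ultimately show ?case using r(1) by (simp add: smult_assoc1)
qed

context ffinite_ring
begin

text \<open>Sums an estimate over a composition series of \<open>J_P / I_P\<close>, whose steps are
  instances of \<open>simple_step\<close> by \<open>len_simple\<close>; saturation of the lower
  ideal gives \<open>P u \<subseteq> I\<close> in \<open>R\<close> itself. The functionals are
  abstract because the lemma serves three times: for a crude bound with \<open>F2 = 0\<close>, and
  for both directions of the comparison.\<close>

lemma chain_le:
  assumes P: "primeideal P R"
    and add1: "\<forall>I H J. ideal I R \<longrightarrow> ideal H R \<longrightarrow> ideal J R \<longrightarrow> I \<subseteq> H \<longrightarrow> H \<subseteq> J \<longrightarrow> F1 I J = F1 I H + (F1 H J :: enat)"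
    and add2: "\<forall>I H J. ideal I R \<longrightarrow> ideal H R \<longrightarrow> ideal J R \<longrightarrow> I \<subseteq> H \<longrightarrow> H \<subseteq> J \<longrightarrow> F2 I J = F2 I H + (F2 H J :: enat)"
    and zero: "\<forall>I. ideal I R \<longrightarrow> F1 I I = 0"
    and step: "\<forall>I J u. simple_step R P I J u \<longrightarrow> F1 I J \<le> F2 I J + B"
    and I: "ideal I R" "psat R Rm P I = I" and J: "ideal J R" "psat R Rm P J = J" and IJ: "I \<subseteq> J"
    and n: "len R Rm P I J = enat n"
  shows "F1 I J \<le> F2 I J + enat n * B"
  using I IJ n
proof (induction n arbitrary: I)
  case 0
  interpret S: module R Rm by (rule module_self)
  have "J \<subseteq> psat R Rm P I"
    using S.len_zero_iff[OF P submodule_self_ideal[OF 0(1)] submodule_self_ideal[OF J(1)]] 0 J(2)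
    by (simp add: zero_enat_def)
  then have "I = J" using 0 by blast
  then show ?case using zero[rule_format, OF 0(1)] by simp
next
  case (Suc n)
  interpret S: module R Rm by (rule module_self)
  have sI: "submodule I R Rm" and sJ: "submodule J R Rm"
    by (rule submodule_self_ideal[OF Suc(2)], rule submodule_self_ideal[OF J(1)])
  have IpJ: "I \<subseteq> psat R Rm P J" using Suc(4) J(2) by simp
  obtain H where H: "submodule H R Rm" "psat R Rm P H = H" "I \<subseteq> H" "H \<subseteq> psat R Rm P J"
      "len R Rm P I H = 1" "len R Rm P H J = enat n"
    using S.len_split_Suc[OF P sI sJ IpJ Suc(5)] by blast
  have HJ: "H \<subseteq> J" using H(4) J(2) by simp
  have iH: "ideal H R" using H(1) by (simp add: submodule_self_iff)
  have IpH: "I \<subseteq> psat R Rm P H" using H by simp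
  obtain u where u: "u \<in> H" "H \<subseteq> psat R Rm P (I <+>\<^bsub>Rm\<^esub> cyc R Rm u)"
      "\<And>r. r \<in> carrier R \<Longrightarrow> r \<odot>\<^bsub>Rm\<^esub> u \<in> psat R Rm P I \<longleftrightarrow> r \<in> P"
    using S.len_simple[OF P sI H(1) IpH H(5)] by blast
  have uc: "u \<in> carrier R" using S.submodule_carrier[OF H(1) u(1)] by simp
  have "simple_step R P I H u"
    unfolding simple_step_def
  proof (intro conjI ballI)
    show "ideal I R" "ideal H R" "I \<subseteq> H" "u \<in> H" by fact+
    show "a \<otimes> u \<in> I" if a: "a \<in> P" for a
    proof -
      have ac: "a \<in> carrier R" using a primeideal_subset[OF P] by blast
      show ?thesis using u(3)[OF ac] a Suc(3) by simp
    qed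
    fix j assume "j \<in> H"
    then have "j \<in> psat R Rm P (I <+>\<^bsub>Rm\<^esub> cyc R Rm u)" using u(2) by blast
    then obtain s where s: "s \<in> carrier R - P" "s \<otimes> j \<in> I <+>\<^bsub>Rm\<^esub> cyc R Rm u" by (auto simp: psat_def)
    then obtain i r where "i \<in> I" "r \<in> carrier R" "s \<otimes> j = i \<oplus> r \<otimes> u" by (auto simp: S.sum_cyc_iff)
    then show "\<exists>s\<in>carrier R - P. \<exists>i\<in>I. \<exists>r\<in>carrier R. s \<otimes> j = i \<oplus> u \<otimes> r"
      using s(1) uc m_comm[of u] by metis
  qed
  then have 1: "F1 I H \<le> F2 I H + B" by (rule step[rule_format])
  have 2: "F1 H J \<le> F2 H J + enat n * B" by (rule Suc.IH[OF iH H(2) HJ H(6)])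
  have a1: "F1 I J = F1 I H + F1 H J" by (rule add1[rule_format, OF Suc(2) iH J(1) H(3) HJ])
  have a2: "F2 I J = F2 I H + F2 H J" by (rule add2[rule_format, OF Suc(2) iH J(1) H(3) HJ])
  have "F1 I J \<le> (F2 I H + B) + (F2 H J + enat n * B)" unfolding a1 by (rule add_mono[OF 1 2])
  also have "\<dots> = F2 I J + (B + enat n * B)" unfolding a2 by (simp only: add_ac)
  also have "B + enat n * B = enat (Suc n) * B" by (simp add: eSuc_enat[symmetric] mult_eSuc)
  finally show ?case .
qed

lemma Phi_add:
  assumes M: "module R M" and P: "primeideal P R" and I: "ideal I R" and H: "ideal H R" and J: "ideal J R"
    and "I \<subseteq> H" "H \<subseteq> J"
  shows "Phi e M P I J (carrier M) = Phi e M P I H (carrier M) + Phi e M P H J (carrier M)"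
proof -
  interpret M: module R M by fact
  interpret F: module R "fpush R p e M" by (rule module_fpush[OF M])
  note W = M.carrier_is_submodule
  have c: "B \<subseteq> carrier R" if "ideal B R" for B using that ideal.axioms(1) additive_subgroup.a_subset by blast
  have s: "submodule (isub R (fpush R p e M) B (carrier M)) R (fpush R p e M)" if "ideal B R" for B
    by (rule submodule_fpush[OF M isub_fpush_submodule[OF M c[OF that] W]])
  note up = F.psat_upper[OF P F.submoduleE(1)[OF s]]
  have "isub R (fpush R p e M) I (carrier M) \<subseteq> isub R (fpush R p e M) H (carrier M)"
    "isub R (fpush R p e M) H (carrier M) \<subseteq> isub R (fpush R p e M) J (carrier M)"
    by (intro F.isub_mono assms subset_refl)+
  then show ?thesis
    unfolding Phi_eq[OF M W c[OF I] c[OF J]] Phi_eq[OF M W c[OF I] c[OF H]] Phi_eq[OF M W c[OF H] c[OF J]]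
    using up[OF H] up[OF J] by (intro F.len_add[OF P s[OF I] s[OF H] s[OF J]]) blast+
qed

lemma Phi_self:
  assumes M: "module R M" and P: "primeideal P R" and I: "ideal I R"
  shows "Phi e M P I I (carrier M) = 0"
proof -
  interpret M: module R M by fact
  interpret F: module R "fpush R p e M" by (rule module_fpush[OF M])
  have c: "I \<subseteq> carrier R" using I ideal.axioms(1) additive_subgroup.a_subset by blast
  note s = submodule_fpush[OF M isub_fpush_submodule[OF M c M.carrier_is_submodule]]
  show ?thesis
    unfolding Phi_eq[OF M M.carrier_is_submodule c c]
    by (intro F.len_zero[OF P s s] F.psat_upper[OF P F.submoduleE(1)[OF s]])
qed

lemma Phi_fpush: "Phi e (fpush R p e' M) P I J L = Phi (e + e') M P I J L"
  by (simp add: rPhi_def fpush_fpush)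

text \<open>If \<open>r\<close> lies in all filtration primes of \<open>M\<close>, then
  \<open>r ^ e0\<close> kills \<open>M\<close>; as \<open>p ^ e0 > e0\<close>, the restriction along
  \<open>e0\<close> steps of Frobenius is killed by the intersection of these primes. For
  \<open>e \<ge> e0\<close> the reduced case applies to this restriction at level
  \<open>e - e0\<close>, and the finitely many smaller levels are covered by a crude bound. Either
  way the loss is at most the factor \<open>p ^ e0\<close>, which explains the constant.\<close>

lemma Phi_compare:
  assumes M: "module R M" and fg: "fg_sub R M (carrier M)"
  shows "\<exists>C::nat. \<forall>P d e I J n. primeideal P R \<longrightarrow> ideal I R \<longrightarrow> psat R Rm P I = I \<longrightarrow>
    ideal J R \<longrightarrow> psat R Rm P J = J \<longrightarrow> I \<subseteq> J \<longrightarrow> len R Rm P I J = enat n \<longrightarrow>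
    (\<forall>Q'. primeideal Q' R \<longrightarrow> Q' \<subseteq> P \<longrightarrow> annihilator R M \<subseteq> Q' \<longrightarrow> (\<exists>k\<le>d. fdeg Q' = p ^ k * fdeg P)) \<longrightarrow>
    (\<exists>a b. Phi e M P I J (carrier M) = enat a \<and> Phi (Suc e) M P I J (carrier M) = enat b \<and>
      p ^ e * b \<le> p ^ e * (p ^ d * fdeg P) * a + n * C * (p ^ d * fdeg P) ^ Suc e \<and>
      p ^ e * (p ^ d * fdeg P) * a \<le> p ^ e * b + n * C * (p ^ d * fdeg P) ^ Suc e)"
proof -
  interpret M: module R M by fact
  note Z = M.submodule_zero_set
  note W = M.carrier_is_submodule
  obtain Es where Es: "pfilt R M {\<zero>\<^bsub>M\<^esub>} Es (carrier M)"
    using M.fg_sub_pfilt[OF noetherian_ring_axioms Z fg M.submoduleE(1)[OF Z]] by blast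
  have prE: "primeideal E R" if "E \<in> set Es" for E by (rule M.pfilt_primes[OF Es that])
  have annE: "annihilator R M \<subseteq> E" if E: "E \<in> set Es" for E
  proof
    fix a assume "a \<in> annihilator R M"
    then have a: "a \<in> carrier R" "\<forall>x\<in>carrier M. a \<odot>\<^bsub>M\<^esub> x = \<zero>\<^bsub>M\<^esub>" by (simp_all add: annihilator_def)
    show "a \<in> E" by (rule M.pfilt_ann[OF Es Z a(1) _ E]) (use a(2) in simp)
  qed
  define e0 where "e0 = length Es"
  \<comment> \<open>The minimal filtration primes are incomparable and have the same intersection as
    all filtration primes.\<close>
  define \<Q> where "\<Q> = {Q \<in> set Es. \<forall>Q'\<in>set Es. Q' \<subseteq> Q \<longrightarrow> Q' = Q}"
  have fin: "finite \<Q>" by (simp add: \<Q>_def)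
  have pr: "\<forall>Q\<in>\<Q>. primeideal Q R" using prE by (simp add: \<Q>_def)
  have inc: "\<forall>Q\<in>\<Q>. \<forall>Q'\<in>\<Q>. Q \<subseteq> Q' \<longrightarrow> Q = Q'" by (simp add: \<Q>_def)
  have below: "\<exists>Q\<in>\<Q>. Q \<subseteq> E" if E: "E \<in> set Es" for E
  proof -
    obtain Q where "Q \<in> set Es" "Q \<subseteq> E" "\<forall>Q'\<in>set Es. Q' \<subseteq> Q \<longrightarrow> Q = Q'"
      using finite_has_minimal2[OF finite_set E] by blast
    then show ?thesis by (intro bexI[of _ Q]) (auto simp: \<Q>_def)
  qed
  let ?M = "fpush R p e0 M"
  note M1 = module_fpush[OF M, of e0]
  have ann: "\<forall>r\<in>carrier R. (\<forall>Q\<in>\<Q>. r \<in> Q) \<longrightarrow> (\<forall>x\<in>carrier ?M. r \<odot>\<^bsub>?M\<^esub> x = \<zero>\<^bsub>?M\<^esub>)"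
  proof (intro ballI impI)
    fix r x assume r: "r \<in> carrier R" and rQ: "\<forall>Q\<in>\<Q>. r \<in> Q" and x: "x \<in> carrier ?M"
    have rE: "\<forall>E\<in>set Es. r \<in> E"
    proof
      fix E assume "E \<in> set Es"
      then show "r \<in> E" using below[of E] rQ by auto
    qed
    have xc: "x \<in> carrier M" using x by simp
    have "(r [^] e0) \<odot>\<^bsub>M\<^esub> x \<in> {\<zero>\<^bsub>M\<^esub>}" unfolding e0_def by (rule M.pfilt_pow_kill[OF Es Z r rE xc])
    then have k: "(r [^] e0) \<odot>\<^bsub>M\<^esub> x = \<zero>\<^bsub>M\<^esub>" by simp
    have "e0 < p ^ e0" using prime_gt_Suc_0_nat[OF p_prime] by (rule power_gt_expt)
    then have "r [^] (p ^ e0) = r [^] (p ^ e0 - e0) \<otimes> r [^] e0" using r by (simp add: nat_pow_mult)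
    then have "(r [^] (p ^ e0)) \<odot>\<^bsub>M\<^esub> x = (r [^] (p ^ e0 - e0)) \<odot>\<^bsub>M\<^esub> ((r [^] e0) \<odot>\<^bsub>M\<^esub> x)"
      using r xc by (simp add: M.smult_assoc1)
    then show "r \<odot>\<^bsub>?M\<^esub> x = \<zero>\<^bsub>?M\<^esub>" using r k by (simp add: fpush_smult)
  qed
  have fg1: "fg_sub R ?M (carrier ?M)" using fg_fpush[OF M fg, of e0] by simp
  obtain D where D: "\<forall>P d e I J u. primeideal P R \<longrightarrow> simple_step R P I J u \<longrightarrow>
      (\<forall>Q'. primeideal Q' R \<longrightarrow> Q' \<subseteq> P \<longrightarrow> (\<exists>Q\<in>\<Q>. Q \<subseteq> Q') \<longrightarrow> (\<exists>k\<le>d. fdeg Q' = p ^ k * fdeg P)) \<longrightarrow>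
      enat (p ^ e) * Phi (Suc e) ?M P I J (carrier ?M)
        \<le> enat (p ^ e * (p ^ d * fdeg P)) * Phi e ?M P I J (carrier ?M) + enat (D * (p ^ d * fdeg P) ^ Suc e) \<and>
      enat (p ^ e * (p ^ d * fdeg P)) * Phi e ?M P I J (carrier ?M)
        \<le> enat (p ^ e) * Phi (Suc e) ?M P I J (carrier ?M) + enat (D * (p ^ d * fdeg P) ^ Suc e)"
    using reduced_main[OF M1 fg1 fin pr inc ann] by (elim exE)
  have "\<exists>C::nat. \<forall>P e T c. primeideal P R \<longrightarrow> (\<forall>Q\<in>set Es. Q \<subseteq> P \<longrightarrow> c * fdeg Q \<le> T) \<longrightarrow>
    enat (c ^ e) * (\<Sum>Q\<leftarrow>Es. gam e Rm P Q P (carrier R)) \<le> enat (C * T ^ e)"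
    by (rule gam_list_bound) (rule prE)
  then obtain C1 where C1: "\<forall>P e T c. primeideal P R \<longrightarrow> (\<forall>Q\<in>set Es. Q \<subseteq> P \<longrightarrow> c * fdeg Q \<le> T) \<longrightarrow>
    enat (c ^ e) * (\<Sum>Q\<leftarrow>Es. gam e Rm P Q P (carrier R)) \<le> enat (C1 * T ^ e)" by (elim exE)
  define C where "C = p ^ e0 * (D + C1)"
  show ?thesis
  proof (rule exI[of _ C], intro allI impI)
    fix P d e I J n
    assume P: "primeideal P R" and I: "ideal I R" "psat R Rm P I = I" and J: "ideal J R" "psat R Rm P J = J"
      and IJ: "I \<subseteq> J" and n: "len R Rm P I J = enat n"
      and H: "\<forall>Q'. primeideal Q' R \<longrightarrow> Q' \<subseteq> P \<longrightarrow> annihilator R M \<subseteq> Q' \<longrightarrow> (\<exists>k\<le>d. fdeg Q' = p ^ k * fdeg P)"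
    define T where "T = p ^ d * fdeg P"
    have p0: "0 < p" "1 \<le> p" using prime_gt_0_nat[OF p_prime] by simp_all
    have T1: "1 \<le> T" using fdeg_pos[OF P] p0 by (simp add: T_def Suc_le_eq)
    have H': "\<forall>Q'. primeideal Q' R \<longrightarrow> Q' \<subseteq> P \<longrightarrow> (\<exists>Q\<in>\<Q>. Q \<subseteq> Q') \<longrightarrow> (\<exists>k\<le>d. fdeg Q' = p ^ k * fdeg P)"
    proof (intro allI impI)
      fix Q' assume Q': "primeideal Q' R" "Q' \<subseteq> P" "\<exists>Q\<in>\<Q>. Q \<subseteq> Q'"
      then obtain Q where "Q \<in> \<Q>" "Q \<subseteq> Q'" by blast
      then have "annihilator R M \<subseteq> Q'" using annE[of Q] by (auto simp: \<Q>_def)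
      then show "\<exists>k\<le>d. fdeg Q' = p ^ k * fdeg P" using H Q'(1,2) by simp
    qed
    have ET: "1 * fdeg Q \<le> T" if Q: "Q \<in> set Es" "Q \<subseteq> P" for Q
    proof -
      obtain k where "k \<le> d" "fdeg Q = p ^ k * fdeg P" using H prE[OF Q(1)] Q(2) annE[OF Q(1)] by blast
      then show ?thesis unfolding T_def using p0 by (simp add: power_increasing)
    qed
    have addP: "\<forall>I H J. ideal I R \<longrightarrow> ideal H R \<longrightarrow> ideal J R \<longrightarrow> I \<subseteq> H \<longrightarrow> H \<subseteq> J \<longrightarrow>
      enat c * Phi e M P I J (carrier M) = enat c * Phi e M P I H (carrier M) + enat c * Phi e M P H J (carrier M)" for c e
    proof (intro allI impI)
      fix I H J assume "ideal I R" "ideal H R" "ideal J R" "I \<subseteq> H" "H \<subseteq> J"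
      then have "Phi e M P I J (carrier M) = Phi e M P I H (carrier M) + Phi e M P H J (carrier M)"
        by (rule Phi_add[OF M P])
      then show "enat c * Phi e M P I J (carrier M) = enat c * Phi e M P I H (carrier M) + enat c * Phi e M P H J (carrier M)"
        by (simp only: distrib_left)
    qed
    have zeroP: "\<forall>I. ideal I R \<longrightarrow> enat c * Phi e M P I I (carrier M) = 0" for c e
      using Phi_self[OF M P] by simp
    \<comment> \<open>This bound provides finiteness at every level. For \<open>e < e0\<close> it
      also replaces the comparison, since both terms are then small against the allowed
      error.\<close>
    have crude: "Phi e M P I J (carrier M) \<le> enat (n * (C1 * T ^ e))" for e
    proof -
      have "\<forall>I J u. simple_step R P I J u \<longrightarrow> enat 1 * Phi e M P I J (carrier M) \<le> 0 + enat (C1 * T ^ e)"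
      proof (intro allI impI)
        fix I J u assume st: "simple_step R P I J u"
        have "Phi e M P I J (carrier M) \<le> gam e M P {\<zero>\<^bsub>M\<^esub>} P (carrier M)"
          by (rule rPhi_le_gam[OF M P st Z W M.submoduleE(1)[OF Z]])
        also have "\<dots> \<le> (\<Sum>Q\<leftarrow>Es. gam e Rm P Q P (carrier R))"
          by (rule gam_pfilt_le[OF M P Z primeideal_subset[OF P] Es])
        also have "\<dots> = enat (1 ^ e) * (\<Sum>Q\<leftarrow>Es. gam e Rm P Q P (carrier R))"
          by (simp add: one_enat_def[symmetric] del: One_nat_def)
        also have "\<dots> \<le> enat (C1 * T ^ e)"
          by (rule C1[rule_format, OF P]) (rule ET)
        finally show "enat 1 * Phi e M P I J (carrier M) \<le> 0 + enat (C1 * T ^ e)"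
          by (simp add: one_enat_def[symmetric] del: One_nat_def)
      qed
      then have "enat 1 * Phi e M P I J (carrier M) \<le> 0 + enat n * enat (C1 * T ^ e)"
        by (intro chain_le[where ?F1.0 = "\<lambda>I J. enat 1 * Phi e M P I J (carrier M)" and ?F2.0 = "\<lambda>_ _. 0",
              OF P addP _ zeroP _ I J IJ n]) simp_all
      then show ?thesis by (simp add: one_enat_def[symmetric] del: One_nat_def)
    qed
    obtain a where a: "Phi e M P I J (carrier M) = enat a" "a \<le> n * (C1 * T ^ e)"
      using enat_eq_of_le[OF crude[of e]] by blast
    obtain b where b: "Phi (Suc e) M P I J (carrier M) = enat b" "b \<le> n * (C1 * T ^ Suc e)"
      using enat_eq_of_le[OF crude[of "Suc e"]] by blast
    have "p ^ e * b \<le> p ^ e * T * a + n * C * T ^ Suc e \<and> p ^ e * T * a \<le> p ^ e * b + n * C * T ^ Suc e"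
    proof (cases "e0 \<le> e")
      case True
      define e' where "e' = e - e0"
      have ee: "e = e' + e0" using True by (simp add: e'_def)
      have Pa: "Phi e' ?M P I J (carrier ?M) = Phi e M P I J (carrier M)"
        and Pb: "Phi (Suc e') ?M P I J (carrier ?M) = Phi (Suc e) M P I J (carrier M)" for I J
        using Phi_fpush[of e' e0 M P I J "carrier M"] Phi_fpush[of "Suc e'" e0 M P I J "carrier M"] by (simp_all add: ee)
      have D': "\<forall>I J u. simple_step R P I J u \<longrightarrow>
        enat (p ^ e') * Phi (Suc e) M P I J (carrier M)
          \<le> enat (p ^ e' * T) * Phi e M P I J (carrier M) + enat (D * T ^ Suc e') \<and>
        enat (p ^ e' * T) * Phi e M P I J (carrier M)
          \<le> enat (p ^ e') * Phi (Suc e) M P I J (carrier M) + enat (D * T ^ Suc e')"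
      proof (intro allI impI)
        fix I J u assume st: "simple_step R P I J u"
        show "enat (p ^ e') * Phi (Suc e) M P I J (carrier M)
          \<le> enat (p ^ e' * T) * Phi e M P I J (carrier M) + enat (D * T ^ Suc e') \<and>
        enat (p ^ e' * T) * Phi e M P I J (carrier M)
          \<le> enat (p ^ e') * Phi (Suc e) M P I J (carrier M) + enat (D * T ^ Suc e')"
          using D[rule_format, OF P st, of d e'] H' unfolding Pa Pb T_def by simp
      qed
      have c1: "\<forall>I J u. simple_step R P I J u \<longrightarrow> enat (p ^ e') * Phi (Suc e) M P I J (carrier M)
          \<le> enat (p ^ e' * T) * Phi e M P I J (carrier M) + enat (D * T ^ Suc e')"
        and c2: "\<forall>I J u. simple_step R P I J u \<longrightarrow> enat (p ^ e' * T) * Phi e M P I J (carrier M)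
          \<le> enat (p ^ e') * Phi (Suc e) M P I J (carrier M) + enat (D * T ^ Suc e')"
        using D' by blast+
      have f1: "p ^ e' * b \<le> p ^ e' * T * a + n * (D * T ^ Suc e')"
        using chain_le[where ?F1.0 = "\<lambda>I J. enat (p ^ e') * Phi (Suc e) M P I J (carrier M)"
            and ?F2.0 = "\<lambda>I J. enat (p ^ e' * T) * Phi e M P I J (carrier M)", OF P addP addP zeroP c1 I J IJ n]
        unfolding a(1) b(1)
        by (simp only: times_enat_simps plus_enat_simps enat_ord_simps)
      have f2: "p ^ e' * T * a \<le> p ^ e' * b + n * (D * T ^ Suc e')"
        using chain_le[where ?F2.0 = "\<lambda>I J. enat (p ^ e') * Phi (Suc e) M P I J (carrier M)"
            and ?F1.0 = "\<lambda>I J. enat (p ^ e' * T) * Phi e M P I J (carrier M)", OF P addP addP zeroP c2 I J IJ n]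
        unfolding a(1) b(1)
        by (simp only: times_enat_simps plus_enat_simps enat_ord_simps)
      have TT: "T ^ Suc e' \<le> T ^ Suc e" using T1 by (intro power_increasing) (simp_all add: ee)
      have g: "p ^ e0 * (n * (D * T ^ Suc e')) \<le> n * C * T ^ Suc e"
      proof -
        have "p ^ e0 * (n * (D * T ^ Suc e')) = (n * (p ^ e0 * D)) * T ^ Suc e'" by (simp only: mult_ac)
        also have "\<dots> \<le> (n * C) * T ^ Suc e"
          by (intro mult_mono TT) (simp_all add: C_def)
        finally show ?thesis .
      qed
      have "p ^ e * b = p ^ e0 * (p ^ e' * b)" by (simp add: ee power_add)
      also have "\<dots> \<le> p ^ e0 * (p ^ e' * T * a + n * (D * T ^ Suc e'))" by (rule mult_left_mono[OF f1]) simp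
      also have "\<dots> = p ^ e * T * a + p ^ e0 * (n * (D * T ^ Suc e'))" by (simp add: ee power_add algebra_simps)
      finally have 1: "p ^ e * b \<le> p ^ e * T * a + n * C * T ^ Suc e" using g by linarith
      have "p ^ e * T * a = p ^ e0 * (p ^ e' * T * a)" by (simp add: ee power_add)
      also have "\<dots> \<le> p ^ e0 * (p ^ e' * b + n * (D * T ^ Suc e'))" by (rule mult_left_mono[OF f2]) simp
      also have "\<dots> = p ^ e * b + p ^ e0 * (n * (D * T ^ Suc e'))" by (simp add: ee power_add algebra_simps)
      finally have 2: "p ^ e * T * a \<le> p ^ e * b + n * C * T ^ Suc e" using g by linarith
      show ?thesis using 1 2 by blast
    next
      case False
      then have pe: "p ^ e \<le> p ^ e0" using p0 by (intro power_increasing) simp_all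
      have g: "p ^ e0 * (n * (C1 * T ^ Suc e)) \<le> n * C * T ^ Suc e"
      proof -
        have "p ^ e0 * (n * (C1 * T ^ Suc e)) = (n * (p ^ e0 * C1)) * T ^ Suc e" by (simp only: mult_ac)
        also have "\<dots> \<le> (n * C) * T ^ Suc e" by (intro mult_right_mono) (simp_all add: C_def)
        finally show ?thesis .
      qed
      have "p ^ e * b \<le> p ^ e0 * (n * (C1 * T ^ Suc e))" by (rule mult_mono[OF pe b(2)]) simp_all
      then have 1: "p ^ e * b \<le> p ^ e * T * a + n * C * T ^ Suc e" using g by linarith
      have "p ^ e * T * a = p ^ e * (T * a)" by (simp only: mult.assoc)
      also have "\<dots> \<le> p ^ e0 * (T * (n * (C1 * T ^ e)))" by (intro mult_mono pe a(2)) simp_all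
      also have "\<dots> = p ^ e0 * (n * (C1 * T ^ Suc e))" by (simp only: power_Suc mult_ac)
      finally have 2: "p ^ e * T * a \<le> p ^ e * b + n * C * T ^ Suc e" using g by linarith
      show ?thesis using 1 2 by blast
    qed
    then show "\<exists>a b. Phi e M P I J (carrier M) = enat a \<and> Phi (Suc e) M P I J (carrier M) = enat b \<and>
      p ^ e * b \<le> p ^ e * (p ^ d * fdeg P) * a + n * C * (p ^ d * fdeg P) ^ Suc e \<and>
      p ^ e * (p ^ d * fdeg P) * a \<le> p ^ e * b + n * C * (p ^ d * fdeg P) ^ Suc e"
      using a(1) b(1) unfolding T_def by blast
  qed
qed

end

subsection \<open>Submodules of a localization\<close>

lemma quotient_module_simps [simp]:
  "carrier (quotient_module M L K) = a_rcosets\<^bsub>M\<lparr>carrier := L\<rparr>\<^esub> K"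
  "zero (quotient_module M L K) = K"
  "add (quotient_module M L K) = (\<lambda>X Y. X <+>\<^bsub>M\<^esub> Y)"
  "smult (quotient_module M L K) = (\<lambda>a X. \<Union>x\<in>X. K +>\<^bsub>M\<^esub> (a \<odot>\<^bsub>M\<^esub> x))"
  by (simp_all add: quotient_module_def)

lemma quotient_carrier_iff:
  "X \<in> a_rcosets\<^bsub>M\<lparr>carrier := L\<rparr>\<^esub> K \<longleftrightarrow> (\<exists>y\<in>L. X = K +>\<^bsub>M\<^esub> y)"
  by (auto simp: A_RCOSETS_def' a_r_coset_def')

context module
begin

lemma submodule_abelian_subgroup: "submodule K R M \<Longrightarrow> abelian_subgroup K M"
  by (rule abelian_subgroupI3) (auto intro: additive_subgroupI submodule.axioms(1) M.abelian_group_axioms)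

lemma coset_eq_iff:
  assumes K: "submodule K R M" and "x \<in> carrier M" "y \<in> carrier M"
  shows "K +>\<^bsub>M\<^esub> x = K +>\<^bsub>M\<^esub> y \<longleftrightarrow> x \<ominus>\<^bsub>M\<^esub> y \<in> K"
proof -
  interpret K: abelian_subgroup K M by (rule submodule_abelian_subgroup[OF K])
  show ?thesis
    using K.a_rcos_module[OF assms(3,2)] K.a_repr_independence'[of x y] K.a_rcos_self[OF assms(2)] assms
    by (auto simp: a_minus_def)
qed

lemma coset_add:
  assumes K: "submodule K R M" and "x \<in> carrier M" "y \<in> carrier M"
  shows "(K +>\<^bsub>M\<^esub> x) <+>\<^bsub>M\<^esub> (K +>\<^bsub>M\<^esub> y) = K +>\<^bsub>M\<^esub> (x \<oplus>\<^bsub>M\<^esub> y)"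
  by (rule abelian_subgroup.a_rcos_sum[OF submodule_abelian_subgroup[OF K] assms(2,3)])

lemma coset_zero: assumes K: "submodule K R M" shows "K +>\<^bsub>M\<^esub> \<zero>\<^bsub>M\<^esub> = K"
  by (rule abelian_subgroup.a_rcos_const[OF submodule_abelian_subgroup[OF K] submodule_zero[OF K]])

lemma coset_smult:
  assumes K: "submodule K R M" and x: "x \<in> carrier M" and a: "a \<in> carrier R"
  shows "(\<Union>z\<in>K +>\<^bsub>M\<^esub> x. K +>\<^bsub>M\<^esub> (a \<odot>\<^bsub>M\<^esub> z)) = K +>\<^bsub>M\<^esub> (a \<odot>\<^bsub>M\<^esub> x)"
proof -
  interpret K: abelian_subgroup K M by (rule submodule_abelian_subgroup[OF K])
  have "K +>\<^bsub>M\<^esub> (a \<odot>\<^bsub>M\<^esub> z) = K +>\<^bsub>M\<^esub> (a \<odot>\<^bsub>M\<^esub> x)" if zx: "z \<in> K +>\<^bsub>M\<^esub> x" for z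
  proof -
    obtain k where k: "k \<in> K" "z = k \<oplus>\<^bsub>M\<^esub> x" using zx by (auto simp: a_r_coset_def')
    have kc: "k \<in> carrier M" using submodule_carrier[OF K k(1)] .
    have "a \<odot>\<^bsub>M\<^esub> z \<ominus>\<^bsub>M\<^esub> a \<odot>\<^bsub>M\<^esub> x = a \<odot>\<^bsub>M\<^esub> k"
      using a x kc by (simp add: k(2) smult_r_distr a_minus_def M.a_assoc M.r_neg)
    then show ?thesis using coset_eq_iff[OF K] submodule_smult[OF K a k(1)] a x kc k(2) by simp
  qed
  moreover have "x \<in> K +>\<^bsub>M\<^esub> x" by (rule K.a_rcos_self[OF x])
  ultimately show ?thesis by blast
qed

text \<open>A submodule has to be closed under the inverse of the additive monoid, and this inverse
  is given by a definite description; it is evaluated here directly on cosets.\<close>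

lemma quotient_inv:
  assumes K: "submodule K R M" and L: "submodule L R M" and KL: "K \<subseteq> L" and y: "y \<in> L"
  shows "inv\<^bsub>add_monoid (quotient_module M L K)\<^esub> (K +>\<^bsub>M\<^esub> y) = K +>\<^bsub>M\<^esub> (\<ominus>\<^bsub>M\<^esub> y)"
  unfolding m_inv_def
proof (rule the_equality)
  have yc: "y \<in> carrier M" using submodule_carrier[OF L y] .
  show "K +>\<^bsub>M\<^esub> (\<ominus>\<^bsub>M\<^esub> y) \<in> carrier (add_monoid (quotient_module M L K)) \<and>
    (K +>\<^bsub>M\<^esub> y) \<otimes>\<^bsub>add_monoid (quotient_module M L K)\<^esub> (K +>\<^bsub>M\<^esub> (\<ominus>\<^bsub>M\<^esub> y)) = \<one>\<^bsub>add_monoid (quotient_module M L K)\<^esub> \<and>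
    (K +>\<^bsub>M\<^esub> (\<ominus>\<^bsub>M\<^esub> y)) \<otimes>\<^bsub>add_monoid (quotient_module M L K)\<^esub> (K +>\<^bsub>M\<^esub> y) = \<one>\<^bsub>add_monoid (quotient_module M L K)\<^esub>"
    using yc submoduleE(3)[OF L y] by (auto simp: quotient_carrier_iff coset_add[OF K] coset_zero[OF K] M.r_neg M.l_neg)
  fix X assume X: "X \<in> carrier (add_monoid (quotient_module M L K)) \<and>
    (K +>\<^bsub>M\<^esub> y) \<otimes>\<^bsub>add_monoid (quotient_module M L K)\<^esub> X = \<one>\<^bsub>add_monoid (quotient_module M L K)\<^esub> \<and>
    X \<otimes>\<^bsub>add_monoid (quotient_module M L K)\<^esub> (K +>\<^bsub>M\<^esub> y) = \<one>\<^bsub>add_monoid (quotient_module M L K)\<^esub>"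
  then obtain z where z: "z \<in> L" "X = K +>\<^bsub>M\<^esub> z" by (auto simp: quotient_carrier_iff)
  have zc: "z \<in> carrier M" using submodule_carrier[OF L z(1)] .
  have n0: "\<ominus>\<^bsub>M\<^esub> \<zero>\<^bsub>M\<^esub> = \<zero>\<^bsub>M\<^esub>" by (rule M.minus_equality) simp_all
  have "K +>\<^bsub>M\<^esub> (z \<oplus>\<^bsub>M\<^esub> y) = K +>\<^bsub>M\<^esub> \<zero>\<^bsub>M\<^esub>"
    using X zc yc by (simp add: z(2) coset_add[OF K] coset_zero[OF K])
  then have "(z \<oplus>\<^bsub>M\<^esub> y) \<ominus>\<^bsub>M\<^esub> \<zero>\<^bsub>M\<^esub> \<in> K" using coset_eq_iff[OF K, of "z \<oplus>\<^bsub>M\<^esub> y" "\<zero>\<^bsub>M\<^esub>"] zc yc by simp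
  then have "z \<ominus>\<^bsub>M\<^esub> (\<ominus>\<^bsub>M\<^esub> y) \<in> K" using zc yc n0 by (simp add: a_minus_def)
  then show "X = K +>\<^bsub>M\<^esub> (\<ominus>\<^bsub>M\<^esub> y)" using coset_eq_iff[OF K zc, of "\<ominus>\<^bsub>M\<^esub> y"] yc z(2) by simp
qed

end

text \<open>Localization is described by its properties (denominators become units, every element
  has a denominator, the kernel is torsion) instead of a construction. The correspondence of
  submodules is then proved once and used for \<open>M_P\<close> as well as for \<open>R_P\<close>
  as a module over itself.\<close>

locale localization =
  fixes R :: "('a, 'c) ring_scheme" and M :: "('a, 'b, 'd) module_scheme" and P :: "'a set"
    and Rh :: "('r, 's) ring_scheme" and Mh :: "('r, 'm, 't) module_scheme"
    and iR :: "'a \<Rightarrow> 'r" and iM :: "'b \<Rightarrow> 'm"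
  assumes modM: "module R M" and modh: "module Rh Mh" and P: "primeideal P R"
    and iR: "iR \<in> ring_hom R Rh"
    and unit: "\<And>s. s \<in> carrier R - P \<Longrightarrow> iR s \<in> Units Rh"
    and iM_closed: "\<And>x. x \<in> carrier M \<Longrightarrow> iM x \<in> carrier Mh"
    and iM_add: "\<And>x y. \<lbrakk>x \<in> carrier M; y \<in> carrier M\<rbrakk> \<Longrightarrow> iM (x \<oplus>\<^bsub>M\<^esub> y) = iM x \<oplus>\<^bsub>Mh\<^esub> iM y"
    and iM_smult: "\<And>r x. \<lbrakk>r \<in> carrier R; x \<in> carrier M\<rbrakk> \<Longrightarrow> iM (r \<odot>\<^bsub>M\<^esub> x) = iR r \<odot>\<^bsub>Mh\<^esub> iM x"
    and iM_surj: "\<And>y. y \<in> carrier Mh \<Longrightarrow> \<exists>s\<in>carrier R - P. \<exists>x\<in>carrier M. iR s \<odot>\<^bsub>Mh\<^esub> y = iM x"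
    and iM_ker: "\<And>x. \<lbrakk>x \<in> carrier M; iM x = \<zero>\<^bsub>Mh\<^esub>\<rbrakk> \<Longrightarrow> \<exists>s\<in>carrier R - P. s \<odot>\<^bsub>M\<^esub> x = \<zero>\<^bsub>M\<^esub>"
    and iR_surj: "\<And>y. y \<in> carrier Rh \<Longrightarrow> \<exists>s\<in>carrier R - P. \<exists>a\<in>carrier R. iR s \<otimes>\<^bsub>Rh\<^esub> y = iR a"
begin

interpretation M: module R M by (rule modM)
interpretation Mh: module Rh Mh by (rule modh)

lemma iR_closed: "r \<in> carrier R \<Longrightarrow> iR r \<in> carrier Rh"
  using iR by (rule ring_hom_closed)

lemma iM_zero: "iM \<zero>\<^bsub>M\<^esub> = \<zero>\<^bsub>Mh\<^esub>"
proof -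
  have "iM \<zero>\<^bsub>M\<^esub> \<oplus>\<^bsub>Mh\<^esub> iM \<zero>\<^bsub>M\<^esub> = iM \<zero>\<^bsub>M\<^esub> \<oplus>\<^bsub>Mh\<^esub> \<zero>\<^bsub>Mh\<^esub>"
    using iM_add[of "\<zero>\<^bsub>M\<^esub>" "\<zero>\<^bsub>M\<^esub>"] iM_closed[of "\<zero>\<^bsub>M\<^esub>"] by simp
  then show ?thesis using iM_closed[of "\<zero>\<^bsub>M\<^esub>"] by (simp only: Mh.M.add.l_cancel Mh.M.zero_closed M.M.zero_closed)
qed

lemma iM_neg: "x \<in> carrier M \<Longrightarrow> iM (\<ominus>\<^bsub>M\<^esub> x) = \<ominus>\<^bsub>Mh\<^esub> iM x"
proof -
  assume x: "x \<in> carrier M"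
  have "iM (\<ominus>\<^bsub>M\<^esub> x) \<oplus>\<^bsub>Mh\<^esub> iM x = \<zero>\<^bsub>Mh\<^esub>"
    using iM_add[of "\<ominus>\<^bsub>M\<^esub> x" x] x iM_zero by (simp add: M.M.l_neg)
  then show ?thesis using Mh.M.minus_equality[of "iM (\<ominus>\<^bsub>M\<^esub> x)" "iM x"] x iM_closed by simp
qed

lemma unit_cancel:
  assumes H: "submodule H Rh Mh" and s: "s \<in> carrier R - P" and y: "y \<in> carrier Mh" and sy: "iR s \<odot>\<^bsub>Mh\<^esub> y \<in> H"
  shows "y \<in> H"
proof -
  have u: "iR s \<in> Units Rh" by (rule unit[OF s])
  have ui: "inv\<^bsub>Rh\<^esub> (iR s) \<in> carrier Rh" "iR s \<in> carrier Rh" using u by auto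
  have "inv\<^bsub>Rh\<^esub> (iR s) \<odot>\<^bsub>Mh\<^esub> (iR s \<odot>\<^bsub>Mh\<^esub> y) = (inv\<^bsub>Rh\<^esub> (iR s) \<otimes>\<^bsub>Rh\<^esub> iR s) \<odot>\<^bsub>Mh\<^esub> y"
    using ui y by (simp only: Mh.smult_assoc1)
  also have "\<dots> = y" using u y by (simp add: Mh.R.Units_l_inv)
  finally show ?thesis using Mh.submodule_smult[OF H ui(1) sy] by simp
qed

definition cm :: "'m set \<Rightarrow> 'b set" where "cm H = {x \<in> carrier M. iM x \<in> H}"

text \<open>Extension, described by clearing denominators rather than by choosing fractions. With
  the contraction \<open>cm\<close> it gives the bijection between submodules of \<open>Mh\<close>
  and saturated submodules of \<open>M\<close>; see \<open>cm_ex\<close> and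
  \<open>ex_cm\<close>.\<close>

definition ex :: "'b set \<Rightarrow> 'm set" where
  "ex N = {y \<in> carrier Mh. \<exists>s\<in>carrier R - P. \<exists>x\<in>N. iR s \<odot>\<^bsub>Mh\<^esub> y = iM x}"

lemma cm_submodule: assumes H: "submodule H Rh Mh" shows "submodule (cm H) R M"
proof (rule M.submoduleI')
  show "r \<odot>\<^bsub>M\<^esub> x \<in> cm H" if "r \<in> carrier R" "x \<in> cm H" for r x
    using that Mh.submodule_smult[OF H iR_closed] by (simp add: cm_def iM_smult)
qed (use H Mh.submodule_zero Mh.submodule_add in \<open>auto simp: cm_def iM_zero iM_add\<close>)

lemma cm_sat: assumes H: "submodule H Rh Mh" shows "psat R M P (cm H) = cm H"
proof
  show "psat R M P (cm H) \<subseteq> cm H"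
  proof
    fix x assume "x \<in> psat R M P (cm H)"
    then obtain s where s: "x \<in> carrier M" "s \<in> carrier R - P" "s \<odot>\<^bsub>M\<^esub> x \<in> cm H" by (auto simp: psat_def)
    then have "iR s \<odot>\<^bsub>Mh\<^esub> iM x \<in> H" by (simp add: cm_def iM_smult)
    then show "x \<in> cm H" using unit_cancel[OF H s(2) iM_closed[OF s(1)]] s(1) by (simp add: cm_def)
  qed
  show "cm H \<subseteq> psat R M P (cm H)" by (rule M.psat_upper[OF P M.submoduleE(1)[OF cm_submodule[OF H]]])
qed

lemma ex_submodule: assumes N: "submodule N R M" shows "submodule (ex N) Rh Mh"
proof (rule Mh.submoduleI')
  have one: "\<one>\<^bsub>R\<^esub> \<in> carrier R - P" by (rule primeideal_one_notin[OF P])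
  show "ex N \<subseteq> carrier Mh" by (auto simp: ex_def)
  have "iR \<one>\<^bsub>R\<^esub> \<odot>\<^bsub>Mh\<^esub> \<zero>\<^bsub>Mh\<^esub> = iM \<zero>\<^bsub>M\<^esub>" using iR_closed[of "\<one>\<^bsub>R\<^esub>"] by (simp add: iM_zero)
  then show "\<zero>\<^bsub>Mh\<^esub> \<in> ex N" using one M.submodule_zero[OF N] unfolding ex_def by blast
next
  fix y z assume "y \<in> ex N" "z \<in> ex N"
  then obtain s x t w where *: "y \<in> carrier Mh" "z \<in> carrier Mh" "s \<in> carrier R - P" "t \<in> carrier R - P"
    "x \<in> N" "w \<in> N" "iR s \<odot>\<^bsub>Mh\<^esub> y = iM x" "iR t \<odot>\<^bsub>Mh\<^esub> z = iM w" by (auto simp: ex_def)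
  have c: "s \<in> carrier R" "t \<in> carrier R" "iR s \<in> carrier Rh" "iR t \<in> carrier Rh" "x \<in> carrier M" "w \<in> carrier M"
    using * iR_closed M.submodule_carrier[OF N] by auto
  have m: "iR (t \<otimes>\<^bsub>R\<^esub> s) = iR t \<otimes>\<^bsub>Rh\<^esub> iR s" using ring_hom_mult[OF iR] c by simp
  have "iR (t \<otimes>\<^bsub>R\<^esub> s) \<odot>\<^bsub>Mh\<^esub> (y \<oplus>\<^bsub>Mh\<^esub> z)
    = iR t \<odot>\<^bsub>Mh\<^esub> (iR s \<odot>\<^bsub>Mh\<^esub> y) \<oplus>\<^bsub>Mh\<^esub> iR s \<odot>\<^bsub>Mh\<^esub> (iR t \<odot>\<^bsub>Mh\<^esub> z)"
  proof -
    have "(iR t \<otimes>\<^bsub>Rh\<^esub> iR s) \<odot>\<^bsub>Mh\<^esub> y = iR t \<odot>\<^bsub>Mh\<^esub> (iR s \<odot>\<^bsub>Mh\<^esub> y)"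
      by (rule Mh.smult_assoc1[OF c(4,3) *(1)])
    moreover have "(iR t \<otimes>\<^bsub>Rh\<^esub> iR s) \<odot>\<^bsub>Mh\<^esub> z = iR s \<odot>\<^bsub>Mh\<^esub> (iR t \<odot>\<^bsub>Mh\<^esub> z)"
      unfolding Mh.R.m_comm[OF c(4,3)] by (rule Mh.smult_assoc1[OF c(3,4) *(2)])
    ultimately show ?thesis
      unfolding m using Mh.smult_r_distr[OF Mh.R.m_closed[OF c(4,3)] *(1,2)] by simp
  qed
  also have "\<dots> = iM (t \<odot>\<^bsub>M\<^esub> x \<oplus>\<^bsub>M\<^esub> s \<odot>\<^bsub>M\<^esub> w)" using c * by (simp add: iM_add iM_smult)
  finally have eq: "iR (t \<otimes>\<^bsub>R\<^esub> s) \<odot>\<^bsub>Mh\<^esub> (y \<oplus>\<^bsub>Mh\<^esub> z) = iM (t \<odot>\<^bsub>M\<^esub> x \<oplus>\<^bsub>M\<^esub> s \<odot>\<^bsub>M\<^esub> w)" .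
  have "t \<odot>\<^bsub>M\<^esub> x \<oplus>\<^bsub>M\<^esub> s \<odot>\<^bsub>M\<^esub> w \<in> N"
    by (rule M.submodule_add[OF N M.submodule_smult[OF N c(2) *(5)] M.submodule_smult[OF N c(1) *(6)]])
  then show "y \<oplus>\<^bsub>Mh\<^esub> z \<in> ex N"
    unfolding ex_def using eq primeideal_mult_notin[OF P *(4,3)] *(1,2) by blast
next
  fix a y assume a: "a \<in> carrier Rh" and "y \<in> ex N"
  then obtain s x where *: "y \<in> carrier Mh" "s \<in> carrier R - P" "x \<in> N" "iR s \<odot>\<^bsub>Mh\<^esub> y = iM x" by (auto simp: ex_def)
  obtain t b where t: "t \<in> carrier R - P" "b \<in> carrier R" "iR t \<otimes>\<^bsub>Rh\<^esub> a = iR b" using iR_surj[OF a] by blast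
  have c: "s \<in> carrier R" "t \<in> carrier R" "iR s \<in> carrier Rh" "iR t \<in> carrier Rh" "x \<in> carrier M"
    using * t iR_closed M.submodule_carrier[OF N] by auto
  have m: "iR (t \<otimes>\<^bsub>R\<^esub> s) = iR t \<otimes>\<^bsub>Rh\<^esub> iR s" using ring_hom_mult[OF iR] c by simp
  have "(iR t \<otimes>\<^bsub>Rh\<^esub> iR s) \<otimes>\<^bsub>Rh\<^esub> a = (iR t \<otimes>\<^bsub>Rh\<^esub> a) \<otimes>\<^bsub>Rh\<^esub> iR s" using c a by (simp add: Mh.R.m_ac)
  then have "iR (t \<otimes>\<^bsub>R\<^esub> s) \<odot>\<^bsub>Mh\<^esub> (a \<odot>\<^bsub>Mh\<^esub> y) = (iR t \<otimes>\<^bsub>Rh\<^esub> a) \<odot>\<^bsub>Mh\<^esub> (iR s \<odot>\<^bsub>Mh\<^esub> y)"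
    unfolding m using c a *(1) by (simp add: Mh.smult_assoc1[symmetric])
  also have "\<dots> = iM (b \<odot>\<^bsub>M\<^esub> x)" unfolding t(3) *(4) using iM_smult[OF t(2) c(5)] by simp
  finally show "a \<odot>\<^bsub>Mh\<^esub> y \<in> ex N"
    unfolding ex_def using M.submodule_smult[OF N t(2) *(3)] primeideal_mult_notin[OF P t(1) *(2)] a *(1) by blast
qed

lemma cm_ex: assumes N: "submodule N R M" shows "cm (ex N) = psat R M P N"
proof
  show "cm (ex N) \<subseteq> psat R M P N"
  proof
    fix x assume "x \<in> cm (ex N)"
    then obtain s n where *: "x \<in> carrier M" "s \<in> carrier R - P" "n \<in> N" "iR s \<odot>\<^bsub>Mh\<^esub> iM x = iM n"
      by (auto simp: cm_def ex_def)
    have c: "s \<in> carrier R" "n \<in> carrier M" using * M.submodule_carrier[OF N] by auto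
    have "iM (s \<odot>\<^bsub>M\<^esub> x \<ominus>\<^bsub>M\<^esub> n) = \<zero>\<^bsub>Mh\<^esub>"
      using * c iM_closed by (simp add: a_minus_def iM_add iM_neg iM_smult Mh.M.r_neg)
    then obtain t where t: "t \<in> carrier R - P" "t \<odot>\<^bsub>M\<^esub> (s \<odot>\<^bsub>M\<^esub> x \<ominus>\<^bsub>M\<^esub> n) = \<zero>\<^bsub>M\<^esub>"
      using iM_ker[of "s \<odot>\<^bsub>M\<^esub> x \<ominus>\<^bsub>M\<^esub> n"] * c by auto
    define w where "w = s \<odot>\<^bsub>M\<^esub> x \<ominus>\<^bsub>M\<^esub> n"
    have w: "w \<in> carrier M" "s \<odot>\<^bsub>M\<^esub> x = w \<oplus>\<^bsub>M\<^esub> n" "t \<odot>\<^bsub>M\<^esub> w = \<zero>\<^bsub>M\<^esub>"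
      using * c t(2) by (simp_all add: w_def a_minus_def M.M.a_assoc M.M.l_neg)
    have "(t \<otimes>\<^bsub>R\<^esub> s) \<odot>\<^bsub>M\<^esub> x = t \<odot>\<^bsub>M\<^esub> (s \<odot>\<^bsub>M\<^esub> x)" using t(1) c *(1) by (simp add: M.smult_assoc1)
    also have "\<dots> = t \<odot>\<^bsub>M\<^esub> n" unfolding w(2) using t(1) w(1,3) c(2) by (simp add: M.smult_r_distr)
    also have "\<dots> \<in> N" using M.submodule_smult[OF N _ *(3), of t] t(1) by simp
    finally show "x \<in> psat R M P N" using M.psatI[OF *(1) primeideal_mult_notin[OF P t(1) *(2)]] by blast
  qed
  show "psat R M P N \<subseteq> cm (ex N)"
  proof
    fix x assume "x \<in> psat R M P N"
    then obtain s where s: "x \<in> carrier M" "s \<in> carrier R - P" "s \<odot>\<^bsub>M\<^esub> x \<in> N" by (auto simp: psat_def)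
    then have "iR s \<odot>\<^bsub>Mh\<^esub> iM x = iM (s \<odot>\<^bsub>M\<^esub> x)" by (simp add: iM_smult)
    then show "x \<in> cm (ex N)" unfolding cm_def ex_def using s iM_closed by blast
  qed
qed

lemma ex_cm: assumes H: "submodule H Rh Mh" shows "ex (cm H) = H"
proof
  show "ex (cm H) \<subseteq> H"
  proof
    fix y assume "y \<in> ex (cm H)"
    then obtain s x where "y \<in> carrier Mh" "s \<in> carrier R - P" "iM x \<in> H" "iR s \<odot>\<^bsub>Mh\<^esub> y = iM x"
      by (auto simp: ex_def cm_def)
    then show "y \<in> H" using unit_cancel[OF H] by simp
  qed
  show "H \<subseteq> ex (cm H)"
  proof
    fix y assume y: "y \<in> H"
    have yc: "y \<in> carrier Mh" using Mh.submodule_carrier[OF H y] .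
    obtain s x where s: "s \<in> carrier R - P" "x \<in> carrier M" "iR s \<odot>\<^bsub>Mh\<^esub> y = iM x" using iM_surj[OF yc] by blast
    have "iM x \<in> H" unfolding s(3)[symmetric] using Mh.submodule_smult[OF H iR_closed y] s(1) by simp
    then show "y \<in> ex (cm H)" unfolding ex_def cm_def using s yc by blast
  qed
qed

lemma ex_mono: "N \<subseteq> N' \<Longrightarrow> ex N \<subseteq> ex N'"
  unfolding ex_def by blast

lemma cm_mono: "H \<subseteq> H' \<Longrightarrow> cm H \<subseteq> cm H'"
  unfolding cm_def by blast

text \<open>Submodules of the quotient are sets of cosets; they are pulled back to \<open>M\<close>
  in one go along \<open>x \<mapsto> K + iM x\<close>. A coset that separates two of them can be
  multiplied by a denominator so as to come from \<open>M\<close>, and because that denominator acts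
  as a unit the coset still separates.\<close>

lemma module_length_quotient_le:
  assumes K: "submodule K Rh Mh" and L: "submodule L Rh Mh" and KL: "K \<subseteq> L"
  shows "module_length Rh (quotient_module Mh L K) \<le> len R M P (cm K) (cm L)"
  unfolding module_length_def len_def
proof (rule max_chain_length_map[where f = "\<lambda>H. {x \<in> cm L. K +>\<^bsub>Mh\<^esub> iM x \<in> H}"])
  let ?Q = "quotient_module Mh L K"
  fix H assume "H \<in> {H. submodule H Rh ?Q}"
  then have H: "submodule H Rh ?Q" by simp
  have Hg: "subgroup H (add_monoid ?Q)" by (rule submodule.axioms(1)[OF H])
  have Hadd: "X <+>\<^bsub>Mh\<^esub> Y \<in> H" if "X \<in> H" "Y \<in> H" for X Y using subgroup.m_closed[OF Hg that] by simp
  have Hz: "K \<in> H" using subgroup.one_closed[OF Hg] by simp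
  have Hs: "K +>\<^bsub>Mh\<^esub> (a \<odot>\<^bsub>Mh\<^esub> y) \<in> H" if a: "a \<in> carrier Rh" and y: "y \<in> carrier Mh" and "K +>\<^bsub>Mh\<^esub> y \<in> H" for a y
    using submodule.smult_closed[OF H a that(3)] Mh.coset_smult[OF K y a] by simp
  define N where "N = {x \<in> cm L. K +>\<^bsub>Mh\<^esub> iM x \<in> H}"
  have Lc: "x \<in> carrier M" "iM x \<in> L" if "x \<in> cm L" for x using that by (simp_all add: cm_def)
  have sL: "submodule (cm L) R M" by (rule cm_submodule[OF L])
  have N: "submodule N R M"
  proof (rule M.submoduleI')
    show "N \<subseteq> carrier M" using Lc by (auto simp: N_def)
    show "\<zero>\<^bsub>M\<^esub> \<in> N" using M.submodule_zero[OF sL] Hz by (simp add: N_def iM_zero Mh.coset_zero[OF K])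
    show "x \<oplus>\<^bsub>M\<^esub> y \<in> N" if "x \<in> N" "y \<in> N" for x y
      using that Hadd[of "K +>\<^bsub>Mh\<^esub> iM x" "K +>\<^bsub>Mh\<^esub> iM y"] M.submodule_add[OF sL, of x y] Lc iM_closed
      by (simp add: N_def iM_add Mh.coset_add[OF K])
    show "r \<odot>\<^bsub>M\<^esub> x \<in> N" if "r \<in> carrier R" "x \<in> N" for r x
      using that Hs[OF iR_closed iM_closed, of r x] M.submodule_smult[OF sL, of r x] Lc
      by (simp add: N_def iM_smult)
  qed
  have sat: "psat R M P N = N"
  proof
    show "psat R M P N \<subseteq> N"
    proof
      fix x assume "x \<in> psat R M P N"
      then obtain s where s: "x \<in> carrier M" "s \<in> carrier R - P" "s \<odot>\<^bsub>M\<^esub> x \<in> cm L" "K +>\<^bsub>Mh\<^esub> iM (s \<odot>\<^bsub>M\<^esub> x) \<in> H"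
        by (auto simp: psat_def N_def)
      have xL: "x \<in> cm L" using M.psatI[OF s(1-3)] cm_sat[OF L] by simp
      have u: "iR s \<in> Units Rh" by (rule unit[OF s(2)])
      have ui: "inv\<^bsub>Rh\<^esub> (iR s) \<in> carrier Rh" "iR s \<in> carrier Rh" using u by auto
      have "K +>\<^bsub>Mh\<^esub> (inv\<^bsub>Rh\<^esub> (iR s) \<odot>\<^bsub>Mh\<^esub> iM (s \<odot>\<^bsub>M\<^esub> x)) \<in> H"
        by (rule Hs[OF ui(1) _ s(4)]) (use s(1,2) iM_closed in simp)
      moreover have "inv\<^bsub>Rh\<^esub> (iR s) \<odot>\<^bsub>Mh\<^esub> iM (s \<odot>\<^bsub>M\<^esub> x) = iM x"
        using ui u s(1,2) iM_closed by (simp add: iM_smult Mh.smult_assoc1[symmetric] Mh.R.Units_l_inv)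
      ultimately show "x \<in> N" using xL by (simp add: N_def)
    qed
    show "N \<subseteq> psat R M P N" by (rule M.psat_upper[OF P M.submoduleE(1)[OF N]])
  qed
  have "K = K +>\<^bsub>Mh\<^esub> iM x" if "x \<in> cm K" for x
    using abelian_subgroup.a_rcos_const[OF Mh.submodule_abelian_subgroup[OF K]] that by (simp add: cm_def)
  then have "cm K \<subseteq> N" using cm_mono[OF KL] Hz by (auto simp: N_def)
  moreover have "N \<subseteq> psat R M P (cm L)" using cm_sat[OF L] by (auto simp: N_def)
  ultimately show "N \<in> satfam R M P (cm K) (cm L)" by (intro M.satfamI N sat)
next
  let ?Q = "quotient_module Mh L K"
  fix H H' assume "H \<in> {H. submodule H Rh ?Q}" "H' \<in> {H. submodule H Rh ?Q}" and HH: "H \<subset> H'"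
  then have H: "submodule H Rh ?Q" and H': "submodule H' Rh ?Q" by simp_all
  obtain X where X: "X \<in> H'" "X \<notin> H" using HH by blast
  have "X \<in> carrier ?Q" using subgroup.mem_carrier[OF submodule.axioms(1)[OF H'] X(1)] by simp
  then obtain y where y: "y \<in> L" "X = K +>\<^bsub>Mh\<^esub> y" by (auto simp: quotient_carrier_iff)
  have yc: "y \<in> carrier Mh" using Mh.submodule_carrier[OF L y(1)] .
  obtain s x where s: "s \<in> carrier R - P" "x \<in> carrier M" "iR s \<odot>\<^bsub>Mh\<^esub> y = iM x" using iM_surj[OF yc] by blast
  have sc: "iR s \<in> carrier Rh" using iR_closed s(1) by simp
  have u: "iR s \<in> Units Rh" by (rule unit[OF s(1)])
  have ui: "inv\<^bsub>Rh\<^esub> (iR s) \<in> carrier Rh" using u by auto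
  have xL: "x \<in> cm L" using Mh.submodule_smult[OF L sc y(1)] s by (simp add: cm_def)
  have "K +>\<^bsub>Mh\<^esub> iM x \<in> H'"
    using submodule.smult_closed[OF H' sc X(1)] Mh.coset_smult[OF K yc sc] by (simp add: y(2) s(3))
  moreover have "K +>\<^bsub>Mh\<^esub> iM x \<notin> H"
  proof
    assume xH: "K +>\<^bsub>Mh\<^esub> iM x \<in> H"
    have "K +>\<^bsub>Mh\<^esub> (inv\<^bsub>Rh\<^esub> (iR s) \<odot>\<^bsub>Mh\<^esub> iM x) \<in> H"
      using submodule.smult_closed[OF H ui xH] Mh.coset_smult[OF K iM_closed[OF s(2)] ui] by simp
    moreover have "inv\<^bsub>Rh\<^esub> (iR s) \<odot>\<^bsub>Mh\<^esub> iM x = y"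
      unfolding s(3)[symmetric] using ui sc u yc by (simp add: Mh.smult_assoc1[symmetric] Mh.R.Units_l_inv)
    ultimately show False using X(2) y(2) by simp
  qed
  ultimately show "{x \<in> cm L. K +>\<^bsub>Mh\<^esub> iM x \<in> H} \<subset> {x \<in> cm L. K +>\<^bsub>Mh\<^esub> iM x \<in> H'}"
    using xL HH by blast
qed

lemma module_length_quotient_ge:
  assumes K: "submodule K Rh Mh" and L: "submodule L Rh Mh" and KL: "K \<subseteq> L"
  shows "len R M P (cm K) (cm L) \<le> module_length Rh (quotient_module Mh L K)"
  unfolding module_length_def len_def
proof (rule max_chain_length_map[where f = "\<lambda>N. (\<lambda>y. K +>\<^bsub>Mh\<^esub> y) ` ex N"])
  let ?Q = "quotient_module Mh L K"
  have *: "submodule N R M" "psat R M P N = N" "submodule (ex N) Rh Mh" "K \<subseteq> ex N" "ex N \<subseteq> L"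
    if N: "N \<in> satfam R M P (cm K) (cm L)" for N
  proof -
    show 1: "submodule N R M" "psat R M P N = N" using N by (simp_all add: satfam_def)
    show "submodule (ex N) Rh Mh" by (rule ex_submodule[OF 1(1)])
    show "K \<subseteq> ex N" using ex_mono[of "cm K" N] ex_cm[OF K] N by (simp add: satfam_def)
    show "ex N \<subseteq> L" using ex_mono[of N "cm L"] ex_cm[OF L] N cm_sat[OF L] by (simp add: satfam_def)
  qed
  fix N assume N: "N \<in> satfam R M P (cm K) (cm L)"
  note N' = *[OF N]
  have c: "y \<in> carrier Mh" if "y \<in> ex N" for y using Mh.submodule_carrier[OF N'(3) that] .
  have "submodule ((\<lambda>y. K +>\<^bsub>Mh\<^esub> y) ` ex N) Rh ?Q"
  proof (intro submodule.intro subgroup.intro submodule_axioms.intro)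
    show "(\<lambda>y. K +>\<^bsub>Mh\<^esub> y) ` ex N \<subseteq> carrier (add_monoid ?Q)"
      using N'(5) by (simp add: image_subset_iff quotient_carrier_iff) blast
    show "\<one>\<^bsub>add_monoid ?Q\<^esub> \<in> (\<lambda>y. K +>\<^bsub>Mh\<^esub> y) ` ex N"
      using Mh.submodule_zero[OF N'(3)] Mh.coset_zero[OF K] by (auto simp: image_iff intro!: bexI[of _ "\<zero>\<^bsub>Mh\<^esub>"])
  next
    fix X Y assume "X \<in> (\<lambda>y. K +>\<^bsub>Mh\<^esub> y) ` ex N" "Y \<in> (\<lambda>y. K +>\<^bsub>Mh\<^esub> y) ` ex N"
    then obtain x y where xy: "x \<in> ex N" "y \<in> ex N" "X = K +>\<^bsub>Mh\<^esub> x" "Y = K +>\<^bsub>Mh\<^esub> y" by blast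
    have "X \<otimes>\<^bsub>add_monoid ?Q\<^esub> Y = K +>\<^bsub>Mh\<^esub> (x \<oplus>\<^bsub>Mh\<^esub> y)" using xy c Mh.coset_add[OF K] by simp
    then show "X \<otimes>\<^bsub>add_monoid ?Q\<^esub> Y \<in> (\<lambda>y. K +>\<^bsub>Mh\<^esub> y) ` ex N"
      using Mh.submodule_add[OF N'(3) xy(1,2)] by blast
  next
    fix X assume "X \<in> (\<lambda>y. K +>\<^bsub>Mh\<^esub> y) ` ex N"
    then obtain x where x: "x \<in> ex N" "X = K +>\<^bsub>Mh\<^esub> x" by blast
    have xL: "x \<in> L" using x(1) N'(5) by blast
    show "inv\<^bsub>add_monoid ?Q\<^esub> X \<in> (\<lambda>y. K +>\<^bsub>Mh\<^esub> y) ` ex N"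
      unfolding x(2) Mh.quotient_inv[OF K L KL xL] using Mh.submoduleE(3)[OF N'(3) x(1)] by blast
  next
    fix a X assume a: "a \<in> carrier Rh" and "X \<in> (\<lambda>y. K +>\<^bsub>Mh\<^esub> y) ` ex N"
    then obtain x where x: "x \<in> ex N" "X = K +>\<^bsub>Mh\<^esub> x" by blast
    have "a \<odot>\<^bsub>?Q\<^esub> X = K +>\<^bsub>Mh\<^esub> (a \<odot>\<^bsub>Mh\<^esub> x)" using Mh.coset_smult[OF K c[OF x(1)] a] by (simp add: x(2))
    then show "a \<odot>\<^bsub>?Q\<^esub> X \<in> (\<lambda>y. K +>\<^bsub>Mh\<^esub> y) ` ex N"
      using Mh.submodule_smult[OF N'(3) a x(1)] by blast
  qed
  then show "(\<lambda>y. K +>\<^bsub>Mh\<^esub> y) ` ex N \<in> {H. submodule H Rh ?Q}" by simp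
  fix N1 assume N1: "N1 \<in> satfam R M P (cm K) (cm L)" and NN: "N \<subset> N1"
  note N1' = *[OF N1]
  obtain x where x: "x \<in> N1" "x \<notin> N" using NN by blast
  have xc: "x \<in> carrier M" using M.submodule_carrier[OF N1'(1) x(1)] .
  have ix: "iM x \<in> ex N1" using x(1) N1' cm_ex[OF N1'(1)] unfolding cm_def by blast
  have "K +>\<^bsub>Mh\<^esub> iM x \<notin> (\<lambda>y. K +>\<^bsub>Mh\<^esub> y) ` ex N"
  proof
    assume "K +>\<^bsub>Mh\<^esub> iM x \<in> (\<lambda>y. K +>\<^bsub>Mh\<^esub> y) ` ex N"
    then obtain y where y: "y \<in> ex N" "K +>\<^bsub>Mh\<^esub> iM x = K +>\<^bsub>Mh\<^esub> y" by blast
    have "iM x \<ominus>\<^bsub>Mh\<^esub> y \<in> ex N"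
      using Mh.coset_eq_iff[OF K iM_closed[OF xc] c[OF y(1)]] y(2) N'(4) by blast
    then have "(iM x \<ominus>\<^bsub>Mh\<^esub> y) \<oplus>\<^bsub>Mh\<^esub> y \<in> ex N" using Mh.submodule_add[OF N'(3)] y(1) by blast
    moreover have "(iM x \<ominus>\<^bsub>Mh\<^esub> y) \<oplus>\<^bsub>Mh\<^esub> y = iM x"
      using iM_closed[OF xc] c[OF y(1)] by (simp add: a_minus_def Mh.M.a_assoc Mh.M.l_neg)
    ultimately have "x \<in> cm (ex N)" using xc by (simp add: cm_def)
    then show False using cm_ex[OF N'(1)] N'(2) x(2) by simp
  qed
  then show "(\<lambda>y. K +>\<^bsub>Mh\<^esub> y) ` ex N \<subset> (\<lambda>y. K +>\<^bsub>Mh\<^esub> y) ` ex N1"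
    using ix ex_mono[of N N1] NN by blast
qed

lemma module_length_quotient:
  assumes "submodule K Rh Mh" "submodule L Rh Mh" "K \<subseteq> L"
  shows "module_length Rh (quotient_module Mh L K) = len R M P (cm K) (cm L)"
  using module_length_quotient_le[OF assms] module_length_quotient_ge[OF assms] by (rule antisym)

lemma iR_image: assumes "ideal J R" shows "iR ` J \<subseteq> carrier Rh"
  using iR_closed ideal.axioms(1)[OF assms] additive_subgroup.a_subset by blast

lemma ext_ideal: assumes "ideal J R" shows "ideal (genideal Rh (iR ` J)) Rh"
  by (rule Mh.R.genideal_ideal[OF iR_image[OF assms]])

lemma ideal_smult_isub: "ideal_smult Rh I Mh = isub Rh Mh I (carrier Mh)"
  by (simp add: ideal_smult_def isub_def)

lemma ideal_smult_submodule:
  assumes "ideal J R" shows "submodule (ideal_smult Rh (genideal Rh (iR ` J)) Mh) Rh Mh"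
  unfolding ideal_smult_isub
  by (rule Mh.isub_submodule[OF _ subset_refl])
    (use ideal.axioms(1)[OF ext_ideal[OF assms]] additive_subgroup.a_subset in blast)

text \<open>Products of images of elements of \<open>J\<close> with module elements fall into
  \<open>J M\<close> after clearing one denominator. Arbitrary elements of the extended ideal follow
  from the minimality of \<open>genideal\<close>, since the multipliers of a fixed element into a
  submodule form an ideal.\<close>

lemma cm_ideal_smult:
  assumes J: "ideal J R"
  shows "cm (ideal_smult Rh (genideal Rh (iR ` J)) Mh) = psat R M P (isub R M J (carrier M))"
proof
  let ?J = "genideal Rh (iR ` J)" and ?N = "isub R M J (carrier M)"
  note sJ = ideal_smult_submodule[OF J]
  have Jc: "J \<subseteq> carrier R" using ideal.axioms(1)[OF J] additive_subgroup.a_subset by blast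
  have N: "submodule ?N R M" by (rule M.isub_submodule[OF Jc subset_refl])
  have "ideal_smult Rh ?J Mh \<subseteq> ex ?N"
    unfolding ideal_smult_isub
  proof (rule Mh.isub_least[OF ex_submodule[OF N]])
    fix a y assume a: "a \<in> ?J" and y: "y \<in> carrier Mh"
    have "?J \<subseteq> {a \<in> carrier Rh. a \<odot>\<^bsub>Mh\<^esub> y \<in> ex ?N}"
    proof (rule Mh.R.genideal_minimal[OF Mh.submodule_ideal_quot[OF ex_submodule[OF N] y]], rule subsetI)
      fix b assume "b \<in> iR ` J"
      then obtain j where j: "j \<in> J" "b = iR j" by blast
      have jc: "j \<in> carrier R" using j Jc by blast
      obtain s x where s: "s \<in> carrier R - P" "x \<in> carrier M" "iR s \<odot>\<^bsub>Mh\<^esub> y = iM x" using iM_surj[OF y] by blast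
      have c: "iR s \<in> carrier Rh" "iR j \<in> carrier Rh" using s(1) jc iR_closed by simp_all
      have "iR s \<odot>\<^bsub>Mh\<^esub> (iR j \<odot>\<^bsub>Mh\<^esub> y) = iR j \<odot>\<^bsub>Mh\<^esub> (iR s \<odot>\<^bsub>Mh\<^esub> y)"
        using Mh.smult_assoc1[OF c y] Mh.smult_assoc1[OF c(2,1) y] Mh.R.m_comm[OF c] by simp
      also have "\<dots> = iM (j \<odot>\<^bsub>M\<^esub> x)" unfolding s(3) using iM_smult[OF jc s(2)] by simp
      finally have "iR j \<odot>\<^bsub>Mh\<^esub> y \<in> ex ?N"
        unfolding ex_def using s(1) M.isub_mem[OF j(1) s(2)] Mh.smult_closed[OF c(2) y] by blast
      then show "b \<in> {a \<in> carrier Rh. a \<odot>\<^bsub>Mh\<^esub> y \<in> ex ?N}" using c(2) j(2) by simp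
    qed
    then show "a \<odot>\<^bsub>Mh\<^esub> y \<in> ex ?N" using a by blast
  qed
  then show "cm (ideal_smult Rh ?J Mh) \<subseteq> psat R M P ?N" using cm_mono cm_ex[OF N] by blast
  have "?N \<subseteq> cm (ideal_smult Rh ?J Mh)"
  proof (rule M.isub_least[OF cm_submodule[OF sJ]])
    fix j x assume j: "j \<in> J" and x: "x \<in> carrier M"
    have "iR j \<in> ?J" using Mh.R.genideal_self[OF iR_image[OF J]] j by blast
    then have "iR j \<odot>\<^bsub>Mh\<^esub> iM x \<in> ideal_smult Rh ?J Mh"
      unfolding ideal_smult_isub using Mh.isub_mem iM_closed[OF x] by blast
    then show "j \<odot>\<^bsub>M\<^esub> x \<in> cm (ideal_smult Rh ?J Mh)" using j Jc x by (auto simp: cm_def iM_smult)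
  qed
  then show "psat R M P ?N \<subseteq> cm (ideal_smult Rh ?J Mh)" using M.psat_mono cm_sat[OF sJ] by blast
qed

end

lemma cm_genideal:
  assumes l: "localization R (self_module R) P Rh (self_module Rh) iR iR" and R: "cring R" and Rh: "cring Rh"
    and J: "ideal J R"
  shows "localization.cm (self_module R) iR (genideal Rh (iR ` J)) = psat R (self_module R) P J"
    "submodule (genideal Rh (iR ` J)) Rh (self_module Rh)"
proof -
  interpret localization R "self_module R" P Rh "self_module Rh" iR iR by (rule l)
  interpret R: cring R by (rule R)
  interpret Rh: cring Rh by (rule Rh)
  interpret S: module R "self_module R" by (rule R.module_self)
  let ?J = "genideal Rh (iR ` J)"
  show sJ: "submodule ?J Rh (self_module Rh)" using ext_ideal[OF J] by (simp add: Rh.submodule_self_iff)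
  have N: "submodule J R (self_module R)" by (rule R.submodule_self_ideal[OF J])
  have "?J \<subseteq> ex J"
  proof (rule Rh.genideal_minimal, unfold Rh.submodule_self_iff[symmetric])
    show "submodule (ex J) Rh (self_module Rh)" by (rule ex_submodule[OF N])
    show "iR ` J \<subseteq> ex J"
    proof
      fix b assume "b \<in> iR ` J"
      then obtain j where j: "j \<in> J" "b = iR j" by blast
      have "j \<in> carrier R" using S.submodule_carrier[OF N j(1)] by simp
      then have "b \<in> carrier Rh" using iR_closed j(2) by simp
      moreover have "iR \<one>\<^bsub>R\<^esub> = \<one>\<^bsub>Rh\<^esub>" by (rule ring_hom_one[OF iR])
      ultimately have "iR \<one>\<^bsub>R\<^esub> \<odot>\<^bsub>self_module Rh\<^esub> b = iR j" using j(2) by simp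
      then show "b \<in> ex J" unfolding ex_def using primeideal_one_notin[OF P] j(1) \<open>b \<in> carrier Rh\<close> by auto
    qed
  qed
  then have 1: "cm ?J \<subseteq> psat R (self_module R) P J" using cm_mono cm_ex[OF N] by blast
  have "J \<subseteq> cm ?J"
    using Rh.genideal_self[OF iR_image[OF J]] S.submodule_carrier[OF N] by (auto simp: cm_def)
  then have "psat R (self_module R) P J \<subseteq> cm ?J" using S.psat_mono cm_sat[OF sJ] by blast
  then show "cm ?J = psat R (self_module R) P J" using 1 by (intro antisym)
qed

subsection \<open>Fractions\<close>

context module
begin

context
  fixes P assumes P: "primeideal P R"
begin

abbreviation (input) "S \<equiv> carrier R - P"
abbreviation (input) "fr \<equiv> fraction R M (carrier R - P)"

lemma fr_iff: "(y, t) \<in> fr x s \<longleftrightarrow> y \<in> carrier M \<and> t \<in> S \<and> (\<exists>u\<in>S. u \<odot>\<^bsub>M\<^esub> (t \<odot>\<^bsub>M\<^esub> x) = u \<odot>\<^bsub>M\<^esub> (s \<odot>\<^bsub>M\<^esub> y))"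
  by (simp add: fraction_def)

lemma S_mult: "s \<in> S \<Longrightarrow> t \<in> S \<Longrightarrow> s \<otimes> t \<in> S"
  by (rule primeideal_mult_notin[OF P])

text \<open>Transitivity of equality of fractions when nothing can be cancelled: the product of the
  two witnesses and the shared denominator \<open>s\<close> is a witness for the third
  equality.\<close>

lemma fr_trans:
  assumes c: "x \<in> carrier M" "s \<in> S" "y \<in> carrier M" "t \<in> S" and xy: "(y, t) \<in> fr x s"
  shows "fr x s \<subseteq> fr y t"
proof
  fix w assume w: "w \<in> fr x s"
  obtain z r where zr: "w = (z, r)" by (cases w)
  obtain v where v: "z \<in> carrier M" "r \<in> S" "v \<in> S" "v \<odot>\<^bsub>M\<^esub> (r \<odot>\<^bsub>M\<^esub> x) = v \<odot>\<^bsub>M\<^esub> (s \<odot>\<^bsub>M\<^esub> z)"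
    using w unfolding zr fr_iff by blast
  obtain u where u: "u \<in> S" "u \<odot>\<^bsub>M\<^esub> (t \<odot>\<^bsub>M\<^esub> x) = u \<odot>\<^bsub>M\<^esub> (s \<odot>\<^bsub>M\<^esub> y)"
    using xy unfolding fr_iff by blast
  have cr: "s \<in> carrier R" "t \<in> carrier R" "r \<in> carrier R" "u \<in> carrier R" "v \<in> carrier R" using c v u by auto
  have "(u \<otimes> v \<otimes> s) \<odot>\<^bsub>M\<^esub> (r \<odot>\<^bsub>M\<^esub> y) = (v \<otimes> r) \<odot>\<^bsub>M\<^esub> (u \<odot>\<^bsub>M\<^esub> (s \<odot>\<^bsub>M\<^esub> y))"
    using cr c(3) by (simp add: smult_assoc1[symmetric] R.m_ac)
  also have "\<dots> = (u \<otimes> t) \<odot>\<^bsub>M\<^esub> (v \<odot>\<^bsub>M\<^esub> (r \<odot>\<^bsub>M\<^esub> x))"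
    unfolding u(2)[symmetric] using cr c(1) by (simp add: smult_assoc1[symmetric] R.m_ac)
  also have "\<dots> = (u \<otimes> v \<otimes> s) \<odot>\<^bsub>M\<^esub> (t \<odot>\<^bsub>M\<^esub> z)"
    unfolding v(4) using cr v(1) by (simp add: smult_assoc1[symmetric] R.m_ac)
  finally show "w \<in> fr y t"
    unfolding zr fr_iff using v(1,2) S_mult[OF S_mult[OF u(1) v(3)] c(2)] by blast
qed

lemma fr_eq:
  assumes c: "x \<in> carrier M" "s \<in> S" "y \<in> carrier M" "t \<in> S" and xy: "(y, t) \<in> fr x s"
  shows "fr x s = fr y t"
proof (rule antisym)
  show "fr x s \<subseteq> fr y t" by (rule fr_trans[OF assms])
  have "(x, s) \<in> fr y t" using xy c unfolding fr_iff by metis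
  then show "fr y t \<subseteq> fr x s" by (rule fr_trans[OF c(3,4,1,2)])
qed

lemma fr_eqI:
  assumes c: "x \<in> carrier M" "s \<in> S" "y \<in> carrier M" "t \<in> S" and xy: "t \<odot>\<^bsub>M\<^esub> x = s \<odot>\<^bsub>M\<^esub> y"
  shows "fr x s = fr y t"
  by (rule fr_eq[OF c]) (use c xy primeideal_one_notin[OF P] in \<open>auto simp: fr_iff intro!: bexI[of _ \<one>]\<close>)

lemma fr_self: "x \<in> carrier M \<Longrightarrow> s \<in> S \<Longrightarrow> (x, s) \<in> fr x s"
  unfolding fr_iff using primeideal_one_notin[OF P] by blast

lemma fr_eqD:
  assumes "x \<in> carrier M" "s \<in> S" "y \<in> carrier M" "t \<in> S" "fr x s = fr y t"
  shows "\<exists>u\<in>S. u \<odot>\<^bsub>M\<^esub> (t \<odot>\<^bsub>M\<^esub> x) = u \<odot>\<^bsub>M\<^esub> (s \<odot>\<^bsub>M\<^esub> y)"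
  using fr_self[OF assms(3,4)] unfolding assms(5)[symmetric] fr_iff by blast

abbreviation (input) "L \<equiv> localize_module R M (carrier R - P)"

lemma loc_carrier: "carrier L = {fr x s | x s. x \<in> carrier M \<and> s \<in> S}"
  by (simp add: localize_module_def)

lemma loc_zero: "\<zero>\<^bsub>L\<^esub> = fr \<zero>\<^bsub>M\<^esub> \<one>"
  by (simp add: localize_module_def)

text \<open>The sum is encoded as a union over all representatives. The fact \<open>*\<close> shows
  that the members of this union coincide, and the given representatives show that the common value
  occurs.\<close>

lemma loc_add:
  assumes c: "x \<in> carrier M" "s \<in> S" "y \<in> carrier M" "t \<in> S"
  shows "fr x s \<oplus>\<^bsub>L\<^esub> fr y t = fr (t \<odot>\<^bsub>M\<^esub> x \<oplus>\<^bsub>M\<^esub> s \<odot>\<^bsub>M\<^esub> y) (s \<otimes> t)"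
proof -
  have *: "fr (t' \<odot>\<^bsub>M\<^esub> x' \<oplus>\<^bsub>M\<^esub> s' \<odot>\<^bsub>M\<^esub> y') (s' \<otimes> t') = fr (t \<odot>\<^bsub>M\<^esub> x \<oplus>\<^bsub>M\<^esub> s \<odot>\<^bsub>M\<^esub> y) (s \<otimes> t)"
    if xs: "(x', s') \<in> fr x s" and yt: "(y', t') \<in> fr y t" for x' s' y' t'
  proof -
    obtain u where u: "x' \<in> carrier M" "s' \<in> S" "u \<in> S" "u \<odot>\<^bsub>M\<^esub> (s' \<odot>\<^bsub>M\<^esub> x) = u \<odot>\<^bsub>M\<^esub> (s \<odot>\<^bsub>M\<^esub> x')"
      using xs unfolding fr_iff by blast
    obtain v where v: "y' \<in> carrier M" "t' \<in> S" "v \<in> S" "v \<odot>\<^bsub>M\<^esub> (t' \<odot>\<^bsub>M\<^esub> y) = v \<odot>\<^bsub>M\<^esub> (t \<odot>\<^bsub>M\<^esub> y')"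
      using yt unfolding fr_iff by blast
    have cr: "s \<in> carrier R" "t \<in> carrier R" "s' \<in> carrier R" "t' \<in> carrier R" "u \<in> carrier R" "v \<in> carrier R"
      using c u v by auto
    have 1: "(u \<otimes> v) \<odot>\<^bsub>M\<^esub> ((s \<otimes> t) \<odot>\<^bsub>M\<^esub> (t' \<odot>\<^bsub>M\<^esub> x')) = (u \<otimes> v) \<odot>\<^bsub>M\<^esub> ((s' \<otimes> t') \<odot>\<^bsub>M\<^esub> (t \<odot>\<^bsub>M\<^esub> x))"
    proof -
      have "(u \<otimes> v) \<odot>\<^bsub>M\<^esub> ((s \<otimes> t) \<odot>\<^bsub>M\<^esub> (t' \<odot>\<^bsub>M\<^esub> x')) = (v \<otimes> t \<otimes> t') \<odot>\<^bsub>M\<^esub> (u \<odot>\<^bsub>M\<^esub> (s \<odot>\<^bsub>M\<^esub> x'))"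
        using cr u(1) by (simp add: smult_assoc1[symmetric] R.m_ac)
      also have "\<dots> = (u \<otimes> v) \<odot>\<^bsub>M\<^esub> ((s' \<otimes> t') \<odot>\<^bsub>M\<^esub> (t \<odot>\<^bsub>M\<^esub> x))"
        unfolding u(4)[symmetric] using cr c(1) by (simp add: smult_assoc1[symmetric] R.m_ac)
      finally show ?thesis .
    qed
    have 2: "(u \<otimes> v) \<odot>\<^bsub>M\<^esub> ((s \<otimes> t) \<odot>\<^bsub>M\<^esub> (s' \<odot>\<^bsub>M\<^esub> y')) = (u \<otimes> v) \<odot>\<^bsub>M\<^esub> ((s' \<otimes> t') \<odot>\<^bsub>M\<^esub> (s \<odot>\<^bsub>M\<^esub> y))"
    proof -
      have "(u \<otimes> v) \<odot>\<^bsub>M\<^esub> ((s \<otimes> t) \<odot>\<^bsub>M\<^esub> (s' \<odot>\<^bsub>M\<^esub> y')) = (u \<otimes> s \<otimes> s') \<odot>\<^bsub>M\<^esub> (v \<odot>\<^bsub>M\<^esub> (t \<odot>\<^bsub>M\<^esub> y'))"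
        using cr v(1) by (simp add: smult_assoc1[symmetric] R.m_ac)
      also have "\<dots> = (u \<otimes> v) \<odot>\<^bsub>M\<^esub> ((s' \<otimes> t') \<odot>\<^bsub>M\<^esub> (s \<odot>\<^bsub>M\<^esub> y))"
        unfolding v(4)[symmetric] using cr c(3) by (simp add: smult_assoc1[symmetric] R.m_ac)
      finally show ?thesis .
    qed
    have st: "s \<otimes> t \<in> S" "s' \<otimes> t' \<in> S" "u \<otimes> v \<in> S" using S_mult c u v by blast+
    show ?thesis
    proof (rule fr_eq)
      have "(u \<otimes> v) \<odot>\<^bsub>M\<^esub> ((s \<otimes> t) \<odot>\<^bsub>M\<^esub> (t' \<odot>\<^bsub>M\<^esub> x' \<oplus>\<^bsub>M\<^esub> s' \<odot>\<^bsub>M\<^esub> y'))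
        = (u \<otimes> v) \<odot>\<^bsub>M\<^esub> ((s' \<otimes> t') \<odot>\<^bsub>M\<^esub> (t \<odot>\<^bsub>M\<^esub> x \<oplus>\<^bsub>M\<^esub> s \<odot>\<^bsub>M\<^esub> y))"
        using 1 2 cr c(1,3) u(1) v(1) by (simp add: smult_r_distr)
      then show "(t \<odot>\<^bsub>M\<^esub> x \<oplus>\<^bsub>M\<^esub> s \<odot>\<^bsub>M\<^esub> y, s \<otimes> t) \<in> fr (t' \<odot>\<^bsub>M\<^esub> x' \<oplus>\<^bsub>M\<^esub> s' \<odot>\<^bsub>M\<^esub> y') (s' \<otimes> t')"
        unfolding fr_iff using st cr c(1,3) by blast
    qed (use st cr c u v in simp_all)
  qed
  have "fr x s \<oplus>\<^bsub>L\<^esub> fr y t = (\<Union>(x', s')\<in>fr x s. \<Union>(y', t')\<in>fr y t.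
      fr (t' \<odot>\<^bsub>M\<^esub> x' \<oplus>\<^bsub>M\<^esub> s' \<odot>\<^bsub>M\<^esub> y') (s' \<otimes> t'))"
    by (simp add: localize_module_def)
  also have "\<dots> = fr (t \<odot>\<^bsub>M\<^esub> x \<oplus>\<^bsub>M\<^esub> s \<odot>\<^bsub>M\<^esub> y) (s \<otimes> t)"
  proof (rule antisym)
    show "(\<Union>(x', s')\<in>fr x s. \<Union>(y', t')\<in>fr y t. fr (t' \<odot>\<^bsub>M\<^esub> x' \<oplus>\<^bsub>M\<^esub> s' \<odot>\<^bsub>M\<^esub> y') (s' \<otimes> t'))
      \<subseteq> fr (t \<odot>\<^bsub>M\<^esub> x \<oplus>\<^bsub>M\<^esub> s \<odot>\<^bsub>M\<^esub> y) (s \<otimes> t)"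
    proof (rule UN_least, clarify)
      fix x' s' w1 w2 y' t' assume a: "(x', s') \<in> fr x s" "(y', t') \<in> fr y t"
        "(w1, w2) \<in> fr (t' \<odot>\<^bsub>M\<^esub> x' \<oplus>\<^bsub>M\<^esub> s' \<odot>\<^bsub>M\<^esub> y') (s' \<otimes> t')"
      then show "(w1, w2) \<in> fr (t \<odot>\<^bsub>M\<^esub> x \<oplus>\<^bsub>M\<^esub> s \<odot>\<^bsub>M\<^esub> y) (s \<otimes> t)" using *[OF a(1,2)] by simp
    qed
    show "fr (t \<odot>\<^bsub>M\<^esub> x \<oplus>\<^bsub>M\<^esub> s \<odot>\<^bsub>M\<^esub> y) (s \<otimes> t)
      \<subseteq> (\<Union>(x', s')\<in>fr x s. \<Union>(y', t')\<in>fr y t. fr (t' \<odot>\<^bsub>M\<^esub> x' \<oplus>\<^bsub>M\<^esub> s' \<odot>\<^bsub>M\<^esub> y') (s' \<otimes> t'))"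
      using fr_self[OF c(1,2)] fr_self[OF c(3,4)] by blast
  qed
  finally show ?thesis .
qed

lemma loc_smult:
  assumes c: "a \<in> carrier R" "s \<in> S" "y \<in> carrier M" "t \<in> S"
  shows "ring_fraction R S a s \<odot>\<^bsub>L\<^esub> fr y t = fr (a \<odot>\<^bsub>M\<^esub> y) (s \<otimes> t)"
proof -
  have *: "fr (a' \<odot>\<^bsub>M\<^esub> y') (s' \<otimes> t') = fr (a \<odot>\<^bsub>M\<^esub> y) (s \<otimes> t)"
    if xs: "(a', s') \<in> ring_fraction R S a s" and yt: "(y', t') \<in> fr y t" for a' s' y' t'
  proof -
    obtain u where u: "a' \<in> carrier R" "s' \<in> S" "u \<in> S" "u \<otimes> (s' \<otimes> a) = u \<otimes> (s \<otimes> a')"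
      using xs unfolding fraction_def by auto
    obtain v where v: "y' \<in> carrier M" "t' \<in> S" "v \<in> S" "v \<odot>\<^bsub>M\<^esub> (t' \<odot>\<^bsub>M\<^esub> y) = v \<odot>\<^bsub>M\<^esub> (t \<odot>\<^bsub>M\<^esub> y')"
      using yt unfolding fr_iff by blast
    have cr: "s \<in> carrier R" "t \<in> carrier R" "s' \<in> carrier R" "t' \<in> carrier R" "u \<in> carrier R" "v \<in> carrier R"
      using c u v by auto
    have st: "s \<otimes> t \<in> S" "s' \<otimes> t' \<in> S" "u \<otimes> v \<in> S" using S_mult c u v by blast+
    show ?thesis
    proof (rule fr_eq)
      have "(u \<otimes> v) \<odot>\<^bsub>M\<^esub> ((s \<otimes> t) \<odot>\<^bsub>M\<^esub> (a' \<odot>\<^bsub>M\<^esub> y')) = (u \<otimes> (s \<otimes> a')) \<odot>\<^bsub>M\<^esub> (v \<odot>\<^bsub>M\<^esub> (t \<odot>\<^bsub>M\<^esub> y'))"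
        using cr u(1) v(1) by (simp add: smult_assoc1[symmetric] R.m_ac)
      also have "\<dots> = (u \<otimes> v) \<odot>\<^bsub>M\<^esub> ((s' \<otimes> t') \<odot>\<^bsub>M\<^esub> (a \<odot>\<^bsub>M\<^esub> y))"
        unfolding u(4)[symmetric] v(4)[symmetric] using cr c(1,3) by (simp add: smult_assoc1[symmetric] R.m_ac)
      finally show "(a \<odot>\<^bsub>M\<^esub> y, s \<otimes> t) \<in> fr (a' \<odot>\<^bsub>M\<^esub> y') (s' \<otimes> t')"
        unfolding fr_iff using st c by blast
    qed (use st c u v in simp_all)
  qed
  have sf: "(a, s) \<in> ring_fraction R S a s"
    unfolding fraction_def using c primeideal_one_notin[OF P] by auto
  have "ring_fraction R S a s \<odot>\<^bsub>L\<^esub> fr y t = (\<Union>(a', s')\<in>ring_fraction R S a s. \<Union>(y', t')\<in>fr y t.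
      fr (a' \<odot>\<^bsub>M\<^esub> y') (s' \<otimes> t'))"
    by (simp add: localize_module_def)
  also have "\<dots> = fr (a \<odot>\<^bsub>M\<^esub> y) (s \<otimes> t)"
  proof (rule antisym)
    show "(\<Union>(a', s')\<in>ring_fraction R S a s. \<Union>(y', t')\<in>fr y t. fr (a' \<odot>\<^bsub>M\<^esub> y') (s' \<otimes> t'))
      \<subseteq> fr (a \<odot>\<^bsub>M\<^esub> y) (s \<otimes> t)"
    proof (rule UN_least, clarify)
      fix x' s' w1 w2 y' t' assume a: "(x', s') \<in> ring_fraction R S a s" "(y', t') \<in> fr y t"
        "(w1, w2) \<in> fr (x' \<odot>\<^bsub>M\<^esub> y') (s' \<otimes> t')"
      then show "(w1, w2) \<in> fr (a \<odot>\<^bsub>M\<^esub> y) (s \<otimes> t)" using *[OF a(1,2)] by simp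
    qed
    show "fr (a \<odot>\<^bsub>M\<^esub> y) (s \<otimes> t)
      \<subseteq> (\<Union>(a', s')\<in>ring_fraction R S a s. \<Union>(y', t')\<in>fr y t. fr (a' \<odot>\<^bsub>M\<^esub> y') (s' \<otimes> t'))"
      using sf fr_self[OF c(3,4)] by blast
  qed
  finally show ?thesis .
qed

lemma locE:
  assumes "X \<in> carrier L" obtains x s where "x \<in> carrier M" "s \<in> S" "X = fr x s"
  using assms unfolding loc_carrier by blast

lemma loc_memI: "x \<in> carrier M \<Longrightarrow> s \<in> S \<Longrightarrow> fr x s \<in> carrier L"
  unfolding loc_carrier by blast

lemma abelian_group_loc: "abelian_group L"
proof (rule abelian_groupI)
  note one = primeideal_one_notin[OF P]
  show "\<zero>\<^bsub>L\<^esub> \<in> carrier L" unfolding loc_zero by (rule loc_memI[OF M.zero_closed one])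
  fix X assume "X \<in> carrier L"
  then obtain x s where X: "x \<in> carrier M" "s \<in> S" "X = fr x s" by (rule locE)
  have sc: "s \<in> carrier R" using X(2) by simp
  show "\<zero>\<^bsub>L\<^esub> \<oplus>\<^bsub>L\<^esub> X = X"
    unfolding loc_zero X(3) loc_add[OF M.zero_closed one X(1,2)] using X sc by simp
  have "(\<ominus>\<^bsub>M\<^esub> x) \<in> carrier M" using X(1) by simp
  moreover have "fr (\<ominus>\<^bsub>M\<^esub> x) s \<oplus>\<^bsub>L\<^esub> X = \<zero>\<^bsub>L\<^esub>"
    unfolding loc_zero X(3) loc_add[OF M.a_inv_closed[OF X(1)] X(2,1,2)]
  proof (rule fr_eqI[OF _ S_mult[OF X(2,2)] M.zero_closed one])
    show "\<one> \<odot>\<^bsub>M\<^esub> (s \<odot>\<^bsub>M\<^esub> (\<ominus>\<^bsub>M\<^esub> x) \<oplus>\<^bsub>M\<^esub> s \<odot>\<^bsub>M\<^esub> x) = (s \<otimes> s) \<odot>\<^bsub>M\<^esub> \<zero>\<^bsub>M\<^esub>"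
      using sc X(1) by (simp add: smult_r_distr[symmetric] M.l_neg)
  qed (use sc X(1) in simp)
  ultimately show "\<exists>Y\<in>carrier L. Y \<oplus>\<^bsub>L\<^esub> X = \<zero>\<^bsub>L\<^esub>" using loc_memI[OF _ X(2)] by blast
  fix Y assume "Y \<in> carrier L"
  then obtain y t where Y: "y \<in> carrier M" "t \<in> S" "Y = fr y t" by (rule locE)
  have tc: "t \<in> carrier R" using Y(2) by simp
  show "X \<oplus>\<^bsub>L\<^esub> Y \<in> carrier L"
    unfolding X(3) Y(3) loc_add[OF X(1,2) Y(1,2)]
    by (rule loc_memI[OF _ S_mult[OF X(2) Y(2)]]) (use X(1) Y(1) sc tc in simp)
  show "X \<oplus>\<^bsub>L\<^esub> Y = Y \<oplus>\<^bsub>L\<^esub> X"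
    unfolding X(3) Y(3) loc_add[OF X(1,2) Y(1,2)] loc_add[OF Y(1,2) X(1,2)]
    using X(1) Y(1) sc tc by (simp add: M.a_comm R.m_comm)
  fix Z assume "Z \<in> carrier L"
  then obtain z r where Z: "z \<in> carrier M" "r \<in> S" "Z = fr z r" by (rule locE)
  have rc: "r \<in> carrier R" using Z(2) by simp
  have c1: "t \<odot>\<^bsub>M\<^esub> x \<oplus>\<^bsub>M\<^esub> s \<odot>\<^bsub>M\<^esub> y \<in> carrier M" "r \<odot>\<^bsub>M\<^esub> y \<oplus>\<^bsub>M\<^esub> t \<odot>\<^bsub>M\<^esub> z \<in> carrier M"
    using X(1) Y(1) Z(1) sc tc rc by simp_all
  show "X \<oplus>\<^bsub>L\<^esub> Y \<oplus>\<^bsub>L\<^esub> Z = X \<oplus>\<^bsub>L\<^esub> (Y \<oplus>\<^bsub>L\<^esub> Z)"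
    unfolding X(3) Y(3) Z(3) loc_add[OF X(1,2) Y(1,2)] loc_add[OF Y(1,2) Z(1,2)]
      loc_add[OF c1(1) S_mult[OF X(2) Y(2)] Z(1,2)] loc_add[OF X(1,2) c1(2) S_mult[OF Y(2) Z(2)]]
    using X(1) Y(1) Z(1) sc tc rc
    by (simp add: smult_r_distr smult_assoc1[symmetric] M.a_assoc R.m_assoc R.m_comm R.m_lcomm)
qed

end

end

section \<open>The local ring \<open>R_P\<close> and its modules\<close>

text \<open>\<open>R_P\<close> is the localization of \<open>R\<close> as a module over itself, its
  multiplication read as scalar multiplication. The calculus of fractions for modules therefore
  covers the ring as well.\<close>

lemma (in cring) ring_at_simps:
  fixes P
  defines "L \<equiv> localize_module R (self_module R) (carrier R - P)"
  shows "carrier (ring_at R P) = carrier L" "add (ring_at R P) = add L" "zero (ring_at R P) = zero L"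
    "mult (ring_at R P) = smult L" "one (ring_at R P) = ring_fraction R (carrier R - P) \<one> \<one>"
  by (simp_all add: L_def ring_at_def localize_ring_def localize_module_def)

lemma (in cring) cring_ring_at:
  assumes P: "primeideal P R" shows "cring (ring_at R P)"
proof -
  interpret S: module R "self_module R" by (rule module_self)
  let ?S = "carrier R - P" and ?L = "localize_module R (self_module R) (carrier R - P)"
  let ?f = "ring_fraction R (carrier R - P)"
  note one = primeideal_one_notin[OF P]
  note st = primeideal_mult_notin[OF P]
  have mem: "?f a s \<in> carrier (ring_at R P)" if "a \<in> carrier R" "s \<in> ?S" for a s
    using S.loc_memI[OF P, of a s] that by (simp add: ring_at_simps)
  have el: "\<exists>a\<in>carrier R. \<exists>s\<in>?S. X = ?f a s" if "X \<in> carrier (ring_at R P)" for X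
    using that S.loc_carrier[OF P] by (auto simp: ring_at_simps)
  have mul: "?f a s \<otimes>\<^bsub>ring_at R P\<^esub> ?f b t = ?f (a \<otimes> b) (s \<otimes> t)"
    if "a \<in> carrier R" "s \<in> ?S" "b \<in> carrier R" "t \<in> ?S" for a s b t
    using S.loc_smult[OF P, of a s b t] that by (simp add: ring_at_simps)
  have add: "?f a s \<oplus>\<^bsub>ring_at R P\<^esub> ?f b t = ?f (t \<otimes> a \<oplus> s \<otimes> b) (s \<otimes> t)"
    if "a \<in> carrier R" "s \<in> ?S" "b \<in> carrier R" "t \<in> ?S" for a s b t
    using S.loc_add[OF P, of a s b t] that by (simp add: ring_at_simps)
  have eqI: "?f a s = ?f b t" if "a \<in> carrier R" "s \<in> ?S" "b \<in> carrier R" "t \<in> ?S" "t \<otimes> a = s \<otimes> b" for a s b t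
    using S.fr_eqI[OF P, of a s b t] that by simp
  have ag: "abelian_group (ring_at R P)"
  proof (rule abelian_groupI, unfold ring_at_simps)
    interpret L: abelian_group ?L by (rule S.abelian_group_loc[OF P])
    show "\<exists>y\<in>carrier ?L. y \<oplus>\<^bsub>?L\<^esub> x = \<zero>\<^bsub>?L\<^esub>" if "x \<in> carrier ?L" for x
      using L.a_inv_closed[OF that] L.l_neg[OF that] by blast
    show "x \<oplus>\<^bsub>?L\<^esub> y = y \<oplus>\<^bsub>?L\<^esub> x" if "x \<in> carrier ?L" "y \<in> carrier ?L" for x y
      by (rule L.a_comm[OF that])
    show "x \<oplus>\<^bsub>?L\<^esub> y \<oplus>\<^bsub>?L\<^esub> z = x \<oplus>\<^bsub>?L\<^esub> (y \<oplus>\<^bsub>?L\<^esub> z)"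
      if "x \<in> carrier ?L" "y \<in> carrier ?L" "z \<in> carrier ?L" for x y z
      by (rule L.a_assoc[OF that])
  qed (use S.abelian_group_loc[OF P] in \<open>simp_all add: abelian_group.axioms(1) abelian_monoid.a_closed abelian_monoid.l_zero abelian_monoid.zero_closed\<close>)
  have cm: "comm_monoid (ring_at R P)"
  proof (rule comm_monoidI)
    fix X Y assume "X \<in> carrier (ring_at R P)" "Y \<in> carrier (ring_at R P)"
    then obtain a s b t where *: "a \<in> carrier R" "s \<in> ?S" "b \<in> carrier R" "t \<in> ?S" "X = ?f a s" "Y = ?f b t"
      using el by metis
    show "X \<otimes>\<^bsub>ring_at R P\<^esub> Y \<in> carrier (ring_at R P)"
      unfolding *(5,6) mul[OF *(1-4)] by (rule mem) (use * st in simp_all)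
    show "X \<otimes>\<^bsub>ring_at R P\<^esub> Y = Y \<otimes>\<^bsub>ring_at R P\<^esub> X"
      unfolding *(5,6) mul[OF *(1-4)] mul[OF *(3,4,1,2)] using * by (simp add: m_comm)
  next
    show "\<one>\<^bsub>ring_at R P\<^esub> \<in> carrier (ring_at R P)" unfolding ring_at_simps(5) by (rule mem[OF one_closed one])
  next
    fix X Y Z assume "X \<in> carrier (ring_at R P)" "Y \<in> carrier (ring_at R P)" "Z \<in> carrier (ring_at R P)"
    then obtain a s b t c r where *: "a \<in> carrier R" "s \<in> ?S" "b \<in> carrier R" "t \<in> ?S" "c \<in> carrier R" "r \<in> ?S"
      "X = ?f a s" "Y = ?f b t" "Z = ?f c r"
      using el by metis
    show "X \<otimes>\<^bsub>ring_at R P\<^esub> Y \<otimes>\<^bsub>ring_at R P\<^esub> Z = X \<otimes>\<^bsub>ring_at R P\<^esub> (Y \<otimes>\<^bsub>ring_at R P\<^esub> Z)"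
      unfolding *(7-9) mul[OF *(1-4)] mul[OF *(3-6)]
        mul[OF m_closed[OF *(1,3)] st[OF *(2,4)] *(5,6)] mul[OF *(1,2) m_closed[OF *(3,5)] st[OF *(4,6)]]
      using * by (simp add: m_assoc)
  next
    fix X assume "X \<in> carrier (ring_at R P)"
    then obtain a s where *: "a \<in> carrier R" "s \<in> ?S" "X = ?f a s" using el by metis
    show "\<one>\<^bsub>ring_at R P\<^esub> \<otimes>\<^bsub>ring_at R P\<^esub> X = X"
      unfolding *(3) ring_at_simps(5) mul[OF one_closed one *(1,2)] using * by simp
  qed
  show ?thesis
  proof (rule cringI[OF ag cm])
    fix X Y Z assume "X \<in> carrier (ring_at R P)" "Y \<in> carrier (ring_at R P)" "Z \<in> carrier (ring_at R P)"
    then obtain a s b t c r where *: "a \<in> carrier R" "s \<in> ?S" "b \<in> carrier R" "t \<in> ?S" "c \<in> carrier R" "r \<in> ?S"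
      "X = ?f a s" "Y = ?f b t" "Z = ?f c r"
      using el by metis
    have cr: "s \<in> carrier R" "t \<in> carrier R" "r \<in> carrier R" using * by simp_all
    have sum: "t \<otimes> a \<oplus> s \<otimes> b \<in> carrier R" using * cr by simp
    show "(X \<oplus>\<^bsub>ring_at R P\<^esub> Y) \<otimes>\<^bsub>ring_at R P\<^esub> Z = X \<otimes>\<^bsub>ring_at R P\<^esub> Z \<oplus>\<^bsub>ring_at R P\<^esub> Y \<otimes>\<^bsub>ring_at R P\<^esub> Z"
      unfolding *(7-9) add[OF *(1-4)] mul[OF sum st[OF *(2,4)] *(5,6)] mul[OF *(1,2,5,6)] mul[OF *(3-6)]
        add[OF m_closed[OF *(1,5)] st[OF *(2,6)] m_closed[OF *(3,5)] st[OF *(4,6)]]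
    proof (rule eqI)
      have d: "(t \<otimes> a \<oplus> s \<otimes> b) \<otimes> c = t \<otimes> (a \<otimes> c) \<oplus> s \<otimes> (b \<otimes> c)"
        using * cr by (simp add: l_distr m_assoc)
      show "(s \<otimes> r \<otimes> (t \<otimes> r)) \<otimes> ((t \<otimes> a \<oplus> s \<otimes> b) \<otimes> c)
        = (s \<otimes> t \<otimes> r) \<otimes> (t \<otimes> r \<otimes> (a \<otimes> c) \<oplus> s \<otimes> r \<otimes> (b \<otimes> c))"
        unfolding d using * cr by (simp add: r_distr m_ac)
    qed (use * cr st in simp_all)
  qed
qed

lemma (in module) module_module_at:
  assumes P: "primeideal P R" shows "module (ring_at R P) (module_at R M P)"
proof -
  interpret S: module R "self_module R" by (rule R.module_self)
  let ?S = "carrier R - P" and ?L = "localize_module R M (carrier R - P)"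
  let ?f = "ring_fraction R (carrier R - P)" and ?g = "fraction R M (carrier R - P)"
  note one = primeideal_one_notin[OF P]
  note st = primeideal_mult_notin[OF P]
  have el: "\<exists>a\<in>carrier R. \<exists>s\<in>?S. X = ?f a s" if "X \<in> carrier (ring_at R P)" for X
    using that S.loc_carrier[OF P] by (auto simp: R.ring_at_simps)
  have elM: "\<exists>x\<in>carrier M. \<exists>s\<in>?S. X = ?g x s" if "X \<in> carrier ?L" for X
    using that loc_carrier[OF P] by auto
  have mul: "?f a s \<otimes>\<^bsub>ring_at R P\<^esub> ?f b t = ?f (a \<otimes> b) (s \<otimes> t)"
    if "a \<in> carrier R" "s \<in> ?S" "b \<in> carrier R" "t \<in> ?S" for a s b t
    using S.loc_smult[OF P, of a s b t] that by (simp add: R.ring_at_simps)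
  have add: "?f a s \<oplus>\<^bsub>ring_at R P\<^esub> ?f b t = ?f (t \<otimes> a \<oplus> s \<otimes> b) (s \<otimes> t)"
    if "a \<in> carrier R" "s \<in> ?S" "b \<in> carrier R" "t \<in> ?S" for a s b t
    using S.loc_add[OF P, of a s b t] that by (simp add: R.ring_at_simps)
  show ?thesis
    unfolding module_at_def
  proof (rule moduleI[OF R.cring_ring_at[OF P] abelian_group_loc[OF P]])
    fix A X assume "A \<in> carrier (ring_at R P)" "X \<in> carrier ?L"
    then obtain a s x r where *: "a \<in> carrier R" "s \<in> ?S" "x \<in> carrier M" "r \<in> ?S" "A = ?f a s" "X = ?g x r"
      using el elM by metis
    show "A \<odot>\<^bsub>?L\<^esub> X \<in> carrier ?L"
      unfolding *(5,6) loc_smult[OF P *(1-4)] by (rule loc_memI[OF P _ st[OF *(2,4)]]) (use * in simp)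
  next
    fix A B X assume "A \<in> carrier (ring_at R P)" "B \<in> carrier (ring_at R P)" "X \<in> carrier ?L"
    then obtain a s b t x r where *: "a \<in> carrier R" "s \<in> ?S" "b \<in> carrier R" "t \<in> ?S" "x \<in> carrier M" "r \<in> ?S"
      "A = ?f a s" "B = ?f b t" "X = ?g x r"
      using el elM by metis
    have cr: "s \<in> carrier R" "t \<in> carrier R" "r \<in> carrier R" using * by simp_all
    have sum: "t \<otimes> a \<oplus> s \<otimes> b \<in> carrier R" using * cr by simp
    have ab: "a \<odot>\<^bsub>M\<^esub> x \<in> carrier M" "b \<odot>\<^bsub>M\<^esub> x \<in> carrier M" using * by simp_all
    show "(A \<oplus>\<^bsub>ring_at R P\<^esub> B) \<odot>\<^bsub>?L\<^esub> X = A \<odot>\<^bsub>?L\<^esub> X \<oplus>\<^bsub>?L\<^esub> B \<odot>\<^bsub>?L\<^esub> X"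
      unfolding *(7-9) add[OF *(1-4)] loc_smult[OF P sum st[OF *(2,4)] *(5,6)]
        loc_smult[OF P *(1,2,5,6)] loc_smult[OF P *(3-6)] loc_add[OF P ab(1) st[OF *(2,6)] ab(2) st[OF *(4,6)]]
    proof (rule fr_eqI[OF P])
      have d: "(t \<otimes> a \<oplus> s \<otimes> b) \<odot>\<^bsub>M\<^esub> x = t \<odot>\<^bsub>M\<^esub> (a \<odot>\<^bsub>M\<^esub> x) \<oplus>\<^bsub>M\<^esub> s \<odot>\<^bsub>M\<^esub> (b \<odot>\<^bsub>M\<^esub> x)"
        using * cr by (simp add: smult_l_distr smult_assoc1)
      define y z where "y = a \<odot>\<^bsub>M\<^esub> x" and "z = b \<odot>\<^bsub>M\<^esub> x"
      have yz: "y \<in> carrier M" "z \<in> carrier M" using ab by (simp_all add: y_def z_def)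
      show "(s \<otimes> r \<otimes> (t \<otimes> r)) \<odot>\<^bsub>M\<^esub> ((t \<otimes> a \<oplus> s \<otimes> b) \<odot>\<^bsub>M\<^esub> x)
        = (s \<otimes> t \<otimes> r) \<odot>\<^bsub>M\<^esub> ((t \<otimes> r) \<odot>\<^bsub>M\<^esub> (a \<odot>\<^bsub>M\<^esub> x) \<oplus>\<^bsub>M\<^esub> (s \<otimes> r) \<odot>\<^bsub>M\<^esub> (b \<odot>\<^bsub>M\<^esub> x))"
        unfolding d y_def[symmetric] z_def[symmetric] using yz cr
        by (simp add: smult_r_distr smult_assoc1[symmetric] R.m_ac)
    qed (use * cr ab st in simp_all)
    show "(A \<otimes>\<^bsub>ring_at R P\<^esub> B) \<odot>\<^bsub>?L\<^esub> X = A \<odot>\<^bsub>?L\<^esub> (B \<odot>\<^bsub>?L\<^esub> X)"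
      unfolding *(7-9) mul[OF *(1-4)] loc_smult[OF P R.m_closed[OF *(1,3)] st[OF *(2,4)] *(5,6)]
        loc_smult[OF P *(3-6)] loc_smult[OF P *(1,2) ab(2) st[OF *(4,6)]]
      using * cr by (simp add: smult_assoc1 R.m_assoc)
  next
    fix A X Y assume "A \<in> carrier (ring_at R P)" "X \<in> carrier ?L" "Y \<in> carrier ?L"
    then obtain a s x t y r where *: "a \<in> carrier R" "s \<in> ?S" "x \<in> carrier M" "t \<in> ?S" "y \<in> carrier M" "r \<in> ?S"
      "A = ?f a s" "X = ?g x t" "Y = ?g y r"
      using el elM by metis
    have cr: "s \<in> carrier R" "t \<in> carrier R" "r \<in> carrier R" using * by simp_all
    have sum: "r \<odot>\<^bsub>M\<^esub> x \<oplus>\<^bsub>M\<^esub> t \<odot>\<^bsub>M\<^esub> y \<in> carrier M" using * cr by simp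
    have ab: "a \<odot>\<^bsub>M\<^esub> x \<in> carrier M" "a \<odot>\<^bsub>M\<^esub> y \<in> carrier M" using * by simp_all
    show "A \<odot>\<^bsub>?L\<^esub> (X \<oplus>\<^bsub>?L\<^esub> Y) = A \<odot>\<^bsub>?L\<^esub> X \<oplus>\<^bsub>?L\<^esub> A \<odot>\<^bsub>?L\<^esub> Y"
      unfolding *(7-9) loc_add[OF P *(3-6)] loc_smult[OF P *(1,2) sum st[OF *(4,6)]]
        loc_smult[OF P *(1-4)] loc_smult[OF P *(1,2,5,6)] loc_add[OF P ab(1) st[OF *(2,4)] ab(2) st[OF *(2,6)]]
      by (rule fr_eqI[OF P]) (use * cr ab st in \<open>simp_all add: smult_r_distr smult_assoc1[symmetric] R.m_ac\<close>)
  next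
    fix X assume "X \<in> carrier ?L"
    then obtain x r where *: "x \<in> carrier M" "r \<in> ?S" "X = ?g x r" using elM by metis
    show "\<one>\<^bsub>ring_at R P\<^esub> \<odot>\<^bsub>?L\<^esub> X = X"
      unfolding *(3) R.ring_at_simps(5) loc_smult[OF P R.one_closed one *(1,2)] using * by simp
  qed
qed

lemma (in cring) ring_at_hom:
  assumes P: "primeideal P R"
  defines "i \<equiv> \<lambda>a. ring_fraction R (carrier R - P) a \<one>"
  shows "i \<in> ring_hom R (ring_at R P)"
    and "\<And>s. s \<in> carrier R - P \<Longrightarrow> i s \<in> Units (ring_at R P)"
    and "\<And>y. y \<in> carrier (ring_at R P) \<Longrightarrow> \<exists>s\<in>carrier R - P. \<exists>a\<in>carrier R. i s \<otimes>\<^bsub>ring_at R P\<^esub> y = i a"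
    and "\<And>x. \<lbrakk>x \<in> carrier R; i x = \<zero>\<^bsub>ring_at R P\<^esub>\<rbrakk> \<Longrightarrow> \<exists>s\<in>carrier R - P. s \<otimes> x = \<zero>"
proof -
  interpret S: module R "self_module R" by (rule module_self)
  let ?S = "carrier R - P" and ?f = "ring_fraction R (carrier R - P)"
  note one = primeideal_one_notin[OF P]
  note st = primeideal_mult_notin[OF P]
  have mem: "?f a s \<in> carrier (ring_at R P)" if "a \<in> carrier R" "s \<in> ?S" for a s
    using S.loc_memI[OF P, of a s] that by (simp add: ring_at_simps)
  have mul: "?f a s \<otimes>\<^bsub>ring_at R P\<^esub> ?f b t = ?f (a \<otimes> b) (s \<otimes> t)"
    if "a \<in> carrier R" "s \<in> ?S" "b \<in> carrier R" "t \<in> ?S" for a s b t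
    using S.loc_smult[OF P, of a s b t] that by (simp add: ring_at_simps)
  have add: "?f a s \<oplus>\<^bsub>ring_at R P\<^esub> ?f b t = ?f (t \<otimes> a \<oplus> s \<otimes> b) (s \<otimes> t)"
    if "a \<in> carrier R" "s \<in> ?S" "b \<in> carrier R" "t \<in> ?S" for a s b t
    using S.loc_add[OF P, of a s b t] that by (simp add: ring_at_simps)
  have eqI: "?f a s = ?f b t" if "a \<in> carrier R" "s \<in> ?S" "b \<in> carrier R" "t \<in> ?S" "t \<otimes> a = s \<otimes> b" for a s b t
    using S.fr_eqI[OF P, of a s b t] that by simp
  show "i \<in> ring_hom R (ring_at R P)"
  proof (rule ring_hom_memI)
    show "i x \<in> carrier (ring_at R P)" if "x \<in> carrier R" for x unfolding i_def by (rule mem[OF that one])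
    show "i (x \<otimes> y) = i x \<otimes>\<^bsub>ring_at R P\<^esub> i y" if "x \<in> carrier R" "y \<in> carrier R" for x y
      unfolding i_def using mul[OF that(1) one that(2) one] by simp
    show "i (x \<oplus> y) = i x \<oplus>\<^bsub>ring_at R P\<^esub> i y" if "x \<in> carrier R" "y \<in> carrier R" for x y
      unfolding i_def using add[OF that(1) one that(2) one] that by simp
    show "i \<one> = \<one>\<^bsub>ring_at R P\<^esub>" by (simp add: i_def ring_at_simps)
  qed
  show "i s \<in> Units (ring_at R P)" if s: "s \<in> carrier R - P" for s
  proof -
    have sc: "s \<in> carrier R" using s by simp
    have "?f s s = ?f \<one> \<one>" by (rule eqI[OF sc s one_closed one]) (use sc in simp)
    then have "?f s \<one> \<otimes>\<^bsub>ring_at R P\<^esub> ?f \<one> s = \<one>\<^bsub>ring_at R P\<^esub>" "?f \<one> s \<otimes>\<^bsub>ring_at R P\<^esub> ?f s \<one> = \<one>\<^bsub>ring_at R P\<^esub>"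
      unfolding mul[OF sc one one_closed s] mul[OF one_closed s sc one] ring_at_simps(5) using sc by simp_all
    then show ?thesis unfolding Units_def i_def using mem[OF sc one] mem[OF one_closed s] by blast
  qed
  show "\<exists>s\<in>carrier R - P. \<exists>a\<in>carrier R. i s \<otimes>\<^bsub>ring_at R P\<^esub> y = i a" if y: "y \<in> carrier (ring_at R P)" for y
  proof -
    obtain a s where *: "a \<in> carrier R" "s \<in> ?S" "y = ?f a s"
      using y S.loc_carrier[OF P] by (auto simp: ring_at_simps)
    have sc: "s \<in> carrier R" using *(2) by simp
    have "i s \<otimes>\<^bsub>ring_at R P\<^esub> y = ?f (s \<otimes> a) (\<one> \<otimes> s)" unfolding i_def *(3) by (rule mul[OF sc one *(1,2)])
    also have "\<dots> = i a" unfolding i_def by (rule eqI) (use * sc one in simp_all)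
    finally show ?thesis using *(1,2) by blast
  qed
  show "\<exists>s\<in>carrier R - P. s \<otimes> x = \<zero>" if x: "x \<in> carrier R" "i x = \<zero>\<^bsub>ring_at R P\<^esub>" for x
  proof -
    have "\<exists>u\<in>?S. u \<otimes> (\<one> \<otimes> x) = u \<otimes> (\<one> \<otimes> \<zero>)"
      using S.fr_eqD[OF P, of x \<one> \<zero> \<one>] x one by (simp add: i_def ring_at_simps S.loc_zero[OF P])
    then obtain u where u: "u \<in> ?S" "u \<otimes> (\<one> \<otimes> x) = u \<otimes> (\<one> \<otimes> \<zero>)" by (elim bexE)
    then have "u \<otimes> x = \<zero>" using x(1) by simp
    then show ?thesis using u(1) by blast
  qed
qed

lemma (in cring) localization_self:
  assumes P: "primeideal P R"
  shows "localization R (self_module R) P (ring_at R P) (self_module (ring_at R P))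
    (\<lambda>a. ring_fraction R (carrier R - P) a \<one>) (\<lambda>a. ring_fraction R (carrier R - P) a \<one>)"
proof -
  note h = ring_at_hom[OF P]
  interpret Rh: cring "ring_at R P" by (rule cring_ring_at[OF P])
  show ?thesis
    by (rule localization.intro[OF module_self Rh.module_self P h(1)])
      (use h(2,3,4) ring_hom_closed[OF h(1)] ring_hom_add[OF h(1)] ring_hom_mult[OF h(1)] in simp_all)
qed

lemma (in module) localization_module:
  assumes P: "primeideal P R"
  shows "localization R M P (ring_at R P) (module_at R M P)
    (\<lambda>a. ring_fraction R (carrier R - P) a \<one>) (\<lambda>x. fraction R M (carrier R - P) x \<one>)"
proof -
  note h = R.ring_at_hom[OF P]
  let ?S = "carrier R - P" and ?L = "localize_module R M (carrier R - P)"
  let ?f = "ring_fraction R (carrier R - P)" and ?g = "fraction R M (carrier R - P)"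
  note one = primeideal_one_notin[OF P]
  show ?thesis
  proof (rule localization.intro[OF module_axioms module_module_at[OF P] P h(1)], goal_cases)
    case (1 s) then show ?case by (rule h(2))
  next
    case (2 x) then show ?case unfolding module_at_def by (rule loc_memI[OF P _ one])
  next
    case (3 x y) then show ?case unfolding module_at_def using loc_add[OF P _ one _ one, of x y] by simp
  next
    case (4 r x) then show ?case unfolding module_at_def using loc_smult[OF P _ one _ one, of r x] by simp
  next
    case (5 y)
    then obtain x s where *: "x \<in> carrier M" "s \<in> ?S" "y = ?g x s"
      unfolding module_at_def by (rule locE[OF P])
    have sc: "s \<in> carrier R" using *(2) by simp
    have "?f s \<one> \<odot>\<^bsub>?L\<^esub> y = ?g (s \<odot>\<^bsub>M\<^esub> x) (\<one> \<otimes> s)" unfolding *(3) by (rule loc_smult[OF P sc one *(1,2)])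
    also have "\<dots> = ?g x \<one>" by (rule fr_eqI[OF P]) (use * sc one in simp_all)
    finally show ?case unfolding module_at_def using *(1,2) by blast
  next
    case (6 x)
    then have "?g x \<one> = ?g \<zero>\<^bsub>M\<^esub> \<one>" unfolding module_at_def loc_zero[OF P] by simp
    then have "\<exists>u\<in>?S. u \<odot>\<^bsub>M\<^esub> (\<one> \<odot>\<^bsub>M\<^esub> x) = u \<odot>\<^bsub>M\<^esub> (\<one> \<odot>\<^bsub>M\<^esub> \<zero>\<^bsub>M\<^esub>)"
      using fr_eqD[OF P 6(1) one M.zero_closed one] by simp
    then obtain u where "u \<in> ?S" "u \<odot>\<^bsub>M\<^esub> (\<one> \<odot>\<^bsub>M\<^esub> x) = u \<odot>\<^bsub>M\<^esub> (\<one> \<odot>\<^bsub>M\<^esub> \<zero>\<^bsub>M\<^esub>)" by (elim bexE)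
    then show ?case using 6(1) by (intro bexI[of _ u]) simp_all
  next
    case (7 y) then show ?case by (rule h(3))
  qed
qed

subsection \<open>Dimension\<close>

lemma annihilator_ideal:
  assumes "module R M" shows "ideal (annihilator R M) R"
proof -
  interpret M: module R M by fact
  interpret S: module R "self_module R" by (rule M.R.module_self)
  have "submodule (annihilator R M) R (self_module R)"
    by (rule S.submoduleI') (auto simp: annihilator_def M.smult_l_distr M.smult_assoc1)
  then show ?thesis by (simp add: M.R.submodule_self_iff)
qed

lemma (in cring) psat_smaller_prime:
  assumes P: "primeideal P R" and Q: "primeideal Q R" and QP: "Q \<subseteq> P"
  shows "psat R (self_module R) P Q = Q"
proof -
  interpret S: module R "self_module R" by (rule module_self)
  interpret Q: primeideal Q R by (rule Q)
  have "psat R (self_module R) P Q \<subseteq> Q"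
  proof
    fix x assume "x \<in> psat R (self_module R) P Q"
    then obtain s where s: "x \<in> carrier R" "s \<in> carrier R - P" "s \<otimes> x \<in> Q" by (auto simp: psat_def)
    then show "x \<in> Q" using Q.I_prime[of s x] QP by blast
  qed
  moreover have "Q \<subseteq> psat R (self_module R) P Q" using S.psat_upper[OF P, of Q] Q.a_subset by simp
  ultimately show ?thesis by (rule antisym)
qed

context ffinite_ring
begin

text \<open>Finiteness of the dimension comes from degrees: a chain of \<open>n\<close> primes steps
  multiplies the degree by at least \<open>p ^ n\<close>, and degrees are bounded. Conversely, the
  chain supplied by \<open>prime_chain\<close> survives in the quotient of \<open>R_P\<close> by the
  annihilator of \<open>M_P\<close>, so its length is at most the dimension. This is the one place
  where dimension and degrees meet.\<close>

lemma krull_dim_bound: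
  assumes M: "module R M" and fg: "fg_sub R M (carrier M)"
    and l: "localization R M P Rh Mh iR iM"
    and lR: "localization R Rm P Rh (self_module Rh) iR iR"
  shows "\<exists>d. krull_dim (Rh Quot (annihilator Rh Mh)) = enat d \<and>
    (\<forall>Q. primeideal Q R \<longrightarrow> Q \<subseteq> P \<longrightarrow> annihilator R M \<subseteq> Q \<longrightarrow> (\<exists>k\<le>d. fdeg Q = p ^ k * fdeg P))"
proof -
  interpret l: localization R M P Rh Mh iR iM by (rule l)
  interpret s: localization R Rm P Rh "self_module Rh" iR iR by (rule lR)
  interpret M: module R M by (rule M)
  interpret Mh: module Rh Mh by (rule l.modh)
  interpret S: module R Rm by (rule module_self)
  note P = l.P
  let ?A = "annihilator Rh Mh"
  let ?Q = "Rh Quot ?A"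
  have A: "ideal ?A Rh" by (rule annihilator_ideal[OF l.modh])
  interpret A: ideal ?A Rh by (rule A)
  interpret Q: cring ?Q by (rule A.quotient_is_cring[OF Mh.R.is_cring])
  define \<pi> where "\<pi> y = ?A +>\<^bsub>Rh\<^esub> y" for y
  have \<pi>: "\<pi> \<in> ring_hom Rh ?Q" unfolding \<pi>_def using A.rcos_ring_hom by simp
  have \<pi>surj: "\<exists>y\<in>carrier Rh. X = \<pi> y" if "X \<in> carrier ?Q" for X
    using that by (auto simp: FactRing_def A_RCOSETS_def' \<pi>_def a_r_coset_def')
  have \<pi>eq: "\<pi> x = \<pi> y \<longleftrightarrow> x \<ominus>\<^bsub>Rh\<^esub> y \<in> ?A" if "x \<in> carrier Rh" "y \<in> carrier Rh" for x y
    unfolding \<pi>_def using Mh.R.quotient_eq_iff_same_a_r_cos[OF A that] by simp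
  have mod_mem: "x \<in> E" if E: "ideal E Rh" "?A \<subseteq> E" and x: "x \<in> carrier Rh" and y: "y \<in> E" "\<pi> x = \<pi> y" for E x y
  proof -
    interpret E: ideal E Rh by (rule E(1))
    have yc: "y \<in> carrier Rh" using E.Icarr[OF y(1)] .
    have "x \<ominus>\<^bsub>Rh\<^esub> y \<in> E" using \<pi>eq[OF x yc] y(2) E(2) by blast
    then have "(x \<ominus>\<^bsub>Rh\<^esub> y) \<oplus>\<^bsub>Rh\<^esub> y \<in> E" using E.a_closed y(1) by blast
    moreover have "(x \<ominus>\<^bsub>Rh\<^esub> y) \<oplus>\<^bsub>Rh\<^esub> y = x" using x yc by (simp add: a_minus_def Mh.R.a_assoc Mh.R.l_neg)
    ultimately show ?thesis by simp
  qed
  \<comment> \<open>Finite generation of \<open>M\<close> enters here: an element killing the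
    localized module kills \<open>M\<close> itself after multiplication by one denominator.\<close>
  have annA: "\<exists>t\<in>carrier R - P. t \<otimes> a \<in> annihilator R M" if a: "a \<in> carrier R" and aA: "iR a \<in> ?A" for a
  proof -
    let ?K = "{x \<in> carrier M. a \<odot>\<^bsub>M\<^esub> x \<in> {\<zero>\<^bsub>M\<^esub>}}"
    have K: "submodule ?K R M"
      by (rule mlin_vimage_submodule[OF M M M.mlin_smult[OF a] M.submodule_zero_set])
    have "carrier M \<subseteq> psat R M P ?K"
    proof
      fix x assume x: "x \<in> carrier M"
      have "iR a \<odot>\<^bsub>Mh\<^esub> iM x = \<zero>\<^bsub>Mh\<^esub>"
        using aA l.iM_closed[OF x] unfolding annihilator_def by blast
      then have "iM (a \<odot>\<^bsub>M\<^esub> x) = \<zero>\<^bsub>Mh\<^esub>" using l.iM_smult[OF a x] by (rule trans[rotated])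
      then obtain t where t: "t \<in> carrier R - P" "t \<odot>\<^bsub>M\<^esub> (a \<odot>\<^bsub>M\<^esub> x) = \<zero>\<^bsub>M\<^esub>"
        using l.iM_ker[of "a \<odot>\<^bsub>M\<^esub> x"] a x by auto
      have tc: "t \<in> carrier R" using t(1) by simp
      have "a \<odot>\<^bsub>M\<^esub> (t \<odot>\<^bsub>M\<^esub> x) = \<zero>\<^bsub>M\<^esub>"
        using t(2) M.smult_assoc1[OF tc a x] M.smult_assoc1[OF a tc x] m_comm[OF a tc] by simp
      then show "x \<in> psat R M P ?K" using tc x by (intro M.psatI[OF x t(1)]) simp
    qed
    then obtain t where t: "t \<in> carrier R - P" "\<forall>x\<in>carrier M. t \<odot>\<^bsub>M\<^esub> x \<in> ?K"
      using M.fg_sub_psat_uniform[OF P K fg] by blast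
    have "(t \<otimes> a) \<odot>\<^bsub>M\<^esub> x = \<zero>\<^bsub>M\<^esub>" if x: "x \<in> carrier M" for x
    proof -
      have tc: "t \<in> carrier R" using t(1) by simp
      have "a \<odot>\<^bsub>M\<^esub> (t \<odot>\<^bsub>M\<^esub> x) = \<zero>\<^bsub>M\<^esub>" using t(2) x by simp
      then show ?thesis using M.smult_assoc1[OF a tc x] m_comm[OF a tc] by simp
    qed
    then have "t \<otimes> a \<in> annihilator R M" using t(1) a by (simp add: annihilator_def)
    then show ?thesis using t(1) by blast
  qed
  obtain m where m: "\<And>P. primeideal P R \<Longrightarrow> fdeg P \<le> m" using fdeg_bound by blast
  have "krull_dim ?Q \<le> enat m"
    unfolding krull_dim_def
  proof (rule max_chain_length_le)
    fix n and G :: "nat \<Rightarrow> _"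
    assume G: "\<And>i. i \<le> n \<Longrightarrow> G i \<in> {P. primeideal P ?Q}" "\<And>i. i < n \<Longrightarrow> G i \<subset> G (Suc i)"
    \<comment> \<open>Primes of the quotient are contracted to \<open>R\<close>. Inclusions stay
      strict because elements outside \<open>P\<close> become units, which no prime
      contains.\<close>
    define F where "F i = {a \<in> carrier R. \<pi> (iR a) \<in> G i}" for i
    have g: "(\<lambda>a. \<pi> (iR a)) \<in> ring_hom R ?Q" using ring_hom_trans[OF l.iR \<pi>] by (simp add: comp_def)
    interpret g: ring_hom_ring R ?Q "\<lambda>a. \<pi> (iR a)"
      by (rule ring_hom_ringI2[OF ring_axioms Q.ring_axioms g])
    have Fp: "primeideal (F i) R" if i: "i \<le> n" for i
    proof -
      have Gp: "primeideal (G i) ?Q" using G(1)[OF i] by simp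
      interpret Gi: primeideal "G i" ?Q by (rule Gp)
      show ?thesis
      proof (rule primeidealI[OF _ is_cring])
        show "ideal (F i) R" unfolding F_def by (rule g.ideal_vimage[OF Gi.is_ideal])
        show "carrier R \<noteq> F i"
        proof
          assume "carrier R = F i"
          then have "\<pi> (iR \<one>) \<in> G i" unfolding F_def using one_closed by blast
          then have "\<one>\<^bsub>?Q\<^esub> \<in> G i" using ring_hom_one[OF g] by simp
          then show False using Gi.one_imp_carrier Gi.I_notcarr by simp
        qed
        fix a b assume ab: "a \<in> carrier R" "b \<in> carrier R" "a \<otimes> b \<in> F i"
        then have "\<pi> (iR a) \<otimes>\<^bsub>?Q\<^esub> \<pi> (iR b) \<in> G i" using ring_hom_mult[OF g ab(1,2)] by (simp add: F_def)
        then show "a \<in> F i \<or> b \<in> F i"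
          using Gi.I_prime ring_hom_closed[OF g] ab(1,2) by (simp add: F_def)
      qed
    qed
    have Fs: "F i \<subset> F (Suc i)" if i: "i < n" for i
    proof -
      have Gp: "primeideal (G i) ?Q" "primeideal (G (Suc i)) ?Q" using G(1)[of i] G(1)[of "Suc i"] i by simp_all
      interpret Gi: primeideal "G i" ?Q by (rule Gp(1))
      interpret Gj: primeideal "G (Suc i)" ?Q by (rule Gp(2))
      obtain X where X: "X \<in> G (Suc i)" "X \<notin> G i" using G(2)[OF i] by blast
      have Xc: "X \<in> carrier ?Q" using Gj.Icarr[OF X(1)] .
      obtain y where y: "y \<in> carrier Rh" "X = \<pi> y" using \<pi>surj[OF Xc] by blast
      obtain s a where s: "s \<in> carrier R - P" "a \<in> carrier R" "iR s \<otimes>\<^bsub>Rh\<^esub> y = iR a" using l.iR_surj[OF y(1)] by blast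
      have sc: "s \<in> carrier R" using s(1) by simp
      have isc: "iR s \<in> carrier Rh" by (rule l.iR_closed[OF sc])
      have pa: "\<pi> (iR a) = \<pi> (iR s) \<otimes>\<^bsub>?Q\<^esub> X" unfolding s(3)[symmetric] y(2) by (rule ring_hom_mult[OF \<pi> isc y(1)])
      have psc: "\<pi> (iR s) \<in> carrier ?Q" by (rule ring_hom_closed[OF \<pi> isc])
      have "\<pi> (iR a) \<in> G (Suc i)" using Gj.I_l_closed[OF X(1) psc] by (simp only: pa)
      then have "a \<in> F (Suc i)" using s(2) by (simp add: F_def)
      moreover have "a \<notin> F i"
      proof
        assume "a \<in> F i"
        then have "\<pi> (iR a) \<in> G i" by (simp add: F_def)
        then have "\<pi> (iR s) \<otimes>\<^bsub>?Q\<^esub> X \<in> G i" by (simp only: pa)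
        then have ps: "\<pi> (iR s) \<in> G i" using Gi.I_prime[OF psc Xc] X(2) by blast
        have u: "iR s \<in> Units Rh" by (rule l.unit[OF s(1)])
        have ui: "inv\<^bsub>Rh\<^esub> (iR s) \<in> carrier Rh" using u by auto
        have "\<pi> (inv\<^bsub>Rh\<^esub> (iR s)) \<otimes>\<^bsub>?Q\<^esub> \<pi> (iR s) \<in> G i"
          by (rule Gi.I_l_closed[OF ps ring_hom_closed[OF \<pi> ui]])
        moreover have "\<pi> (inv\<^bsub>Rh\<^esub> (iR s)) \<otimes>\<^bsub>?Q\<^esub> \<pi> (iR s) = \<one>\<^bsub>?Q\<^esub>"
          using ring_hom_mult[OF \<pi> ui isc] Mh.R.Units_l_inv[OF u] ring_hom_one[OF \<pi>] by simp
        ultimately show False using Gi.one_imp_carrier Gi.I_notcarr by simp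
      qed
      moreover have "F i \<subseteq> F (Suc i)" using G(2)[OF i] by (auto simp: F_def)
      ultimately show ?thesis by blast
    qed
    \<comment> \<open>Exponential growth against the fixed bound \<open>m\<close> on degrees limits
      the length of the chain.\<close>
    have "n < p ^ n" using prime_gt_Suc_0_nat[OF p_prime] by (rule power_gt_expt)
    also have "p ^ n \<le> p ^ n * fdeg (F n)" using fdeg_pos[OF Fp[OF order_refl]] by simp
    also have "\<dots> \<le> fdeg (F 0)" by (rule fdeg_chain) (use Fp Fs in simp_all)
    also have "\<dots> \<le> m" by (rule m[OF Fp]) simp
    finally show "enat n \<le> enat m" by simp
  qed
  then obtain d where d: "krull_dim ?Q = enat d" using enat_eq_of_le by blast
  have "\<exists>k\<le>d. fdeg Q = p ^ k * fdeg P"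
    if Q: "primeideal Q R" and QP: "Q \<subseteq> P" and AQ: "annihilator R M \<subseteq> Q" for Q
  proof -
    obtain k F where F: "F 0 = Q" "F k = P" "\<forall>i\<le>k. primeideal (F i) R" "\<forall>i<k. F i \<subset> F (Suc i)"
      "fdeg Q = p ^ k * fdeg P"
      using prime_chain[OF P Q QP] by blast
    have mono: "F i \<subseteq> F j" if "i \<le> j" "j \<le> k" for i j
      using that
    proof (induction j)
      case (Suc j)
      show ?case
      proof (cases "i = Suc j")
        case False
        then have "F i \<subseteq> F j" using Suc by simp
        also have "\<dots> \<subseteq> F (Suc j)" using F(4) Suc.prems by (simp add: psubset_imp_subset)
        finally show ?thesis .
      qed simp
    qed simp
    have QF: "Q \<subseteq> F i" if "i \<le> k" for i using mono[OF _ that, of 0] F(1) by simp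
    have FP: "F i \<subseteq> P" if "i \<le> k" for i using mono[OF that order_refl] F(2) by simp
    define E where "E i = s.ex (F i)" for i
    have pF: "primeideal (F i) R" if "i \<le> k" for i using F(3) that by simp
    have sF: "submodule (F i) R Rm" if "i \<le> k" for i by (rule submodule_self_prime[OF pF[OF that]])
    have iE: "ideal (E i) Rh" if "i \<le> k" for i
      using s.ex_submodule[OF sF[OF that]] unfolding E_def by (simp add: Mh.R.submodule_self_iff)
    have cmE: "s.cm (E i) = F i" if "i \<le> k" for i
      unfolding E_def s.cm_ex[OF sF[OF that]] by (rule psat_smaller_prime[OF P pF[OF that] FP[OF that]])
    \<comment> \<open>Membership in an extended ideal is decided on a numerator. This transfers
      primality and strict inclusions from the chain in \<open>R\<close> to the chain of extended
      ideals.\<close>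
    have memE: "y \<in> E i \<longleftrightarrow> a \<in> F i"
      if i: "i \<le> k" and y: "y \<in> carrier Rh" and sa: "s \<in> carrier R - P" "a \<in> carrier R" "iR s \<otimes>\<^bsub>Rh\<^esub> y = iR a" for i y s a
    proof
      assume "y \<in> E i"
      then have "iR a \<in> E i" unfolding sa(3)[symmetric] using ideal.I_l_closed[OF iE[OF i]] l.iR_closed sa(1) by simp
      then have "a \<in> s.cm (E i)" using sa(2) by (simp add: s.cm_def)
      then show "a \<in> F i" using cmE[OF i] by simp
    next
      assume "a \<in> F i"
      then show "y \<in> E i" unfolding E_def s.ex_def using y sa by auto
    qed
    have AE: "?A \<subseteq> E i" if i: "i \<le> k" for i
    proof
      fix y assume y: "y \<in> ?A"
      have yc: "y \<in> carrier Rh" by (rule A.Icarr[OF y])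
      obtain s a where s: "s \<in> carrier R - P" "a \<in> carrier R" "iR s \<otimes>\<^bsub>Rh\<^esub> y = iR a" using l.iR_surj[OF yc] by blast
      have "iR a \<in> ?A" unfolding s(3)[symmetric] using A.I_l_closed[OF y] l.iR_closed s(1) by simp
      then obtain t where t: "t \<in> carrier R - P" "t \<otimes> a \<in> annihilator R M" using annA[OF s(2)] by blast
      have "t \<otimes> a \<in> F i" using t(2) AQ QF[OF i] by blast
      then have "a \<in> F i" using primeideal.I_prime[OF pF[OF i], of t a] t(1) s(2) FP[OF i] by blast
      then show "y \<in> E i" using memE[OF i yc s] by simp
    qed
    define G where "G i = \<pi> ` E i" for i
    have Gp: "primeideal (G i) ?Q" if i: "i \<le> k" for i
    proof (rule primeidealI[OF _ Q.is_cring])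
      have "(+>\<^bsub>Rh\<^esub>) ?A = \<pi>" by (rule ext) (simp add: \<pi>_def)
      then show iG: "ideal (G i) ?Q" unfolding G_def using Mh.R.ring_ideal_imp_quot_ideal[OF A iE[OF i]] by simp
      have lift_mem: "y \<in> E i" if y: "y \<in> carrier Rh" "\<pi> y \<in> G i" for y
      proof -
        obtain z where "z \<in> E i" "\<pi> y = \<pi> z" using y(2) unfolding G_def by blast
        then show ?thesis by (rule mod_mem[OF iE[OF i] AE[OF i] y(1)])
      qed
      show "carrier ?Q \<noteq> G i"
      proof
        assume eq: "carrier ?Q = G i"
        have "\<pi> \<one>\<^bsub>Rh\<^esub> \<in> carrier ?Q" by (rule ring_hom_closed[OF \<pi>]) simp
        then have "\<one>\<^bsub>Rh\<^esub> \<in> E i" using lift_mem[of "\<one>\<^bsub>Rh\<^esub>"] eq by simp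
        moreover have "iR \<one> \<otimes>\<^bsub>Rh\<^esub> \<one>\<^bsub>Rh\<^esub> = iR \<one>" using l.iR_closed[of \<one>] by simp
        ultimately have "\<one> \<in> F i" using memE[OF i Mh.R.one_closed primeideal_one_notin[OF P] one_closed] by blast
        then show False using FP[OF i] primeideal_one_notin[OF P] by blast
      qed
      fix X Y assume XY: "X \<in> carrier ?Q" "Y \<in> carrier ?Q" "X \<otimes>\<^bsub>?Q\<^esub> Y \<in> G i"
      obtain x where x: "x \<in> carrier Rh" "X = \<pi> x" using \<pi>surj[OF XY(1)] by blast
      obtain y where y: "y \<in> carrier Rh" "Y = \<pi> y" using \<pi>surj[OF XY(2)] by blast
      have "\<pi> (x \<otimes>\<^bsub>Rh\<^esub> y) \<in> G i" using XY(3) ring_hom_mult[OF \<pi> x(1) y(1)] x(2) y(2) by simp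
      then have xy: "x \<otimes>\<^bsub>Rh\<^esub> y \<in> E i" using lift_mem[of "x \<otimes>\<^bsub>Rh\<^esub> y"] x(1) y(1) by simp
      obtain s a where s: "s \<in> carrier R - P" "a \<in> carrier R" "iR s \<otimes>\<^bsub>Rh\<^esub> x = iR a" using l.iR_surj[OF x(1)] by blast
      obtain t b where t: "t \<in> carrier R - P" "b \<in> carrier R" "iR t \<otimes>\<^bsub>Rh\<^esub> y = iR b" using l.iR_surj[OF y(1)] by blast
      have c: "s \<in> carrier R" "t \<in> carrier R" "iR s \<in> carrier Rh" "iR t \<in> carrier Rh" using s(1) t(1) l.iR_closed by simp_all
      have "iR (s \<otimes> t) \<otimes>\<^bsub>Rh\<^esub> (x \<otimes>\<^bsub>Rh\<^esub> y) = (iR s \<otimes>\<^bsub>Rh\<^esub> x) \<otimes>\<^bsub>Rh\<^esub> (iR t \<otimes>\<^bsub>Rh\<^esub> y)"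
        using ring_hom_mult[OF l.iR c(1,2)] c x(1) y(1) by (simp add: Mh.R.m_ac)
      also have "\<dots> = iR (a \<otimes> b)" unfolding s(3) t(3) using ring_hom_mult[OF l.iR s(2) t(2)] by simp
      finally have st: "iR (s \<otimes> t) \<otimes>\<^bsub>Rh\<^esub> (x \<otimes>\<^bsub>Rh\<^esub> y) = iR (a \<otimes> b)" .
      have "a \<otimes> b \<in> F i"
        using memE[OF i Mh.R.m_closed[OF x(1) y(1)] primeideal_mult_notin[OF P s(1) t(1)] m_closed[OF s(2) t(2)] st] xy by simp
      then have "a \<in> F i \<or> b \<in> F i" by (rule primeideal.I_prime[OF pF[OF i] s(2) t(2)])
      then show "X \<in> G i \<or> Y \<in> G i"
        using memE[OF i x(1) s] memE[OF i y(1) t] unfolding G_def x(2) y(2) by blast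
    qed
    have Gs: "G i \<subset> G (Suc i)" if i: "i < k" for i
    proof -
      have i': "i \<le> k" "Suc i \<le> k" using i by simp_all
      have FF: "F i \<subset> F (Suc i)" using F(4) i by simp
      obtain x where x: "x \<in> F (Suc i)" "x \<notin> F i" using FF by blast
      have xc: "x \<in> carrier R" using x(1) primeideal_subset[OF pF[OF i'(2)]] by blast
      have ixc: "iR x \<in> carrier Rh" by (rule l.iR_closed[OF xc])
      have "iR \<one> = \<one>\<^bsub>Rh\<^esub>" by (rule ring_hom_one[OF l.iR])
      then have ix: "iR \<one> \<otimes>\<^bsub>Rh\<^esub> iR x = iR x" using ixc by simp
      have "iR x \<in> E (Suc i)" "iR x \<notin> E i"
        using memE[OF i'(2) ixc primeideal_one_notin[OF P] xc ix] memE[OF i'(1) ixc primeideal_one_notin[OF P] xc ix] x by simp_all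
      moreover have "\<pi> (iR x) \<notin> G i" if no: "iR x \<notin> E i"
      proof
        assume "\<pi> (iR x) \<in> G i"
        then obtain z where "z \<in> E i" "\<pi> (iR x) = \<pi> z" unfolding G_def by blast
        then have "iR x \<in> E i" by (rule mod_mem[OF iE[OF i'(1)] AE[OF i'(1)] ixc])
        then show False using no by simp
      qed
      moreover have "E i \<subseteq> E (Suc i)" unfolding E_def using FF by (intro s.ex_mono) blast
      ultimately show ?thesis unfolding G_def by blast
    qed
    have "enat k \<le> krull_dim ?Q" unfolding krull_dim_def by (rule max_chain_length_ge[of _ G]) (use Gp Gs in simp_all)
    then have "k \<le> d" using d by simp
    then show ?thesis using F(5) by blast
  qed
  then show ?thesis using d by blast
qed

end

subsection \<open>Frobenius powers of localized ideals\<close>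

context prime_char_ring
begin

text \<open>The elements \<open>i^q x\<close> generate both sides. This is the passage from
  Frobenius powers of ideals, as they occur in the statement, to products over restricted
  scalars.\<close>

lemma isub_frobenius_power:
  assumes M: "module R M" and I: "ideal I R"
  shows "isub R M (frobenius_power R I (p ^ e)) (carrier M) = isub R (fpush R p e M) I (carrier M)"
proof
  interpret M: module R M by (rule M)
  let ?F = "fpush R p e M"
  interpret F: module R ?F by (rule module_fpush[OF M])
  interpret I: ideal I R by (rule I)
  let ?B = "frobenius_power R I (p ^ e)"
  have Ic: "I \<subseteq> carrier R" by (rule I.a_subset)
  have q: "(\<lambda>a. a [^] (p ^ e)) ` I \<subseteq> carrier R" using Ic by auto
  have B: "ideal ?B R" unfolding frobenius_power_def by (rule genideal_ideal[OF q])
  interpret B: ideal ?B R by (rule B)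
  have sN: "submodule (isub R ?F I (carrier M)) R M"
    by (rule isub_fpush_submodule[OF M Ic M.carrier_is_submodule])
  show "isub R M ?B (carrier M) \<subseteq> isub R ?F I (carrier M)"
  proof (rule M.isub_least[OF sN])
    fix a x assume a: "a \<in> ?B" and x: "x \<in> carrier M"
    have "?B \<subseteq> {r \<in> carrier R. r \<odot>\<^bsub>M\<^esub> x \<in> isub R ?F I (carrier M)}"
      unfolding frobenius_power_def
    proof (rule genideal_minimal[OF M.submodule_ideal_quot[OF sN x]], rule subsetI)
      fix b assume "b \<in> (\<lambda>a. a [^] (p ^ e)) ` I"
      then obtain i where i: "i \<in> I" "b = i [^] (p ^ e)" by blast
      have ic: "i \<in> carrier R" using i(1) Ic by blast
      have "i \<odot>\<^bsub>?F\<^esub> x \<in> isub R ?F I (carrier M)" by (rule F.isub_mem[OF i(1) x])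
      then show "b \<in> {r \<in> carrier R. r \<odot>\<^bsub>M\<^esub> x \<in> isub R ?F I (carrier M)}"
        using ic i(2) by (simp add: fpush_smult[OF ic])
    qed
    then show "a \<odot>\<^bsub>M\<^esub> x \<in> isub R ?F I (carrier M)" using a by blast
  qed
  have sB: "submodule (isub R M ?B (carrier M)) R M" by (rule M.isub_submodule[OF B.a_subset subset_refl])
  show "isub R ?F I (carrier M) \<subseteq> isub R M ?B (carrier M)"
  proof (rule F.isub_least[OF submodule_fpush[OF M sB]])
    fix a x assume a: "a \<in> I" and x: "x \<in> carrier M"
    have "a [^] (p ^ e) \<in> ?B" unfolding frobenius_power_def using genideal_self[OF q] a by blast
    then have "(a [^] (p ^ e)) \<odot>\<^bsub>M\<^esub> x \<in> isub R M ?B (carrier M)" by (rule M.isub_mem[OF _ x])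
    then show "a \<odot>\<^bsub>?F\<^esub> x \<in> isub R M ?B (carrier M)" using a Ic by (simp add: fpush_smult subset_iff)
  qed
qed

text \<open>If \<open>s a \<in> I\<close>, then \<open>s^q a^q x\<close> lies in
  \<open>I^[q] M\<close>, and \<open>s^q\<close> is again a denominator. The given ideals may thus
  be replaced by their saturations, for which the estimates are stated.\<close>

lemma psat_isub_fpush:
  assumes M: "module R M" and P: "primeideal P R" and I: "ideal I R"
  shows "psat R M P (isub R (fpush R p e M) I (carrier M))
    = psat R M P (isub R (fpush R p e M) (psat R (self_module R) P I) (carrier M))"
proof
  interpret M: module R M by (rule M)
  let ?F = "fpush R p e M" and ?I = "psat R (self_module R) P I"
  interpret F: module R ?F by (rule module_fpush[OF M])
  interpret S: module R "self_module R" by (rule module_self)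
  interpret I: ideal I R by (rule I)
  have Ic: "I \<subseteq> carrier R" by (rule I.a_subset)
  have I': "I \<subseteq> ?I" using S.psat_upper[OF P, of I] Ic by simp
  show "psat R M P (isub R ?F I (carrier M)) \<subseteq> psat R M P (isub R ?F ?I (carrier M))"
    by (rule M.psat_mono[OF F.isub_mono[OF I' subset_refl]])
  let ?N = "isub R ?F I (carrier M)"
  have sN: "submodule ?N R M" by (rule isub_fpush_submodule[OF M Ic M.carrier_is_submodule])
  have Nc: "?N \<subseteq> carrier M" using M.submodule_carrier[OF sN] by blast
  have "isub R ?F ?I (carrier M) \<subseteq> psat R M P ?N"
  proof (rule F.isub_least[OF submodule_fpush[OF M M.submodule_psat[OF P sN]]])
    fix a x assume a: "a \<in> ?I" and x: "x \<in> carrier M"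
    obtain s where s: "a \<in> carrier R" "s \<in> carrier R - P" "s \<otimes> a \<in> I" using a by (auto simp: psat_def)
    have sc: "s \<in> carrier R" using s(2) by simp
    have qc: "a [^] (p ^ e) \<in> carrier R" "s [^] (p ^ e) \<in> carrier R" using s(1) sc by simp_all
    have "(s \<otimes> a) \<odot>\<^bsub>?F\<^esub> x \<in> ?N" by (rule F.isub_mem[OF s(3) x])
    moreover have "(s \<otimes> a) \<odot>\<^bsub>?F\<^esub> x = (s [^] (p ^ e)) \<odot>\<^bsub>M\<^esub> ((a [^] (p ^ e)) \<odot>\<^bsub>M\<^esub> x)"
      unfolding fpush_smult[OF m_closed[OF sc s(1)]] nat_pow_distrib[OF sc s(1)] by (rule M.smult_assoc1[OF qc(2,1) x])
    ultimately have "(s [^] (p ^ e)) \<odot>\<^bsub>M\<^esub> ((a [^] (p ^ e)) \<odot>\<^bsub>M\<^esub> x) \<in> ?N" by simp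
    moreover have "s [^] (p ^ e) \<in> carrier R - P" using primeideal_pow_mem[OF P sc] qc(2) s(2) by blast
    ultimately have "(a [^] (p ^ e)) \<odot>\<^bsub>M\<^esub> x \<in> psat R M P ?N"
      using M.psatI[OF M.smult_closed[OF qc(1) x]] by blast
    then show "a \<odot>\<^bsub>?F\<^esub> x \<in> psat R M P ?N" by (simp add: fpush_smult[OF s(1)])
  qed
  then show "psat R M P (isub R ?F ?I (carrier M)) \<subseteq> psat R M P ?N" by (rule M.psat_least[OF P _ Nc])
qed

end

context localization
begin

text \<open>Contraction reflects inclusions, since every element of \<open>Mh\<close> becomes an
  image from \<open>M\<close> after multiplication by a unit.\<close>

lemma subset_if_cm_subset:
  assumes K: "submodule K Rh Mh" and L: "submodule L Rh Mh" and KL: "cm K \<subseteq> cm L"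
  shows "K \<subseteq> L"
proof
  interpret Mh: module Rh Mh by (rule modh)
  fix y assume y: "y \<in> K"
  have yc: "y \<in> carrier Mh" by (rule Mh.submodule_carrier[OF K y])
  obtain s x where s: "s \<in> carrier R - P" "x \<in> carrier M" "iR s \<odot>\<^bsub>Mh\<^esub> y = iM x" using iM_surj[OF yc] by blast
  have "iM x \<in> K" unfolding s(3)[symmetric] using Mh.submodule_smult[OF K iR_closed y] s(1) by simp
  then have "x \<in> cm L" using s(2) KL by (auto simp: cm_def)
  then have "iR s \<odot>\<^bsub>Mh\<^esub> y \<in> L" using s(3) by (simp add: cm_def)
  then show "y \<in> L" by (rule unit_cancel[OF L s(1) yc])
qed

end

lemma (in module) quotient_length_at_eq:
  assumes P: "primeideal P R" and I: "ideal I R" and J: "ideal J R"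
    and IJ: "psat R M P (isub R M I (carrier M)) \<subseteq> psat R M P (isub R M J (carrier M))"
  shows "quotient_length_at R M P J I
    = the_enat (len R M P (psat R M P (isub R M I (carrier M))) (psat R M P (isub R M J (carrier M))))"
proof -
  let ?i = "\<lambda>a. ring_fraction R (carrier R - P) a \<one>" and ?j = "\<lambda>x. fraction R M (carrier R - P) x \<one>"
  interpret l: localization R M P "ring_at R P" "module_at R M P" ?i ?j by (rule localization_module[OF P])
  note cmI = l.cm_ideal_smult[OF I] and cmJ = l.cm_ideal_smult[OF J]
  note sI = l.ideal_smult_submodule[OF I] and sJ = l.ideal_smult_submodule[OF J]
  show ?thesis
    unfolding quotient_length_at_def ideal_at_def
    using l.module_length_quotient[OF sI sJ l.subset_if_cm_subset[OF sI sJ]] IJ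
    by (simp only: cmI cmJ)
qed

context cring
begin

lemma psat_subset_if_ideal_at_subset:
  assumes P: "primeideal P R" and I: "ideal I R" and J: "ideal J R" and IJ: "ideal_at R I P \<subseteq> ideal_at R J P"
  shows "psat R (self_module R) P I \<subseteq> psat R (self_module R) P J"
    and "ideal_quotient_length_at R P J I
      = the_enat (len R (self_module R) P (psat R (self_module R) P I) (psat R (self_module R) P J))"
proof -
  note l = localization_self[OF P]
  interpret l: localization R "self_module R" P "ring_at R P" "self_module (ring_at R P)"
    "\<lambda>a. ring_fraction R (carrier R - P) a \<one>" "\<lambda>a. ring_fraction R (carrier R - P) a \<one>" by (rule l)
  note cI = cm_genideal[OF l is_cring cring_ring_at[OF P] I, folded ideal_at_def]
  note cJ = cm_genideal[OF l is_cring cring_ring_at[OF P] J, folded ideal_at_def]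
  show "psat R (self_module R) P I \<subseteq> psat R (self_module R) P J"
    unfolding cI(1)[symmetric] cJ(1)[symmetric] by (rule l.cm_mono[OF IJ])
  show "ideal_quotient_length_at R P J I
      = the_enat (len R (self_module R) P (psat R (self_module R) P I) (psat R (self_module R) P J))"
    unfolding ideal_quotient_length_at_def l.module_length_quotient[OF cI(2) cJ(2) IJ] cI(1) cJ(1) ..
qed

text \<open>Contracts the radical condition from \<open>R_P\<close> to \<open>R\<close>, in the form
  from which \<open>len_primary_finite\<close> derives that lengths are finite.\<close>

lemma power_mem_psat_if_radical:
  assumes P: "primeideal P R" and I: "ideal I R"
    and rad: "radical (ring_at R P) (ideal_at R I P) = ideal_at R P P" and r: "r \<in> P"
  shows "\<exists>k::nat. r [^] k \<in> psat R (self_module R) P I"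
proof -
  let ?i = "\<lambda>a. ring_fraction R (carrier R - P) a \<one>"
  note l = localization_self[OF P]
  interpret l: localization R "self_module R" P "ring_at R P" "self_module (ring_at R P)" ?i ?i by (rule l)
  interpret Rh: cring "ring_at R P" by (rule cring_ring_at[OF P])
  interpret h: ring_hom_ring R "ring_at R P" ?i
    by (rule ring_hom_ringI2[OF ring_axioms Rh.ring_axioms l.iR])
  have Pc: "P \<subseteq> carrier R" by (rule primeideal_subset[OF P])
  have im: "?i ` P \<subseteq> carrier (ring_at R P)" using Pc l.iR_closed by blast
  have "?i r \<in> ideal_at R P P" unfolding ideal_at_def using Rh.genideal_self[OF im] r by blast
  then obtain k :: nat where "?i r [^]\<^bsub>ring_at R P\<^esub> k \<in> ideal_at R I P"
    unfolding rad[symmetric] radical_def by blast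
  moreover have "?i r [^]\<^bsub>ring_at R P\<^esub> k = ?i (r [^] k)" using h.hom_nat_pow[of r k] r Pc by auto
  ultimately have "r [^] k \<in> l.cm (ideal_at R I P)" using r Pc by (auto simp: l.cm_def)
  then show ?thesis
    using cm_genideal(1)[OF l is_cring cring_ring_at[OF P] I, folded ideal_at_def] by blast
qed

text \<open>The characteristic is defined as a gcd, which has to be shown to annihilate the unit. By
  division with remainder, the least positive annihilating integer divides all others and hence
  equals the gcd.\<close>

lemma ring_char_nat_mult_one:
  assumes "ring_char R = p" "Factorial_Ring.prime p"
  shows "[p] \<cdot> \<one> = \<zero>"
proof -
  let ?S = "{n::nat. [n] \<cdot> \<one> = \<zero>}"
  have G: "Gcd ?S = p" using assms(1) by (simp add: ring_char_def)
  have "p \<noteq> 0" using assms(2) by auto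
  then have "\<not> ?S \<subseteq> {0}" using G Gcd_0_iff[of ?S] by metis
  then have ex: "\<exists>n. n \<in> ?S \<and> n \<noteq> 0" by blast
  define g where "g = (LEAST n. n \<in> ?S \<and> n \<noteq> 0)"
  have g: "g \<in> ?S \<and> g \<noteq> 0" unfolding g_def by (rule LeastI_ex[OF ex])
  have least: "g \<le> n" if "n \<in> ?S \<and> n \<noteq> 0" for n unfolding g_def using that by (rule Least_le)
  have g1: "[g] \<cdot> \<one> = \<zero>" using g by blast
  have gdvd: "g dvd n" if n: "n \<in> ?S" for n
  proof (rule ccontr)
    assume "\<not> g dvd n"
    then have m0: "n mod g \<noteq> 0" by (simp add: mod_eq_0_iff_dvd)
    have "[(g * (n div g))] \<cdot> \<one> \<oplus> [(n mod g)] \<cdot> \<one> = [n] \<cdot> \<one>"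
      using add.nat_pow_mult[OF one_closed, of "g * (n div g)" "n mod g"] by simp
    moreover have "[(g * (n div g))] \<cdot> \<one> = \<zero>" unfolding add.nat_pow_pow[OF one_closed, symmetric] g1 by (rule add.nat_pow_one)
    ultimately have "[(n mod g)] \<cdot> \<one> = \<zero>" using n by simp
    then have "g \<le> n mod g" using m0 by (intro least) simp
    moreover have "n mod g < g" using g by simp
    ultimately show False by simp
  qed
  have "g dvd p" unfolding G[symmetric] by (simp only: dvd_Gcd_iff) (blast intro: gdvd)
  moreover have "p dvd g" unfolding G[symmetric] using g by (intro Gcd_dvd) simp
  ultimately show ?thesis using g dvd_antisym[of g p] by simp
qed

end

section \<open>Finiteness of the lengths and assembly of the estimate\<close>

context ffinite_ring
begin

text \<open>Each element of \<open>P\<close> has a power in \<open>I\<close>, so the filtration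
  primes of \<open>R / I\<close> contain \<open>P\<close>. At \<open>P\<close> only the factors
  \<open>R / P\<close> survive, and each counts one.\<close>

lemma len_primary_finite:
  assumes P: "primeideal P R" and I: "ideal I R" and pow: "\<forall>r\<in>P. \<exists>k::nat. r [^] k \<in> I"
    and J: "ideal J R" and IJ: "I \<subseteq> J"
  shows "\<exists>n. len R Rm P I J = enat n"
proof -
  interpret S: module R Rm by (rule module_self)
  interpret I: ideal I R by (rule I)
  interpret J: ideal J R by (rule J)
  have sI: "submodule I R Rm" and sJ: "submodule J R Rm" by (rule submodule_self_ideal[OF I], rule submodule_self_ideal[OF J])
  have sR: "submodule (carrier R) R Rm" by (rule submodule_self_carrier)
  obtain Qs where Qs: "pfilt R Rm I Qs (carrier R)"
    using S.fg_sub_pfilt[OF noetherian_ring_axioms sI fg_sub_self I.a_subset] by blast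
  have prQ: "primeideal Q R" if "Q \<in> set Qs" for Q by (rule S.pfilt_primes[OF Qs that])
  have PQ: "P \<subseteq> Q" if Q: "Q \<in> set Qs" for Q
  proof
    fix r assume r: "r \<in> P"
    have rc: "r \<in> carrier R" using primeideal_subset[OF P] r by blast
    obtain k :: nat where k: "r [^] k \<in> I" using pow r by blast
    have "r [^] k \<in> Q"
    proof (rule S.pfilt_ann[OF Qs sI _ _ Q])
      show "(r [^] k) \<odot>\<^bsub>Rm\<^esub> x \<in> I" if "x \<in> carrier R" for x using I.I_r_closed[OF k that] by simp
    qed (use rc in simp)
    then show "r \<in> Q" by (rule primeideal_pow_mem[OF prQ[OF Q] rc])
  qed
  have "len R Rm P I (carrier R) = (\<Sum>Q\<leftarrow>Qs. len R Rm P Q (carrier R))"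
    using len_pfilt[OF module_self P sI Qs, of 0] by simp
  also have "\<dots> = (\<Sum>Q\<leftarrow>Qs. enat (if Q = P then 1 else 0))"
  proof (rule arg_cong[where f = sum_list], rule map_cong[OF refl])
    fix Q assume Q: "Q \<in> set Qs"
    have "len R Rm P Q (carrier R) = (if Q = P then 1 else 0)"
      by (rule len_quot_prime[OF P prQ[OF Q]]) (use PQ[OF Q] in blast)
    then show "len R Rm P Q (carrier R) = enat (if Q = P then 1 else 0)" by (simp add: one_enat_def zero_enat_def)
  qed
  also have "\<dots> = enat (\<Sum>Q\<leftarrow>Qs. if Q = P then 1 else 0)" by (rule sum_list_enat)
  finally have fin: "len R Rm P I (carrier R) = enat (\<Sum>Q\<leftarrow>Qs. if Q = P then 1 else 0)" .
  have u: "X \<subseteq> psat R Rm P X" if "X \<subseteq> carrier R" for X using S.psat_upper[OF P, of X] that by simp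
  have R1: "psat R Rm P (carrier R) = carrier R" using S.psat_zero_full[OF P] by simp
  have "len R Rm P I J \<le> len R Rm P I (carrier R)"
    by (rule S.len_mono[OF P sI sR sI sJ]) (use u I.a_subset J.a_subset R1 in simp_all)
  then show ?thesis unfolding fin using enat_eq_of_le by blast
qed

text \<open>\<open>Phi\<close> is the length over restricted scalars and equals
  \<open>fdeg P ^ e\<close> times the length over \<open>R_P\<close>. Every term of the one-step
  comparison carries the factor \<open>fdeg P ^ (e + 1)\<close>; removing it leaves an estimate for
  lengths over \<open>R_P\<close> with growth \<open>p ^ d\<close>, to which
  \<open>telescope\<close> applies.\<close>

lemma frobenius_length_bound:
  assumes M: "module R M" and fg: "fg_sub R M (carrier M)"
  shows "\<exists>C::nat. \<forall>P d I J n e k. primeideal P R \<longrightarrow> ideal I R \<longrightarrow> psat R Rm P I = I \<longrightarrow>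
    ideal J R \<longrightarrow> psat R Rm P J = J \<longrightarrow> I \<subseteq> J \<longrightarrow> len R Rm P I J = enat n \<longrightarrow>
    (\<forall>Q. primeideal Q R \<longrightarrow> Q \<subseteq> P \<longrightarrow> annihilator R M \<subseteq> Q \<longrightarrow> (\<exists>k\<le>d. fdeg Q = p ^ k * fdeg P)) \<longrightarrow>
    (\<exists>\<phi>::nat \<Rightarrow> nat. (\<forall>e. len R M P (isub R (fpush R p e M) I (carrier M)) (isub R (fpush R p e M) J (carrier M)) = enat (\<phi> e))
      \<and> \<bar>real p ^ (d * k) * real (\<phi> e) - real (\<phi> (e + k))\<bar> \<le> 2 * (real n * real C) * real p ^ (d * (e + k)) / real p ^ e)"
proof -
  interpret M: module R M by (rule M)
  obtain C :: nat where C: "\<forall>P d e I J n. primeideal P R \<longrightarrow> ideal I R \<longrightarrow> psat R Rm P I = I \<longrightarrow>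
    ideal J R \<longrightarrow> psat R Rm P J = J \<longrightarrow> I \<subseteq> J \<longrightarrow> len R Rm P I J = enat n \<longrightarrow>
    (\<forall>Q'. primeideal Q' R \<longrightarrow> Q' \<subseteq> P \<longrightarrow> annihilator R M \<subseteq> Q' \<longrightarrow> (\<exists>k\<le>d. fdeg Q' = p ^ k * fdeg P)) \<longrightarrow>
    (\<exists>a b. Phi e M P I J (carrier M) = enat a \<and> Phi (Suc e) M P I J (carrier M) = enat b \<and>
      p ^ e * b \<le> p ^ e * (p ^ d * fdeg P) * a + n * C * (p ^ d * fdeg P) ^ Suc e \<and>
      p ^ e * (p ^ d * fdeg P) * a \<le> p ^ e * b + n * C * (p ^ d * fdeg P) ^ Suc e)"
    using Phi_compare[OF M fg] by (elim exE)
  show ?thesis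
  proof (rule exI[of _ C], intro allI impI)
    fix P d I J n e k
    assume P: "primeideal P R" and I: "ideal I R" "psat R Rm P I = I" and J: "ideal J R" "psat R Rm P J = J"
      and IJ: "I \<subseteq> J" and n: "len R Rm P I J = enat n"
      and H: "\<forall>Q. primeideal Q R \<longrightarrow> Q \<subseteq> P \<longrightarrow> annihilator R M \<subseteq> Q \<longrightarrow> (\<exists>k\<le>d. fdeg Q = p ^ k * fdeg P)"
    have Ic: "I \<subseteq> carrier R" by (rule additive_subgroup.a_subset[OF ideal.axioms(1)[OF I(1)]])
    have Jc: "J \<subseteq> carrier R" by (rule additive_subgroup.a_subset[OF ideal.axioms(1)[OF J(1)]])
    let ?l = "\<lambda>e. len R M P (isub R (fpush R p e M) I (carrier M)) (isub R (fpush R p e M) J (carrier M))"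
    have Ph: "Phi e M P I J (carrier M) = enat (fdeg P ^ e) * ?l e" for e
    proof -
      let ?F = "fpush R p e M"
      have sI: "submodule (isub R ?F I (carrier M)) R M" and sJ: "submodule (isub R ?F J (carrier M)) R M"
        by (rule isub_fpush_submodule[OF M Ic M.carrier_is_submodule], rule isub_fpush_submodule[OF M Jc M.carrier_is_submodule])
      have "isub R ?F I (carrier M) \<subseteq> isub R ?F J (carrier M)"
        by (rule module.isub_mono[OF module_fpush[OF M] IJ subset_refl])
      also have "\<dots> \<subseteq> psat R M P (isub R ?F J (carrier M))"
        by (rule M.psat_upper[OF P]) (use M.submodule_carrier[OF sJ] in blast)
      finally show ?thesis
        unfolding Phi_eq[OF M M.carrier_is_submodule Ic Jc] by (rule len_fpush[OF M sI sJ P])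
    qed
    have step: "\<exists>a b. Phi e M P I J (carrier M) = enat a \<and> Phi (Suc e) M P I J (carrier M) = enat b \<and>
      p ^ e * b \<le> p ^ e * (p ^ d * fdeg P) * a + n * C * (p ^ d * fdeg P) ^ Suc e \<and>
      p ^ e * (p ^ d * fdeg P) * a \<le> p ^ e * b + n * C * (p ^ d * fdeg P) ^ Suc e" for e
      using C[THEN spec[of _ P], THEN spec[of _ d], THEN spec[of _ e], THEN spec[of _ I], THEN spec[of _ J], THEN spec[of _ n],
          THEN mp[OF _ P], THEN mp[OF _ I(1)], THEN mp[OF _ I(2)],
          THEN mp[OF _ J(1)], THEN mp[OF _ J(2)], THEN mp[OF _ IJ], THEN mp[OF _ n], THEN mp[OF _ H]] .
    have f0: "0 < fdeg P" by (rule fdeg_pos[OF P])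
    have p2: "2 \<le> p" using p_prime by (rule prime_ge_2_nat)
    have "\<exists>m. ?l e = enat m" for e
    proof (cases "?l e")
      case infinity
      then have "Phi e M P I J (carrier M) = \<infinity>" using f0 by (simp add: Ph imult_is_infinity zero_enat_def)
      then show ?thesis using step[of e] by auto
    qed simp
    then obtain \<phi> where \<phi>: "\<forall>e. ?l e = enat (\<phi> e)" by metis
    have st: "\<bar>real p ^ d * real (\<phi> e) - real (\<phi> (Suc e))\<bar> \<le> (real n * real C) * real p ^ (d * Suc e) / real p ^ e" for e
    proof -
      define f where "f = fdeg P"
      have "p ^ e * (f ^ Suc e * \<phi> (Suc e)) \<le> p ^ e * (p ^ d * f) * (f ^ e * \<phi> e) + n * C * (p ^ d * f) ^ Suc e"
        "p ^ e * (p ^ d * f) * (f ^ e * \<phi> e) \<le> p ^ e * (f ^ Suc e * \<phi> (Suc e)) + n * C * (p ^ d * f) ^ Suc e"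
        using step[of e] \<phi> by (auto simp: Ph f_def)
      \<comment> \<open>The common factor is exposed and then cancelled, as \<open>fdeg P\<close> is
        positive. Afterwards the bound depends on the prime and the ideals only through
        \<open>d\<close> and \<open>n\<close>.\<close>
      then have "f ^ Suc e * (p ^ e * \<phi> (Suc e)) \<le> f ^ Suc e * (p ^ e * p ^ d * \<phi> e + n * C * (p ^ d) ^ Suc e)"
        "f ^ Suc e * (p ^ e * p ^ d * \<phi> e) \<le> f ^ Suc e * (p ^ e * \<phi> (Suc e) + n * C * (p ^ d) ^ Suc e)"
        by (simp_all add: algebra_simps power_mult_distrib)
      then have "p ^ e * \<phi> (Suc e) \<le> p ^ e * p ^ d * \<phi> e + n * C * (p ^ d) ^ Suc e"
        "p ^ e * p ^ d * \<phi> e \<le> p ^ e * \<phi> (Suc e) + n * C * (p ^ d) ^ Suc e"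
        using f0 by (simp_all only: mult_le_cancel1 f_def zero_less_power)
      then have r: "real (p ^ e * \<phi> (Suc e)) \<le> real (p ^ e * p ^ d * \<phi> e + n * C * (p ^ d) ^ Suc e)"
        "real (p ^ e * p ^ d * \<phi> e) \<le> real (p ^ e * \<phi> (Suc e) + n * C * (p ^ d) ^ Suc e)"
        by (simp_all only: of_nat_le_iff)
      have pe: "0 < real p ^ e" using p2 by simp
      have "\<bar>real p ^ d * real (\<phi> e) - real (\<phi> (Suc e))\<bar> * real p ^ e
        = \<bar>real p ^ e * (real p ^ d * real (\<phi> e)) - real p ^ e * real (\<phi> (Suc e))\<bar>"
        unfolding right_diff_distrib[symmetric] abs_mult abs_of_pos[OF pe] by (rule mult.commute)
      also have "\<dots> \<le> real n * real C * real p ^ (d * Suc e)"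
        using r unfolding of_nat_add of_nat_mult of_nat_power power_mult by (simp only: abs_le_iff) (simp add: mult.assoc)
      finally show ?thesis using pe by (simp only: pos_le_divide_eq)
    qed
    have "\<bar>real p ^ (d * k) * real (\<phi> e) - real (\<phi> (e + k))\<bar> \<le> 2 * (real n * real C) * real p ^ (d * (e + k)) / real p ^ e"
      by (rule telescope[where f = "\<lambda>e. real (\<phi> e)"]) (use p2 st in simp_all)
    then show "\<exists>\<phi>. (\<forall>e. ?l e = enat (\<phi> e)) \<and>
      \<bar>real p ^ (d * k) * real (\<phi> e) - real (\<phi> (e + k))\<bar> \<le> 2 * (real n * real C) * real p ^ (d * (e + k)) / real p ^ e"
      using \<phi> by blast
  qed
qed

text \<open>Combines the translation of lengths over \<open>R_P\<close> into saturated lengths with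
  the replacement of Frobenius powers by products over restricted scalars. Saturating the end points
  does not change the length, by \<open>len_cong\<close>.\<close>

lemma quotient_length_at_frobenius_power:
  assumes M: "module R M" and P: "primeideal P R" and I: "ideal I R" and J: "ideal J R"
    and IJ: "psat R Rm P I \<subseteq> psat R Rm P J"
  shows "quotient_length_at R M P (frobenius_power R J (p ^ e)) (frobenius_power R I (p ^ e))
    = the_enat (len R M P (isub R (fpush R p e M) (psat R Rm P I) (carrier M))
        (isub R (fpush R p e M) (psat R Rm P J) (carrier M)))"
proof -
  interpret M: module R M by (rule M)
  interpret S: module R Rm by (rule module_self)
  let ?F = "fpush R p e M"
  have fi: "ideal (frobenius_power R X (p ^ e)) R" if "ideal X R" for X
  proof -
    have "X \<subseteq> carrier R" using ideal.axioms(1)[OF that] additive_subgroup.a_subset by blast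
    then show ?thesis unfolding frobenius_power_def by (intro genideal_ideal) auto
  qed
  have pi: "psat R Rm P X \<subseteq> carrier R" for X by (auto simp: psat_def)
  have eq: "psat R M P (isub R M (frobenius_power R X (p ^ e)) (carrier M))
      = psat R M P (isub R ?F (psat R Rm P X) (carrier M))" if X: "ideal X R" for X
    unfolding isub_frobenius_power[OF M X] by (rule psat_isub_fpush[OF M P X])
  have s: "submodule (isub R ?F (psat R Rm P X) (carrier M)) R M" for X
    by (rule isub_fpush_submodule[OF M pi M.carrier_is_submodule])
  have sc: "isub R ?F (psat R Rm P X) (carrier M) \<subseteq> carrier M" for X using M.submodule_carrier[OF s] by blast
  have "isub R ?F (psat R Rm P I) (carrier M) \<subseteq> isub R ?F (psat R Rm P J) (carrier M)"
    by (rule module.isub_mono[OF module_fpush[OF M] IJ subset_refl])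
  then have le: "psat R M P (isub R ?F (psat R Rm P I) (carrier M)) \<subseteq> psat R M P (isub R ?F (psat R Rm P J) (carrier M))"
    by (rule M.psat_mono)
  have "quotient_length_at R M P (frobenius_power R J (p ^ e)) (frobenius_power R I (p ^ e))
    = the_enat (len R M P (psat R M P (isub R ?F (psat R Rm P I) (carrier M))) (psat R M P (isub R ?F (psat R Rm P J) (carrier M))))"
    using M.quotient_length_at_eq[OF P fi[OF I] fi[OF J]] le unfolding eq[OF I] eq[OF J] by blast
  also have "len R M P (psat R M P (isub R ?F (psat R Rm P I) (carrier M))) (psat R M P (isub R ?F (psat R Rm P J) (carrier M)))
    = len R M P (isub R ?F (psat R Rm P I) (carrier M)) (isub R ?F (psat R Rm P J) (carrier M))"
    by (rule M.len_cong[OF P M.submodule_psat[OF P s] M.submodule_psat[OF P s] s s])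
      (use le in \<open>simp_all only: M.psat_idem[OF P sc]\<close>)
  finally show ?thesis .
qed

end

theorem theorem3p6:
  fixes R :: "('a, 'c) ring_scheme" and M :: "('a, 'b, 'd) module_scheme" and p :: nat
  assumes "cring R" and "noetherian_ring R"
    and "Factorial_Ring.prime p" and "ring_char R = p"
    and "F_finite R"
    and "module R M" and "finitely_generated R M"
  shows "\<exists>C::real. \<forall>P e1 e2 I J.
    primeideal P R \<longrightarrow> ideal I R \<longrightarrow> ideal J R \<longrightarrow>
    primary_pair (ring_at R P) (ideal_at R P P) (ideal_at R I P) (ideal_at R J P) \<longrightarrow>
    (let d = dim_at R M P; q1 = p ^ e1; q2 = p ^ e2 in
      \<bar>real (quotient_length_at R M P (frobenius_power R J q1) (frobenius_power R I q1))
           * real q2 ^ d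
         - real (quotient_length_at R M P (frobenius_power R J (q1 * q2))
             (frobenius_power R I (q1 * q2)))\<bar>
      \<le> C * real q2 ^ d * real q1 powi (int d - 1) * real (ideal_quotient_length_at R P J I))"
proof -
  interpret ffinite_ring R p
  proof (intro ffinite_ring.intro prime_char_ring.intro prime_char_ring_axioms.intro ffinite_ring_axioms.intro)
    show "cring R" by fact
    show "noetherian_ring R" by fact
    show "Factorial_Ring.prime p" by fact
    show "[p] \<cdot>\<^bsub>R\<^esub> \<one>\<^bsub>R\<^esub> = \<zero>\<^bsub>R\<^esub>" by (rule cring.ring_char_nat_mult_one[OF \<open>cring R\<close> \<open>ring_char R = p\<close> \<open>Factorial_Ring.prime p\<close>])
    \<comment> \<open>On \<open>R\<close> itself, restriction of scalars along one Frobenius step is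
      the module that defines F-finiteness.\<close>
    have "frobenius_module R p = tw R p (self_module R)"
      by (simp add: frobenius_module_def tw_def self_module_def)
    then show "finitely_generated R (tw R p (self_module R))"
      using \<open>F_finite R\<close> \<open>ring_char R = p\<close> by (simp add: F_finite_def)
  qed
  note M = \<open>module R M\<close>
  interpret M: module R M by (rule M)
  interpret S: module R Rm by (rule module_self)
  have fg: "fg_sub R M (carrier M)" using \<open>finitely_generated R M\<close> by (rule M.fg_sub_carrier)
  obtain C :: nat where C: "\<forall>P d I J n e k. primeideal P R \<longrightarrow> ideal I R \<longrightarrow> psat R Rm P I = I \<longrightarrow>
    ideal J R \<longrightarrow> psat R Rm P J = J \<longrightarrow> I \<subseteq> J \<longrightarrow> len R Rm P I J = enat n \<longrightarrow>
    (\<forall>Q. primeideal Q R \<longrightarrow> Q \<subseteq> P \<longrightarrow> annihilator R M \<subseteq> Q \<longrightarrow> (\<exists>k\<le>d. fdeg Q = p ^ k * fdeg P)) \<longrightarrow>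
    (\<exists>\<phi>::nat \<Rightarrow> nat. (\<forall>e. len R M P (isub R (fpush R p e M) I (carrier M)) (isub R (fpush R p e M) J (carrier M)) = enat (\<phi> e))
      \<and> \<bar>real p ^ (d * k) * real (\<phi> e) - real (\<phi> (e + k))\<bar> \<le> 2 * (real n * real C) * real p ^ (d * (e + k)) / real p ^ e)"
    using frobenius_length_bound[OF M fg] by (elim exE)
  \<comment> \<open>\<open>C\<close> is the constant of a single Frobenius step, and the factor
    \<open>2\<close> is the sum of the geometric series in \<open>telescope\<close>. Both are fixed
    before \<open>P\<close>, the ideals and the exponents.\<close>
  show ?thesis
  proof (rule exI[of _ "2 * real C"], intro allI impI)
    fix P e1 e2 I J
    assume P: "primeideal P R" and I: "ideal I R" and J: "ideal J R"
      and pp: "primary_pair (ring_at R P) (ideal_at R P P) (ideal_at R I P) (ideal_at R J P)"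
    \<comment> \<open>The ideals enter only through their localizations, so they are replaced by the
      contractions of their extensions to \<open>R_P\<close>.\<close>
    let ?I = "psat R Rm P I" and ?J = "psat R Rm P J"
    have IJ': "ideal_at R I P \<subseteq> ideal_at R J P"
      and rad: "radical (ring_at R P) (ideal_at R I P) = ideal_at R P P"
      using pp by (simp_all add: primary_pair_def)
    note IJ = psat_subset_if_ideal_at_subset[OF P I J IJ']
    have pc: "X \<subseteq> carrier Rm" if "ideal X R" for X
      using ideal.axioms(1)[OF that] additive_subgroup.a_subset by (simp add: additive_subgroup.a_subset)
    have Is: "ideal ?I R" "psat R Rm P ?I = ?I"
      using S.submodule_psat[OF P submodule_self_ideal[OF I]] S.psat_idem[OF P pc[OF I]] by (simp_all only: submodule_self_iff)
    have Js: "ideal ?J R" "psat R Rm P ?J = ?J"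
      using S.submodule_psat[OF P submodule_self_ideal[OF J]] S.psat_idem[OF P pc[OF J]] by (simp_all only: submodule_self_iff)
    have "\<forall>r\<in>P. \<exists>k::nat. r [^]\<^bsub>R\<^esub> k \<in> ?I" by (rule ballI) (rule power_mem_psat_if_radical[OF P I rad])
    then obtain n where n: "len R Rm P ?I ?J = enat n" using len_primary_finite[OF P Is(1) _ Js(1) IJ(1)] by blast
    obtain d where d: "krull_dim (ring_at R P Quot annihilator (ring_at R P) (module_at R M P)) = enat d"
      "\<forall>Q. primeideal Q R \<longrightarrow> Q \<subseteq> P \<longrightarrow> annihilator R M \<subseteq> Q \<longrightarrow> (\<exists>k\<le>d. fdeg Q = p ^ k * fdeg P)"
      using krull_dim_bound[OF M fg M.localization_module[OF P] localization_self[OF P]] by (elim exE conjE)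
    have dim: "dim_at R M P = d" by (simp add: dim_at_def module_dim_def d(1))
    have il: "ideal_quotient_length_at R P J I = n" by (simp add: IJ(2) n)
    obtain \<phi> :: "nat \<Rightarrow> nat" where
      \<phi>: "\<forall>e. len R M P (isub R (fpush R p e M) ?I (carrier M)) (isub R (fpush R p e M) ?J (carrier M)) = enat (\<phi> e)"
      and b: "\<bar>real p ^ (d * e2) * real (\<phi> e1) - real (\<phi> (e1 + e2))\<bar> \<le> 2 * (real n * real C) * real p ^ (d * (e1 + e2)) / real p ^ e1"
      using C[THEN spec[of _ P], THEN spec[of _ d], THEN spec[of _ ?I], THEN spec[of _ ?J], THEN spec[of _ n],
          THEN spec[of _ e1], THEN spec[of _ e2], THEN mp[OF _ P], THEN mp[OF _ Is(1)], THEN mp[OF _ Is(2)],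
          THEN mp[OF _ Js(1)], THEN mp[OF _ Js(2)], THEN mp[OF _ IJ(1)], THEN mp[OF _ n], THEN mp[OF _ d(2)]]
      by (elim exE conjE)
    have ql: "quotient_length_at R M P (frobenius_power R J (p ^ e)) (frobenius_power R I (p ^ e)) = \<phi> e" for e
      unfolding quotient_length_at_frobenius_power[OF M P I J IJ(1)] using \<phi> by simp
    have p0: "real p \<noteq> 0" using p_prime by auto
    \<comment> \<open>The exponent \<open>d - 1\<close> is an integer that may be \<open>-1\<close>:
      for \<open>d = 0\<close> the error has the order \<open>1 / q1\<close>, and the quotient
      \<open>q1 ^ d / q1\<close> covers all cases.\<close>
    have "real (p ^ e1) powi (int d - 1) = (real p ^ e1) ^ d / real p ^ e1"
      using p0 by (simp add: power_int_diff)
    then have "2 * (real n * real C) * real p ^ (d * (e1 + e2)) / real p ^ e1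
      = 2 * real C * real (p ^ e2) ^ d * real (p ^ e1) powi (int d - 1) * real n"
      by (simp add: power_add algebra_simps power_mult[symmetric])
    then show "let d = dim_at R M P; q1 = p ^ e1; q2 = p ^ e2 in
      \<bar>real (quotient_length_at R M P (frobenius_power R J q1) (frobenius_power R I q1))
           * real q2 ^ d
         - real (quotient_length_at R M P (frobenius_power R J (q1 * q2))
             (frobenius_power R I (q1 * q2)))\<bar>
      \<le> 2 * real C * real q2 ^ d * real q1 powi (int d - 1) * real (ideal_quotient_length_at R P J I)"
      using b unfolding Let_def dim il power_add[symmetric] ql
      by (simp add: power_mult[symmetric] mult.commute)
  qed
qed

end
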